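(* Let $C$ be a geometrically integral and regular curve over $K$ and $P\in C$ a closed point. Then $$[\mathbf{k}(C,P):K]\ \big|\ c(C,P)+d(C,P)-1.$$
   Context: $K$ is a non-perfect, separably closed field of characteristic $p>0$ with algebraic closure $\overline{K}$. $\mathbf{k}(C,P)$ is the residue field at $P$. $C^{\overline{K}}=C\times_{\operatorname{Spec}K}\operatorname{Spec}\overline{K}$, $P^{\overline{K}}$ is its unique point over $P$, with local ring $\overline{K}\mathcal{O}_{C,P}$; $\widetilde{C^{\overline{K}}}$ is the normalization and $\widetilde{P^{\overline{K}}}$ its unique point over $P$; $\nu_0$ is the normalized discrete valuation with valuation ring $\mathcal{O}_{\widetilde{C^{\overline{K}}},\widetilde{P^{\overline{K}}}}$. The differential degree is $d(C,P)=1+\dim_{\overline{K}}\operatorname{Coker}(\alpha)$, where $\alpha\colon\mathcal{O}_{\widetilde{C^{\overline{K}}},\widetilde{P^{\overline{K}}}}\,\Omega_{\overline{K}\mathcal{O}_{C,P}/\overline{K}}\to\Omega_{\mathcal{O}_{\widetilde{C^{\overline{K}}},\widetilde{P^{\overline{K}}}}/\overline{K}}$ is the natural homomorphism (its image is the $\mathcal{O}_{\widetilde{C^{\overline{K}}},\widetilde{P^{\overline{K}}}}$-submodule generated by all $dx$, $x\in\overline{K}\mathcal{O}_{C,P}$). $c(C,P)$ is the conductor of the semigroup $\Gamma_{C^{\overline{K}},P^{\overline{K}}}=\{\nu_0(x) : 0\neq x\in\overline{K}\mathcal{O}_{C,P}\}$: the largest positive integer $c$ in the semigroup such that $c-1$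 is a gap, with $c(C,P)=0$ when there are no gaps (i.e. when $P$ is smooth). *)

theory Defs
  imports
    "HOL-Algebra.Algebraic_Closure_Type"
    "HOL-Algebra.Ring_Divisibility"
    "HOL-Algebra.Generated_Rings"
    "HOL-Analysis.Function_Topology"
    "HOL-Library.Poly_Mapping"
begin

section \<open>Fields\<close>

definition separable_irreducible :: "'k::field poly \<Rightarrow> bool" where
  "separable_irreducible p \<longleftrightarrow> Factorial_Ring.irreducible p \<and> coprime p (pderiv p)"

definition perfect_field :: "'k::field itself \<Rightarrow> bool" where
  "perfect_field _ \<longleftrightarrow>
     (\<forall>p :: 'k poly. Factorial_Ring.irreducible p \<longrightarrow> separable_irreducible p)"

definition separably_closed :: "'k::field itself \<Rightarrow> bool" where
  "separably_closed _ \<longleftrightarrow>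
     (\<forall>p :: 'k poly. separable_irreducible p \<longrightarrow> Polynomial.degree p = 1)"


section \<open>Linear algebra\<close>

text \<open>Finite sums of multiples \<open>sc r g\<close> with \<open>r \<in> R\<close> and \<open>g \<in> G\<close>. When \<open>R\<close> is a ring acting
  through \<open>sc\<close> this is the \<open>R\<close>-submodule generated by \<open>G\<close>.\<close>

inductive_set lin_span :: "('r \<Rightarrow> 'v \<Rightarrow> 'v::ab_group_add) \<Rightarrow> 'r set \<Rightarrow> 'v set \<Rightarrow> 'v set"
  for sc R G where
    zero: "0 \<in> lin_span sc R G"
  | add: "r \<in> R \<Longrightarrow> g \<in> G \<Longrightarrow> v \<in> lin_span sc R G \<Longrightarrow> sc r g + v \<in> lin_span sc R G"

text \<open>\<open>B \<subseteq> V\<close> is a system of representatives of a basis of the quotient space \<open>V / W\<close>.\<close>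

definition quotient_basis ::
  "('s::field \<Rightarrow> 'v \<Rightarrow> 'v::ab_group_add) \<Rightarrow> 'v set \<Rightarrow> 'v set \<Rightarrow> 'v set \<Rightarrow> bool" where
  "quotient_basis sc V W B \<longleftrightarrow> B \<subseteq> V \<and>
     (\<forall>v\<in>V. \<exists>!c. finite {b. c b \<noteq> 0} \<and> {b. c b \<noteq> 0} \<subseteq> B \<and>
        v - (\<Sum>b | c b \<noteq> 0. sc (c b) b) \<in> W)"

text \<open>As for the library constant \<open>dim\<close>, the value is \<open>0\<close> for infinite-dimensional \<open>V / W\<close>.\<close>

definition quotient_dim ::
  "('s::field \<Rightarrow> 'v \<Rightarrow> 'v::ab_group_add) \<Rightarrow> 'v set \<Rightarrow> 'v set \<Rightarrow> nat" where
  "quotient_dim sc V W = card (SOME B. quotient_basis sc V W B)"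

text \<open>The tensor product \<open>A \<otimes>\<^sub>K B\<close> of two \<open>K\<close>-algebras is the free abelian group on \<open>A \<times> B\<close>
  modulo the usual bilinearity relations; the latter form \<open>tensor_relations\<close>.
  The predicate \<open>is_tensor_product\<close> says that
  \<open>a \<otimes> b \<mapsto> f a * g b\<close> induces a bijection from \<open>A \<otimes>\<^sub>K B\<close> onto \<open>R\<close>.\<close>

definition tensor_relations ::
  "('k::field \<Rightarrow> 'a::field) \<Rightarrow> ('k \<Rightarrow> 'b::field) \<Rightarrow> 'a set \<Rightarrow> 'b set \<Rightarrow> ('a \<times> 'b \<Rightarrow>\<^sub>0 int) set" where
  "tensor_relations \<iota> \<iota>' A B =
     {frag_of (a + a', b) - frag_of (a, b) - frag_of (a', b) | a a' b. a \<in> A \<and> a' \<in> A \<and> b \<in> B} \<union>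
     {frag_of (a, b + b') - frag_of (a, b) - frag_of (a, b') | a b b'. a \<in> A \<and> b \<in> B \<and> b' \<in> B} \<union>
     {frag_of (\<iota> c * a, b) - frag_of (a, \<iota>' c * b) | a b c. a \<in> A \<and> b \<in> B}"

definition tensor_eval ::
  "('a \<Rightarrow> 'l::field) \<Rightarrow> ('b \<Rightarrow> 'l) \<Rightarrow> ('a \<times> 'b \<Rightarrow>\<^sub>0 int) \<Rightarrow> 'l" where
  "tensor_eval f g z =
     (\<Sum>(a, b)\<in>Poly_Mapping.keys z. of_int (Poly_Mapping.lookup z (a, b)) * (f a * g b))"

definition is_tensor_product ::
  "('k::field \<Rightarrow> 'a::field) \<Rightarrow> ('k \<Rightarrow> 'b::field) \<Rightarrow> ('a \<Rightarrow> 'l::field) \<Rightarrow> ('b \<Rightarrow> 'l)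
     \<Rightarrow> 'a set \<Rightarrow> 'b set \<Rightarrow> 'l set \<Rightarrow> bool" where
  "is_tensor_product \<iota> \<iota>' f g A B R \<longleftrightarrow>
     (\<forall>c. f (\<iota> c) = g (\<iota>' c)) \<and>
     tensor_eval f g ` {z. Poly_Mapping.keys z \<subseteq> A \<times> B} = R \<and>
     (\<forall>z. Poly_Mapping.keys z \<subseteq> A \<times> B \<and> tensor_eval f g z = 0 \<longrightarrow>
        z \<in> lin_span frag_cmul UNIV (tensor_relations \<iota> \<iota>' A B))"


section \<open>Subrings of a field\<close>

abbreviation subring_of_field :: "'f::field set \<Rightarrow> bool" where
  "subring_of_field A \<equiv> subring A ring_of_type_algebra"

definition field_hom :: "('a::field \<Rightarrow> 'b::field) \<Rightarrow> bool" where
  "field_hom h \<longleftrightarrow> h \<in> ring_hom ring_of_type_algebra ring_of_type_algebra"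

definition as_ring :: "'f::field set \<Rightarrow> 'f ring" where
  "as_ring A = ring_of_type_algebra\<lparr>carrier := A\<rparr>"

definition nonunits :: "'f::field set \<Rightarrow> 'f set" where
  "nonunits A = A - Units (as_ring A)"

definition Spec :: "'f::field set \<Rightarrow> 'f set topology" where
  "Spec A = topology_generated_by {{\<pp>. primeideal \<pp> (as_ring A) \<and> f \<notin> \<pp>} | f. f \<in> A}"

text \<open>A longest strict chain \<open>Z 0 \<subset> \<dots> \<subset> Z n\<close> of members of \<open>\<F>\<close> has \<open>n\<close> inclusions. This gives the Krull
  dimension for the family of prime ideals of a ring or of irreducible closed sets of a space.\<close>

definition has_chain :: "'a set set \<Rightarrow> nat \<Rightarrow> bool" where
  "has_chain \<F> n \<longleftrightarrow> (\<exists>Z. (\<forall>i\<le>n. Z i \<in> \<F>) \<and> (\<forall>i<n. Z i \<subset> Z (Suc i)))"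

definition chain_dimension :: "'a set set \<Rightarrow> nat \<Rightarrow> bool" where
  "chain_dimension \<F> n \<longleftrightarrow> has_chain \<F> n \<and> \<not> has_chain \<F> (Suc n)"

definition krull_dimension :: "'f::field set \<Rightarrow> nat \<Rightarrow> bool" where
  "krull_dimension A n \<longleftrightarrow> chain_dimension {\<pp>. primeideal \<pp> (as_ring A)} n"

definition regular_local_ring :: "'f::field set \<Rightarrow> bool" where
  "regular_local_ring A \<longleftrightarrow>
     subring_of_field A \<and> noetherian_ring (as_ring A) \<and>
     {\<mm>. maximalideal \<mm> (as_ring A)} = {nonunits A} \<and>
     (\<exists>n G. krull_dimension A n \<and> G \<subseteq> A \<and> finite G \<and> card G = n \<and>
        nonunits A = genideal (as_ring A) G)"

definition finitely_generated_algebra :: "('k::field \<Rightarrow> 'f::field) \<Rightarrow> 'f set \<Rightarrow> bool" where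
  "finitely_generated_algebra \<iota> A \<longleftrightarrow>
     (\<exists>G. finite G \<and> A = generate_ring ring_of_type_algebra (range \<iota> \<union> G))"

text \<open>The integral closure of \<open>A\<close> in the whole field.\<close>

definition integral_closure :: "'f::field set \<Rightarrow> 'f set" where
  "integral_closure A =
     {x. \<exists>p. Polynomial.lead_coeff p = 1 \<and> (\<forall>i. Polynomial.coeff p i \<in> A) \<and> poly p x = 0}"


section \<open>Integral schemes\<close>

text \<open>The structure sheaf of an integral scheme embeds into the constant sheaf given by its
  function field (the stalk at the generic point). We therefore present an integral scheme with
  function field \<open>'f\<close> as a topological space together with a sheaf of subrings of \<open>'f\<close> on its
  nonempty open subsets whose restriction maps are inclusions. The space is irreducible, so a
  matching family of sections on a nonempty cover is one element of \<open>'f\<close>; the sheaf axiom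
  becomes an intersection. The value of \<open>sections\<close> on the empty set is irrelevant.\<close>

record ('p, 'f) ringed_space =
  space :: "'p topology"
  sections :: "'p set \<Rightarrow> 'f set"

definition stalk :: "('p, 'f::field) ringed_space \<Rightarrow> 'p \<Rightarrow> 'f set" where
  "stalk \<X> P = (\<Union>U \<in> {U. openin (space \<X>) U \<and> P \<in> U}. sections \<X> U)"

text \<open>The canonical map \<open>U \<rightarrow> Spec (\<O>(U))\<close>, sending \<open>P\<close> to the sections that vanish at \<open>P\<close>, is an
  isomorphism: it is a homeomorphism, and on a basic open set \<open>D(f) \<noteq> {}\<close> the sections are the
  localization \<open>\<O>(U)\<^sub>f\<close>.\<close>

definition affine_open :: "('p, 'f::field) ringed_space \<Rightarrow> 'p set \<Rightarrow> bool" where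
  "affine_open \<X> U \<longleftrightarrow>
     openin (space \<X>) U \<and> U \<noteq> {} \<and>
     homeomorphic_map (subtopology (space \<X>) U) (Spec (sections \<X> U))
       (\<lambda>P. sections \<X> U \<inter> nonunits (stalk \<X> P)) \<and>
     (\<forall>f \<in> sections \<X> U - {0}.
        sections \<X> {P \<in> U. f \<notin> nonunits (stalk \<X> P)} = {a / f ^ n | a n. a \<in> sections \<X> U})"

definition integral_scheme :: "('p, 'f::field) ringed_space \<Rightarrow> bool" where
  "integral_scheme \<X> \<longleftrightarrow>
     topspace (space \<X>) \<noteq> {} \<and>
     (\<forall>U V. openin (space \<X>) U \<and> U \<noteq> {} \<and> openin (space \<X>) V \<and> V \<noteq> {} \<longrightarrow> U \<inter> V \<noteq> {}) \<and>
     (\<forall>U. openin (space \<X>) U \<and> U \<noteq> {} \<longrightarrow> subring_of_field (sections \<X> U)) \<and>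
     (\<forall>\<U>. \<U> \<noteq> {} \<and> (\<forall>U\<in>\<U>. openin (space \<X>) U \<and> U \<noteq> {}) \<longrightarrow>
        sections \<X> (\<Union>\<U>) = (\<Inter>U\<in>\<U>. sections \<X> U)) \<and>
     (\<Union>U \<in> {U. openin (space \<X>) U \<and> U \<noteq> {}}. sections \<X> U) = UNIV \<and>
     (\<forall>P \<in> topspace (space \<X>). \<exists>U. affine_open \<X> U \<and> P \<in> U)"

text \<open>The structure morphism to \<open>Spec K\<close> is given by the induced embedding of \<open>K\<close> into the function
  field.\<close>

definition scheme_over :: "('k::field \<Rightarrow> 'f::field) \<Rightarrow> ('p, 'f) ringed_space \<Rightarrow> bool" where
  "scheme_over \<iota> \<X> \<longleftrightarrow> field_hom \<iota> \<and> range \<iota> \<subseteq> sections \<X> (topspace (space \<X>))"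

definition finite_type_over :: "('k::field \<Rightarrow> 'f::field) \<Rightarrow> ('p, 'f) ringed_space \<Rightarrow> bool" where
  "finite_type_over \<iota> \<X> \<longleftrightarrow>
     (\<exists>\<U>. finite \<U> \<and> \<Union>\<U> = topspace (space \<X>) \<and>
        (\<forall>U\<in>\<U>. affine_open \<X> U \<and> finitely_generated_algebra \<iota> (sections \<X> U)))"

definition irreducible_closed :: "'p topology \<Rightarrow> 'p set \<Rightarrow> bool" where
  "irreducible_closed T Z \<longleftrightarrow> closedin T Z \<and> Z \<noteq> {} \<and>
     (\<forall>A B. closedin T A \<and> closedin T B \<and> Z \<subseteq> A \<union> B \<longrightarrow> Z \<subseteq> A \<or> Z \<subseteq> B)"

text \<open>Integral curves. Separatedness is not required, since conventions differ.\<close>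

definition integral_curve_over :: "('k::field \<Rightarrow> 'f::field) \<Rightarrow> ('p, 'f) ringed_space \<Rightarrow> bool" where
  "integral_curve_over \<iota> C \<longleftrightarrow>
     integral_scheme C \<and> scheme_over \<iota> C \<and> finite_type_over \<iota> C \<and>
     chain_dimension {Z. irreducible_closed (space C) Z} 1"

definition regular_scheme :: "('p, 'f::field) ringed_space \<Rightarrow> bool" where
  "regular_scheme \<X> \<longleftrightarrow> (\<forall>P \<in> topspace (space \<X>). regular_local_ring (stalk \<X> P))"

text \<open>Morphisms of locally ringed spaces whose map on sections is induced by an embedding \<open>j\<close> of
  function fields (dominant morphisms).\<close>

definition dominant_morphism ::
  "('q, 'l::field) ringed_space \<Rightarrow> ('p, 'f::field) ringed_space \<Rightarrow> ('q \<Rightarrow> 'p) \<Rightarrow> ('f \<Rightarrow> 'l) \<Rightarrow> bool" where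
  "dominant_morphism \<Y> \<X> \<pi> j \<longleftrightarrow>
     continuous_map (space \<Y>) (space \<X>) \<pi> \<and> field_hom j \<and>
     (\<forall>U. openin (space \<X>) U \<and> U \<noteq> {} \<longrightarrow>
        j ` sections \<X> U \<subseteq> sections \<Y> {Q \<in> topspace (space \<Y>). \<pi> Q \<in> U}) \<and>
     (\<forall>Q \<in> topspace (space \<Y>). j ` nonunits (stalk \<X> (\<pi> Q)) \<subseteq> nonunits (stalk \<Y> Q))"

text \<open>\<open>\<Y>\<close>, with projection \<open>(\<pi>, j)\<close> and structure morphism \<open>\<kappa>\<close>, is the fibre product of \<open>\<X>\<close> and the
  spectrum of the algebraic closure of \<open>K\<close>: over every affine open \<open>U\<close> of \<open>\<X>\<close> it is the spectrum of
  the tensor product of \<open>\<O>(U)\<close> with that algebraic closure. Together with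
  \<open>integral_scheme \<Y>\<close> this expresses that \<open>\<X>\<close> is geometrically integral.\<close>

definition is_geometric_base_change ::
  "('k::field \<Rightarrow> 'f::field) \<Rightarrow> ('p, 'f) ringed_space \<Rightarrow> ('k alg_closure \<Rightarrow> 'l::field) \<Rightarrow>
     ('q, 'l) ringed_space \<Rightarrow> ('q \<Rightarrow> 'p) \<Rightarrow> ('f \<Rightarrow> 'l) \<Rightarrow> bool" where
  "is_geometric_base_change \<iota> \<X> \<kappa> \<Y> \<pi> j \<longleftrightarrow>
     scheme_over \<kappa> \<Y> \<and> dominant_morphism \<Y> \<X> \<pi> j \<and>
     (\<forall>U. affine_open \<X> U \<longrightarrow>
        affine_open \<Y> {Q \<in> topspace (space \<Y>). \<pi> Q \<in> U} \<and>
        is_tensor_product \<iota> to_ac j \<kappa> (sections \<X> U) UNIV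
          (sections \<Y> {Q \<in> topspace (space \<Y>). \<pi> Q \<in> U}))"


section \<open>Invariants of a closed point\<close>

definition residue_degree :: "('k::field \<Rightarrow> 'f::field) \<Rightarrow> ('p, 'f) ringed_space \<Rightarrow> 'p \<Rightarrow> nat" where
  "residue_degree \<iota> \<X> P = quotient_dim (\<lambda>c x. \<iota> c * x) (stalk \<X> P) (nonunits (stalk \<X> P))"

definition point_over :: "('q, 'l::field) ringed_space \<Rightarrow> ('q \<Rightarrow> 'p) \<Rightarrow> 'p \<Rightarrow> 'q" where
  "point_over \<Y> \<pi> P = (THE Q. Q \<in> topspace (space \<Y>) \<and> \<pi> Q = P)"

text \<open>The local ring of the normalization of \<open>\<Y>\<close> at the point over \<open>Q\<close>. The fibre over \<open>Q\<close> of the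
  normalization is the set of maximal ideals of the integral closure of the local ring at \<open>Q\<close>;
  when there is just one such point, its local ring is that integral closure.\<close>

definition normalization_stalk :: "('q, 'l::field) ringed_space \<Rightarrow> 'q \<Rightarrow> 'l set" where
  "normalization_stalk \<Y> Q = integral_closure (stalk \<Y> Q)"

text \<open>The value at \<open>0\<close>, which should be \<open>\<infinity>\<close>, is set to \<open>0\<close> by convention.\<close>

definition normalized_discrete_valuation :: "'l::field set \<Rightarrow> ('l \<Rightarrow> int) \<Rightarrow> bool" where
  "normalized_discrete_valuation R \<nu> \<longleftrightarrow>
     \<nu> 0 = 0 \<and> \<nu> ` (- {0}) = UNIV \<and>
     (\<forall>x y. x \<noteq> 0 \<and> y \<noteq> 0 \<longrightarrow> \<nu> (x * y) = \<nu> x + \<nu> y) \<and>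
     (\<forall>x y. x \<noteq> 0 \<and> y \<noteq> 0 \<and> x + y \<noteq> 0 \<longrightarrow> min (\<nu> x) (\<nu> y) \<le> \<nu> (x + y)) \<and>
     R = {x. x = 0 \<or> 0 \<le> \<nu> x}"

definition valuation_of :: "'l::field set \<Rightarrow> 'l \<Rightarrow> int" where
  "valuation_of R = (THE \<nu>. normalized_discrete_valuation R \<nu>)"

definition value_semigroup :: "('q, 'l::field) ringed_space \<Rightarrow> 'q \<Rightarrow> nat set" where
  "value_semigroup \<Y> Q =
     {n. \<exists>x \<in> stalk \<Y> Q. x \<noteq> 0 \<and> valuation_of (normalization_stalk \<Y> Q) x = int n}"

definition semigroup_conductor :: "nat set \<Rightarrow> nat" where
  "semigroup_conductor \<Gamma> =
     (if \<Gamma> = UNIV then 0 else (GREATEST c. 0 < c \<and> c \<in> \<Gamma> \<and> c - 1 \<notin> \<Gamma>))"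

definition conductor_at :: "('q, 'l::field) ringed_space \<Rightarrow> ('q \<Rightarrow> 'p) \<Rightarrow> 'p \<Rightarrow> nat" where
  "conductor_at \<Y> \<pi> P = semigroup_conductor (value_semigroup \<Y> (point_over \<Y> \<pi> P))"

text \<open>Kaehler differentials of a subring \<open>R\<close> over the image of \<open>\<kappa>\<close>: the free \<open>R\<close>-module on symbols
  \<open>dx\<close> (\<open>x \<in> R\<close>), consisting of finitely supported functions, modulo the submodule generated by
  \<open>kaehler_relations\<close>.\<close>

definition scalar_mult :: "'l::field \<Rightarrow> ('l \<Rightarrow>\<^sub>0 'l) \<Rightarrow> ('l \<Rightarrow>\<^sub>0 'l)" where
  "scalar_mult r = Poly_Mapping.map ((*) r)"

abbreviation diff_symbol :: "'l::field \<Rightarrow> ('l \<Rightarrow>\<^sub>0 'l)" where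
  "diff_symbol x \<equiv> Poly_Mapping.single x 1"

definition free_differentials :: "'l::field set \<Rightarrow> ('l \<Rightarrow>\<^sub>0 'l) set" where
  "free_differentials R = lin_span scalar_mult R (diff_symbol ` R)"

definition kaehler_relations :: "('c \<Rightarrow> 'l::field) \<Rightarrow> 'l set \<Rightarrow> ('l \<Rightarrow>\<^sub>0 'l) set" where
  "kaehler_relations \<kappa> R =
     {diff_symbol (x + y) - diff_symbol x - diff_symbol y | x y. x \<in> R \<and> y \<in> R} \<union>
     {diff_symbol (x * y) - scalar_mult x (diff_symbol y) - scalar_mult y (diff_symbol x) | x y.
        x \<in> R \<and> y \<in> R} \<union>
     {diff_symbol (\<kappa> c) | c. True}"

text \<open>The dimension of the cokernel of \<open>\<alpha>\<close>, that is, of the differentials of \<open>R\<close> modulo the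
  \<open>R\<close>-submodule generated by all \<open>dx\<close> with \<open>x \<in> S\<close>.\<close>

definition differential_cokernel_dim ::
  "('c::field \<Rightarrow> 'l::field) \<Rightarrow> 'l set \<Rightarrow> 'l set \<Rightarrow> nat" where
  "differential_cokernel_dim \<kappa> S R =
     quotient_dim (\<lambda>c. scalar_mult (\<kappa> c)) (free_differentials R)
       (lin_span scalar_mult R (kaehler_relations \<kappa> R \<union> diff_symbol ` S))"

definition differential_degree_at ::
  "('c::field \<Rightarrow> 'l::field) \<Rightarrow> ('q, 'l) ringed_space \<Rightarrow> ('q \<Rightarrow> 'p) \<Rightarrow> 'p \<Rightarrow> nat" where
  "differential_degree_at \<kappa> \<Y> \<pi> P =
     1 + differential_cokernel_dim \<kappa> (stalk \<Y> (point_over \<Y> \<pi> P))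
           (normalization_stalk \<Y> (point_over \<Y> \<pi> P))"

end

(* The local ring A of the base change at the point over P is spanned over the algebraic closure of K by the
   discrete valuation ring D of C at P, and the function field extension L / F is purely inseparable. With w a
   uniformizer of D, the residue degree is dim A / w A. This equals dim R / w R = nu(w) for the normalization R
   of A, because R / A is finite-dimensional.

   Let x in D minimize nu(dx/dz), where z is a uniformizer of R, and put u = dx/dz; then d(C,P) - 1 = nu(u). Let
   q be a large power of p, so that u^q lies in F, and let tau(y) be the coefficient of x^(q-1) in the expansion
   of y in the basis 1, x, ..., x^(q-1) of L over L^q. The dual of R, consisting of all y with tau(y R) contained
   in R, is u^(q-1) R, and the dual of A is g A for some g in F. Hence the conductor is
   c = (q-1) nu(u) - nu(g), so c + d - 1 = nu(u^q / g) is the value of an element of F, a multiple of nu(w). *)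
theory Submission
  imports Defs
begin

section \<open>Bases modulo a subspace\<close>

text \<open>The trace of the purely inseparable extension L / L^q is zero, so a duality between A
  and R needs another linear form, and \<tau> is one. Its parameter x is taken in D: then \<tau>
  maps F to F and is linear over the constants, so that the dual of A is spanned over the constants
  by a D-module. Over a discrete valuation ring this module is principal, whence g in F; this is how
  regularity of C enters the duality. The form attached to z instead of x would make R its own dual;
  the factor u^(q-1) measures the passage from z to x, and the one missing factor u is supplied by d
  - 1.

  Separable closedness enters through a single fact: every element of the algebraic closure has a
  p-power in K. Hence all of L is reached from F by extracting p-power roots. As L / F has infinite
  degree, discreteness of the extended valuation and finiteness of R / A are not automatic. Both
  come from A being finitely generated up to localization, which makes L finite over L^p.
  Completions are replaced by expansions in z to finite order, combined with bounded
  denominators.\<close>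

locale linear_quotient = vector_space scale
  for scale :: "'a::field \<Rightarrow> 'b::ab_group_add \<Rightarrow> 'b" (infixr \<open>*s\<close> 75)
begin

text \<open>Finiteness of \<open>B\<close> is built in, so that the sums are genuine and
  cardinalities can be compared. Values of \<open>c\<close> outside \<open>B\<close> are irrelevant
  here, whereas \<open>quotient_basis\<close> requires them to vanish.\<close>

definition indep_mod :: "'b set \<Rightarrow> 'b set \<Rightarrow> bool" where
  "indep_mod W B \<longleftrightarrow> finite B \<and> (\<forall>c. (\<Sum>b\<in>B. c b *s b) \<in> W \<longrightarrow> (\<forall>b\<in>B. c b = 0))"

definition basis_mod :: "'b set \<Rightarrow> 'b set \<Rightarrow> 'b set \<Rightarrow> bool" where
  "basis_mod V W B \<longleftrightarrow> B \<subseteq> V \<and> indep_mod W B \<and> (\<forall>v\<in>V. \<exists>c. v - (\<Sum>b\<in>B. c b *s b) \<in> W)"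

lemma indep_modD: "indep_mod W B \<Longrightarrow> (\<Sum>b\<in>B. c b *s b) \<in> W \<Longrightarrow> b \<in> B \<Longrightarrow> c b = 0"
  by (auto simp: indep_mod_def)

lemma basis_mod_indep: "basis_mod V W B \<Longrightarrow> indep_mod W B"
  by (simp add: basis_mod_def)

text \<open>A relation among the representatives \<open>f y\<close> differs from the same relation
  among the \<open>y\<close> by an element of \<open>W\<close>, so it is trivial. The
  representatives are therefore independent in \<open>span E\<close>, and the exchange bound
  applies.\<close>

lemma indep_mod_card_le:
  assumes W: "subspace W" and Y: "indep_mod W Y" and E: "finite E"
    and sp: "\<And>y. y \<in> Y \<Longrightarrow> \<exists>x \<in> span E. y - x \<in> W"
  shows "card Y \<le> card E"
proof -
  from sp obtain f where f: "\<And>y. y \<in> Y \<Longrightarrow> f y \<in> span E" "\<And>y. y \<in> Y \<Longrightarrow> y - f y \<in> W" by metis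
  have Yf: "finite Y" using Y by (simp add: indep_mod_def)
  have key: "\<forall>y\<in>Y. c y = 0" if "(\<Sum>y\<in>Y. c y *s f y) = 0" for c
  proof -
    have "(\<Sum>y\<in>Y. c y *s y) = (\<Sum>y\<in>Y. c y *s (y - f y)) + (\<Sum>y\<in>Y. c y *s f y)"
      by (simp add: scale_right_diff_distrib sum_subtractf)
    moreover have "(\<Sum>y\<in>Y. c y *s (y - f y)) \<in> W"
      using W f(2) by (intro subspace_sum subspace_scale) auto
    ultimately have "(\<Sum>y\<in>Y. c y *s y) \<in> W" using that by simp
    then show ?thesis using indep_modD[OF Y] by blast
  qed
  \<comment> \<open>Independence of the image set would not notice two equal representatives; such a
    coincidence is the relation with coefficients 1 and -1.\<close>
  have inj: "inj_on f Y"
  proof (rule inj_onI, rule ccontr)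
    fix y y' assume y: "y \<in> Y" "y' \<in> Y" "f y = f y'" "y \<noteq> y'"
    define c where "c = (\<lambda>u. if u = y then 1 else if u = y' then - 1 else (0::'a))"
    have "(\<Sum>u\<in>Y. c u *s f u) = (\<Sum>u\<in>{y,y'}. c u *s f u)"
      using Yf y by (intro sum.mono_neutral_right) (auto simp: c_def)
    also have "\<dots> = 0" using y by (simp add: c_def)
    finally have "c y = 0" using key y by blast
    then show False by (simp add: c_def)
  qed
  have "independent (f ` Y)"
    unfolding dependent_finite[OF finite_imageI[OF Yf]]
  proof clarify
    fix u v assume u: "v \<in> Y" "u (f v) \<noteq> 0" "(\<Sum>v\<in>f ` Y. u v *s v) = 0"
    then have "(\<Sum>y\<in>Y. u (f y) *s f y) = 0" using inj by (simp add: sum.reindex)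
    then show False using key[of "\<lambda>y. u (f y)"] u by blast
  qed
  from independent_span_bound[OF E this] have "card (f ` Y) \<le> card E" using f(1) by blast
  then show ?thesis using inj by (simp add: card_image)
qed

lemma basis_mod_spanD:
  assumes "basis_mod V W B" "v \<in> V"
  shows "\<exists>x \<in> span B. v - x \<in> W"
proof -
  from assms obtain c where "v - (\<Sum>b\<in>B. c b *s b) \<in> W" unfolding basis_mod_def by blast
  moreover have "(\<Sum>b\<in>B. c b *s b) \<in> span B" by (intro span_sum span_scale span_base)
  ultimately show ?thesis by blast
qed

lemma basis_mod_card_unique:
  assumes "subspace W" "basis_mod V W B" "basis_mod V W B'"
  shows "card B = card B'"
proof -
  have "card B \<le> card B'" if "basis_mod V W B" "basis_mod V W B'" for B B'
    using that by (intro indep_mod_card_le[OF assms(1)] basis_mod_spanD[of V W B'])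
      (auto simp: basis_mod_def indep_mod_def)
  then show ?thesis using assms by (metis order_antisym)
qed

text \<open>A relation with nonzero coefficient at \<open>v\<close> could be solved for
  \<open>v\<close>.\<close>

lemma indep_mod_insert:
  assumes W: "subspace W" and B: "indep_mod W B" and v: "\<And>c. v - (\<Sum>b\<in>B. c b *s b) \<notin> W"
  shows "v \<notin> B \<and> indep_mod W (insert v B)"
proof -
  have f: "finite B" using B by (simp add: indep_mod_def)
  have vB: "v \<notin> B"
  proof
    assume "v \<in> B"
    then have "(\<Sum>b\<in>B. (if b = v then 1 else 0) *s b) = v"
      using f by (simp add: if_distrib[of "\<lambda>x. x *s _"] sum.delta cong: if_cong)
    then show False using v[of "\<lambda>b. if b = v then 1 else 0"] W by (simp add: subspace_0)
  qed
  have "\<forall>b\<in>insert v B. c b = 0" if c: "(\<Sum>b\<in>insert v B. c b *s b) \<in> W" for c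
  proof (cases "c v = 0")
    case True
    then have "(\<Sum>b\<in>B. c b *s b) \<in> W" using c f vB by simp
    then show ?thesis using indep_modD[OF B] True by blast
  next
    case False
    have "inverse (c v) *s (\<Sum>b\<in>insert v B. c b *s b) = v - (\<Sum>b\<in>B. (- inverse (c v) * c b) *s b)"
      using f vB False by (simp add: scale_right_distrib scale_sum_right sum_negf)
    then show ?thesis using v[of "\<lambda>b. - inverse (c v) * c b"] c subspace_scale[OF W] by metis
  qed
  then show ?thesis using vB f by (auto simp: indep_mod_def)
qed

text \<open>An independent set of greatest cardinality spans, since otherwise
  \<open>indep_mod_insert\<close> would enlarge it; the bound \<open>N\<close> guarantees that a
  greatest cardinality exists.\<close>

lemma basis_mod_exists:
  assumes W: "subspace W" and bd: "\<And>B. B \<subseteq> V \<Longrightarrow> indep_mod W B \<Longrightarrow> card B \<le> N"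
  shows "\<exists>B. basis_mod V W B"
proof -
  define P where "P n \<longleftrightarrow> (\<exists>B. B \<subseteq> V \<and> indep_mod W B \<and> card B = n)" for n
  have P0: "P 0" unfolding P_def by (auto intro!: exI[of _ "{}"] simp: indep_mod_def)
  have b: "\<And>n. P n \<Longrightarrow> n \<le> N" using bd by (auto simp: P_def)
  obtain n where n: "P n" "\<And>m. P m \<Longrightarrow> m \<le> n" using Nat.ex_has_greatest_nat[of P 0 N] P0 b by blast
  then obtain B where B: "B \<subseteq> V" "indep_mod W B" "card B = n" by (auto simp: P_def)
  have "\<exists>c. v - (\<Sum>b\<in>B. c b *s b) \<in> W" if "v \<in> V" for v
  proof (rule ccontr)
    assume "\<not> ?thesis"
    then have i: "v \<notin> B" "indep_mod W (insert v B)" using indep_mod_insert[OF W B(2)] by blast+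
    then have "P (Suc n)" unfolding P_def using B that by (auto intro!: exI[of _ "insert v B"] simp: indep_mod_def)
    then show False using n(2) by fastforce
  qed
  then show ?thesis using B by (auto simp: basis_mod_def)
qed

lemma indep_mod_mono:
  assumes "indep_mod W B" "U \<subseteq> W" shows "indep_mod U B"
  using assms unfolding indep_mod_def by blast

text \<open>Additivity of dimension. A relation is first read modulo \<open>W\<close>, where
  \<open>B1\<close> disappears, and then modulo \<open>U\<close>. Disjointness is recorded because
  the cardinalities are added later.\<close>

lemma basis_mod_trans:
  assumes U: "subspace U" and W: "subspace W" and UW: "U \<subseteq> W" and WV: "W \<subseteq> V"
    and B1: "basis_mod W U B1" and B2: "basis_mod V W B2"
  shows "B1 \<inter> B2 = {} \<and> basis_mod V U (B1 \<union> B2)"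
proof -
  have f: "finite B1" "finite B2" using B1 B2 by (auto simp: basis_mod_def indep_mod_def)
  have B1W: "B1 \<subseteq> W" using B1 by (simp add: basis_mod_def)
  have B1s: "(\<Sum>b\<in>B1. c b *s b) \<in> W" for c
    using W B1W by (intro subspace_sum subspace_scale) auto
  have dj: "B1 \<inter> B2 = {}"
  proof (rule ccontr)
    assume "B1 \<inter> B2 \<noteq> {}"
    then obtain b where b: "b \<in> B1" "b \<in> B2" by auto
    have "(\<Sum>u\<in>B2. (if u = b then 1 else 0) *s u) = b"
      using f b by (simp add: if_distrib[of "\<lambda>x. x *s _"] sum.delta cong: if_cong)
    then have "(if b = b then 1 else (0::'a)) = 0"
      using indep_modD[OF basis_mod_indep[OF B2], of "\<lambda>u. if u = b then 1 else 0" b] b B1W by auto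
    then show False by simp
  qed
  have ind: "indep_mod U (B1 \<union> B2)"
    unfolding indep_mod_def
  proof (intro conjI allI impI)
    show "finite (B1 \<union> B2)" using f by simp
    fix c assume "(\<Sum>b\<in>B1 \<union> B2. c b *s b) \<in> U"
    then have s: "(\<Sum>b\<in>B1. c b *s b) + (\<Sum>b\<in>B2. c b *s b) \<in> U" using f dj by (simp add: sum.union_disjoint)
    then have "(\<Sum>b\<in>B2. c b *s b) \<in> W" using B1s[of c] UW subspace_diff[OF W]
      by (metis (no_types, lifting) add_diff_cancel_left' subsetD)
    then have c2: "\<forall>b\<in>B2. c b = 0" using indep_modD[OF basis_mod_indep[OF B2]] by blast
    then have "(\<Sum>b\<in>B1. c b *s b) \<in> U" using s by simp
    then have "\<forall>b\<in>B1. c b = 0" using indep_modD[OF basis_mod_indep[OF B1]] by blast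
    then show "\<forall>b\<in>B1 \<union> B2. c b = 0" using c2 by auto
  qed
  have sp: "\<exists>c. v - (\<Sum>b\<in>B1 \<union> B2. c b *s b) \<in> U" if v: "v \<in> V" for v
  proof -
    obtain c2 where c2: "v - (\<Sum>b\<in>B2. c2 b *s b) \<in> W" using B2 v by (auto simp: basis_mod_def)
    then obtain c1 where c1: "v - (\<Sum>b\<in>B2. c2 b *s b) - (\<Sum>b\<in>B1. c1 b *s b) \<in> U" using B1 by (auto simp: basis_mod_def)
    define c where "c = (\<lambda>b. if b \<in> B1 then c1 b else c2 b)"
    have "(\<Sum>b\<in>B1 \<union> B2. c b *s b) = (\<Sum>b\<in>B1. c1 b *s b) + (\<Sum>b\<in>B2. c2 b *s b)"
      using f dj by (subst sum.union_disjoint) (auto simp: c_def intro!: arg_cong2[of _ _ _ _ "(+)"] sum.cong)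
    then have "v - (\<Sum>b\<in>B1 \<union> B2. c b *s b) \<in> U" using c1 by (simp add: algebra_simps)
    then show ?thesis by blast
  qed
  show ?thesis using dj ind sp B1 B2 WV by (auto simp: basis_mod_def)
qed

lemma quotient_basis_sum_eq:
  assumes "finite B" "{b. c b \<noteq> 0} \<subseteq> B"
  shows "(\<Sum>b | c b \<noteq> 0. c b *s b) = (\<Sum>b\<in>B. c b *s b)"
  using assms by (intro sum.mono_neutral_left) auto

lemma basis_mod_imp_quotient_basis:
  assumes W: "subspace W" and B: "basis_mod V W B"
  shows "quotient_basis scale V W B"
  unfolding quotient_basis_def
proof (intro conjI ballI)
  have f: "finite B" using B by (auto simp: basis_mod_def indep_mod_def)
  show "B \<subseteq> V" using B by (simp add: basis_mod_def)
  fix v assume "v \<in> V"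
  then obtain c0 where c0: "v - (\<Sum>b\<in>B. c0 b *s b) \<in> W" using B by (auto simp: basis_mod_def)
  define c where "c = (\<lambda>b. if b \<in> B then c0 b else 0)"
  have c: "{b. c b \<noteq> 0} \<subseteq> B" by (auto simp: c_def)
  have "(\<Sum>b | c b \<noteq> 0. c b *s b) = (\<Sum>b\<in>B. c0 b *s b)"
    unfolding quotient_basis_sum_eq[OF f c] by (rule sum.cong) (auto simp: c_def)
  with c0 have c1: "v - (\<Sum>b | c b \<noteq> 0. c b *s b) \<in> W" by simp
  show "\<exists>!c. finite {b. c b \<noteq> 0} \<and> {b. c b \<noteq> 0} \<subseteq> B \<and> v - (\<Sum>b | c b \<noteq> 0. c b *s b) \<in> W"
  proof (rule ex1I[of _ c])
    show "finite {b. c b \<noteq> 0} \<and> {b. c b \<noteq> 0} \<subseteq> B \<and> v - (\<Sum>b | c b \<noteq> 0. c b *s b) \<in> W"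
      by (intro conjI c c1 finite_subset[OF c f])
    fix d assume d: "finite {b. d b \<noteq> 0} \<and> {b. d b \<noteq> 0} \<subseteq> B \<and> v - (\<Sum>b | d b \<noteq> 0. d b *s b) \<in> W"
    have "(\<Sum>b\<in>B. (d b - c b) *s b) = (v - (\<Sum>b | c b \<noteq> 0. c b *s b)) - (v - (\<Sum>b | d b \<noteq> 0. d b *s b))"
      using d quotient_basis_sum_eq[OF f c] quotient_basis_sum_eq[OF f, of d]
      by (simp add: scale_left_diff_distrib sum_subtractf)
    also have "\<dots> \<in> W" using d by (intro subspace_diff[OF W c1]) auto
    finally have "(\<Sum>b\<in>B. (d b - c b) *s b) \<in> W" .
    then have "\<forall>b\<in>B. d b - c b = 0" using indep_modD[OF basis_mod_indep[OF B], of "\<lambda>b. d b - c b"] by blast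
    moreover have "d b = 0 \<and> c b = 0" if "b \<notin> B" for b using c d that by (auto simp: subset_eq)
    ultimately show "d = c" by (intro ext) (metis eq_iff_diff_eq_0)
  qed
qed

text \<open>\<open>quotient_dim\<close> counts an arbitrarily chosen \<open>quotient_basis\<close>,
  of which not even finiteness is known. Uniqueness of coordinates makes its finite subsets
  independent, so none has more elements than \<open>B\<close>; being finite, the chosen set is then
  a \<open>basis_mod\<close> itself.\<close>

lemma quotient_dim_eq_card:
  assumes W: "subspace W" and B: "basis_mod V W B"
  shows "quotient_dim scale V W = card B"
proof -
  define B' where "B' = (SOME B. quotient_basis scale V W B)"
  have q: "quotient_basis scale V W B'"
    unfolding B'_def using basis_mod_imp_quotient_basis[OF assms] by (rule someI)
  have fB: "finite B" using B by (auto simp: basis_mod_def indep_mod_def)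
  have i: "indep_mod W Y" if Y: "Y \<subseteq> B'" "finite Y" for Y
    unfolding indep_mod_def
  proof (intro conjI allI impI Y(2) ballI)
    fix c b assume c: "(\<Sum>b\<in>Y. c b *s b) \<in> W" and b: "b \<in> Y"
    have "b \<in> V" using q b Y by (auto simp: quotient_basis_def)
    then have ex1: "\<exists>!c. finite {b. c b \<noteq> 0} \<and> {b. c b \<noteq> 0} \<subseteq> B' \<and> b - (\<Sum>b | c b \<noteq> 0. c b *s b) \<in> W"
      using q by (auto simp: quotient_basis_def)
    \<comment> \<open>If the combination with coefficients \<open>c\<close> lies in
      \<open>W\<close>, then \<open>b\<close> has the two expansions \<open>e\<close> and
      \<open>e + c\<close> modulo \<open>W\<close>; uniqueness gives \<open>c b = 0\<close>.\<close>
    define e where "e = (\<lambda>u. if u = b then 1 else (0::'a))"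
    define d where "d = (\<lambda>u. if u \<in> Y then e u + c u else 0)"
    have e: "{u. e u \<noteq> 0} = {b}" by (auto simp: e_def)
    have e1: "(\<Sum>u | e u \<noteq> 0. e u *s u) = b" unfolding e by (simp add: e_def)
    have d: "{u. d u \<noteq> 0} \<subseteq> Y" by (auto simp: d_def)
    have "(\<Sum>u | d u \<noteq> 0. d u *s u) = (\<Sum>u\<in>Y. e u *s u) + (\<Sum>u\<in>Y. c u *s u)"
      unfolding quotient_basis_sum_eq[OF Y(2) d]
      by (simp add: d_def scale_left_distrib sum.distrib)
    also have "(\<Sum>u\<in>Y. e u *s u) = b" using e1 quotient_basis_sum_eq[OF Y(2), of e] e b by simp
    finally have "b - (\<Sum>u | d u \<noteq> 0. d u *s u) = - (\<Sum>u\<in>Y. c u *s u)" by simp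
    then have "b - (\<Sum>u | d u \<noteq> 0. d u *s u) \<in> W" using subspace_neg[OF W c] by simp
    moreover have "b - (\<Sum>u | e u \<noteq> 0. e u *s u) \<in> W" using e1 W by (simp add: subspace_0)
    moreover have "finite {u. d u \<noteq> 0}" "finite {u. e u \<noteq> 0}" using finite_subset[OF d Y(2)] e by auto
    moreover have "{u. d u \<noteq> 0} \<subseteq> B'" "{u. e u \<noteq> 0} \<subseteq> B'" using d Y e b by auto
    ultimately have "d = e" using ex1 by blast
    then have "d b = e b" by simp
    then show "c b = 0" using b by (simp add: d_def)
  qed
  have le: "card Y \<le> card B" if "Y \<subseteq> B'" "finite Y" for Y
    using indep_mod_card_le[OF W i[OF that] fB] basis_mod_spanD[OF B] q that
    by (auto simp: quotient_basis_def subset_eq)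
  have fin: "finite B'"
  proof (rule ccontr)
    assume "infinite B'"
    then obtain Y where "Y \<subseteq> B'" "finite Y" "card Y = Suc (card B)" using infinite_arbitrarily_large by metis
    then show False using le[of Y] by simp
  qed
  have "basis_mod V W B'"
    unfolding basis_mod_def
  proof (intro conjI ballI)
    show "B' \<subseteq> V" using q by (simp add: quotient_basis_def)
    show "indep_mod W B'" using i fin by blast
    fix v assume "v \<in> V"
    then obtain c where "{b. c b \<noteq> 0} \<subseteq> B'" "v - (\<Sum>b | c b \<noteq> 0. c b *s b) \<in> W" using q by (auto simp: quotient_basis_def)
    then show "\<exists>c. v - (\<Sum>b\<in>B'. c b *s b) \<in> W" using quotient_basis_sum_eq[OF fin, of c] by (intro exI[of _ c]) simp
  qed
  from basis_mod_card_unique[OF W B this] show ?thesis by (simp only: quotient_dim_def B'_def)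
qed

end

section \<open>Local rings with a coordinate system over a discrete valuation ring\<close>

text \<open>A \<open>C\<close>-combination of monomials with exponents below \<open>q\<close> stays
  one after multiplication by a generator, because \<open>g ^ q\<close> is absorbed by
  \<open>C\<close>. Used once with \<open>C\<close> the p-th powers of \<open>A\<close>, and once
  with \<open>C\<close> the constants plus \<open>\<omega>\<close> times \<open>A\<close>.\<close>

lemma sum_generated_monomials:
  fixes C G H :: "'l::field set"
  assumes C: "1 \<in> C" "\<And>x y. x \<in> C \<Longrightarrow> y \<in> C \<Longrightarrow> x - y \<in> C" "\<And>x y. x \<in> C \<Longrightarrow> y \<in> C \<Longrightarrow> x * y \<in> C"
    and G: "finite G" and q: "q > 0" "\<And>g. g \<in> G \<Longrightarrow> g ^ q \<in> C" and H: "H \<subseteq> C"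
    and s: "s \<in> generate_ring ring_of_type_algebra (H \<union> G)"
  shows "\<exists>\<gamma>. (\<forall>\<beta>. \<gamma> \<beta> \<in> C) \<and> s = (\<Sum>\<beta>\<in>G \<rightarrow>\<^sub>E {..<q}. \<gamma> \<beta> * (\<Prod>g\<in>G. g ^ \<beta> g))"
proof -
  define B where "B = G \<rightarrow>\<^sub>E {..<q}"
  have fB: "finite B" unfolding B_def using G by (intro finite_PiE) auto
  define mo where "mo \<beta> = (\<Prod>g\<in>G. g ^ \<beta> g)" for \<beta>
  define T where "T = {\<Sum>\<beta>\<in>B. \<gamma> \<beta> * mo \<beta> | \<gamma>. \<forall>\<beta>. \<gamma> \<beta> \<in> C}"
  have C0: "0 \<in> C" using C(2)[OF C(1) C(1)] by simp
  have Cadd: "x + y \<in> C" if "x \<in> C" "y \<in> C" for x y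
    using C(2)[OF that(1) C(2)[OF C0 that(2)]] by simp
  have Tadd: "x + y \<in> T" if "x \<in> T" "y \<in> T" for x y
  proof -
    from that obtain \<gamma> \<delta> where g: "\<forall>\<beta>. \<gamma> \<beta> \<in> C" "\<forall>\<beta>. \<delta> \<beta> \<in> C" "x = (\<Sum>\<beta>\<in>B. \<gamma> \<beta> * mo \<beta>)" "y = (\<Sum>\<beta>\<in>B. \<delta> \<beta> * mo \<beta>)"
      unfolding T_def by auto
    have "x + y = (\<Sum>\<beta>\<in>B. (\<gamma> \<beta> + \<delta> \<beta>) * mo \<beta>)" using g by (simp add: sum.distrib distrib_right)
    moreover have "\<forall>\<beta>. \<gamma> \<beta> + \<delta> \<beta> \<in> C" using g Cadd by auto
    ultimately show ?thesis unfolding T_def by (intro CollectI exI[of _ "\<lambda>\<beta>. \<gamma> \<beta> + \<delta> \<beta>"]) auto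
  qed
  have Tmul: "c * x \<in> T" if "c \<in> C" "x \<in> T" for c x
  proof -
    from that obtain \<gamma> where g: "\<forall>\<beta>. \<gamma> \<beta> \<in> C" "x = (\<Sum>\<beta>\<in>B. \<gamma> \<beta> * mo \<beta>)" unfolding T_def by auto
    have "c * x = (\<Sum>\<beta>\<in>B. (c * \<gamma> \<beta>) * mo \<beta>)" using g by (simp add: sum_distrib_left mult_ac)
    then show ?thesis unfolding T_def using g that C(3) by (intro CollectI exI[of _ "\<lambda>\<beta>. c * \<gamma> \<beta>"]) auto
  qed
  have T0: "0 \<in> T" unfolding T_def using C0 by (intro CollectI exI[of _ "\<lambda>_. 0"]) auto
  have Tsum: "(\<Sum>i\<in>J. h i) \<in> T" if "\<And>i. i \<in> J \<Longrightarrow> h i \<in> T" for J :: "('l \<Rightarrow> nat) set" and h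
    using that by (induction J rule: infinite_finite_induct) (auto intro: T0 Tadd)
  have moT: "mo \<beta> \<in> T" if "\<beta> \<in> B" for \<beta>
  proof -
    have "(\<Sum>\<beta>'\<in>B. (if \<beta>' = \<beta> then 1 else 0) * mo \<beta>') = mo \<beta>"
      using fB that by (simp add: if_distrib[of "\<lambda>x. x * _"] sum.delta cong: if_cong)
    then show ?thesis unfolding T_def using C(1) C0
      by (intro CollectI exI[of _ "\<lambda>\<beta>'. if \<beta>' = \<beta> then 1 else 0"]) auto
  qed
  have mo_upd: "mo (\<beta>(g := n)) = g ^ n * (\<Prod>h\<in>G - {g}. h ^ \<beta> h)" if "g \<in> G" for \<beta> g n
    unfolding mo_def using G that by (subst prod.remove[of G g]) (auto intro!: arg_cong2[of _ _ _ _ "(*)"] prod.cong)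
  have gT: "g * mo \<beta> \<in> T" if g: "g \<in> G" and b: "\<beta> \<in> B" for g \<beta>
  proof -
    have e: "g * mo \<beta> = g ^ Suc (\<beta> g) * (\<Prod>h\<in>G - {g}. h ^ \<beta> h)"
      using mo_upd[OF g, of \<beta> "\<beta> g"] by simp
    have lt: "\<beta> g < q" using b g by (auto simp: B_def)
    show ?thesis
    proof (cases "Suc (\<beta> g) < q")
      case True
      have "\<beta>(g := Suc (\<beta> g)) \<in> B" using b g True by (auto simp: B_def PiE_def extensional_def)
      from moT[OF this] show ?thesis unfolding e mo_upd[OF g] .
    next
      case False
      \<comment> \<open>The exponent wraps around to 0, and \<open>g ^ q\<close> becomes part of the
        coefficient.\<close>
      then have "Suc (\<beta> g) = q" using lt by simp
      then have "g * mo \<beta> = g ^ q * mo (\<beta>(g := 0))" using e mo_upd[OF g, of \<beta> 0] by simp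
      moreover have "\<beta>(g := 0) \<in> B" using b g q by (auto simp: B_def PiE_def extensional_def)
      ultimately show ?thesis using Tmul moT q(2)[OF g] by simp
    qed
  qed
  \<comment> \<open>The multiplier ring of \<open>T\<close>: it suffices to place the generators in
    it, and no product of two general elements of \<open>T\<close> has to be expanded.\<close>
  define T' where "T' = {s. \<forall>t\<in>T. s * t \<in> T}"
  have "g \<in> T'" if g: "g \<in> G" for g
  proof -
    have "g * t \<in> T" if "t \<in> T" for t
    proof -
      from that obtain \<gamma> where gam: "\<forall>\<beta>. \<gamma> \<beta> \<in> C" "t = (\<Sum>\<beta>\<in>B. \<gamma> \<beta> * mo \<beta>)" unfolding T_def by auto
      have "g * t = (\<Sum>\<beta>\<in>B. \<gamma> \<beta> * (g * mo \<beta>))" using gam by (simp add: sum_distrib_left mult_ac)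
      then show ?thesis using gT[OF g] Tmul gam by (auto intro!: Tsum)
    qed
    then show ?thesis by (simp add: T'_def)
  qed
  moreover have "H \<subseteq> T'" using H Tmul by (auto simp: T'_def)
  ultimately have gens: "H \<union> G \<subseteq> T'" by auto
  have m1: "-1 \<in> C" using C(2)[OF C0 C(1)] by simp
  from s have sT': "s \<in> T'"
  proof (induction rule: generate_ring.induct)
    case (a_inv h)
    have "\<ominus>\<^bsub>ring_of_type_algebra\<^esub> h = - h"
    proof -
      interpret cring "ring_of_type_algebra :: 'l ring" by (rule cring_from_type_algebra)
      have "h \<oplus>\<^bsub>ring_of_type_algebra\<^esub> - h = \<zero>\<^bsub>ring_of_type_algebra\<^esub>" by (simp add: ring_of_type_algebra_def)
      then show ?thesis by (metis (no_types, lifting) add.inv_equality UNIV_I a_comm partial_object.select_convs(1) ring_of_type_algebra_def)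
    qed
    moreover have "- h * t \<in> T" if "t \<in> T" for t using a_inv that Tmul[OF m1, of "h * t"] by (auto simp: T'_def)
    ultimately show ?case by (auto simp: T'_def)
  next
    case (eng_add h1 h2)
    then show ?case using Tadd by (auto simp: T'_def ring_of_type_algebra_def distrib_right)
  next
    case (eng_mult h1 h2)
    then show ?case by (auto simp: T'_def ring_of_type_algebra_def mult.assoc)
  qed (use gens in \<open>auto simp: T'_def ring_of_type_algebra_def\<close>)
  have "mo (\<lambda>g. if g \<in> G then 0 else undefined) = 1" unfolding mo_def by simp
  moreover have "(\<lambda>g. if g \<in> G then 0 else undefined) \<in> B" using q by (auto simp: B_def)
  ultimately have "1 \<in> T" using moT by metis
  then have "s \<in> T" using sT' by (auto simp: T'_def)
  then show ?thesis unfolding T_def mo_def B_def by auto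
qed

text \<open>In the application \<open>F\<close> is the image of the function field of the curve in that of the base change, \<open>D\<close> the
  image of the local ring at the point, with uniformizer \<open>\<omega>\<close>, and \<open>\<Phi> b y\<close> the coordinate of \<open>y\<close> at the member
  \<open>\<kappa> b\<close> of the \<open>F\<close>-basis \<open>\<kappa> ` I\<close>. The local ring of the base change consists of the elements with
  coordinates in \<open>D\<close>.\<close>

locale geom_point =
  fixes \<kappa> :: "'a::alg_closed_field \<Rightarrow> 'l::field" and F D :: "'l set"
    and I :: "'a set" and \<Phi> :: "'a \<Rightarrow> 'l \<Rightarrow> 'l" and \<omega> :: 'l and G :: "'l set" and p :: nat
  assumes \<kappa>_one [simp]: "\<kappa> 1 = 1" and \<kappa>_add: "\<kappa> (c + c') = \<kappa> c + \<kappa> c'" and \<kappa>_mult: "\<kappa> (c * c') = \<kappa> c * \<kappa> c'"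
    and p_prime: "prime p" and CHAR: "CHAR('l) = p"
    and F1: "1 \<in> F" and F_diff: "x \<in> F \<Longrightarrow> y \<in> F \<Longrightarrow> x - y \<in> F"
    and F_mult: "x \<in> F \<Longrightarrow> y \<in> F \<Longrightarrow> x * y \<in> F" and F_inverse: "x \<in> F \<Longrightarrow> inverse x \<in> F"
    and DF: "D \<subseteq> F" and D1: "1 \<in> D" and D_diff: "x \<in> D \<Longrightarrow> y \<in> D \<Longrightarrow> x - y \<in> D"
    and D_mult: "x \<in> D \<Longrightarrow> y \<in> D \<Longrightarrow> x * y \<in> D"
    and \<omega>_D: "\<omega> \<in> D" and \<omega>_nz: "\<omega> \<noteq> 0" and \<omega>_nonunit: "inverse \<omega> \<notin> D"
    and dvr: "x \<in> F \<Longrightarrow> x \<noteq> 0 \<Longrightarrow> \<exists>u n. u \<in> D \<and> u \<noteq> 0 \<and> inverse u \<in> D \<and> (x = \<omega> ^ n * u \<or> x * \<omega> ^ n = u)"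
    and power_F: "\<exists>N. y ^ (p ^ N) \<in> F"
    and \<kappa>_power_D: "\<exists>N. \<kappa> c ^ (p ^ N) \<in> D"
    and \<Phi>_F: "b \<in> I \<Longrightarrow> \<Phi> b y \<in> F"
    and \<Phi>_add: "b \<in> I \<Longrightarrow> \<Phi> b (y + y') = \<Phi> b y + \<Phi> b y'"
    and \<Phi>_scale: "b \<in> I \<Longrightarrow> f \<in> F \<Longrightarrow> \<Phi> b (f * y) = f * \<Phi> b y"
    and \<Phi>_\<kappa>: "b \<in> I \<Longrightarrow> \<Phi> b (\<kappa> c) \<in> D \<inter> range \<kappa>"
    and \<Phi>_finite: "finite {b \<in> I. \<Phi> b y \<noteq> 0}"
    and \<Phi>_sum: "y = (\<Sum>b | b \<in> I \<and> \<Phi> b y \<noteq> 0. \<kappa> b * \<Phi> b y)"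
    and one_I: "1 \<in> I" and \<Phi>_basis: "b \<in> I \<Longrightarrow> b' \<in> I \<Longrightarrow> \<Phi> b (\<kappa> b') = (if b = b' then 1 else 0)"
    and G_finite: "finite G" and G_int: "g \<in> G \<Longrightarrow> b \<in> I \<Longrightarrow> \<Phi> b g \<in> D"
    and localization: "(\<And>b. b \<in> I \<Longrightarrow> \<Phi> b a \<in> D) \<Longrightarrow>
       \<exists>s t. s \<in> generate_ring ring_of_type_algebra (range \<kappa> \<union> G) \<and>
         t \<in> generate_ring ring_of_type_algebra (range \<kappa> \<union> G) \<and> t \<noteq> 0 \<and>
         (\<forall>b\<in>I. \<Phi> b (inverse t) \<in> D) \<and> a * t = s"
    and approx: "(\<And>b. b \<in> I \<Longrightarrow> \<Phi> b a \<in> D) \<Longrightarrow>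
       \<exists>s a'. s \<in> generate_ring ring_of_type_algebra (range \<kappa> \<union> G) \<and>
         (\<forall>b\<in>I. \<Phi> b a' \<in> D) \<and> a = s + \<omega> * a'"
    and residue: "g \<in> G \<Longrightarrow> \<exists>c N d. d \<in> D \<and> (g - \<kappa> c) ^ (p ^ N) = \<omega> * d"
begin

definition "A = {y. \<forall>b\<in>I. \<Phi> b y \<in> D}"
abbreviation "S \<equiv> generate_ring ring_of_type_algebra (range \<kappa> \<union> G)"

lemma p_gt_1: "p > 1" using p_prime by (rule prime_gt_1_nat)

lemma frobenius_add: "(x + y) ^ (p ^ N) = x ^ (p ^ N) + (y::'l) ^ (p ^ N)"
  using freshmans_dream'[where ?'a = 'l] p_prime CHAR by blast

lemma frobenius_sum: "(\<Sum>i\<in>J. h i) ^ (p ^ N) = (\<Sum>i\<in>J. (h i :: 'l) ^ (p ^ N))"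
  using freshmans_dream_sum'[where ?'a = 'l] p_prime CHAR by blast

lemma frobenius_uminus: "(- x) ^ (p ^ N) = - (x ^ (p ^ N) :: 'l)"
  using frobenius_add[of x "-x" N] p_gt_1 by (simp add: power_0_left eq_neg_iff_add_eq_0 add.commute)

lemma frobenius_diff: "(x - y) ^ (p ^ N) = x ^ (p ^ N) - (y::'l) ^ (p ^ N)"
  using frobenius_add[of x "-y" N] frobenius_uminus[of y N] by simp

lemma of_nat_p: "of_nat p = (0::'l)"
  using CHAR of_nat_CHAR by metis

lemma \<kappa>_0 [simp]: "\<kappa> 0 = 0" using \<kappa>_add[of 0 0] by (metis add.right_neutral add_left_cancel)

lemma \<kappa>_uminus: "\<kappa> (- x) = - \<kappa> x" using \<kappa>_add[of x "-x"] by (simp add: eq_neg_iff_add_eq_0 add.commute)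

lemma \<kappa>_diff: "\<kappa> (x - y) = \<kappa> x - \<kappa> y" using \<kappa>_add[of x "-y"] by (simp add: \<kappa>_uminus)

lemma \<kappa>_power: "\<kappa> (x ^ n) = \<kappa> x ^ n" by (induction n) (auto simp: \<kappa>_mult)

lemma \<kappa>_eq_0: "\<kappa> x = 0 \<longleftrightarrow> x = 0"
proof
  assume "\<kappa> x = 0"
  show "x = 0"
  proof (rule ccontr)
    assume "x \<noteq> 0"
    then have "\<kappa> x * \<kappa> (inverse x) = 1" by (simp flip: \<kappa>_mult)
    then show False using \<open>\<kappa> x = 0\<close> by simp
  qed
qed simp

text \<open>The constants form an algebraically closed, hence perfect, field. This is what makes
  every map that is linear over p-power subfields, such as the derivation and \<tau> below, linear
  over the constants.\<close>

lemma \<kappa>_root: "\<exists>c'. \<kappa> c = \<kappa> c' ^ (p ^ N)"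
proof -
  have "p ^ N > 0" using p_gt_1 by simp
  then obtain c' where "c' ^ (p ^ N) = c" using nth_root_exists[of "p ^ N" c] by auto
  then show ?thesis using \<kappa>_power by metis
qed

lemma F0: "0 \<in> F" using F_diff[OF F1 F1] by simp
lemma F_add: "x \<in> F \<Longrightarrow> y \<in> F \<Longrightarrow> x + y \<in> F" using F_diff[of x "0 - y"] F_diff[of 0 y] F0 by simp
lemma F_power: "x \<in> F \<Longrightarrow> x ^ n \<in> F" by (induction n) (auto intro: F1 F_mult)
lemma F_divide: "x \<in> F \<Longrightarrow> y \<in> F \<Longrightarrow> x / y \<in> F" using F_mult F_inverse by (simp add: divide_inverse)
lemma D0: "0 \<in> D" using D_diff[OF D1 D1] by simp
lemma D_add: "x \<in> D \<Longrightarrow> y \<in> D \<Longrightarrow> x + y \<in> D" using D_diff[of x "0 - y"] D_diff[of 0 y] D0 by simp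
lemma D_power: "x \<in> D \<Longrightarrow> x ^ n \<in> D" by (induction n) (auto intro: D1 D_mult)
lemma D_sum: "(\<And>i. i \<in> J \<Longrightarrow> h i \<in> D) \<Longrightarrow> (\<Sum>i\<in>J. h i) \<in> D"
  by (induction J rule: infinite_finite_induct) (auto intro: D0 D_add)
lemma DF': "x \<in> D \<Longrightarrow> x \<in> F" using DF by auto

lemma \<Phi>_0: "b \<in> I \<Longrightarrow> \<Phi> b 0 = 0" using \<Phi>_add[of b 0 0] by (metis add.right_neutral add_left_cancel)
lemma \<Phi>_uminus: "b \<in> I \<Longrightarrow> \<Phi> b (- y) = - \<Phi> b y"
  using \<Phi>_add[of b y "-y"] \<Phi>_0[of b] by (simp add: eq_neg_iff_add_eq_0 add.commute)
lemma \<Phi>_diff: "b \<in> I \<Longrightarrow> \<Phi> b (y - y') = \<Phi> b y - \<Phi> b y'"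
  using \<Phi>_add[of b y "-y'"] by (simp add: \<Phi>_uminus)
lemma \<Phi>_sum': "b \<in> I \<Longrightarrow> \<Phi> b (\<Sum>i\<in>J. h i) = (\<Sum>i\<in>J. \<Phi> b (h i))"
  by (induction J rule: infinite_finite_induct) (auto simp: \<Phi>_0 \<Phi>_add)
lemma \<Phi>_1_1: "\<Phi> 1 1 = 1" using \<Phi>_basis[OF one_I one_I] by simp
lemma \<Phi>_1_F: "f \<in> F \<Longrightarrow> \<Phi> 1 f = f"
  using \<Phi>_scale[OF one_I, of f 1] \<Phi>_1_1 by simp

lemma A_iff: "y \<in> A \<longleftrightarrow> (\<forall>b\<in>I. \<Phi> b y \<in> D)" by (simp add: A_def)

lemma A_approx: "a \<in> A \<Longrightarrow> \<exists>s a'. s \<in> S \<and> a' \<in> A \<and> a = s + \<omega> * a'"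
  unfolding A_iff by (rule approx) blast

text \<open>Constants have coordinates in \<open>D\<close>. Together with \<open>\<Phi>_sum\<close>
  this exhibits \<open>A\<close> as the \<open>D\<close>-span of the constants, and so as a
  ring.\<close>

lemma A_\<kappa>_mult: "d \<in> D \<Longrightarrow> \<kappa> c * d \<in> A"
  unfolding A_iff using \<Phi>_scale[of _ d "\<kappa> c"] \<Phi>_\<kappa> D_mult DF by (auto simp: mult.commute subset_eq)
lemma A_0: "0 \<in> A" unfolding A_iff using \<Phi>_0 D0 by simp
lemma A_add: "x \<in> A \<Longrightarrow> y \<in> A \<Longrightarrow> x + y \<in> A" unfolding A_iff using \<Phi>_add D_add by simp
lemma A_diff: "x \<in> A \<Longrightarrow> y \<in> A \<Longrightarrow> x - y \<in> A" unfolding A_iff using \<Phi>_diff D_diff by simp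
lemma A_sum: "(\<And>i. i \<in> J \<Longrightarrow> h i \<in> A) \<Longrightarrow> (\<Sum>i\<in>J. h i) \<in> A"
  by (auto simp: A_iff \<Phi>_sum' intro!: D_sum)
lemma A_D_mult: "d \<in> D \<Longrightarrow> y \<in> A \<Longrightarrow> d * y \<in> A"
  unfolding A_iff using \<Phi>_scale D_mult DF by auto
lemma DA: "d \<in> D \<Longrightarrow> d \<in> A" using A_\<kappa>_mult[of d 1] by simp
lemma \<kappa>A: "\<kappa> c \<in> A" using A_\<kappa>_mult[OF D1] by simp
lemma A_1: "1 \<in> A" using DA D1 by blast
lemma A_\<kappa>: "y \<in> A \<Longrightarrow> \<kappa> c * y \<in> A"
proof -
  assume y: "y \<in> A"
  have "\<kappa> c * y = (\<Sum>b | b \<in> I \<and> \<Phi> b y \<noteq> 0. \<kappa> (c * b) * \<Phi> b y)"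
    by (subst \<Phi>_sum[of y]) (simp add: sum_distrib_left \<kappa>_mult mult.assoc)
  also have "\<dots> \<in> A" using y by (intro A_sum A_\<kappa>_mult) (auto simp: A_iff)
  finally show ?thesis .
qed

lemma A_mult: "x \<in> A \<Longrightarrow> y \<in> A \<Longrightarrow> x * y \<in> A"
proof -
  assume x: "x \<in> A" and y: "y \<in> A"
  have "x * y = (\<Sum>b | b \<in> I \<and> \<Phi> b x \<noteq> 0. \<kappa> b * (\<Phi> b x * y))"
    by (subst \<Phi>_sum[of x]) (simp add: sum_distrib_right mult.assoc)
  also have "\<dots> \<in> A" using x y by (intro A_sum A_\<kappa> A_D_mult) (auto simp: A_iff)
  finally show ?thesis .
qed

lemma A_power: "x \<in> A \<Longrightarrow> x ^ n \<in> A"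
  by (induction n) (auto intro: A_1 A_mult)

lemma D_power_mono: "y ^ (p ^ N) \<in> D \<Longrightarrow> N \<le> M \<Longrightarrow> y ^ (p ^ M) \<in> D"
proof -
  assume "y ^ (p ^ N) \<in> D" "N \<le> M"
  then have "(y ^ (p ^ N)) ^ (p ^ (M - N)) \<in> D" using D_power by blast
  then show ?thesis using \<open>N \<le> M\<close> by (simp flip: power_mult power_add)
qed

lemma F_power_mono: "y ^ (p ^ N) \<in> F \<Longrightarrow> N \<le> M \<Longrightarrow> y ^ (p ^ M) \<in> F"
proof -
  assume "y ^ (p ^ N) \<in> F" "N \<le> M"
  then have "(y ^ (p ^ N)) ^ (p ^ (M - N)) \<in> F" using F_power by blast
  then show ?thesis using \<open>N \<le> M\<close> by (simp flip: power_mult power_add)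
qed

text \<open>Frobenius is additive, and the finitely many basis constants occurring in
  \<open>y\<close> have powers in \<open>D\<close> for a common exponent.\<close>

lemma A_power_D:
  assumes y: "y \<in> A" shows "\<exists>N. y ^ (p ^ N) \<in> D"
proof -
  let ?J = "{b. b \<in> I \<and> \<Phi> b y \<noteq> 0}"
  have "\<forall>b. \<exists>N. \<kappa> b ^ (p ^ N) \<in> D" using \<kappa>_power_D by blast
  then obtain n where n: "\<And>b. \<kappa> b ^ (p ^ n b) \<in> D" by metis
  define N where "N = (\<Sum>b\<in>?J. n b)"
  have fJ: "finite ?J" using \<Phi>_finite[of y] by simp
  have kb: "\<kappa> b ^ (p ^ N) \<in> D" if "b \<in> ?J" for b
    using D_power_mono[OF n, of b N] fJ that unfolding N_def by (metis member_le_sum zero_le)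
  have "y ^ (p ^ N) = (\<Sum>b\<in>?J. \<kappa> b ^ (p ^ N) * \<Phi> b y ^ (p ^ N))"
    by (subst \<Phi>_sum[of y]) (simp add: frobenius_sum power_mult_distrib)
  also have "\<dots> \<in> D" using y by (intro D_sum D_mult kb D_power) (auto simp: A_iff)
  finally show ?thesis by blast
qed

end

section \<open>The discrete valuation of \<open>F\<close>, its extension to the whole field, and the
  residue field\<close>

context geom_point begin

definition unit :: "'l \<Rightarrow> bool" where "unit u \<longleftrightarrow> u \<in> D \<and> u \<noteq> 0 \<and> inverse u \<in> D"

lemma unit_mult: "unit u \<Longrightarrow> unit v \<Longrightarrow> unit (u * v)" by (auto simp: unit_def D_mult)
lemma unit_1: "unit 1" by (auto simp: unit_def D1)
lemma uniformizer_power_nonunit: "n > 0 \<Longrightarrow> unit u \<Longrightarrow> unit v \<Longrightarrow> \<omega> ^ n * u \<noteq> v"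
proof
  assume n: "n > 0" and u: "unit u" "unit v" and e: "\<omega> ^ n * u = v"
  have "\<omega> * (\<omega> ^ (n - 1) * u * inverse v) = 1"
    using n e u \<omega>_nz by (cases n) (auto simp: unit_def field_simps)
  then have "inverse \<omega> = \<omega> ^ (n - 1) * u * inverse v" by (rule inverse_unique)
  moreover have "\<omega> ^ (n - 1) * u * inverse v \<in> D" using u \<omega>_D by (auto simp: unit_def D_mult D_power)
  ultimately show False using \<omega>_nonunit by simp
qed

lemma F_cases: "f \<in> F \<Longrightarrow> f \<noteq> 0 \<Longrightarrow> \<exists>u n. unit u \<and> f = \<omega> powi n * u"
proof -
  assume "f \<in> F" "f \<noteq> 0"
  then obtain u n where u: "unit u" "f = \<omega> ^ n * u \<or> f * \<omega> ^ n = u" using dvr unfolding unit_def by blast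
  from u(2) show ?thesis
  proof
    assume "f = \<omega> ^ n * u"
    then show ?thesis using u(1) by (intro exI[of _ u] exI[of _ "int n"]) simp
  next
    assume "f * \<omega> ^ n = u"
    then have "f = \<omega> powi (- int n) * u" using \<omega>_nz by (simp add: power_int_minus field_simps)
    then show ?thesis using u(1) by blast
  qed
qed

text \<open>Meaningful only on nonzero elements of \<open>F\<close>: at 0 no \<open>n\<close>
  qualifies and the value is unspecified, so nonvanishing is assumed throughout.\<close>

definition vF :: "'l \<Rightarrow> int" where "vF f = (THE n. \<exists>u. unit u \<and> f = \<omega> powi n * u)"

lemma vF_eq: assumes "unit u" shows "vF (\<omega> powi n * u) = n"
  unfolding vF_def
proof (rule the_equality)
  show "\<exists>u'. unit u' \<and> \<omega> powi n * u = \<omega> powi n * u'" using assms by blast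
  fix m assume "\<exists>u'. unit u' \<and> \<omega> powi n * u = \<omega> powi m * u'"
  then obtain v where v: "unit v" "\<omega> powi n * u = \<omega> powi m * v" by blast
  have "\<omega> powi (n - m) * u = v" "\<omega> powi (m - n) * v = u"
    using v \<omega>_nz by (simp_all add: power_int_diff field_simps)
  then show "m = n"
    using uniformizer_power_nonunit[of "nat (n - m)" u v] uniformizer_power_nonunit[of "nat (m - n)" v u] assms v(1)
    by (cases n m rule: linorder_cases) (auto simp: power_int_def)
qed

lemma vF_mult: "f \<in> F \<Longrightarrow> g \<in> F \<Longrightarrow> f \<noteq> 0 \<Longrightarrow> g \<noteq> 0 \<Longrightarrow> vF (f * g) = vF f + vF g"
proof -
  assume "f \<in> F" "g \<in> F" "f \<noteq> 0" "g \<noteq> 0"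
  then obtain u n v m where u: "unit u" "f = \<omega> powi n * u" "unit v" "g = \<omega> powi m * v" using F_cases by metis
  then have "f * g = \<omega> powi (n + m) * (u * v)" using \<omega>_nz by (simp add: power_int_add)
  then show ?thesis using vF_eq u unit_mult by metis
qed

lemma vF_power: "f \<in> F \<Longrightarrow> f \<noteq> 0 \<Longrightarrow> vF (f ^ n) = int n * vF f"
proof (induction n)
  case 0
  then show ?case using vF_eq[OF unit_1, of 0] by simp
next
  case (Suc n)
  then show ?case using vF_mult[of f "f ^ n"] F_power by (simp add: algebra_simps)
qed

lemma vF_\<omega>: "vF \<omega> = 1" using vF_eq[OF unit_1, of 1] by simp

lemma vF_D: "f \<in> F \<Longrightarrow> f \<noteq> 0 \<Longrightarrow> f \<in> D \<longleftrightarrow> 0 \<le> vF f"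
proof -
  assume "f \<in> F" "f \<noteq> 0"
  then obtain u n where u: "unit u" "f = \<omega> powi n * u" using F_cases by metis
  show ?thesis
  proof
    assume f: "f \<in> D"
    show "0 \<le> vF f"
    proof (rule ccontr)
      assume "\<not> 0 \<le> vF f"
      then have n: "n < 0" using vF_eq u by simp
      then have "\<omega> ^ nat (- n) * f = u" using u \<omega>_nz by (simp add: power_int_def field_simps)
      then have "\<omega> * (\<omega> ^ (nat (-n) - 1) * f * inverse u) = 1"
        using n u by (cases "nat (-n)") (auto simp: unit_def field_simps)
      then have "inverse \<omega> = \<omega> ^ (nat (-n) - 1) * f * inverse u" by (rule inverse_unique)
      moreover have "\<omega> ^ (nat (-n) - 1) * f * inverse u \<in> D" using u f \<omega>_D by (auto simp: unit_def D_mult D_power)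
      ultimately show False using \<omega>_nonunit by simp
    qed
  next
    assume "0 \<le> vF f"
    then have "f = \<omega> ^ nat n * u" using vF_eq u by (simp add: power_int_def)
    then show "f \<in> D" using u \<omega>_D by (auto simp: unit_def D_mult D_power)
  qed
qed

lemma vF_add: "f \<in> F \<Longrightarrow> g \<in> F \<Longrightarrow> f \<noteq> 0 \<Longrightarrow> g \<noteq> 0 \<Longrightarrow> f + g \<noteq> 0 \<Longrightarrow> min (vF f) (vF g) \<le> vF (f + g)"
proof -
  have *: "vF f \<le> vF (f + g)" if "f \<in> F" "g \<in> F" "f \<noteq> 0" "g \<noteq> 0" "f + g \<noteq> 0" "vF f \<le> vF g" for f g
  proof -
    have gf: "g / f \<in> F" "1 + g / f \<in> F" using that F_divide F_add F1 by auto
    have "vF g = vF f + vF (g / f)" using vF_mult[of f "g / f"] that gf by simp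
    then have "g / f \<in> D" using vF_D[of "g / f"] that gf by simp
    then have "1 + g / f \<in> D" using D_add D1 by blast
    moreover have "1 + g / f \<noteq> 0" using that by (simp add: field_simps add_eq_0_iff)
    ultimately have "0 \<le> vF (1 + g / f)" using vF_D gf by blast
    moreover have "f + g = f * (1 + g / f)" using that by (simp add: field_simps)
    ultimately show ?thesis using vF_mult[of f "1 + g / f"] that gf \<open>1 + g / f \<noteq> 0\<close> by simp
  qed
  assume "f \<in> F" "g \<in> F" "f \<noteq> 0" "g \<noteq> 0" "f + g \<noteq> 0"
  then show ?thesis using *[of f g] *[of g f] by (cases "vF f \<le> vF g") (auto simp: add.commute)
qed

text \<open>The unique extension of \<open>vF\<close> along a purely inseparable extension, read off
  from a p-power in \<open>F\<close> and normalized by \<open>v0 \<omega> = 1\<close>. Values are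
  real because the denominators \<open>p ^ N\<close> are not yet known to be bounded.\<close>

definition v0 :: "'l \<Rightarrow> real" where
  "v0 y = (let N = (SOME N. y ^ (p ^ N) \<in> F) in vF (y ^ (p ^ N)) / p ^ N)"

text \<open>A larger exponent multiplies the value and the denominator by the same power of
  \<open>p\<close>, so the choice made in \<open>v0\<close> is immaterial.\<close>

lemma v0_eq: assumes y: "y \<noteq> 0" "y ^ (p ^ N) \<in> F" shows "v0 y = vF (y ^ (p ^ N)) / p ^ N"
proof -
  have *: "vF (y ^ (p ^ N)) / p ^ N = vF (y ^ (p ^ M)) / p ^ M" if "N \<le> M" "y ^ (p ^ N) \<in> F" for N M
  proof -
    have "y ^ (p ^ M) = (y ^ (p ^ N)) ^ (p ^ (M - N))" using that by (simp flip: power_mult power_add)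
    then have "vF (y ^ (p ^ M)) = int (p ^ (M - N)) * vF (y ^ (p ^ N))" using vF_power[OF that(2)] y by simp
    moreover have "real p ^ M = real p ^ N * real p ^ (M - N)" using that by (simp flip: power_add)
    ultimately show ?thesis using p_gt_1 by simp
  qed
  define M where "M = (SOME N. y ^ (p ^ N) \<in> F)"
  have M: "y ^ (p ^ M) \<in> F" unfolding M_def using someI_ex[OF power_F] .
  have "vF (y ^ (p ^ M)) / p ^ M = vF (y ^ (p ^ N)) / p ^ N"
  proof (cases "M \<le> N")
    case True
    then show ?thesis using *[OF True M] by simp
  next
    case False
    then have "N \<le> M" by simp
    from *[OF this y(2)] show ?thesis by (rule sym)
  qed
  then show ?thesis unfolding v0_def M_def[symmetric] Let_def .
qed

lemma power_F2: "\<exists>N. x ^ (p ^ N) \<in> F \<and> y ^ (p ^ N) \<in> F"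
proof -
  obtain N M where "x ^ (p ^ N) \<in> F" "y ^ (p ^ M) \<in> F" using power_F by metis
  then show ?thesis using F_power_mono[of x N "max N M"] F_power_mono[of y M "max N M"] by auto
qed

lemma v0_F: "f \<in> F \<Longrightarrow> f \<noteq> 0 \<Longrightarrow> v0 f = vF f"
  using v0_eq[of f 0] by simp

lemma v0_mult: "x \<noteq> 0 \<Longrightarrow> y \<noteq> 0 \<Longrightarrow> v0 (x * y) = v0 x + v0 y"
proof -
  assume nz: "x \<noteq> 0" "y \<noteq> 0"
  obtain N where N: "x ^ (p ^ N) \<in> F" "y ^ (p ^ N) \<in> F" using power_F2 by blast
  then show ?thesis
    using v0_eq[of "x * y" N] v0_eq[of x N] v0_eq[of y N] nz vF_mult[OF N] F_mult[OF N]
    by (simp add: power_mult_distrib add_divide_distrib)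
qed

lemma v0_add: "x \<noteq> 0 \<Longrightarrow> y \<noteq> 0 \<Longrightarrow> x + y \<noteq> 0 \<Longrightarrow> min (v0 x) (v0 y) \<le> v0 (x + y)"
proof -
  assume nz: "x \<noteq> 0" "y \<noteq> 0" "x + y \<noteq> 0"
  obtain N where N: "x ^ (p ^ N) \<in> F" "y ^ (p ^ N) \<in> F" using power_F2 by blast
  have "(x + y) ^ (p ^ N) \<noteq> 0" using nz by simp
  then have "min (vF (x ^ (p ^ N))) (vF (y ^ (p ^ N))) \<le> vF ((x + y) ^ (p ^ N))"
    using vF_add[OF N] nz by (simp add: frobenius_add)
  moreover have "(x + y) ^ (p ^ N) \<in> F" using N F_add by (simp add: frobenius_add)
  moreover have "real p ^ N > 0" using p_gt_1 by simp
  ultimately show ?thesis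
    using v0_eq[of "x + y" N] v0_eq[of x N] v0_eq[of y N] nz N
    by (simp add: min_def divide_le_cancel split: if_splits) linarith?
qed

lemma v0_power: "x \<noteq> 0 \<Longrightarrow> v0 (x ^ n) = n * v0 x"
proof (induction n)
  case 0
  then show ?case using v0_F[OF F1] vF_eq[OF unit_1, of 0] by simp
next
  case (Suc n)
  then show ?case using v0_mult[of x "x ^ n"] by (simp add: algebra_simps)
qed

text \<open>The p-power roots of elements of \<open>D\<close>. This form needs no valuation; it is
  the valuation ring of \<open>v0\<close> by \<open>R_iff\<close> and turns out to be the integral
  closure of \<open>A\<close>.\<close>

definition "R = {y. \<exists>N. y ^ (p ^ N) \<in> D}"

lemma R_iff: "y \<in> R \<longleftrightarrow> y = 0 \<or> 0 \<le> v0 y"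
proof (cases "y = 0")
  case True
  have "(0::'l) ^ (p ^ 0) \<in> D" using D0 by simp
  then show ?thesis using True unfolding R_def by blast
next
  case False
  have *: "y ^ (p ^ N) \<in> D \<longleftrightarrow> 0 \<le> v0 y" if "y ^ (p ^ N) \<in> F" for N
  proof -
    have "real p ^ N > 0" using p_gt_1 by simp
    from this show ?thesis using v0_eq[OF False that] vF_D[OF that] False pos_le_divide_eq[of "real p ^ N" 0 "real_of_int (vF (y ^ p ^ N))"] by simp
  qed
  obtain N where "y ^ (p ^ N) \<in> F" using power_F by blast
  from *[OF this] *[OF DF'] this show ?thesis using False unfolding R_def by blast
qed

lemma AR: "y \<in> A \<Longrightarrow> y \<in> R" using A_power_D unfolding R_def by blast

lemma v0_uminus: "v0 (- x) = v0 x"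
proof (cases "x = 0")
  case False
  have m1: "- 1 \<in> F" using F_diff[OF F0 F1] by simp
  have "2 * vF (-1) = vF ((-1) * (-1))" using vF_mult[OF m1 m1] by simp
  also have "\<dots> = 0" using vF_eq[OF unit_1, of 0] by simp
  finally have "v0 (-1) = 0" using v0_F[OF m1] by simp
  then show ?thesis using v0_mult[of "-1" x] False by simp
qed simp

lemma R_add: "x \<in> R \<Longrightarrow> y \<in> R \<Longrightarrow> x + y \<in> R"
  using v0_add[of x y] unfolding R_iff by (cases "x = 0"; cases "y = 0"; cases "x + y = 0") auto

lemma R_mult: "x \<in> R \<Longrightarrow> y \<in> R \<Longrightarrow> x * y \<in> R"
  using v0_mult[of x y] unfolding R_iff by (cases "x = 0"; cases "y = 0") auto

lemma R_uminus: "x \<in> R \<Longrightarrow> - x \<in> R" unfolding R_iff by (simp add: v0_uminus)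
lemma R_\<kappa>: "\<kappa> c \<in> R" using AR \<kappa>A by blast
lemma R_D: "d \<in> D \<Longrightarrow> d \<in> R" using AR DA by blast
lemma R_0: "0 \<in> R" by (simp add: R_iff)
lemma R_1: "1 \<in> R" using R_D D1 by blast
lemma R_sum: "(\<And>i. i \<in> J \<Longrightarrow> h i \<in> R) \<Longrightarrow> (\<Sum>i\<in>J. h i) \<in> R"
  by (induction J rule: infinite_finite_induct) (auto intro: R_0 R_add)
lemma R_power: "x \<in> R \<Longrightarrow> x ^ n \<in> R" by (induction n) (auto intro: R_1 R_mult)

lemma v0_\<kappa>: "c \<noteq> 0 \<Longrightarrow> v0 (\<kappa> c) = 0"
proof -
  assume c: "c \<noteq> 0"
  have "0 \<le> v0 (\<kappa> c)" "0 \<le> v0 (\<kappa> (inverse c))" using R_\<kappa> c R_iff \<kappa>_eq_0 by (metis nonzero_imp_inverse_nonzero)+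
  moreover have "v0 (\<kappa> c) + v0 (\<kappa> (inverse c)) = v0 1"
    using v0_mult[of "\<kappa> c" "\<kappa> (inverse c)"] c \<kappa>_eq_0 by (simp flip: \<kappa>_mult)
  moreover have "v0 1 = 0" using v0_power[of 1 0] by simp
  ultimately show ?thesis by linarith
qed

definition "M = {y. y = 0 \<or> 0 < v0 y}"

lemma M_add: "x \<in> M \<Longrightarrow> y \<in> M \<Longrightarrow> x + y \<in> M"
  using v0_add[of x y] unfolding M_def by (cases "x = 0"; cases "y = 0"; cases "x + y = 0") auto
lemma M_mult: "x \<in> M \<Longrightarrow> y \<in> R \<Longrightarrow> x * y \<in> M"
  using v0_mult[of x y] unfolding M_def R_iff by (cases "x = 0"; cases "y = 0") auto
lemma M_uminus: "x \<in> M \<Longrightarrow> - x \<in> M" unfolding M_def by (simp add: v0_uminus)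
lemma M_power: "x ^ n \<in> M \<longleftrightarrow> x \<in> M" if "n > 0"
  using v0_power[of x n] that unfolding M_def by (cases "x = 0") (auto simp: zero_less_mult_iff)
lemma \<omega>_M: "\<omega> \<in> M" using v0_F[OF DF'[OF \<omega>_D] \<omega>_nz] vF_\<omega> by (simp add: M_def)

text \<open>Each generator differs from a constant by an element with a p-power in
  \<open>\<omega>\<close> times \<open>D\<close>, hence of positive value; congruence to constants
  modulo \<open>M\<close> survives the ring operations.\<close>

lemma S_residue: "s \<in> S \<Longrightarrow> s \<in> R \<and> (\<exists>c. s - \<kappa> c \<in> M)"
proof (induction rule: generate_ring.induct)
  case one
  have "1 - \<kappa> 1 \<in> M" by (simp add: M_def)
  then have "1 \<in> R \<and> (\<exists>c. 1 - \<kappa> c \<in> M)" using R_1 by blast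
  then show ?case by (simp add: ring_of_type_algebra_def)
next
  case (incl h)
  then consider c where "h = \<kappa> c" | "h \<in> G" by auto
  then show ?case
  proof cases
    case 1
    have "h - \<kappa> c \<in> M" using 1 by (simp add: M_def)
    then show ?thesis using 1 R_\<kappa> by blast
  next
    case 2
    from residue[OF this] obtain c N d where c: "d \<in> D" "(h - \<kappa> c) ^ (p ^ N) = \<omega> * d" by blast
    then have "(h - \<kappa> c) ^ (p ^ N) \<in> M" using M_mult[OF \<omega>_M R_D] by simp
    then have "h - \<kappa> c \<in> M" using M_power[of "p ^ N"] p_gt_1 by simp
    moreover have "h \<in> A" using G_int 2 by (auto simp: A_iff)
    ultimately show ?thesis using AR by blast
  qed
next
  case (a_inv h)
  have e: "\<ominus>\<^bsub>ring_of_type_algebra\<^esub> h = - h"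
  proof -
    interpret cring "ring_of_type_algebra :: 'l ring" by (rule cring_from_type_algebra)
    have "h \<oplus>\<^bsub>ring_of_type_algebra\<^esub> - h = \<zero>\<^bsub>ring_of_type_algebra\<^esub>" by (simp add: ring_of_type_algebra_def)
    then show ?thesis by (metis (no_types, lifting) add.inv_equality UNIV_I a_comm partial_object.select_convs(1) ring_of_type_algebra_def)
  qed
  from a_inv obtain c where "h \<in> R" "h - \<kappa> c \<in> M" by blast
  moreover have "- h - \<kappa> (- c) = - (h - \<kappa> c)" by (simp add: \<kappa>_uminus)
  ultimately show ?case unfolding e using M_uminus R_uminus by metis
next
  case (eng_add h1 h2)
  then obtain c1 c2 where c: "h1 \<in> R" "h2 \<in> R" "h1 - \<kappa> c1 \<in> M" "h2 - \<kappa> c2 \<in> M" by blast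
  have "h1 + h2 - \<kappa> (c1 + c2) = (h1 - \<kappa> c1) + (h2 - \<kappa> c2)" by (simp add: \<kappa>_add)
  then have "h1 + h2 - \<kappa> (c1 + c2) \<in> M" using M_add c by metis
  then show ?case using R_add c by (auto simp: ring_of_type_algebra_def)
next
  case (eng_mult h1 h2)
  then obtain c1 c2 where c: "h1 \<in> R" "h2 \<in> R" "h1 - \<kappa> c1 \<in> M" "h2 - \<kappa> c2 \<in> M" by blast
  have "h1 * h2 - \<kappa> (c1 * c2) = (h1 - \<kappa> c1) * h2 + (h2 - \<kappa> c2) * \<kappa> c1" by (simp add: \<kappa>_mult algebra_simps)
  then have "h1 * h2 - \<kappa> (c1 * c2) \<in> M" using M_add M_mult c R_\<kappa> by metis
  then show ?case using R_mult c by (auto simp: ring_of_type_algebra_def)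
qed

text \<open>The residue field of \<open>R\<close> consists of constants only. A p-power of
  \<open>y\<close> lies in \<open>D\<close>, where \<open>approx\<close> replaces it by an element
  of \<open>S\<close> modulo \<open>\<omega>\<close>; the constant found there has a p-power root,
  and Frobenius is injective modulo \<open>M\<close>.\<close>

lemma R_residue: "y \<in> R \<Longrightarrow> \<exists>c. y - \<kappa> c \<in> M"
proof -
  assume "y \<in> R"
  then obtain N where N: "y ^ (p ^ N) \<in> D" by (auto simp: R_def)
  obtain s a' where s: "s \<in> S" "a' \<in> A" "y ^ (p ^ N) = s + \<omega> * a'" using A_approx[OF DA[OF N]] by blast
  then obtain c where c: "s - \<kappa> c \<in> M" using S_residue by blast
  obtain c' where c': "\<kappa> c = \<kappa> c' ^ (p ^ N)" using \<kappa>_root by blast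
  have "(y - \<kappa> c') ^ (p ^ N) = (s - \<kappa> c) + \<omega> * a'" using s(3) c' by (simp only: frobenius_diff) simp
  then have "(y - \<kappa> c') ^ (p ^ N) \<in> M" using M_add[OF c M_mult[OF \<omega>_M AR[OF s(2)]]] by simp
  moreover have "p ^ N > 0" using p_gt_1 by simp
  ultimately have "y - \<kappa> c' \<in> M" using M_power by blast
  then show ?thesis by blast
qed

end

section \<open>Finiteness over the field of p-th powers, bounded denominators, and
  discreteness\<close>

context geom_point begin

lemma frobenius1: "(x + y) ^ p = x ^ p + (y::'l) ^ p" "(x - y) ^ p = x ^ p - (y::'l) ^ p"
  "(\<Sum>i\<in>J. h i) ^ p = (\<Sum>i\<in>J. (h i :: 'l) ^ p)"
  using frobenius_add[of x y 1] frobenius_diff[of x y 1] frobenius_sum[of h J 1] by simp_all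

text \<open>L as a vector space over L^p, with scalars represented by their p-th roots. The scalar
  field is then the whole type, and coordinates are p-th roots of the usual ones.\<close>

sublocale frob: vector_space "\<lambda>a y. a ^ p * (y::'l)"
  by unfold_locales (auto simp: frobenius1 algebra_simps power_mult_distrib)

sublocale lin: linear_quotient "\<lambda>c y. \<kappa> c * y"
  by unfold_locales (auto simp: \<kappa>_add \<kappa>_mult algebra_simps)

lemma F_denominator: "f \<in> F \<Longrightarrow> \<exists>n. \<omega> ^ n * f \<in> D"
proof (cases "f = 0")
  case False
  assume f: "f \<in> F"
  then obtain u n where u: "u \<in> D" "f = \<omega> ^ n * u \<or> f * \<omega> ^ n = u" using dvr False by blast
  from u(2) show ?thesis
  proof
    assume "f = \<omega> ^ n * u"
    then have "\<omega> ^ 0 * f \<in> D" using u \<omega>_D D_mult D_power by simp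
    then show ?thesis by blast
  next
    assume "f * \<omega> ^ n = u"
    then have "\<omega> ^ n * f \<in> D" using u by (simp add: mult.commute)
    then show ?thesis by blast
  qed
qed (auto simp: D0)

lemma \<omega>_power_D: "\<omega> ^ n \<in> D" by (rule D_power[OF \<omega>_D])

lemma A_denominator: "\<exists>n. \<omega> ^ n * y \<in> A"
proof -
  let ?J = "{b. b \<in> I \<and> \<Phi> b y \<noteq> 0}"
  have "\<forall>b\<in>I. \<exists>n. \<omega> ^ n * \<Phi> b y \<in> D" using F_denominator \<Phi>_F by blast
  then obtain n where n: "\<And>b. b \<in> I \<Longrightarrow> \<omega> ^ n b * \<Phi> b y \<in> D" by metis
  define N where "N = (\<Sum>b\<in>?J. n b)"
  have fJ: "finite ?J" using \<Phi>_finite[of y] by simp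
  have "\<Phi> b (\<omega> ^ N * y) \<in> D" if b: "b \<in> I" for b
  proof (cases "\<Phi> b y = 0")
    case True
    then show ?thesis using \<Phi>_scale[OF b DF'[OF \<omega>_power_D]] D0 by simp
  next
    case False
    then have "n b \<le> N" unfolding N_def using fJ b by (intro member_le_sum) auto
    then have "\<omega> ^ N = \<omega> ^ (N - n b) * \<omega> ^ n b" by (simp flip: power_add)
    then have "\<Phi> b (\<omega> ^ N * y) = \<omega> ^ (N - n b) * (\<omega> ^ n b * \<Phi> b y)"
      using \<Phi>_scale[OF b DF'[OF \<omega>_power_D]] by (simp add: mult.assoc)
    then show ?thesis using D_mult[OF \<omega>_power_D n[OF b]] by simp
  qed
  then show ?thesis unfolding A_iff by blast
qed

lemma A_denominator_mono: "\<omega> ^ n * y \<in> A \<Longrightarrow> n \<le> m \<Longrightarrow> \<omega> ^ m * y \<in> A"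
proof -
  assume a: "\<omega> ^ n * y \<in> A" "n \<le> m"
  then have "\<omega> ^ m = \<omega> ^ (m - n) * \<omega> ^ n" by (simp flip: power_add)
  then show ?thesis using A_D_mult[OF \<omega>_power_D a(1), of "m - n"] by (simp add: mult.assoc)
qed

lemma A_common_denominator:
  assumes "finite J" shows "\<exists>n. \<forall>j\<in>J. \<omega> ^ n * h j \<in> A"
  using assms
proof (induction J)
  case (insert j J)
  then obtain n where n: "\<forall>j\<in>J. \<omega> ^ n * h j \<in> A" by blast
  obtain m where m: "\<omega> ^ m * h j \<in> A" using A_denominator by blast
  have "\<forall>j\<in>insert j J. \<omega> ^ max n m * h j \<in> A"
  proof
    fix i assume "i \<in> insert j J"
    then consider "i = j" | "\<omega> ^ n * h i \<in> A" using n by blast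
    then show "\<omega> ^ max n m * h i \<in> A"
      by cases (use A_denominator_mono[OF m, of "max n m"] A_denominator_mono[of n "h i" "max n m"] in simp_all)
  qed
  then show ?case by blast
qed auto

lemma S_mult: "s \<in> S \<Longrightarrow> t \<in> S \<Longrightarrow> s * t \<in> S"
  using generate_ring.eng_mult[of s ring_of_type_algebra "range \<kappa> \<union> G" t] by (simp add: ring_of_type_algebra_def)

lemma S_power: "s \<in> S \<Longrightarrow> s ^ n \<in> S"
proof (induction n)
  case 0
  show ?case using generate_ring.one[of ring_of_type_algebra "range \<kappa> \<union> G"] by (simp add: ring_of_type_algebra_def)
qed (auto intro: S_mult)

lemma G_A: "g \<in> G \<Longrightarrow> g \<in> A" using G_int by (auto simp: A_iff)

text \<open>Localization adds no generators over p-th powers, because a denominator can be made a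
  p-th power; \<open>S\<close> is then handled by \<open>sum_generated_monomials\<close>.\<close>

lemma frobenius_span:
  assumes a: "a \<in> A"
  shows "\<exists>\<gamma>. (\<forall>\<beta>. \<gamma> \<beta> \<in> A) \<and> a = (\<Sum>\<beta>\<in>G \<rightarrow>\<^sub>E {..<p}. \<gamma> \<beta> ^ p * (\<Prod>g\<in>G. g ^ \<beta> g))"
proof -
  obtain s t where st: "s \<in> S" "t \<in> S" "t \<noteq> 0" "inverse t \<in> A" "a * t = s"
    using localization[of a] a by (auto simp: A_iff)
  \<comment> \<open>From \<open>a = s / t\<close> one gets
    \<open>a = (1 / t) ^ p * (s * t ^ (p - 1))\<close>, and \<open>1 / t\<close> lies in
    \<open>A\<close>.\<close>
  define s' where "s' = s * t ^ (p - 1)"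
  have s': "s' \<in> S" unfolding s'_def using st S_mult S_power by blast
  have "a = s / t" using st by (simp add: field_simps)
  also have "\<dots> = inverse t ^ p * s'" unfolding s'_def using st p_gt_1 by (cases p) (auto simp: field_simps)
  finally have a_eq: "a = inverse t ^ p * s'" .
  define C where "C = (\<lambda>x. x ^ p) ` A"
  have "\<exists>\<gamma>. (\<forall>\<beta>. \<gamma> \<beta> \<in> C) \<and> s' = (\<Sum>\<beta>\<in>G \<rightarrow>\<^sub>E {..<p}. \<gamma> \<beta> * (\<Prod>g\<in>G. g ^ \<beta> g))"
  proof (rule sum_generated_monomials[where H = "range \<kappa>"])
    show "1 \<in> C" unfolding C_def using A_1 by (intro image_eqI[of _ _ 1]) auto
    show "x - y \<in> C" if "x \<in> C" "y \<in> C" for x y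
      using that A_diff unfolding C_def by (auto simp: frobenius1(2)[symmetric])
    show "x * y \<in> C" if "x \<in> C" "y \<in> C" for x y
      using that A_mult unfolding C_def by (auto simp: power_mult_distrib[symmetric])
    show "finite G" by (rule G_finite)
    show "p > 0" using p_gt_1 by simp
    show "g ^ p \<in> C" if "g \<in> G" for g using G_A[OF that] unfolding C_def by blast
    show "range \<kappa> \<subseteq> C"
    proof
      fix x assume "x \<in> range \<kappa>"
      then obtain c' where "x = \<kappa> c' ^ p" using \<kappa>_root[of _ 1] by auto
      then show "x \<in> C" unfolding C_def using \<kappa>A by blast
    qed
  qed (use s' in simp)
  then obtain \<gamma> where g: "\<And>\<beta>. \<gamma> \<beta> \<in> C" "s' = (\<Sum>\<beta>\<in>G \<rightarrow>\<^sub>E {..<p}. \<gamma> \<beta> * (\<Prod>g\<in>G. g ^ \<beta> g))" by blast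
  have ex: "\<exists>x. x \<in> A \<and> \<gamma> \<beta> = x ^ p" for \<beta> using g(1)[of \<beta>] unfolding C_def by blast
  define \<delta> where "\<delta> \<beta> = (SOME x. x \<in> A \<and> \<gamma> \<beta> = x ^ p)" for \<beta>
  have d: "\<delta> \<beta> \<in> A" "\<gamma> \<beta> = \<delta> \<beta> ^ p" for \<beta> using someI_ex[OF ex[of \<beta>]] unfolding \<delta>_def by auto
  have "a = (\<Sum>\<beta>\<in>G \<rightarrow>\<^sub>E {..<p}. (inverse t * \<delta> \<beta>) ^ p * (\<Prod>g\<in>G. g ^ \<beta> g))"
    unfolding a_eq g(2) sum_distrib_left by (intro sum.cong refl) (simp only: d(2) power_mult_distrib mult.assoc)
  moreover have "inverse t * \<delta> \<beta> \<in> A" for \<beta> using A_mult[OF st(4) d(1)] .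
  ultimately show ?thesis by (intro exI[of _ "\<lambda>\<beta>. inverse t * \<delta> \<beta>"]) auto
qed

text \<open>A basis of L over L^p is selected among 1 and the monomials in \<open>G\<close>. Writing
  the finitely many monomials in it costs one fixed denominator, so the coordinates of all elements
  of \<open>A\<close> have denominators dividing the same \<open>\<omega> ^ k\<close>.\<close>

lemma frobenius_basis:
  "\<exists>B k. finite B \<and> frob.independent B \<and> 1 \<in> B \<and> frob.span B = UNIV \<and>
    (\<forall>a\<in>A. \<exists>s. (\<forall>b\<in>B. \<omega> ^ k * s b \<in> A) \<and> a = (\<Sum>b\<in>B. s b ^ p * b))"
proof -
  define Be where "Be = G \<rightarrow>\<^sub>E {..<p}"
  have fBe: "finite Be" unfolding Be_def using G_finite by (intro finite_PiE) auto
  define mo where "mo \<beta> = (\<Prod>g\<in>G. g ^ \<beta> g)" for \<beta> :: "'l \<Rightarrow> nat"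
  \<comment> \<open>The element 1 is forced into the basis, since later the coordinate at 1 of a
    p-th power is to be read off.\<close>
  have "frob.independent {1}" by simp
  then obtain B where B: "{1} \<subseteq> B" "B \<subseteq> insert 1 (mo ` Be)" "frob.independent B" "insert 1 (mo ` Be) \<subseteq> frob.span B"
    using frob.maximal_independent_subset_extend[of "{1}" "insert 1 (mo ` Be)"] by blast
  have fB: "finite B" using B(2) fBe finite_subset by blast
  have "\<forall>\<beta>\<in>Be. \<exists>r. mo \<beta> = (\<Sum>b\<in>B. r b ^ p * b)" using B(4) frob.span_finite[OF fB] by auto
  then obtain r where r: "\<And>\<beta>. \<beta> \<in> Be \<Longrightarrow> mo \<beta> = (\<Sum>b\<in>B. r \<beta> b ^ p * b)" by metis
  obtain k where k: "\<forall>j\<in>Be \<times> B. \<omega> ^ k * (case j of (\<beta>, b) \<Rightarrow> r \<beta> b) \<in> A"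
    using A_common_denominator[of "Be \<times> B"] fBe fB by blast
  have main: "\<exists>s. (\<forall>b\<in>B. \<omega> ^ k * s b \<in> A) \<and> a = (\<Sum>b\<in>B. s b ^ p * b)" if a: "a \<in> A" for a
  proof -
    obtain \<gamma> where g: "\<And>\<beta>. \<gamma> \<beta> \<in> A" "a = (\<Sum>\<beta>\<in>Be. \<gamma> \<beta> ^ p * mo \<beta>)"
      using frobenius_span[OF a] unfolding Be_def mo_def by blast
    define s where "s b = (\<Sum>\<beta>\<in>Be. \<gamma> \<beta> * r \<beta> b)" for b
    have "\<omega> ^ k * s b \<in> A" if "b \<in> B" for b
    proof -
      have "\<omega> ^ k * s b = (\<Sum>\<beta>\<in>Be. \<gamma> \<beta> * (\<omega> ^ k * r \<beta> b))" unfolding s_def by (simp add: sum_distrib_left mult_ac)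
      also have "\<dots> \<in> A" using k that by (intro A_sum A_mult[OF g(1)]) auto
      finally show ?thesis .
    qed
    moreover have "a = (\<Sum>\<beta>\<in>Be. \<Sum>b\<in>B. (\<gamma> \<beta> * r \<beta> b) ^ p * b)"
      unfolding g(2) by (intro sum.cong refl) (simp only: r sum_distrib_left power_mult_distrib mult.assoc)
    then have "a = (\<Sum>b\<in>B. s b ^ p * b)"
      unfolding s_def frobenius1(3) by (subst (asm) sum.swap) (simp add: sum_distrib_right)
    ultimately show ?thesis by blast
  qed
  \<comment> \<open>\<open>\<omega> ^ (n * p)\<close> is a p-th power, hence an invertible scalar,
    so clearing denominators does not affect membership in the span.\<close>
  have "y \<in> frob.span B" for y
  proof -
    obtain n where n: "\<omega> ^ n * y \<in> A" using A_denominator by blast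
    have "n \<le> n * p" using p_gt_1 by simp
    with n have "\<omega> ^ (n * p) * y \<in> A" by (rule A_denominator_mono)
    from main[OF this] have "\<omega> ^ (n * p) * y \<in> frob.span B" using frob.span_finite[OF fB] by auto
    then have "inverse (\<omega> ^ n) ^ p * (\<omega> ^ (n * p) * y) \<in> frob.span B" by (rule frob.span_scale)
    moreover have "inverse (\<omega> ^ n) ^ p * \<omega> ^ (n * p) = 1"
      using \<omega>_nz by (simp add: power_mult flip: power_mult_distrib)
    ultimately show ?thesis by (simp flip: mult.assoc)
  qed
  then have sp: "frob.span B = UNIV" by auto
  have "1 \<in> B" using B(1) by simp
  show ?thesis by (intro exI[of _ B] exI[of _ k] conjI ballI fB B(3) \<open>1 \<in> B\<close> sp main)
qed

text \<open>This is finiteness of the normalization. For \<open>y ^ p\<close> in \<open>A\<close>,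
  the coordinate at the basis element 1 is \<open>y\<close> itself, so
  \<open>\<omega> ^ k * y\<close> lies in \<open>A\<close>; every element of \<open>R\<close> is
  reached from \<open>D\<close> by finitely many extractions of p-th roots, and the denominators do
  not accumulate.\<close>

lemma conductor_exists: "\<exists>e. \<forall>y\<in>R. \<omega> ^ e * y \<in> A"
proof -
  obtain B k where B: "finite B" "frob.independent B" "1 \<in> B" "frob.span B = UNIV"
    "\<And>a. a \<in> A \<Longrightarrow> \<exists>s. (\<forall>b\<in>B. \<omega> ^ k * s b \<in> A) \<and> a = (\<Sum>b\<in>B. s b ^ p * b)"
    using frobenius_basis by blast
  have step: "\<omega> ^ k * y \<in> A" if y: "y ^ p \<in> A" for y
  proof -
    obtain s where s: "\<forall>b\<in>B. \<omega> ^ k * s b \<in> A" "y ^ p = (\<Sum>b\<in>B. s b ^ p * b)" using B(5)[OF y] by blast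
    have "y ^ p = (\<Sum>b\<in>B. (if b = 1 then y else 0) ^ p * b)"
      using B(1,3) p_gt_1 by (simp add: if_distrib[of "\<lambda>x. x ^ p"] if_distrib[of "\<lambda>x. x * _"] sum.delta cong: if_cong)
    then have "(\<Sum>b\<in>B. (s b - (if b = 1 then y else 0)) ^ p * b) = 0"
      using s(2) by (simp only: frobenius1(2) left_diff_distrib sum_subtractf) simp
    then have "s 1 - (if (1::'l) = 1 then y else 0) = 0"
      using frob.independentD[OF B(2) B(1) order_refl, of "\<lambda>b. s b - (if b = 1 then y else 0)" 1] B(3) by blast
    then show ?thesis using s(1) B(3) by auto
  qed
  \<comment> \<open>The exponent \<open>2 * k\<close> is a fixed point of the induction:
    \<open>\<omega> ^ (2 * k) * y ^ p\<close> in \<open>A\<close> gives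
    \<open>(\<omega> ^ k * y) ^ p\<close> in \<open>A\<close> because 2 is at most \<open>p\<close>,
    and \<open>step\<close> costs one more factor \<open>\<omega> ^ k\<close>.\<close>
  have "\<omega> ^ (2 * k) * y \<in> A" if "y ^ (p ^ N) \<in> A" for N y
    using that
  proof (induction N arbitrary: y)
    case 0
    then show ?case using A_denominator_mono[of 0 y "2 * k"] by simp
  next
    case (Suc N)
    from Suc.prems have "(y ^ p) ^ (p ^ N) \<in> A" by (simp add: power_mult)
    then have "\<omega> ^ (2 * k) * y ^ p \<in> A" by (rule Suc.IH)
    moreover have "2 * k \<le> k * p" using p_gt_1 by simp
    ultimately have "\<omega> ^ (k * p) * y ^ p \<in> A" by (rule A_denominator_mono)
    then have "(\<omega> ^ k * y) ^ p \<in> A" by (simp add: power_mult power_mult_distrib)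
    from step[OF this] show ?case by (simp add: mult_2 power_add mult.assoc)
  qed
  then have "\<forall>y\<in>R. \<omega> ^ (2 * k) * y \<in> A" unfolding R_def using DA by blast
  then show ?thesis by blast
qed

text \<open>Modulo \<open>\<omega>\<close> every generator has a p-power that is constant, so
  finitely many monomials span over the constants. The case of general \<open>m\<close> is filtered
  by the powers of \<open>\<omega>\<close>, each layer being a copy of the first.\<close>

lemma A_finite_mod: "\<exists>E. finite E \<and> (\<forall>a\<in>A. \<exists>x\<in>lin.span E. \<exists>a'\<in>A. a = x + \<omega> ^ m * a')"
proof -
  have D\<omega>: "\<omega> * a \<in> A" if "a \<in> A" for a using A_D_mult[OF \<omega>_D that] .
  define C where "C = {\<kappa> c + \<omega> * a | c a. a \<in> A}"
  have C1: "1 \<in> C" unfolding C_def using A_0 by (intro CollectI exI[of _ 1] exI[of _ 0]) auto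
  have Cdiff: "x - y \<in> C" if "x \<in> C" "y \<in> C" for x y
  proof -
    from that obtain c a c' a' where c: "x = \<kappa> c + \<omega> * a" "y = \<kappa> c' + \<omega> * a'" "a \<in> A" "a' \<in> A" unfolding C_def by blast
    have "x - y = \<kappa> (c - c') + \<omega> * (a - a')" unfolding c by (simp add: \<kappa>_diff algebra_simps)
    then show ?thesis unfolding C_def using A_diff[OF c(3,4)] by blast
  qed
  have Cmult: "x * y \<in> C" if "x \<in> C" "y \<in> C" for x y
  proof -
    from that obtain c a c' a' where c: "x = \<kappa> c + \<omega> * a" "y = \<kappa> c' + \<omega> * a'" "a \<in> A" "a' \<in> A" unfolding C_def by blast
    have "x * y = \<kappa> (c * c') + \<omega> * (\<kappa> c * a' + \<kappa> c' * a + a * (\<omega> * a'))" unfolding c by (simp add: \<kappa>_mult algebra_simps)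
    moreover have "\<kappa> c * a' + \<kappa> c' * a + a * (\<omega> * a') \<in> A"
      by (intro A_add A_mult[OF c(3)] A_\<kappa> c(3,4) D\<omega>)
    ultimately show ?thesis unfolding C_def by blast
  qed
  have Cpow: "x ^ n \<in> C" if "x \<in> C" for x n by (induction n) (auto intro: C1 Cmult that)
  have "\<exists>N. g ^ (p ^ N) \<in> C" if g: "g \<in> G" for g
  proof -
    from residue[OF g] obtain c N d where c: "d \<in> D" "(g - \<kappa> c) ^ (p ^ N) = \<omega> * d" by blast
    then have "g ^ (p ^ N) = \<kappa> (c ^ (p ^ N)) + \<omega> * d" by (simp add: frobenius_diff \<kappa>_power algebra_simps)
    then show ?thesis unfolding C_def using DA[OF c(1)] by blast
  qed
  then obtain n where n: "\<And>g. g \<in> G \<Longrightarrow> g ^ (p ^ n g) \<in> C" by metis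
  define N where "N = (\<Sum>g\<in>G. n g)"
  have gN: "g ^ (p ^ N) \<in> C" if "g \<in> G" for g
  proof -
    have "n g \<le> N" unfolding N_def using G_finite that by (intro member_le_sum) auto
    then have "g ^ (p ^ N) = (g ^ (p ^ n g)) ^ (p ^ (N - n g))" by (simp flip: power_mult power_add)
    then show ?thesis using Cpow[OF n[OF that]] by simp
  qed
  define Be where "Be = G \<rightarrow>\<^sub>E {..<p ^ N}"
  have fBe: "finite Be" unfolding Be_def using G_finite by (intro finite_PiE) auto
  define mo where "mo \<beta> = (\<Prod>g\<in>G. g ^ \<beta> g)" for \<beta> :: "'l \<Rightarrow> nat"
  define E where "E = mo ` Be"
  have moA: "mo \<beta> \<in> A" for \<beta>
  proof -
    have "(\<Prod>g\<in>H. g ^ \<beta> g) \<in> A" if "H \<subseteq> G" for H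
      using finite_subset[OF that G_finite] that
    proof (induction H)
      case empty
      then show ?case using A_1 by simp
    next
      case (insert g H)
      have "g ^ \<beta> g * (\<Prod>g\<in>H. g ^ \<beta> g) \<in> A" using insert by (intro A_mult[OF A_power[OF G_A]]) auto
      then show ?case using insert by simp
    qed
    then show ?thesis unfolding mo_def by blast
  qed
  have E1: "\<exists>x\<in>lin.span E. \<exists>a'\<in>A. a = x + \<omega> * a'" if a: "a \<in> A" for a
  proof -
    obtain s a' where s: "s \<in> S" "a' \<in> A" "a = s + \<omega> * a'" using A_approx[OF a] by blast
    have "\<exists>\<gamma>. (\<forall>\<beta>. \<gamma> \<beta> \<in> C) \<and> s = (\<Sum>\<beta>\<in>G \<rightarrow>\<^sub>E {..<p ^ N}. \<gamma> \<beta> * (\<Prod>g\<in>G. g ^ \<beta> g))"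
    proof (rule sum_generated_monomials[where H = "range \<kappa>"])
      have "\<kappa> c = \<kappa> c + \<omega> * 0" for c by simp
      then show "range \<kappa> \<subseteq> C" unfolding C_def using A_0 by blast
      show "p ^ N > 0" using p_gt_1 by simp
      show "s \<in> S" by (rule s(1))
    qed (auto intro: C1 Cdiff Cmult gN G_finite)
    then obtain \<gamma> where g: "\<And>\<beta>. \<gamma> \<beta> \<in> C" "s = (\<Sum>\<beta>\<in>Be. \<gamma> \<beta> * mo \<beta>)" unfolding Be_def mo_def by blast
    have ex: "\<exists>ca. snd ca \<in> A \<and> \<gamma> \<beta> = \<kappa> (fst ca) + \<omega> * snd ca" for \<beta>
      using g(1)[of \<beta>] unfolding C_def by auto
    define ca where "ca \<beta> = (SOME ca. snd ca \<in> A \<and> \<gamma> \<beta> = \<kappa> (fst ca) + \<omega> * snd ca)" for \<beta>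
    define c al where "c = fst \<circ> ca" and "al = snd \<circ> ca"
    have c: "al \<beta> \<in> A" "\<gamma> \<beta> = \<kappa> (c \<beta>) + \<omega> * al \<beta>" for \<beta>
      using someI_ex[OF ex[of \<beta>]] unfolding ca_def c_def al_def by auto
    have "a = (\<Sum>\<beta>\<in>Be. \<kappa> (c \<beta>) * mo \<beta>) + \<omega> * ((\<Sum>\<beta>\<in>Be. al \<beta> * mo \<beta>) + a')"
      unfolding s(3) g(2) c(2) by (simp add: sum.distrib sum_distrib_left algebra_simps)
    moreover have "(\<Sum>\<beta>\<in>Be. \<kappa> (c \<beta>) * mo \<beta>) \<in> lin.span E"
      unfolding E_def by (intro lin.span_sum lin.span_scale lin.span_base) auto
    moreover have "(\<Sum>\<beta>\<in>Be. al \<beta> * mo \<beta>) + a' \<in> A" by (intro A_add A_sum A_mult c moA s)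
    ultimately show ?thesis by blast
  qed
  show ?thesis
  proof (induction m)
    case 0
    have "\<exists>x\<in>lin.span {}. \<exists>a'\<in>A. a = x + \<omega> ^ 0 * a'" if "a \<in> A" for a
      using that by (intro bexI[of _ 0] bexI[of _ a]) auto
    then show ?case by blast
  next
    case (Suc m)
    then obtain Em where Em: "finite Em" "\<And>a. a \<in> A \<Longrightarrow> \<exists>x\<in>lin.span Em. \<exists>a'\<in>A. a = x + \<omega> ^ m * a'" by blast
    define E' where "E' = Em \<union> (\<lambda>x. \<omega> ^ m * x) ` E"
    have "\<exists>x\<in>lin.span E'. \<exists>a'\<in>A. a = x + \<omega> ^ Suc m * a'" if a: "a \<in> A" for a
    proof -
      obtain x a' where x: "x \<in> lin.span Em" "a' \<in> A" "a = x + \<omega> ^ m * a'" using Em(2)[OF a] by blast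
      obtain x' a'' where x': "x' \<in> lin.span E" "a'' \<in> A" "a' = x' + \<omega> * a''" using E1[OF x(2)] by blast
      have "\<omega> ^ m * x' \<in> lin.span ((\<lambda>x. \<omega> ^ m * x) ` E)"
        using x'(1)
      proof (induction rule: lin.span_induct_alt)
        case base
        then show ?case by (simp add: lin.span_zero)
      next
        case (step c x y)
        have "\<kappa> c * (\<omega> ^ m * x) + \<omega> ^ m * y \<in> lin.span ((\<lambda>x. \<omega> ^ m * x) ` E)"
          by (rule lin.span_add[OF lin.span_scale[OF lin.span_base] step(2)]) (use step(1) in blast)
        moreover have "\<kappa> c * (\<omega> ^ m * x) + \<omega> ^ m * y = \<omega> ^ m * (\<kappa> c * x + y)" by (simp add: algebra_simps)
        ultimately show ?case by (simp only:)
      qed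
      then have x'E: "\<omega> ^ m * x' \<in> lin.span E'" by (rule subsetD[OF lin.span_mono, rotated]) (simp add: E'_def)
      have "x \<in> lin.span E'" using x(1) by (rule subsetD[OF lin.span_mono, rotated]) (simp add: E'_def)
      from lin.span_add[OF this x'E] have "x + \<omega> ^ m * x' \<in> lin.span E'" .
      moreover have "a = (x + \<omega> ^ m * x') + \<omega> ^ Suc m * a''" unfolding x(3) x'(3) by (simp add: algebra_simps)
      ultimately show ?thesis using x'(2) by blast
    qed
    moreover have "finite E'" unfolding E'_def E_def using Em(1) fBe by auto
    ultimately show ?case by blast
  qed
qed

text \<open>Terms of pairwise different values cannot cancel, so the sum has the least of their
  values.\<close>

lemma v0_sum_distinct:
  assumes J: "finite J" and nz: "\<And>j. j \<in> J \<Longrightarrow> h j \<noteq> 0" and inj: "inj_on (\<lambda>j. v0 (h j)) J"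
    and s: "(\<Sum>j\<in>J. h j) = 0 \<or> m \<le> v0 (\<Sum>j\<in>J. h j)" and j: "j \<in> J"
  shows "m \<le> v0 (h j)"
proof -
  have "J \<noteq> {}" using j by auto
  define \<mu> where "\<mu> = Min ((\<lambda>j. v0 (h j)) ` J)"
  have \<mu>_le: "\<mu> \<le> v0 (h i)" if "i \<in> J" for i unfolding \<mu>_def using J that by auto
  have "\<mu> \<in> (\<lambda>j. v0 (h j)) ` J" unfolding \<mu>_def using J \<open>J \<noteq> {}\<close> by (intro Min_in) auto
  then obtain i where i: "i \<in> J" "v0 (h i) = \<mu>" by auto
  define N where "N = {y. y = 0 \<or> \<mu> < v0 y}"
  have Nadd: "x + y \<in> N" if "x \<in> N" "y \<in> N" for x y
    using that v0_add[of x y] unfolding N_def by (cases "x = 0"; cases "y = 0"; cases "x + y = 0") auto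
  have Nsum: "(\<Sum>j\<in>T. h j) \<in> N" if "T \<subseteq> J - {i}" for T
    using finite_subset[OF that finite_Diff[OF J]] that
  proof (induction T)
    case empty
    then show ?case by (simp add: N_def)
  next
    case (insert t T)
    have "v0 (h t) \<noteq> \<mu>" using insert.prems i inj by (auto simp: inj_on_def)
    then have "h t \<in> N" using \<mu>_le[of t] insert.prems unfolding N_def by auto
    then show ?case using insert Nadd by simp
  qed
  have e: "(\<Sum>j\<in>J. h j) = h i + (\<Sum>j\<in>J - {i}. h j)" using J i by (simp add: sum.remove)
  have "m \<le> \<mu>"
  proof (rule ccontr)
    assume "\<not> m \<le> \<mu>"
    then have "(\<Sum>j\<in>J. h j) \<in> N" using s unfolding N_def by auto
    moreover have "- (\<Sum>j\<in>J - {i}. h j) \<in> N" using Nsum[OF order_refl] unfolding N_def by (simp add: v0_uminus)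
    ultimately have "h i \<in> N" using Nadd e by fastforce
    then show False using nz[OF i(1)] i(2) by (simp add: N_def)
  qed
  then show ?thesis using \<mu>_le[OF j] by simp
qed

lemma A_subspace: "lin.subspace ((\<lambda>a. y * a) ` A)"
  unfolding lin.subspace_def
proof (intro conjI ballI allI)
  show "0 \<in> (\<lambda>a. y * a) ` A" using A_0 by (intro image_eqI[of _ _ 0]) auto
  fix u assume "u \<in> (\<lambda>a. y * a) ` A"
  then obtain a where a: "a \<in> A" "u = y * a" by blast
  show "\<kappa> c * u \<in> (\<lambda>a. y * a) ` A" for c
    using A_\<kappa>[OF a(1)] a(2) by (intro image_eqI[of _ _ "\<kappa> c * a"]) (auto simp: mult_ac)
  fix v assume "v \<in> (\<lambda>a. y * a) ` A"
  then obtain a' where a': "a' \<in> A" "v = y * a'" by blast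
  show "u + v \<in> (\<lambda>a. y * a) ` A"
    using A_add[OF a(1) a'(1)] a(2) a'(2) by (intro image_eqI[of _ _ "a + a'"]) (auto simp: distrib_left)
qed

text \<open>Elements with different values in the interval from 0 to 1 are carried into
  \<open>A\<close> by the conductor element \<open>\<omega> ^ e\<close> and are independent over the
  constants modulo \<open>\<omega> ^ Suc e * A\<close>; that quotient is finite-dimensional.\<close>

lemma finite_values: "finite {v0 y | y. y \<noteq> 0 \<and> 0 \<le> v0 y \<and> v0 y < 1}" (is "finite ?V")
proof (rule ccontr)
  assume inf: "infinite ?V"
  obtain e where e: "\<And>y. y \<in> R \<Longrightarrow> \<omega> ^ e * y \<in> A" using conductor_exists by blast
  obtain E where E: "finite E" "\<And>a. a \<in> A \<Longrightarrow> \<exists>x\<in>lin.span E. \<exists>a'\<in>A. a = x + \<omega> ^ Suc e * a'"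
    using A_finite_mod[of "Suc e"] by blast
  obtain T where T: "T \<subseteq> ?V" "finite T" "card T = Suc (card E)" using infinite_arbitrarily_large[OF inf, of "Suc (card E)"] by blast
  then have "\<forall>t\<in>T. \<exists>y. y \<noteq> 0 \<and> 0 \<le> v0 y \<and> v0 y < 1 \<and> t = v0 y" by blast
  from bchoice[OF this] obtain y where "\<forall>t\<in>T. y t \<noteq> 0 \<and> 0 \<le> v0 (y t) \<and> v0 (y t) < 1 \<and> t = v0 (y t)" ..
  then have y: "y t \<noteq> 0 \<and> 0 \<le> v0 (y t) \<and> v0 (y t) < 1" "v0 (y t) = t" if "t \<in> T" for t
    using that by auto
  \<comment> \<open>Its value is \<open>e + t\<close>, strictly below \<open>e + 1\<close>, while
    nonzero elements of the submodule have value at least \<open>e + 1\<close>.\<close>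
  define f where "f t = \<omega> ^ e * y t" for t
  have vw: "v0 \<omega> = 1" using v0_F[OF DF'[OF \<omega>_D] \<omega>_nz] vF_\<omega> by simp
  have vf: "v0 (f t) = real e + t" "f t \<noteq> 0" if "t \<in> T" for t
    unfolding f_def using v0_mult[of "\<omega> ^ e" "y t"] v0_power[OF \<omega>_nz, of e] vw y[OF that] \<omega>_nz by auto
  have inj: "inj_on f T"
  proof (rule inj_onI)
    fix x y assume xy: "x \<in> T" "y \<in> T" "f x = f y"
    then have "v0 (f x) = v0 (f y)" by simp
    then show "x = y" using vf(1)[OF xy(1)] vf(1)[OF xy(2)] by linarith
  qed
  define W where "W = (\<lambda>a. \<omega> ^ Suc e * a) ` A"
  have W: "lin.subspace W" unfolding W_def by (rule A_subspace)
  have Wv: "w = 0 \<or> Suc e \<le> v0 w" if "w \<in> W" for w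
  proof -
    from that obtain a where a: "a \<in> A" "w = \<omega> ^ Suc e * a" unfolding W_def by blast
    show ?thesis
    proof (cases "a = 0")
      case False
      then have "v0 w = real (Suc e) + v0 a"
        using v0_mult[of "\<omega> ^ Suc e" a] v0_power[OF \<omega>_nz, of "Suc e"] vw \<omega>_nz a by simp
      then show ?thesis using AR[OF a(1)] False by (simp add: R_iff)
    qed (use a in simp)
  qed
  have "lin.indep_mod W (f ` T)"
    unfolding lin.indep_mod_def
  proof (intro conjI allI impI)
    show "finite (f ` T)" using T by simp
    fix c assume c: "(\<Sum>b\<in>f ` T. \<kappa> (c b) * b) \<in> W"
    define J where "J = {t \<in> T. c (f t) \<noteq> 0}"
    have fJ: "finite J" unfolding J_def using T by simp
    have v: "v0 (\<kappa> (c (f t)) * f t) = real e + t" "\<kappa> (c (f t)) * f t \<noteq> 0" if "t \<in> J" for t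
    proof -
      have t: "t \<in> T" "c (f t) \<noteq> 0" using that by (auto simp: J_def)
      then have k: "\<kappa> (c (f t)) \<noteq> 0" by (simp add: \<kappa>_eq_0)
      show "v0 (\<kappa> (c (f t)) * f t) = real e + t" using v0_mult[OF k vf(2)[OF t(1)]] v0_\<kappa>[OF t(2)] vf(1)[OF t(1)] by simp
      show "\<kappa> (c (f t)) * f t \<noteq> 0" using k vf(2)[OF t(1)] by simp
    qed
    have "(\<Sum>b\<in>f ` T. \<kappa> (c b) * b) = (\<Sum>t\<in>T. \<kappa> (c (f t)) * f t)" using inj by (simp add: sum.reindex)
    also have "\<dots> = (\<Sum>t\<in>J. \<kappa> (c (f t)) * f t)" unfolding J_def using T by (intro sum.mono_neutral_right) auto
    finally have s: "(\<Sum>t\<in>J. \<kappa> (c (f t)) * f t) = 0 \<or> Suc e \<le> v0 (\<Sum>t\<in>J. \<kappa> (c (f t)) * f t)" using Wv[OF c] by simp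
    have "J = {}"
    proof (rule ccontr)
      assume "J \<noteq> {}"
      then obtain t where t: "t \<in> J" by blast
      have "inj_on (\<lambda>t. v0 (\<kappa> (c (f t)) * f t)) J" by (rule inj_onI) (use v(1) in simp)
      from v0_sum_distinct[OF fJ v(2) this s t] have "real (Suc e) \<le> real e + t" using v(1)[OF t] by simp
      moreover have "t < 1" using y(1,2)[of t] t by (auto simp: J_def)
      ultimately show False by simp
    qed
    then show "\<forall>b\<in>f ` T. c b = 0" by (auto simp: J_def)
  qed
  then have "card (f ` T) \<le> card E"
  proof (rule lin.indep_mod_card_le[OF W _ E(1)])
    fix u assume "u \<in> f ` T"
    then obtain t where t: "t \<in> T" "u = f t" by blast
    have "y t \<in> R" using y(1)[OF t(1)] by (simp add: R_iff)
    then have "u \<in> A" unfolding t f_def by (rule e)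
    from E(2)[OF this] obtain x a' where x: "x \<in> lin.span E" "a' \<in> A" "u = x + \<omega> ^ Suc e * a'" by blast
    then have "u - x \<in> W" unfolding W_def by auto
    then show "\<exists>x\<in>lin.span E. u - x \<in> W" using x(1) by blast
  qed
  then show False using T inj by (simp add: card_image)
qed

text \<open>Finitely many values in the unit interval leave a least positive one, and division with
  remainder shows that it generates the value group.\<close>

lemma discrete: "\<exists>z. z \<noteq> 0 \<and> 0 < v0 z \<and> (\<forall>y. y \<noteq> 0 \<longrightarrow> (\<exists>n::int. v0 y = n * v0 z))"
proof -
  define P where "P = {v0 y | y. y \<noteq> 0 \<and> 0 < v0 y \<and> v0 y \<le> 1}"
  have vw: "v0 \<omega> = 1" using v0_F[OF DF'[OF \<omega>_D] \<omega>_nz] vF_\<omega> by simp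
  have "P \<subseteq> insert 1 {v0 y | y. y \<noteq> 0 \<and> 0 \<le> v0 y \<and> v0 y < 1}" unfolding P_def by force
  then have fP: "finite P" using finite_values finite_subset by blast
  have P1: "1 \<in> P" unfolding P_def using vw \<omega>_nz by (intro CollectI exI[of _ \<omega>]) auto
  have "Min P \<in> P" using fP P1 by (intro Min_in) auto
  then obtain z where z: "z \<noteq> 0" "0 < v0 z" "v0 z = Min P" "v0 z \<le> 1" unfolding P_def by auto
  have zmin: "v0 z \<le> v0 y" if "y \<noteq> 0" "0 < v0 y" for y
  proof (cases "v0 y \<le> 1")
    case True
    then have "v0 y \<in> P" unfolding P_def using that by blast
    then have "Min P \<le> v0 y" using Min_le[OF fP] by blast
    then show ?thesis using z(3) by linarith
  next
    case False
    then show ?thesis using z(4) by linarith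
  qed
  have "\<exists>n::int. v0 y = n * v0 z" if y: "y \<noteq> 0" for y
  proof -
    \<comment> \<open>The remainder has value between 0 and \<open>v0 z\<close>, hence value 0 by
      minimality.\<close>
    define n where "n = \<lfloor>v0 y / v0 z\<rfloor>"
    have vinv: "v0 (inverse x) = - v0 x" if "x \<noteq> 0" for x
      using v0_mult[of x "inverse x"] that v0_power[of 1 0] by simp
    have vz: "v0 (z powi (- n)) = - n * v0 z"
      using z(1) v0_power[OF z(1)] vinv[of "z ^ nat n"] by (auto simp: power_int_def power_inverse)
    define r where "r = y * z powi (- n)"
    have r: "r \<noteq> 0" "v0 r = v0 y - n * v0 z" unfolding r_def using y z(1) vz v0_mult[of y "z powi (- n)"] by auto
    have n1: "n \<le> v0 y / v0 z" "v0 y / v0 z < n + 1" unfolding n_def by linarith+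
    have "n * v0 z \<le> v0 y" "v0 y < (n + 1) * v0 z"
      using n1 z(2) by (simp_all add: pos_le_divide_eq pos_divide_less_eq)
    then have "0 \<le> v0 r" "v0 r < v0 z" using r by (auto simp: algebra_simps)
    then have "v0 r = 0" using zmin[OF r(1)] by linarith
    then show ?thesis using r(2) by auto
  qed
  then show ?thesis using z by blast
qed

end

section \<open>The normalized valuation\<close>

text \<open>Whereas \<open>v0\<close> is normalized on \<open>F\<close>, \<open>nu\<close> is
  normalized on the whole field, with uniformizer \<open>z\<close>. The ratio
  \<open>nu \<omega>\<close> is the ramification index and will be identified with the residue
  degree.\<close>

locale geom_point_val = geom_point +
  fixes z :: 'b and nu :: "'b \<Rightarrow> int"
  assumes z_nz: "z \<noteq> 0" and v0_z: "0 < v0 z" and nu_0: "nu 0 = 0"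
    and v0_nu: "y \<noteq> 0 \<Longrightarrow> v0 y = nu y * v0 z"
begin

lemma v0_le_nu: "x \<noteq> 0 \<Longrightarrow> y \<noteq> 0 \<Longrightarrow> v0 x \<le> v0 y \<longleftrightarrow> nu x \<le> nu y"
  using v0_nu[of x] v0_nu[of y] v0_z by simp

lemma nu_z: "nu z = 1" using v0_nu[OF z_nz] v0_z by simp

lemma nu_mult: "x \<noteq> 0 \<Longrightarrow> y \<noteq> 0 \<Longrightarrow> nu (x * y) = nu x + nu y"
proof -
  assume nz: "x \<noteq> 0" "y \<noteq> 0"
  then have "nu (x * y) * v0 z = (nu x + nu y) * v0 z"
    using v0_mult[OF nz] v0_nu[OF nz(1)] v0_nu[OF nz(2)] v0_nu[of "x * y"] by (simp add: distrib_right)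
  then show ?thesis using v0_z by simp
qed

lemma nu_add: "x \<noteq> 0 \<Longrightarrow> y \<noteq> 0 \<Longrightarrow> x + y \<noteq> 0 \<Longrightarrow> min (nu x) (nu y) \<le> nu (x + y)"
  using v0_add[of x y] v0_le_nu[of x "x + y"] v0_le_nu[of y "x + y"] v0_le_nu[of x y] by (auto simp: min_def split: if_splits)

lemma nu_1: "nu 1 = 0" using nu_mult[of 1 1] by simp

lemma nu_power: "x \<noteq> 0 \<Longrightarrow> nu (x ^ n) = int n * nu x"
  by (induction n) (auto simp: nu_1 nu_mult algebra_simps)

lemma nu_inverse: "x \<noteq> 0 \<Longrightarrow> nu (inverse x) = - nu x"
  using nu_mult[of x "inverse x"] nu_1 by simp

lemma nu_divide: "x \<noteq> 0 \<Longrightarrow> y \<noteq> 0 \<Longrightarrow> nu (x / y) = nu x - nu y"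
  using nu_mult[of x "inverse y"] nu_inverse[of y] by (simp add: divide_inverse)

lemma nu_z_power: "nu (z ^ n) = int n" using nu_power[OF z_nz] nu_z by simp

lemma nu_\<kappa>: "nu (\<kappa> c) = 0"
  using v0_\<kappa>[of c] v0_nu[of "\<kappa> c"] v0_z \<kappa>_eq_0 nu_0 by (cases "c = 0") auto

lemma R_nu: "y \<in> R \<longleftrightarrow> y = 0 \<or> 0 \<le> nu y"
  using v0_nu[of y] v0_z by (cases "y = 0") (auto simp: R_iff zero_le_mult_iff)

lemma M_nu: "y \<in> M \<longleftrightarrow> y = 0 \<or> 0 < nu y"
  using v0_nu[of y] v0_z by (cases "y = 0") (auto simp: M_def zero_less_mult_iff)

lemma nu_\<omega>: "0 < nu \<omega>" using \<omega>_M \<omega>_nz by (simp add: M_nu)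

lemma nu_F: "f \<in> F \<Longrightarrow> nu f = vF f * nu \<omega>" if "f \<noteq> 0"
proof -
  assume f: "f \<in> F"
  have "real_of_int (nu f) * v0 z = vF f" using v0_F[OF f that] v0_nu[OF that] by simp
  moreover have "real_of_int (nu \<omega>) * v0 z = 1" using v0_F[OF DF'[OF \<omega>_D] \<omega>_nz] v0_nu[OF \<omega>_nz] vF_\<omega> by simp
  ultimately have "real_of_int (nu f) * v0 z = real_of_int (vF f * nu \<omega>) * v0 z" by (simp add: algebra_simps)
  then show ?thesis using v0_z by (simp only: mult_cancel_right of_int_eq_iff) simp
qed

text \<open>The source of the divisibility in the theorem: it remains to produce an element of
  \<open>F\<close> with the right value.\<close>

lemma nu_F_dvd: "f \<in> F \<Longrightarrow> nu \<omega> dvd nu f"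
  using nu_F[of f] nu_0 by (cases "f = 0") auto

lemma z_R: "z \<in> R" by (simp add: R_nu nu_z)

lemma z_power_R: "(\<exists>r\<in>R. y = z ^ n * r) \<longleftrightarrow> y = 0 \<or> int n \<le> nu y"
proof (cases "y = 0")
  case False
  show ?thesis
  proof
    assume "\<exists>r\<in>R. y = z ^ n * r"
    then obtain r where r: "r \<in> R" "y = z ^ n * r" by blast
    then have "r \<noteq> 0" using False by auto
    then have "nu y = int n + nu r" using r(2) nu_mult[of "z ^ n" r] z_nz nu_z_power by simp
    then show "y = 0 \<or> int n \<le> nu y" using r(1) \<open>r \<noteq> 0\<close> by (simp add: R_nu)
  next
    assume "y = 0 \<or> int n \<le> nu y"
    then have "y / z ^ n \<in> R" using nu_divide[of y "z ^ n"] z_nz nu_z_power False by (simp add: R_nu)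
    moreover have "y = z ^ n * (y / z ^ n)" using z_nz by simp
    ultimately show "\<exists>r\<in>R. y = z ^ n * r" by blast
  qed
qed (auto intro!: bexI[of _ 0] R_0)

lemma R_expand1: "y \<in> R \<Longrightarrow> \<exists>c. \<exists>r\<in>R. y = \<kappa> c + z * r"
proof -
  assume "y \<in> R"
  then obtain c where "y - \<kappa> c \<in> M" using R_residue by blast
  then have "\<exists>r\<in>R. y - \<kappa> c = z ^ 1 * r" unfolding z_power_R by (auto simp: M_nu)
  then obtain r where "r \<in> R" "y = \<kappa> c + z * r" by (auto simp: algebra_simps)
  then show ?thesis by blast
qed

text \<open>Since residues are constants, power series expansions in \<open>z\<close> exist to every
  finite order; the remainder takes the place of a completion.\<close>

lemma R_expand: "y \<in> R \<Longrightarrow> \<exists>c. \<exists>r\<in>R. y = (\<Sum>i<n. \<kappa> (c i) * z ^ i) + z ^ n * r"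
proof (induction n)
  case (Suc n)
  then obtain c r where c: "r \<in> R" "y = (\<Sum>i<n. \<kappa> (c i) * z ^ i) + z ^ n * r" by blast
  obtain c' r' where r: "r' \<in> R" "r = \<kappa> c' + z * r'" using R_expand1[OF c(1)] by blast
  have "(\<Sum>i<Suc n. \<kappa> ((c(n := c')) i) * z ^ i) = (\<Sum>i<n. \<kappa> (c i) * z ^ i) + \<kappa> c' * z ^ n" by simp
  then have "y = (\<Sum>i<Suc n. \<kappa> ((c(n := c')) i) * z ^ i) + z ^ Suc n * r'"
    unfolding c(2) r(2) by (simp add: algebra_simps)
  then show ?case using r(1) by blast
qed auto

lemma nu_sum_distinct:
  assumes J: "finite J" and nz: "\<And>j. j \<in> J \<Longrightarrow> h j \<noteq> 0" and inj: "inj_on (\<lambda>j. nu (h j)) J"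
    and s: "(\<Sum>j\<in>J. h j) = 0 \<or> m \<le> nu (\<Sum>j\<in>J. h j)" and j: "j \<in> J"
  shows "m \<le> nu (h j)"
proof -
  have "inj_on (\<lambda>j. v0 (h j)) J"
  proof (rule inj_onI)
    fix a b assume ab: "a \<in> J" "b \<in> J" "v0 (h a) = v0 (h b)"
    then have "nu (h a) = nu (h b)" using v0_nu[OF nz] v0_z by simp
    then show "a = b" using inj ab by (simp add: inj_on_def)
  qed
  moreover have "(\<Sum>j\<in>J. h j) = 0 \<or> m * v0 z \<le> v0 (\<Sum>j\<in>J. h j)"
    using s v0_nu[of "\<Sum>j\<in>J. h j"] v0_z by (cases "(\<Sum>j\<in>J. h j) = 0") auto
  ultimately have "m * v0 z \<le> v0 (h j)" using v0_sum_distinct[where h = h and J = J, OF J nz _ _ j] by blast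
  then show ?thesis using v0_nu[OF nz[OF j]] v0_z by simp
qed

text \<open>The value of \<open>a i ^ (p ^ N) * z ^ i\<close> is congruent to \<open>i\<close>
  modulo \<open>p ^ N\<close>, so the terms have different values and cannot cancel. With
  \<open>m = 0\<close> it says that an integral element has integral coordinates; with
  \<open>m\<close> above all values it gives independence.\<close>

lemma z_power_sum:
  assumes s: "(\<Sum>i<p ^ N. a i ^ (p ^ N) * z ^ i) = 0 \<or> int (p ^ N) * m \<le> nu (\<Sum>i<p ^ N. a i ^ (p ^ N) * z ^ i)"
    and i: "i < p ^ N" "a i \<noteq> 0"
  shows "m \<le> nu (a i)"
proof -
  define J where "J = {i. i < p ^ N \<and> a i \<noteq> 0}"
  have nu: "nu (a i ^ (p ^ N) * z ^ i) = int (p ^ N) * nu (a i) + int i" if "a i \<noteq> 0" for i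
    using nu_mult[of "a i ^ (p ^ N)" "z ^ i"] nu_power[OF that, of "p ^ N"] nu_z_power z_nz that by simp
  have J: "finite J" unfolding J_def by simp
  have eq: "(\<Sum>i<p ^ N. a i ^ (p ^ N) * z ^ i) = (\<Sum>i\<in>J. a i ^ (p ^ N) * z ^ i)"
    unfolding J_def using p_gt_1 by (intro sum.mono_neutral_right) auto
  have inj: "inj_on (\<lambda>i. nu (a i ^ (p ^ N) * z ^ i)) J"
  proof (rule inj_onI)
    fix i k assume ik: "i \<in> J" "k \<in> J" "nu (a i ^ (p ^ N) * z ^ i) = nu (a k ^ (p ^ N) * z ^ k)"
    then have "int (p ^ N) * nu (a i) + int i = int (p ^ N) * nu (a k) + int k" using nu by (auto simp: J_def)
    then have "(int (p ^ N) * nu (a i) + int i) mod int (p ^ N) = (int (p ^ N) * nu (a k) + int k) mod int (p ^ N)" by simp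
    then have "int i mod int (p ^ N) = int k mod int (p ^ N)" by simp
    then show "i = k" using ik by (simp add: J_def)
  qed
  have "int (p ^ N) * m \<le> nu (a i ^ (p ^ N) * z ^ i)"
    by (rule nu_sum_distinct[where J = J and h = "\<lambda>i. a i ^ (p ^ N) * z ^ i", OF J _ inj s[unfolded eq]])
      (use i z_nz in \<open>auto simp: J_def\<close>)
  \<comment> \<open>The bound on the term loses \<open>i\<close>, which is less than
    \<open>p ^ N\<close> and is recovered because \<open>nu (a i)\<close> is an integer.\<close>
  moreover have "int i < int (p ^ N)" using i(1) by (simp only: of_nat_less_iff)
  ultimately have "int (p ^ N) * m < int (p ^ N) * (nu (a i) + 1)"
    using nu[OF i(2)] by (simp only: distrib_left mult_1_right)
  then have "m < nu (a i) + 1" by (rule mult_left_less_imp_less) simp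
  then show ?thesis by simp
qed

text \<open>The powers of \<open>x\<close> below \<open>p ^ N\<close> form a basis of L over its
  subfield of \<open>p ^ N\<close>-th powers; coefficients are again represented by their
  roots.\<close>

definition pbasis :: "nat \<Rightarrow> 'b \<Rightarrow> bool" where
  "pbasis N x \<longleftrightarrow> (\<forall>y. \<exists>a. y = (\<Sum>i<p ^ N. a i ^ (p ^ N) * x ^ i)) \<and>
     (\<forall>a. (\<Sum>i<p ^ N. a i ^ (p ^ N) * x ^ i) = 0 \<longrightarrow> (\<forall>i<p ^ N. a i = 0))"

text \<open>Writing an exponent as \<open>j * p + i\<close>, the term
  \<open>a ^ (q * p) * x ^ (j * p + i)\<close> is \<open>(a ^ q * x ^ j) ^ p * x ^ i\<close>: the
  expansion of level N is substituted into the coefficients of the expansion of level 1.\<close>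

lemma pbasis_power:
  assumes x: "pbasis 1 x" shows "pbasis N x"
proof (induction N)
  case 0
  show ?case unfolding pbasis_def by auto
next
  case (Suc N)
  define q where "q = p ^ N"
  have q: "p ^ Suc N = q * p" by (simp add: q_def)
  have reindex: "(\<Sum>i<q * p. f i) = (\<Sum>j<q. \<Sum>i<p. f (j * p + i))" for f :: "nat \<Rightarrow> 'b"
  proof -
    have "(\<Sum>i\<in>{j * p..<j * p + p}. f i) = (\<Sum>i<p. f (j * p + i))" for j
      using sum.shift_bounds_nat_ivl[of f 0 "j * p" p] by (simp add: add.commute lessThan_atLeast0)
    then show ?thesis using sum.nat_group[of f p q] by (simp add: lessThan_atLeast0)
  qed
  have split: "(\<Sum>i<q * p. a i ^ (q * p) * x ^ i) = (\<Sum>i<p. (\<Sum>j<q. a (j * p + i) ^ q * x ^ j) ^ p * x ^ i)" for a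
  proof -
    have "(\<Sum>i<q * p. a i ^ (q * p) * x ^ i) = (\<Sum>j<q. \<Sum>i<p. a (j * p + i) ^ (q * p) * x ^ (j * p + i))" by (rule reindex)
    also have "\<dots> = (\<Sum>i<p. \<Sum>j<q. a (j * p + i) ^ (q * p) * x ^ (j * p + i))" by (rule sum.swap)
    also have "\<dots> = (\<Sum>i<p. (\<Sum>j<q. a (j * p + i) ^ q * x ^ j) ^ p * x ^ i)"
      by (intro sum.cong refl)
        (simp only: frobenius1(3) sum_distrib_right power_mult_distrib power_mult power_add mult.assoc)
    finally show ?thesis .
  qed
  have x1: "\<exists>a. y = (\<Sum>i<p. a i ^ p * x ^ i)" "(\<Sum>i<p. a i ^ p * x ^ i) = 0 \<Longrightarrow> i < p \<Longrightarrow> a i = 0" for y a i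
    using x unfolding pbasis_def by auto
  have xN: "\<exists>a. y = (\<Sum>i<q. a i ^ q * x ^ i)" "(\<Sum>i<q. a i ^ q * x ^ i) = 0 \<Longrightarrow> i < q \<Longrightarrow> a i = 0" for y a i
    using Suc unfolding pbasis_def q_def by auto
  show ?case unfolding pbasis_def q
  proof (intro conjI allI impI)
    fix y
    obtain a where a: "y = (\<Sum>i<p. a i ^ p * x ^ i)" using x1(1) by blast
    define b where "b i = (SOME b. a i = (\<Sum>j<q. b j ^ q * x ^ j))" for i
    have b: "a i = (\<Sum>j<q. b i j ^ q * x ^ j)" for i unfolding b_def using someI_ex[OF xN(1)] .
    define c where "c k = b (k mod p) (k div p)" for k
    have "(\<Sum>k<q * p. c k ^ (q * p) * x ^ k) = (\<Sum>i<p. (\<Sum>j<q. c (j * p + i) ^ q * x ^ j) ^ p * x ^ i)" by (rule split)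
    also have "\<dots> = y" unfolding a by (intro sum.cong refl) (simp add: c_def b[symmetric])
    finally show "\<exists>a. y = (\<Sum>i<q * p. a i ^ (q * p) * x ^ i)" by (intro exI[of _ c]) simp
  next
    fix a k assume a: "(\<Sum>i<q * p. a i ^ (q * p) * x ^ i) = 0" and k: "k < q * p"
    have pp: "p > 0" using p_gt_1 by simp
    have "k mod p < p" using pp by simp
    moreover have "k div p < q" using k by (simp add: less_mult_imp_div_less)
    ultimately have "a (k div p * p + k mod p) = 0"
      using x1(2)[OF a[unfolded split], of "k mod p"]
        xN(2)[where a = "\<lambda>j. a (j * p + k mod p)" and i = "k div p"] by simp
    then show "a k = 0" by simp
  qed
qed

text \<open>Over a complete field, expansions in \<open>z\<close> would show directly that the
  powers of \<open>z\<close> span L over L^p. Here a vector outside their span is detected by a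
  coordinate functional that vanishes on them; the functional has bounded denominators on
  \<open>R\<close>, yet would take a value of arbitrarily large pole order on the remainder of an
  expansion.\<close>

lemma z_pbasis: "pbasis N z"
proof (rule pbasis_power)
  have "\<exists>a. y = (\<Sum>i<p. a i ^ p * z ^ i)" for y
  proof -
    define Z where "Z = (\<lambda>i. z ^ i) ` {..<p}"
    have fZ: "finite Z" by (simp add: Z_def)
    have injz: "inj_on (\<lambda>i. z ^ i) {..<p}"
      by (rule inj_onI) (metis nu_z_power of_nat_eq_iff)
    have zspan: "\<kappa> c * z ^ i \<in> frob.span Z" for c i
    proof -
      obtain c' where c': "\<kappa> c = \<kappa> c' ^ p" using \<kappa>_root[of c 1] by auto
      have "z ^ i = z ^ (i div p * p) * z ^ (i mod p)" by (simp flip: power_add)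
      then have eq: "\<kappa> c * z ^ i = (\<kappa> c' * z ^ (i div p)) ^ p * z ^ (i mod p)"
        by (simp only: c' power_mult_distrib power_mult mult.assoc)
      have "i mod p < p" using p_gt_1 by simp
      then have "z ^ (i mod p) \<in> frob.span Z" unfolding Z_def by (intro frob.span_base) auto
      then show ?thesis unfolding eq by (rule frob.span_scale)
    qed
    have "frob.span Z = UNIV"
    proof (rule ccontr)
      assume "frob.span Z \<noteq> UNIV"
      then obtain y0 where y0: "y0 \<notin> frob.span Z" by blast
      obtain n0 where n0: "\<omega> ^ n0 * y0 \<in> A" using A_denominator by blast
      have "n0 \<le> n0 * p" using p_gt_1 by simp
      with n0 have "\<omega> ^ (n0 * p) * y0 \<in> A" by (rule A_denominator_mono)
      \<comment> \<open>Scaling by a p-th power moves the vector into \<open>R\<close> and keeps it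
        outside the span.\<close>
      define y1 where "y1 = (\<omega> ^ n0) ^ p * y0"
      have y1R: "y1 \<in> R" using AR \<open>\<omega> ^ (n0 * p) * y0 \<in> A\<close> by (simp add: y1_def power_mult)
      have y1: "y1 \<notin> frob.span Z"
      proof
        assume "y1 \<in> frob.span Z"
        then have "inverse (\<omega> ^ n0) ^ p * y1 \<in> frob.span Z" by (rule frob.span_scale)
        moreover have "inverse (\<omega> ^ n0) ^ p * y1 = y0"
          unfolding y1_def using \<omega>_nz by (simp flip: mult.assoc power_mult_distrib)
        ultimately show False using y0 by simp
      qed
      \<comment> \<open>A basis of L over L^p through \<open>y1\<close> is built on a maximal
        independent subset of the powers of \<open>z\<close>, so that its coordinate at
        \<open>y1\<close> vanishes on all of them.\<close>
      obtain Z' where Z': "Z' \<subseteq> Z" "frob.independent Z'" "Z \<subseteq> frob.span Z'" using frob.maximal_independent_subset by (auto simp: subset_eq)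
      have y1Z': "y1 \<notin> frob.span Z'" using y1 subsetD[OF frob.span_mono[OF Z'(1)]] by auto
      have ind: "frob.independent (insert y1 Z')" using Z'(2) y1Z' by (simp add: frob.independent_insert)
      define B' where "B' = frob.extend_basis (insert y1 Z')"
      have B': "insert y1 Z' \<subseteq> B'" "frob.independent B'" "frob.span B' = UNIV"
        unfolding B'_def using frob.extend_basis_superset[OF ind] frob.independent_extend_basis[OF ind] frob.span_extend_basis[OF ind] by auto
      \<comment> \<open>The coordinate at \<open>y1\<close>. Coordinates are p-th roots, so it
        satisfies \<open>lam (a ^ p * v) = a * lam v\<close>.\<close>
      define lam where "lam v = frob.representation B' v y1" for v
      have lam_add: "lam (u + v) = lam u + lam v" for u v
        unfolding lam_def using frob.representation_add[OF B'(2)] B'(3) by simp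
      have lam_scale: "lam (a ^ p * v) = a * lam v" for a v
        unfolding lam_def using frob.representation_scale[OF B'(2)] B'(3) by simp
      have lam_0: "lam 0 = 0" using lam_scale[of 0 0] by simp
      have lam_sum: "lam (\<Sum>i\<in>J. h i) = (\<Sum>i\<in>J. lam (h i))" for h and J :: "'b set"
        by (induction J rule: infinite_finite_induct) (auto simp: lam_0 lam_add)
      have lam_y1: "lam y1 = 1" unfolding lam_def using frob.representation_basis[OF B'(2)] B'(1) by auto
      have lam_Z: "lam v = 0" if "v \<in> frob.span Z" for v
      proof -
        have "v \<in> frob.span Z'" using that frob.span_minimal[OF Z'(3) frob.subspace_span] by auto
        then show ?thesis
        proof (induction rule: frob.span_induct_alt)
          case base
          show ?case by (rule lam_0)
        next
          case (step c x y)
          have "x \<noteq> y1" using step(1) y1Z' frob.span_base[of x Z'] by auto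
          then have "lam x = 0" unfolding lam_def using frob.representation_basis[OF B'(2)] B'(1) step(1) by auto
          then show ?case using step by (simp add: lam_add lam_scale)
        qed
      qed
      obtain B k where B: "finite B" "\<And>a. a \<in> A \<Longrightarrow> \<exists>s. (\<forall>b\<in>B. \<omega> ^ k * s b \<in> A) \<and> a = (\<Sum>b\<in>B. s b ^ p * b)"
        using frobenius_basis by blast
      obtain e where e: "\<And>y. y \<in> R \<Longrightarrow> \<omega> ^ e * y \<in> A" using conductor_exists by blast
      obtain h where h: "\<forall>b\<in>B. \<omega> ^ h * lam b \<in> A" using A_common_denominator[OF B(1)] by blast
      \<comment> \<open>The denominator collects three contributions: \<open>e\<close> moves
        \<open>R\<close> into \<open>A\<close>, \<open>k\<close> bounds the coordinates of elements
        of \<open>A\<close>, and \<open>h\<close> bounds the values of \<open>lam\<close> on the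
        basis.\<close>
      have bound: "\<omega> ^ (e + k + h) * lam v \<in> R" if v: "v \<in> R" for v
      proof -
        have "\<omega> ^ e * v \<in> A" using e[OF v] .
        moreover have "e \<le> e * p" using p_gt_1 by simp
        ultimately have "\<omega> ^ (e * p) * v \<in> A" by (rule A_denominator_mono)
        then obtain s where s: "\<forall>b\<in>B. \<omega> ^ k * s b \<in> A" "\<omega> ^ (e * p) * v = (\<Sum>b\<in>B. s b ^ p * b)" using B(2) by blast
        have "\<omega> ^ e * lam v = lam ((\<omega> ^ e) ^ p * v)" by (simp add: lam_scale)
        also have "\<dots> = (\<Sum>b\<in>B. s b * lam b)" using s(2) by (simp add: lam_sum lam_scale flip: power_mult)
        finally have "\<omega> ^ (e + k + h) * lam v = \<omega> ^ k * \<omega> ^ h * (\<Sum>b\<in>B. s b * lam b)"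
          by (simp add: power_add mult_ac)
        also have "\<dots> = (\<Sum>b\<in>B. (\<omega> ^ k * s b) * (\<omega> ^ h * lam b))" by (simp add: sum_distrib_left mult_ac)
        also have "\<dots> \<in> R" using s(1) h by (intro R_sum R_mult AR) auto
        finally show ?thesis .
      qed
      \<comment> \<open>One more than the value of the denominator. Expanding to order
        \<open>n * p\<close> and applying \<open>lam\<close> leaves
        \<open>z ^ n * lam r = 1\<close>, a pole of order \<open>n\<close> that \<open>bound\<close>
        excludes.\<close>
      define n where "n = Suc (nat (nu (\<omega> ^ (e + k + h))))"
      obtain c r where cr: "r \<in> R" "y1 = (\<Sum>i<n * p. \<kappa> (c i) * z ^ i) + z ^ (n * p) * r" using R_expand[OF y1R] by blast
      have "lam (\<Sum>i<n * p. \<kappa> (c i) * z ^ i) = 0" using zspan by (intro lam_Z frob.span_sum) auto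
      then have "z ^ n * lam r = 1" using cr(2) lam_y1 by (simp add: lam_add lam_scale power_mult)
      moreover from this have l1: "lam r \<noteq> 0" by auto
      ultimately have l: "lam r \<noteq> 0" "nu (z ^ n) + nu (lam r) = 0" using nu_mult[of "z ^ n" "lam r"] nu_1 z_nz by auto
      have "0 \<le> nu (\<omega> ^ (e + k + h)) + nu (lam r)"
        using bound[OF cr(1)] nu_mult[of "\<omega> ^ (e + k + h)" "lam r"] l \<omega>_nz by (simp add: R_nu)
      moreover have "nu (\<omega> ^ (e + k + h)) < int n" unfolding n_def by linarith
      ultimately show False using l(2) nu_z_power[of n] by linarith
    qed
    then have "y \<in> frob.span Z" by simp
    then obtain a where "y = (\<Sum>v\<in>Z. a v ^ p * v)" using frob.span_finite[OF fZ] by auto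
    then have "y = (\<Sum>i<p. a (z ^ i) ^ p * z ^ i)" unfolding Z_def by (simp add: sum.reindex[OF injz])
    then show ?thesis by (rule exI[of _ "\<lambda>i. a (z ^ i)"])
  qed
  moreover have "a i = 0" if "(\<Sum>i<p. a i ^ p * z ^ i) = 0" "i < p" for a i
  proof (rule ccontr)
    assume "a i \<noteq> 0"
    with z_power_sum[where N = 1 and a = a and i = i and m = "nu (a i) + 1"] that show False by simp
  qed
  ultimately show "pbasis 1 z" unfolding pbasis_def by auto
qed

end

section \<open>Kaehler differentials\<close>

lemma lookup_scalar_mult [simp]: "Poly_Mapping.lookup (scalar_mult r v) k = r * Poly_Mapping.lookup v k"
  by (simp add: scalar_mult_def Poly_Mapping.map.rep_eq when_def)

lemma scalar_mult_add: "scalar_mult r (u + v) = scalar_mult r u + scalar_mult r v"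
  by (rule poly_mapping_eqI) (simp add: lookup_add algebra_simps)

lemma scalar_mult_add_left: "scalar_mult (r + s) u = scalar_mult r u + scalar_mult s u"
  by (rule poly_mapping_eqI) (simp add: lookup_add algebra_simps)

lemma scalar_mult_scalar_mult: "scalar_mult r (scalar_mult s u) = scalar_mult (r * s) u"
  by (rule poly_mapping_eqI) (simp add: algebra_simps)

lemma scalar_mult_1: "scalar_mult 1 u = u"
  by (rule poly_mapping_eqI) simp

lemma scalar_mult_0: "scalar_mult 0 u = 0" "scalar_mult r 0 = 0"
  by (rule poly_mapping_eqI, simp)+

lemma scalar_mult_uminus: "scalar_mult (- r) u = - scalar_mult r u" "scalar_mult r (- u) = - scalar_mult r u"
  by (rule poly_mapping_eqI, simp)+

lemma scalar_mult_diff: "scalar_mult r (u - v) = scalar_mult r u - scalar_mult r v"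
  by (rule poly_mapping_eqI) (simp add: lookup_minus algebra_simps)

lemma lin_span_add:
  assumes "u \<in> lin_span sc R G" "v \<in> lin_span sc R G" shows "u + v \<in> lin_span sc R G"
  using assms by (induction rule: lin_span.induct) (auto simp: add.assoc intro: lin_span.add)

lemma lin_span_base: "r \<in> R \<Longrightarrow> g \<in> G \<Longrightarrow> sc r g \<in> lin_span sc R G"
  using lin_span.add[OF _ _ lin_span.zero, of r R g G sc] by simp

lemma lin_span_scalar_mult:
  assumes R: "\<And>r s. r \<in> R \<Longrightarrow> s \<in> R \<Longrightarrow> r * s \<in> R" and r: "r \<in> R" and u: "u \<in> lin_span scalar_mult R G"
  shows "scalar_mult r u \<in> lin_span scalar_mult R G"
  using u
  by (induction rule: lin_span.induct)
    (auto simp: scalar_mult_0 scalar_mult_add scalar_mult_scalar_mult intro!: lin_span.intros R r)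

lemma lin_span_mono: "u \<in> lin_span sc R G \<Longrightarrow> G \<subseteq> G' \<Longrightarrow> u \<in> lin_span sc R G'"
  by (induction rule: lin_span.induct) (auto intro: lin_span.intros)

section \<open>The derivation with respect to the uniformizer\<close>

context geom_point_val begin

lemma pbasisD:
  assumes "pbasis N x"
  shows "\<exists>a. y = (\<Sum>i<p ^ N. a i ^ (p ^ N) * x ^ i)"
    and "(\<Sum>i<p ^ N. a i ^ (p ^ N) * x ^ i) = 0 \<Longrightarrow> i < p ^ N \<Longrightarrow> a i = 0"
  using assms unfolding pbasis_def by auto

definition zc :: "'b \<Rightarrow> nat \<Rightarrow> 'b" where "zc y = (SOME a. y = (\<Sum>i<p. a i ^ p * z ^ i))"

lemma zc_sum: "y = (\<Sum>i<p. zc y i ^ p * z ^ i)"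
proof -
  have "\<exists>a. y = (\<Sum>i<p. a i ^ p * z ^ i)" using z_pbasis[of 1] unfolding pbasis_def by simp
  from someI_ex[OF this] show ?thesis unfolding zc_def .
qed

lemma zc_unique: "i < p \<Longrightarrow> zc (\<Sum>i<p. a i ^ p * z ^ i) i = a i"
proof -
  assume i: "i < p"
  let ?y = "\<Sum>i<p. a i ^ p * z ^ i"
  have "(\<Sum>i<p. (zc ?y i - a i) ^ p * z ^ i) = (\<Sum>i<p. zc ?y i ^ p * z ^ i) - ?y"
    by (simp only: frobenius1(2) left_diff_distrib sum_subtractf)
  also have "\<dots> = 0" using zc_sum[of ?y] by simp
  finally have "zc ?y i - a i = 0"
    using pbasisD(2)[OF z_pbasis[of 1], of "\<lambda>i. zc ?y i - a i" i] i by simp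
  then show ?thesis by simp
qed

text \<open>The derivation d/dz over L^p: formal differentiation of the expansion in
  \<open>z\<close>, with p-th powers as constants. For \<open>i = 0\<close> the truncated exponent
  \<open>i - 1\<close> is harmless, since the factor \<open>of_nat i\<close> vanishes.\<close>

definition der :: "'b \<Rightarrow> 'b" where "der y = (\<Sum>i<p. of_nat i * zc y i ^ p * z ^ (i - 1))"

lemma der_expand: "der (\<Sum>i<p. a i ^ p * z ^ i) = (\<Sum>i<p. of_nat i * a i ^ p * z ^ (i - 1))"
  unfolding der_def by (intro sum.cong refl) (simp add: zc_unique)

lemma der_add: "der (x + y) = der x + der y"
proof -
  have "x + y = (\<Sum>i<p. (zc x i + zc y i) ^ p * z ^ i)"
    by (simp only: frobenius1(1) distrib_right sum.distrib zc_sum[symmetric])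
  then have "der (x + y) = (\<Sum>i<p. of_nat i * (zc x i + zc y i) ^ p * z ^ (i - 1))"
    using der_expand[of "\<lambda>i. zc x i + zc y i"] by simp
  then show ?thesis
    unfolding der_def by (simp only: frobenius1(1) distrib_right distrib_left sum.distrib)
qed

text \<open>For exponents beyond \<open>p - 1\<close> the excess \<open>z ^ (m * p)\<close> is moved
  into the coefficient, and \<open>of_nat k\<close> depends only on \<open>k\<close> modulo
  \<open>p\<close>.\<close>

lemma der_monom: "der (a ^ p * z ^ k) = of_nat k * a ^ p * z ^ (k - 1)"
proof -
  define i m where "i = k mod p" and "m = k div p"
  have k: "k = m * p + i" unfolding i_def m_def by simp
  have i: "i < p" unfolding i_def using p_gt_1 by simp
  have pz: "(0::'b) ^ p = 0" using p_gt_1 by simp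
  have "a ^ p * z ^ k = (a * z ^ m) ^ p * z ^ i" unfolding k by (simp add: power_add power_mult power_mult_distrib)
  also have "\<dots> = (\<Sum>l<p. (if l = i then a * z ^ m else 0) ^ p * z ^ l)"
    using i pz by (simp add: if_distrib[of "\<lambda>x. x ^ p"] if_distrib[of "\<lambda>x. x * _"] sum.delta cong: if_cong)
  finally have "der (a ^ p * z ^ k) = (\<Sum>l<p. of_nat l * (if l = i then a * z ^ m else 0) ^ p * z ^ (l - 1))"
    by (simp only: der_expand)
  also have "\<dots> = (\<Sum>l<p. if l = i then of_nat i * (a * z ^ m) ^ p * z ^ (i - 1) else 0)"
    by (intro sum.cong refl) (use pz in auto)
  also have "\<dots> = of_nat i * (a * z ^ m) ^ p * z ^ (i - 1)" using i by simp
  also have "\<dots> = of_nat k * a ^ p * z ^ (k - 1)"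
  proof -
    have "of_nat k = (of_nat i :: 'b)" unfolding k by (simp add: of_nat_p)
    moreover have "(z ^ m) ^ p * z ^ (i - 1) = z ^ (k - 1)" if "i > 0"
      unfolding k using that by (simp flip: power_mult power_add)
    ultimately show ?thesis by (cases "i = 0") (simp_all add: power_mult_distrib mult.assoc)
  qed
  finally show ?thesis .
qed

lemma der_0: "der 0 = 0" using der_add[of 0 0] by (metis add.right_neutral add_left_cancel)

lemma der_sum: "der (\<Sum>i\<in>J. h i) = (\<Sum>i\<in>J. der (h i))"
  by (induction J rule: infinite_finite_induct) (auto simp: der_0 der_add)

lemma der_mult: "der (x * y) = x * der y + y * der x"
proof -
  have prod: "(\<Sum>i<p. zc x i ^ p * z ^ i) * (\<Sum>j<p. zc y j ^ p * z ^ j) =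
      (\<Sum>i<p. \<Sum>j<p. (zc x i * zc y j) ^ p * z ^ (i + j))"
    unfolding sum_product by (intro sum.cong refl) (simp add: power_mult_distrib power_add mult_ac)
  have "der (x * y) = (\<Sum>i<p. \<Sum>j<p. of_nat (i + j) * (zc x i * zc y j) ^ p * z ^ (i + j - 1))"
    unfolding zc_sum[symmetric] using prod[unfolded zc_sum[symmetric]] by (simp only: der_sum der_monom)
  also have "\<dots> = (\<Sum>i<p. \<Sum>j<p. (zc x i ^ p * z ^ i) * (of_nat j * zc y j ^ p * z ^ (j - 1)) +
      (zc y j ^ p * z ^ j) * (of_nat i * zc x i ^ p * z ^ (i - 1)))"
  proof (intro sum.cong refl)
    fix i j :: nat
    have "of_nat (i + j) * z ^ (i + j - 1) = z ^ i * (of_nat j * z ^ (j - 1)) + z ^ j * (of_nat i * z ^ (i - 1))"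
    proof (cases "i = 0 \<or> j = 0")
      case False
      then obtain i' j' where "i = Suc i'" "j = Suc j'" by (metis not0_implies_Suc)
      then show ?thesis by (simp add: power_add algebra_simps)
    qed auto
    then have "(zc x i * zc y j) ^ p * (of_nat (i + j) * z ^ (i + j - 1)) =
      (zc x i * zc y j) ^ p * (z ^ i * (of_nat j * z ^ (j - 1)) + z ^ j * (of_nat i * z ^ (i - 1)))" by simp
    then show "of_nat (i + j) * (zc x i * zc y j) ^ p * z ^ (i + j - 1) =
        (zc x i ^ p * z ^ i) * (of_nat j * zc y j ^ p * z ^ (j - 1)) +
        (zc y j ^ p * z ^ j) * (of_nat i * zc x i ^ p * z ^ (i - 1))"
      by (simp only: power_mult_distrib distrib_left mult_ac)
  qed
  also have "\<dots> = (\<Sum>i<p. zc x i ^ p * z ^ i) * der y + (\<Sum>j<p. zc y j ^ p * z ^ j) * der x"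
    unfolding der_def sum.distrib sum_product by (rule arg_cong2[of _ _ _ _ "(+)", OF refl sum.swap])
  also have "\<dots> = x * der y + y * der x" by (simp only: zc_sum[symmetric])
  finally show ?thesis .
qed

lemma der_p_power: "der (a ^ p) = 0" using der_monom[of a 0] by simp

lemma der_p_mult: "der (a ^ p * y) = a ^ p * der y" by (simp add: der_mult der_p_power)

lemma der_\<kappa>: "der (\<kappa> c) = 0"
  using \<kappa>_root[of c 1] der_p_power by auto

lemma der_\<kappa>_mult: "der (\<kappa> c * y) = \<kappa> c * der y" by (simp add: der_mult der_\<kappa>)

lemma der_z: "der z = 1" using der_monom[of 1 1] by simp

lemma der_power: "der (x ^ n) = of_nat n * x ^ (n - 1) * der x"
proof (induction n)
  case 0
  then show ?case using der_\<kappa>[of 1] by simp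
next
  case (Suc n)
  then show ?case by (cases n) (auto simp: der_mult algebra_simps)
qed

lemma zc_R: "y \<in> R \<Longrightarrow> i < p \<Longrightarrow> zc y i \<in> R"
  using z_power_sum[where N = 1 and a = "zc y" and i = i and m = 0] zc_sum[of y]
  by (auto simp: R_nu)

lemma of_nat_R: "of_nat n \<in> R" by (induction n) (auto intro: R_0 R_1 R_add)

lemma der_R: "y \<in> R \<Longrightarrow> der y \<in> R"
  unfolding der_def by (intro R_sum R_mult of_nat_R R_power z_R zc_R) auto

lemma der_A: "der a = (\<Sum>b | b \<in> I \<and> \<Phi> b a \<noteq> 0. \<kappa> b * der (\<Phi> b a))"
  by (subst \<Phi>_sum[of a]) (simp add: der_sum der_\<kappa>_mult)

text \<open>An element whose differential generates the submodule generated by the differentials of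
  \<open>A\<close>. It is sought in \<open>D\<close> rather than in \<open>A\<close>, because the
  duality needs it in \<open>F\<close>; \<open>extremal_A\<close> shows that nothing is
  lost.\<close>

definition extremal :: "'b \<Rightarrow> bool" where
  "extremal x \<longleftrightarrow> x \<in> D \<and> der x \<noteq> 0 \<and> (\<forall>d\<in>D. der d = 0 \<or> nu (der x) \<le> nu (der d))"

text \<open>Values of derivatives of elements of \<open>D\<close> are nonnegative, so a least one
  exists once some derivative is nonzero.\<close>

lemma extremal_exists: "\<exists>x. extremal x"
proof -
  have "\<exists>d. d \<in> D \<and> der d \<noteq> 0"
  proof (rule ccontr)
    assume *: "\<not> ?thesis"
    have A0: "der a = 0" if "a \<in> A" for a
      using that * unfolding der_A[of a] by (auto simp: A_iff intro!: sum.neutral)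
    \<comment> \<open>If the derivation vanished on \<open>D\<close>, it would vanish on
      \<open>A\<close>, which contains \<open>\<omega> ^ n\<close> and
      \<open>\<omega> ^ n * z\<close>; but the latter then has derivative
      \<open>\<omega> ^ n\<close>.\<close>
    obtain n where n: "\<omega> ^ n * z \<in> A" using A_denominator by blast
    have "der (\<omega> ^ n * z) = \<omega> ^ n" using A0[OF DA[OF \<omega>_power_D[of n]]] by (simp add: der_mult der_z)
    then show False using A0[OF n] \<omega>_nz by simp
  qed
  then obtain x where x: "x \<in> D" "der x \<noteq> 0"
    "\<And>d. d \<in> D \<Longrightarrow> der d \<noteq> 0 \<Longrightarrow> nat (nu (der x)) \<le> nat (nu (der d))"
    using ex_has_least_nat[of "\<lambda>d. d \<in> D \<and> der d \<noteq> 0" _ "\<lambda>d. nat (nu (der d))"] by blast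
  have "nu (der x) \<le> nu (der d)" if "d \<in> D" "der d \<noteq> 0" for d
    using x(3)[OF that] der_R[OF R_D[OF that(1)]] that(2) by (auto simp: R_nu)
  then show ?thesis using x(1,2) unfolding extremal_def by blast
qed

text \<open>As \<open>nu 0 = 0\<close>, a lower bound \<open>m\<close> on the value has to be
  phrased as \<open>y = 0 \<or> m \<le> nu y\<close>; this and the next two facts are the closure
  rules for this condition.\<close>

lemma nu_ge_add: "(x = 0 \<or> m \<le> nu x) \<Longrightarrow> (y = 0 \<or> m \<le> nu y) \<Longrightarrow> x + y = 0 \<or> m \<le> nu (x + y)"
  using nu_add[of x y] by (cases "x = 0"; cases "y = 0"; cases "x + y = 0") auto

lemma nu_ge_mult: "(x = 0 \<or> m \<le> nu x) \<Longrightarrow> y \<in> R \<Longrightarrow> y * x = 0 \<or> m \<le> nu (y * x)"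
  using nu_mult[of y x] by (cases "x = 0"; cases "y = 0") (auto simp: R_nu)

lemma nu_ge_sum: "(\<And>i. i \<in> J \<Longrightarrow> h i = 0 \<or> m \<le> nu (h i)) \<Longrightarrow> (\<Sum>i\<in>J. h i) = 0 \<or> m \<le> nu (\<Sum>i\<in>J. h i)"
proof (induction J rule: infinite_finite_induct)
  case (insert j J)
  then show ?case using nu_ge_add[of "h j" m "\<Sum>i\<in>J. h i"] by simp
qed auto

text \<open>The derivation is linear over the constants, so the derivative of an element of
  \<open>A\<close> is a combination of derivatives of its coordinates in \<open>D\<close>, with
  coefficients in \<open>R\<close>.\<close>

lemma extremal_A: "extremal x \<Longrightarrow> a \<in> A \<Longrightarrow> der a = 0 \<or> nu (der x) \<le> nu (der a)"
proof -
  assume x: "extremal x" and a: "a \<in> A"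
  have "\<kappa> b * der (\<Phi> b a) = 0 \<or> nu (der x) \<le> nu (\<kappa> b * der (\<Phi> b a))" if "b \<in> I" for b
    using nu_ge_mult[OF _ R_\<kappa>] x a that unfolding extremal_def A_iff by blast
  then show ?thesis unfolding der_A[of a] by (intro nu_ge_sum) auto
qed

text \<open>Differentiating a relation of degree below \<open>p\<close> lowers the degree and
  multiplies the coefficients by integers prime to \<open>p\<close>, which gives independence by
  induction. Spanning is a dimension count, since the powers of \<open>z\<close> show that L has
  dimension \<open>p\<close> over L^p.\<close>

lemma pbasis_if_der_nonzero:
  assumes x: "der x \<noteq> 0" shows "pbasis N x"
proof (rule pbasis_power)
  have indep: "\<forall>i\<le>n. a i = 0" if "n < p" "(\<Sum>i\<le>n. a i ^ p * x ^ i) = 0" for n a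
    using that
  proof (induction n arbitrary: a)
    case 0
    then show ?case by simp
  next
    case (Suc n)
    have pn: "of_nat (Suc i) \<noteq> (0::'b)" if "i \<le> n" for i
      using that Suc.prems(1) CHAR by (auto simp: of_nat_eq_0_iff_char_dvd dest: dvd_imp_le simp del: of_nat_Suc)
    \<comment> \<open>Coefficients are represented by p-th roots, so the integer factor needs a p-th
      root as well; it is a constant and has one.\<close>
    have root: "\<exists>w. of_nat (Suc i) = (w::'b) ^ p" for i
    proof -
      have "\<kappa> (of_nat n) = of_nat n" for n by (induction n) (simp_all add: \<kappa>_add)
      then show ?thesis using \<kappa>_root[of "of_nat (Suc i)" 1] by (metis power_one_right)
    qed
    define w where "w i = (SOME w. of_nat (Suc i) = (w::'b) ^ p)" for i
    have w: "of_nat (Suc i) = w i ^ p" for i unfolding w_def using someI_ex[OF root] .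
    have "0 = der (\<Sum>i\<le>Suc n. a i ^ p * x ^ i)" using Suc.prems(2) by (simp only: der_0)
    also have "\<dots> = (\<Sum>i\<le>Suc n. a i ^ p * (of_nat i * x ^ (i - 1) * der x))"
      by (simp only: der_sum der_p_mult der_power)
    also have "\<dots> = (\<Sum>i\<le>n. a (Suc i) ^ p * (of_nat (Suc i) * x ^ i * der x))"
      by (subst sum.atMost_Suc_shift) simp
    also have "\<dots> = (\<Sum>i\<le>n. (a (Suc i) * w i) ^ p * x ^ i) * der x"
      unfolding sum_distrib_right by (intro sum.cong refl) (simp only: w power_mult_distrib mult_ac)
    finally have s0: "(\<Sum>i\<le>n. (a (Suc i) * w i) ^ p * x ^ i) = 0" using x by simp
    have "\<forall>i\<le>n. a (Suc i) * w i = 0"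
      using Suc.IH[of "\<lambda>i. a (Suc i) * w i"] s0 Suc.prems(1) by simp
    moreover have "w i \<noteq> 0" if "i \<le> n" for i
    proof
      assume "w i = 0"
      then show False using pn[OF that] w[of i] p_gt_1 by simp
    qed
    ultimately have a: "a (Suc i) = 0" if "i \<le> n" for i using that by auto
    have "(\<Sum>i\<le>Suc n. a i ^ p * x ^ i) = a 0 ^ p + (\<Sum>i\<le>n. a (Suc i) ^ p * x ^ Suc i)"
      by (subst sum.atMost_Suc_shift) simp
    also have "(\<Sum>i\<le>n. a (Suc i) ^ p * x ^ Suc i) = 0" using p_gt_1 by (intro sum.neutral ballI) (simp add: a)
    finally have "a 0 = 0" using Suc.prems(2) by simp
    then show ?case using a by (metis Suc_le_D Suc_le_mono not0_implies_Suc)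
  qed
  have indep': "i < p \<Longrightarrow> a i = 0" if "(\<Sum>i<p. a i ^ p * x ^ i) = 0" for a i
  proof -
    have "{..<p} = {..p - 1}" using p_gt_1 by auto
    then show "i < p \<Longrightarrow> a i = 0" using indep[of "p - 1" a] that p_gt_1 by auto
  qed
  define P where "P = (\<lambda>i. x ^ i) ` {..<p}"
  have inj: "inj_on (\<lambda>i. x ^ i) {..<p}"
  proof (rule inj_onI, rule ccontr)
    fix i k assume ik: "i \<in> {..<p}" "k \<in> {..<p}" "x ^ i = x ^ k" "i \<noteq> k"
    define a where "a l = (if l = i then 1 else if l = k then -1 else (0::'b))" for l
    have m1: "(-1::'b) ^ p = -1" using frobenius_uminus[of 1 1] by simp
    have "(\<Sum>l<p. a l ^ p * x ^ l) = (\<Sum>l\<in>{i, k}. a l ^ p * x ^ l)"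
      using ik p_gt_1 by (intro sum.mono_neutral_right) (auto simp: a_def)
    also have "\<dots> = 0" using ik by (simp add: a_def m1)
    finally have "a i = 0" using indep' ik by blast
    then show False by (simp add: a_def)
  qed
  have indP: "frob.independent P"
  proof -
    have "finite P" by (simp add: P_def)
    then show ?thesis unfolding frob.dependent_finite[OF \<open>finite P\<close>]
    proof clarify
      fix u v assume u: "(\<Sum>v\<in>P. u v ^ p * v) = 0" "v \<in> P" "u v \<noteq> 0"
      then have "(\<Sum>i<p. u (x ^ i) ^ p * x ^ i) = 0" unfolding P_def by (simp add: sum.reindex[OF inj])
      then have "\<forall>i<p. u (x ^ i) = 0" using indep'[of "\<lambda>i. u (x ^ i)"] by blast
      then show False using u by (auto simp: P_def)
    qed
  qed
  define Z where "Z = (\<lambda>i. z ^ i) ` {..<p}"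
  have injz: "inj_on (\<lambda>i. z ^ i) {..<p}" by (rule inj_onI) (metis nu_z_power of_nat_eq_iff)
  have spZ: "y \<in> frob.span Z" for y
  proof -
    have "(\<Sum>i<p. zc y i ^ p * z ^ i) \<in> frob.span Z"
      by (rule frob.span_sum, rule frob.span_scale, rule frob.span_base) (simp add: Z_def)
    then show ?thesis by (simp only: zc_sum[symmetric])
  qed
  have fP: "finite P" "finite Z" "card P = p" "card Z = p" by (simp_all add: P_def Z_def card_image inj injz)
  \<comment> \<open>Otherwise there would be \<open>p + 1\<close> independent vectors in a space
    spanned by the \<open>p\<close> powers of \<open>z\<close>.\<close>
  have "y \<in> frob.span P" for y
  proof (rule ccontr)
    assume y: "y \<notin> frob.span P"
    then have i: "frob.independent (insert y P)" using indP by (simp add: frob.independent_insert)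
    have "y \<notin> P" using y frob.span_base by auto
    then have "card (insert y P) = Suc p" using fP by simp
    moreover have "card (insert y P) \<le> card Z"
      using frob.independent_span_bound[OF fP(2) i] spZ by auto
    ultimately show False using fP by simp
  qed
  then have "\<exists>u. y = (\<Sum>v\<in>P. u v ^ p * v)" for y using frob.span_finite[OF fP(1)] by auto
  then have sp: "\<exists>a. y = (\<Sum>i<p. a i ^ p * x ^ i)" for y
  proof -
    obtain u where "y = (\<Sum>v\<in>P. u v ^ p * v)" using \<open>\<And>y. \<exists>u. y = (\<Sum>v\<in>P. u v ^ p * v)\<close> by blast
    then have "y = (\<Sum>i<p. u (x ^ i) ^ p * x ^ i)" unfolding P_def by (simp add: sum.reindex[OF inj])
    then show ?thesis by (rule exI[of _ "\<lambda>i. u (x ^ i)"])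
  qed
  show "pbasis 1 x" unfolding pbasis_def power_one_right using sp indep' by blast
qed

section \<open>The differentials of \<open>R\<close> modulo those of \<open>A\<close>\<close>

sublocale diff: linear_quotient "\<lambda>c. scalar_mult (\<kappa> c) :: ('b \<Rightarrow>\<^sub>0 'b) \<Rightarrow> _"
  by unfold_locales
    (auto simp: \<kappa>_add \<kappa>_mult scalar_mult_add scalar_mult_add_left scalar_mult_scalar_mult scalar_mult_1)

abbreviation "W0 \<equiv> lin_span scalar_mult R (kaehler_relations \<kappa> R)"

lemma W0_add: "u \<in> W0 \<Longrightarrow> v \<in> W0 \<Longrightarrow> u + v \<in> W0" by (rule lin_span_add)
lemma W0_scale: "r \<in> R \<Longrightarrow> u \<in> W0 \<Longrightarrow> scalar_mult r u \<in> W0" by (rule lin_span_scalar_mult) (auto intro: R_mult)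
lemma W0_relation: "u \<in> kaehler_relations \<kappa> R \<Longrightarrow> u \<in> W0"
  using lin_span_base[OF R_1, of u _ scalar_mult] by (simp add: scalar_mult_1)

lemma d_add: "x \<in> R \<Longrightarrow> y \<in> R \<Longrightarrow> diff_symbol (x + y) - (diff_symbol x + diff_symbol y) \<in> W0"
proof -
  assume "x \<in> R" "y \<in> R"
  then have "diff_symbol (x + y) - diff_symbol x - diff_symbol y \<in> W0"
    by (intro W0_relation) (auto simp: kaehler_relations_def)
  then show ?thesis by (simp add: algebra_simps)
qed

lemma d_mult: "x \<in> R \<Longrightarrow> y \<in> R \<Longrightarrow>
  diff_symbol (x * y) - (scalar_mult x (diff_symbol y) + scalar_mult y (diff_symbol x)) \<in> W0"
proof -
  assume "x \<in> R" "y \<in> R"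
  then have "diff_symbol (x * y) - scalar_mult x (diff_symbol y) - scalar_mult y (diff_symbol x) \<in> W0"
    by (intro W0_relation) (auto simp: kaehler_relations_def)
  then show ?thesis by (simp add: algebra_simps)
qed

lemma d_\<kappa>: "diff_symbol (\<kappa> c) \<in> W0"
  by (intro W0_relation) (auto simp: kaehler_relations_def)

lemma d_power: "x \<in> R \<Longrightarrow> diff_symbol (x ^ n) - scalar_mult (of_nat n * x ^ (n - 1)) (diff_symbol x) \<in> W0"
proof (induction n)
  case 0
  then show ?case using d_\<kappa>[of 1] by (simp add: scalar_mult_0)
next
  case (Suc n)
  let ?d = "diff_symbol x :: 'b \<Rightarrow>\<^sub>0 'b"
  have e: "x * (of_nat n * x ^ (n - 1)) + x ^ n = of_nat (Suc n) * x ^ (Suc n - 1)"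
    by (cases n) (auto simp: algebra_simps)
  have "scalar_mult x (diff_symbol (x ^ n) - scalar_mult (of_nat n * x ^ (n - 1)) ?d) \<in> W0"
    using Suc by (intro W0_scale) auto
  moreover have "diff_symbol (x * x ^ n) - (scalar_mult x (diff_symbol (x ^ n)) + scalar_mult (x ^ n) ?d) \<in> W0"
    using Suc by (intro d_mult R_power) auto
  ultimately have "scalar_mult x (diff_symbol (x ^ n) - scalar_mult (of_nat n * x ^ (n - 1)) ?d) +
     (diff_symbol (x * x ^ n) - (scalar_mult x (diff_symbol (x ^ n)) + scalar_mult (x ^ n) ?d)) \<in> W0"
    by (rule W0_add)
  also have "scalar_mult x (diff_symbol (x ^ n) - scalar_mult (of_nat n * x ^ (n - 1)) ?d) +
     (diff_symbol (x * x ^ n) - (scalar_mult x (diff_symbol (x ^ n)) + scalar_mult (x ^ n) ?d)) =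
     diff_symbol (x ^ Suc n) - scalar_mult (x * (of_nat n * x ^ (n - 1)) + x ^ n) ?d"
    by (simp add: scalar_mult_diff scalar_mult_scalar_mult scalar_mult_add_left algebra_simps)
  finally show ?case unfolding e .
qed

lemma d_der_monom: "a \<in> R \<Longrightarrow> diff_symbol (a ^ p * z ^ i) - scalar_mult (of_nat i * a ^ p * z ^ (i - 1)) (diff_symbol z) \<in> W0"
proof -
  assume a: "a \<in> R"
  let ?d = "diff_symbol z :: 'b \<Rightarrow>\<^sub>0 'b"
  have "diff_symbol (a ^ p) \<in> W0" using d_power[OF a, of p] by (simp add: of_nat_p scalar_mult_0)
  then have 1: "scalar_mult (z ^ i) (diff_symbol (a ^ p)) \<in> W0" by (intro W0_scale R_power z_R)
  have 2: "scalar_mult (a ^ p) (diff_symbol (z ^ i) - scalar_mult (of_nat i * z ^ (i - 1)) ?d) \<in> W0"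
    by (intro W0_scale R_power a d_power z_R)
  have 3: "diff_symbol (a ^ p * z ^ i) - (scalar_mult (a ^ p) (diff_symbol (z ^ i)) + scalar_mult (z ^ i) (diff_symbol (a ^ p))) \<in> W0"
    by (intro d_mult R_power a z_R)
  have "scalar_mult (z ^ i) (diff_symbol (a ^ p)) + (scalar_mult (a ^ p) (diff_symbol (z ^ i) - scalar_mult (of_nat i * z ^ (i - 1)) ?d) +
    (diff_symbol (a ^ p * z ^ i) - (scalar_mult (a ^ p) (diff_symbol (z ^ i)) + scalar_mult (z ^ i) (diff_symbol (a ^ p))))) \<in> W0"
    by (intro W0_add 1 2 3)
  also have "scalar_mult (z ^ i) (diff_symbol (a ^ p)) + (scalar_mult (a ^ p) (diff_symbol (z ^ i) - scalar_mult (of_nat i * z ^ (i - 1)) ?d) +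
    (diff_symbol (a ^ p * z ^ i) - (scalar_mult (a ^ p) (diff_symbol (z ^ i)) + scalar_mult (z ^ i) (diff_symbol (a ^ p))))) =
    diff_symbol (a ^ p * z ^ i) - scalar_mult (of_nat i * a ^ p * z ^ (i - 1)) ?d"
    by (simp add: scalar_mult_diff scalar_mult_scalar_mult mult_ac)
  finally show ?thesis .
qed

text \<open>The differentials of \<open>R\<close> are generated by dz: the coefficients of the
  expansion of \<open>y\<close> lie in \<open>R\<close>, and differentials of p-th powers
  vanish.\<close>

lemma d_der: "y \<in> R \<Longrightarrow> diff_symbol y - scalar_mult (der y) (diff_symbol z) \<in> W0"
proof -
  assume y: "y \<in> R"
  let ?d = "diff_symbol z :: 'b \<Rightarrow>\<^sub>0 'b"
  let ?f = "\<lambda>i. zc y i ^ p * z ^ i"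
  let ?g = "\<lambda>i. of_nat i * zc y i ^ p * z ^ (i - 1)"
  \<comment> \<open>Symbols are additive only modulo the relations, and only for elements of
    \<open>R\<close>, so the sum is built up one term at a time.\<close>
  have "diff_symbol (\<Sum>i<n. ?f i) - scalar_mult (\<Sum>i<n. ?g i) ?d \<in> W0" if "n \<le> p" for n
    using that
  proof (induction n)
    case 0
    then show ?case using d_\<kappa>[of 0] by (simp add: scalar_mult_0)
  next
    case (Suc n)
    have fR: "?f i \<in> R" if "i \<le> n" for i using that Suc.prems y by (intro R_mult R_power zc_R z_R) auto
    have 1: "diff_symbol ((\<Sum>i<n. ?f i) + ?f n) - (diff_symbol (\<Sum>i<n. ?f i) + diff_symbol (?f n)) \<in> W0"
      by (intro d_add R_sum fR) auto
    have 2: "diff_symbol (?f n) - scalar_mult (?g n) ?d \<in> W0" using Suc.prems by (intro d_der_monom zc_R y) auto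
    have 3: "diff_symbol (\<Sum>i<n. ?f i) - scalar_mult (\<Sum>i<n. ?g i) ?d \<in> W0" using Suc by simp
    have "(diff_symbol ((\<Sum>i<n. ?f i) + ?f n) - (diff_symbol (\<Sum>i<n. ?f i) + diff_symbol (?f n))) +
      ((diff_symbol (?f n) - scalar_mult (?g n) ?d) + (diff_symbol (\<Sum>i<n. ?f i) - scalar_mult (\<Sum>i<n. ?g i) ?d)) \<in> W0"
      by (intro W0_add 1 2 3)
    also have "(diff_symbol ((\<Sum>i<n. ?f i) + ?f n) - (diff_symbol (\<Sum>i<n. ?f i) + diff_symbol (?f n))) +
      ((diff_symbol (?f n) - scalar_mult (?g n) ?d) + (diff_symbol (\<Sum>i<n. ?f i) - scalar_mult (\<Sum>i<n. ?g i) ?d)) =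
      diff_symbol ((\<Sum>i<n. ?f i) + ?f n) - scalar_mult ((\<Sum>i<n. ?g i) + ?g n) ?d"
      by (simp add: scalar_mult_add_left algebra_simps)
    finally show ?case by simp
  qed
  from this[of p] show ?thesis using zc_sum[of y] unfolding der_def by simp
qed

text \<open>The linear map sending the symbol of \<open>y\<close> to \<open>der y\<close>. It kills
  the relations, and on the differentials of \<open>R\<close> it reads off the coefficient of
  dz.\<close>

definition dval :: "('b \<Rightarrow>\<^sub>0 'b) \<Rightarrow> 'b" where
  "dval v = (\<Sum>y\<in>Poly_Mapping.keys v. Poly_Mapping.lookup v y * der y)"

lemma dval_eq: "finite K \<Longrightarrow> Poly_Mapping.keys v \<subseteq> K \<Longrightarrow> dval v = (\<Sum>y\<in>K. Poly_Mapping.lookup v y * der y)"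
  unfolding dval_def by (intro sum.mono_neutral_left) (auto simp: in_keys_iff)

lemma dval_add: "dval (u + v) = dval u + dval v"
proof -
  define K where "K = Poly_Mapping.keys u \<union> Poly_Mapping.keys v \<union> Poly_Mapping.keys (u + v)"
  have f: "finite K" by (simp add: K_def)
  have "dval w = (\<Sum>y\<in>K. Poly_Mapping.lookup w y * der y)" if "w \<in> {u, v, u + v}" for w
    by (rule dval_eq[OF f]) (use that in \<open>auto simp: K_def\<close>)
  then show ?thesis by (simp add: lookup_add distrib_right sum.distrib)
qed

lemma dval_scale: "dval (scalar_mult r v) = r * dval v"
proof -
  define K where "K = Poly_Mapping.keys v \<union> Poly_Mapping.keys (scalar_mult r v)"
  have f: "finite K" by (simp add: K_def)
  have "dval w = (\<Sum>y\<in>K. Poly_Mapping.lookup w y * der y)" if "w \<in> {v, scalar_mult r v}" for w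
    by (rule dval_eq[OF f]) (use that in \<open>auto simp: K_def\<close>)
  then show ?thesis by (simp add: sum_distrib_left mult.assoc)
qed

lemma dval_single: "dval (diff_symbol y) = der y"
  using dval_eq[of "{y}" "diff_symbol y"] by simp

lemma dval_0: "dval 0 = 0" by (simp add: dval_def)
lemma dval_uminus: "dval (- u) = - dval u" using dval_scale[of "-1" u] by (simp add: scalar_mult_uminus scalar_mult_1)
lemma dval_diff: "dval (u - v) = dval u - dval v" using dval_add[of u "-v"] by (simp add: dval_uminus)

lemma dval_relations: "u \<in> kaehler_relations \<kappa> R \<Longrightarrow> dval u = 0"
  unfolding kaehler_relations_def
  by (auto simp: dval_diff dval_scale dval_single der_add der_mult der_\<kappa>)

text \<open>Through \<open>dval\<close> the differentials of \<open>R\<close> become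
  \<open>R\<close>, and the submodule generated by those of \<open>A\<close> becomes the multiples
  of \<open>der x\<close>. The quotient has the basis \<open>z ^ i\<close> dz with \<open>i\<close>
  below \<open>nu (der x)\<close>.\<close>

theorem differential_cokernel_dim_eq:
  assumes x: "extremal x"
  shows "differential_cokernel_dim \<kappa> A R = nat (nu (der x))"
proof -
  define m where "m = nat (nu (der x))"
  have xD: "x \<in> D" "der x \<noteq> 0" using x by (auto simp: extremal_def)
  have m: "nu (der x) = int m" using der_R[OF R_D[OF xD(1)]] xD(2) by (simp add: R_nu m_def)
  let ?V = "free_differentials R"
  let ?G = "kaehler_relations \<kappa> R \<union> diff_symbol ` A"
  let ?W = "lin_span scalar_mult R ?G"
  let ?d = "diff_symbol z :: 'b \<Rightarrow>\<^sub>0 'b"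
  have W0W: "u \<in> ?W" if "u \<in> W0" for u using that by (rule lin_span_mono) auto
  have Wscale: "r \<in> R \<Longrightarrow> u \<in> ?W \<Longrightarrow> scalar_mult r u \<in> ?W" for r u
    by (rule lin_span_scalar_mult) (auto intro: R_mult)
  have W: "diff.subspace ?W" unfolding diff.subspace_def
    by (auto intro: lin_span.zero lin_span_add Wscale R_\<kappa>)
  \<comment> \<open>Upper bound for the submodule: the relations have image 0 and the differentials
    of \<open>A\<close> have value at least \<open>m\<close> by extremality.\<close>
  have Wd: "dval u = 0 \<or> int m \<le> nu (dval u)" if "u \<in> ?W" for u
    using that
  proof (induction rule: lin_span.induct)
    case zero
    then show ?case by (simp add: dval_0)
  next
    case (add r g v)
    have "dval g = 0 \<or> int m \<le> nu (dval g)"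
    proof (cases "g \<in> kaehler_relations \<kappa> R")
      case True
      then show ?thesis using dval_relations by blast
    next
      case False
      then obtain a where "a \<in> A" "g = diff_symbol a" using add(2) by blast
      then show ?thesis using extremal_A[OF x, of a] m by (simp add: dval_single)
    qed
    from nu_ge_add[OF nu_ge_mult[OF this add(1)] add.IH] show ?case by (simp add: dval_add dval_scale)
  qed
  have Vd: "dval v \<in> R \<and> v - scalar_mult (dval v) ?d \<in> ?W" if "v \<in> ?V" for v
    using that unfolding free_differentials_def
  proof (induction rule: lin_span.induct)
    case zero
    then show ?case by (auto simp: dval_0 scalar_mult_0 R_0 intro: lin_span.zero)
  next
    case (add r g v)
    then obtain y where y: "y \<in> R" "g = diff_symbol y" by blast
    have "scalar_mult r (diff_symbol y - scalar_mult (der y) ?d) + (v - scalar_mult (dval v) ?d) \<in> ?W"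
      using add W0W[OF d_der[OF y(1)]] by (intro lin_span_add Wscale) auto
    also have "scalar_mult r (diff_symbol y - scalar_mult (der y) ?d) + (v - scalar_mult (dval v) ?d) =
      scalar_mult r g + v - scalar_mult (dval (scalar_mult r g + v)) ?d"
      by (simp add: y dval_add dval_scale dval_single scalar_mult_diff scalar_mult_scalar_mult scalar_mult_add_left algebra_simps)
    finally show ?case using add y der_R by (auto simp: dval_add dval_scale dval_single intro!: R_add R_mult)
  qed
  \<comment> \<open>Lower bound: such a \<open>t\<close> is an \<open>R\<close>-multiple of
    \<open>der x\<close>, and dx equals \<open>der x\<close> times dz modulo the relations.\<close>
  have inW: "scalar_mult t ?d \<in> ?W" if t: "t = 0 \<or> int m \<le> nu t" for t
  proof -
    define r where "r = t / der x"
    have r: "r \<in> R" unfolding r_def using t nu_divide[of t "der x"] xD m by (cases "t = 0") (auto simp: R_nu)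
    have t_eq: "t = r * der x" unfolding r_def using xD by simp
    have "scalar_mult r (diff_symbol x) \<in> ?W" using lin_span_base[OF r, of "diff_symbol x" ?G scalar_mult] DA[OF xD(1)] by blast
    moreover have "scalar_mult r (diff_symbol x - scalar_mult (der x) ?d) \<in> ?W"
      by (intro Wscale r W0W d_der R_D xD)
    ultimately have "scalar_mult r (diff_symbol x) - scalar_mult r (diff_symbol x - scalar_mult (der x) ?d) \<in> ?W"
      by (rule diff.subspace_diff[OF W])
    then show ?thesis by (simp add: t_eq scalar_mult_diff scalar_mult_scalar_mult)
  qed
  define f where "f i = scalar_mult (z ^ i) ?d" for i
  have df: "dval (f i) = z ^ i" for i by (simp add: f_def dval_scale dval_single der_z)
  have f_inj: "inj_on f {..<m}"
  proof (rule inj_onI)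
    fix i k assume "f i = f k"
    then have "dval (f i) = dval (f k)" by simp
    then have "z ^ i = z ^ k" by (simp add: f_def dval_scale dval_single der_z)
    then show "i = k" using nu_z_power by (metis of_nat_eq_iff)
  qed
  have "diff.basis_mod ?V ?W (f ` {..<m})"
    unfolding diff.basis_mod_def
  proof (intro conjI ballI)
    show "f ` {..<m} \<subseteq> ?V"
      unfolding f_def free_differentials_def using R_power[OF z_R] z_R by (auto intro!: lin_span_base)
    show "diff.indep_mod ?W (f ` {..<m})" unfolding diff.indep_mod_def
    proof (intro conjI allI impI)
      show "finite (f ` {..<m})" by simp
      fix c assume c: "(\<Sum>b\<in>f ` {..<m}. scalar_mult (\<kappa> (c b)) b) \<in> ?W"
      have ds: "dval (\<Sum>i\<in>J. h i) = (\<Sum>i\<in>J. dval (h i))" for h :: "nat \<Rightarrow> _" and J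
        by (induction J rule: infinite_finite_induct) (auto simp: dval_0 dval_add)
      have "dval (\<Sum>b\<in>f ` {..<m}. scalar_mult (\<kappa> (c b)) b) = (\<Sum>i<m. \<kappa> (c (f i)) * z ^ i)"
        by (simp add: sum.reindex[OF f_inj] ds dval_scale df)
      then have s: "(\<Sum>i<m. \<kappa> (c (f i)) * z ^ i) = 0 \<or> int m \<le> nu (\<Sum>i<m. \<kappa> (c (f i)) * z ^ i)" using Wd[OF c] by simp
      have "c (f i) = 0" if i: "i < m" for i
      proof (rule ccontr)
        assume ci: "c (f i) \<noteq> 0"
        define J where "J = {i. i < m \<and> c (f i) \<noteq> 0}"
        have eq: "(\<Sum>i<m. \<kappa> (c (f i)) * z ^ i) = (\<Sum>i\<in>J. \<kappa> (c (f i)) * z ^ i)"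
          unfolding J_def by (intro sum.mono_neutral_right) auto
        have n: "nu (\<kappa> (c (f i)) * z ^ i) = int i" if "i \<in> J" for i
          using nu_mult[of "\<kappa> (c (f i))" "z ^ i"] that \<kappa>_eq_0 z_nz nu_\<kappa> nu_z_power by (auto simp: J_def)
        have inj: "inj_on (\<lambda>i. nu (\<kappa> (c (f i)) * z ^ i)) J" by (rule inj_onI) (use n in simp)
        have "int m \<le> nu (\<kappa> (c (f i)) * z ^ i)"
          by (rule nu_sum_distinct[where J = J and h = "\<lambda>i. \<kappa> (c (f i)) * z ^ i", OF _ _ inj s[unfolded eq]])
            (use i ci \<kappa>_eq_0 z_nz in \<open>auto simp: J_def\<close>)
        then show False using n[of i] i ci by (simp add: J_def)
      qed
      then show "\<forall>b\<in>f ` {..<m}. c b = 0" by auto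
    qed
    fix v assume v: "v \<in> ?V"
    obtain c r where cr: "r \<in> R" "dval v = (\<Sum>i<m. \<kappa> (c i) * z ^ i) + z ^ m * r" using R_expand[of "dval v" m] Vd[OF v] by auto
    have sms: "scalar_mult (\<Sum>i\<in>J. h i) u = (\<Sum>i\<in>J. scalar_mult (h i) u)" for h :: "nat \<Rightarrow> 'b" and J and u :: "'b \<Rightarrow>\<^sub>0 'b"
      by (induction J rule: infinite_finite_induct) (auto simp: scalar_mult_0 scalar_mult_add_left)
    define g where "g = the_inv_into {..<m} f"
    have g: "g (f i) = i" if "i < m" for i unfolding g_def using f_inj that by (simp add: the_inv_into_f_f)
    have e1: "(\<Sum>b\<in>f ` {..<m}. scalar_mult (\<kappa> (c (g b))) b) = scalar_mult (\<Sum>i<m. \<kappa> (c i) * z ^ i) ?d"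
    proof -
      have "(\<Sum>b\<in>f ` {..<m}. scalar_mult (\<kappa> (c (g b))) b) = (\<Sum>i<m. scalar_mult (\<kappa> (c (g (f i)))) (f i))"
        by (simp add: sum.reindex[OF f_inj])
      also have "\<dots> = (\<Sum>i<m. scalar_mult (\<kappa> (c i)) (f i))" by (intro sum.cong refl) (simp add: g)
      also have "\<dots> = scalar_mult (\<Sum>i<m. \<kappa> (c i) * z ^ i) ?d" by (simp add: sms f_def scalar_mult_scalar_mult)
      finally show ?thesis .
    qed
    have e2: "v - scalar_mult (\<Sum>i<m. \<kappa> (c i) * z ^ i) ?d = (v - scalar_mult (dval v) ?d) + scalar_mult (z ^ m * r) ?d"
      by (simp add: cr(2) scalar_mult_add_left)
    have e3: "(v - scalar_mult (dval v) ?d) + scalar_mult (z ^ m * r) ?d \<in> ?W"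
    proof (intro lin_span_add)
      show "v - scalar_mult (dval v) ?d \<in> ?W" using Vd[OF v] by blast
      have "z ^ m * r = 0 \<or> int m \<le> nu (z ^ m * r)" by (rule z_power_R[THEN iffD1]) (use cr(1) in blast)
      then show "scalar_mult (z ^ m * r) ?d \<in> ?W" by (rule inW)
    qed
    have "v - (\<Sum>b\<in>f ` {..<m}. scalar_mult (\<kappa> (c (g b))) b) \<in> ?W" unfolding e1 e2 by (rule e3)
    then show "\<exists>c. v - (\<Sum>b\<in>f ` {..<m}. scalar_mult (\<kappa> (c b)) b) \<in> ?W" by (rule exI[of _ "\<lambda>b. c (g b)"])
  qed
  from diff.quotient_dim_eq_card[OF W this] show ?thesis
    unfolding differential_cokernel_dim_def m_def by (simp add: card_image[OF f_inj] m_def[symmetric])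
qed

end

section \<open>Duality and the conductor\<close>

text \<open>\<open>N\<close> is large enough for two purposes: \<open>z ^ q\<close> in
  \<open>D\<close> puts all q-th powers of \<open>R\<close> into \<open>A\<close>, and
  \<open>u ^ q\<close> in \<open>F\<close> makes the final value a multiple of
  \<open>nu \<omega>\<close>. Positivity makes q-th powers p-th powers, so that the derivation is
  linear over them.\<close>

locale geom_point_dual = geom_point_val +
  fixes x :: 'b and N :: nat
  assumes x_extremal: "extremal x" and N_pos: "N > 0"
    and der_x_F: "der x ^ (p ^ N) \<in> F" and z_power_D: "z ^ (p ^ N) \<in> D"
begin

abbreviation "q \<equiv> p ^ N"
abbreviation "u \<equiv> der x"

lemma q_gt_1: "q > 1" using one_less_power[OF p_gt_1 N_pos] .

lemma p_pos [simp]: "0 < p" using p_gt_1 by simp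

lemma zero_power_q: "(0::'b) ^ q = 0" by (rule zero_power) simp

lemma der_q_mult: "der (a ^ q * y) = a ^ q * der y"
proof -
  have "p ^ (N - 1) * p = q" using N_pos by (intro power_minus_mult)
  then have e: "a ^ q = (a ^ (p ^ (N - 1))) ^ p" by (metis power_mult)
  show ?thesis unfolding e by (rule der_p_mult)
qed

lemma x_D: "x \<in> D" and u_nz: "u \<noteq> 0" using x_extremal by (auto simp: extremal_def)

text \<open>Expand \<open>r\<close> until the remainder falls into the conductor, hence into
  \<open>A\<close>; the q-th power of the polynomial part is a polynomial in \<open>z ^ q\<close>
  with constant coefficients.\<close>

lemma R_power_A: "r \<in> R \<Longrightarrow> r ^ q \<in> A"
proof -
  assume r: "r \<in> R"
  obtain e where e: "\<And>y. y \<in> R \<Longrightarrow> \<omega> ^ e * y \<in> A" using conductor_exists by blast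
  define n where "n = nat (nu (\<omega> ^ e))"
  obtain c r' where cr: "r' \<in> R" "r = (\<Sum>i<n. \<kappa> (c i) * z ^ i) + z ^ n * r'" using R_expand[OF r] by blast
  have "0 \<le> nu (\<omega> ^ e)" using nu_power[OF \<omega>_nz, of e] nu_\<omega> by simp
  then have "z ^ n * r' / \<omega> ^ e \<in> R"
    using nu_divide[of "z ^ n" "\<omega> ^ e"] nu_z_power[of n] z_nz \<omega>_nz R_mult[OF _ cr(1), of "z ^ n / \<omega> ^ e"]
    by (simp add: R_nu n_def)
  from e[OF this] have a: "z ^ n * r' \<in> A" using \<omega>_nz by simp
  have "r ^ q = (\<Sum>i<n. \<kappa> (c i ^ q) * (z ^ q) ^ i) + (z ^ n * r') ^ q"
    unfolding cr(2) by (simp add: frobenius_add frobenius_sum power_mult_distrib \<kappa>_power mult.commute flip: power_mult)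
  moreover have "(\<Sum>i<n. \<kappa> (c i ^ q) * (z ^ q) ^ i) \<in> A"
    by (intro A_sum A_\<kappa>_mult D_power z_power_D)
  ultimately show ?thesis using A_add A_power[OF a] by simp
qed

definition xc :: "'b \<Rightarrow> nat \<Rightarrow> 'b" where "xc y = (SOME a. y = (\<Sum>i<q. a i ^ q * x ^ i))"

lemma x_pbasis: "pbasis N x" using pbasis_if_der_nonzero u_nz by blast

lemma xc_sum: "y = (\<Sum>i<q. xc y i ^ q * x ^ i)"
  unfolding xc_def using someI_ex[OF pbasisD(1)[OF x_pbasis]] .

lemma xc_unique: "i < q \<Longrightarrow> y = (\<Sum>i<q. a i ^ q * x ^ i) \<Longrightarrow> xc y i = a i"
proof -
  assume i: "i < q" and y: "y = (\<Sum>i<q. a i ^ q * x ^ i)"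
  have "(\<Sum>i<q. (xc y i - a i) ^ q * x ^ i) = (\<Sum>i<q. xc y i ^ q * x ^ i) - (\<Sum>i<q. a i ^ q * x ^ i)"
    by (simp only: frobenius_diff left_diff_distrib sum_subtractf)
  also have "\<dots> = 0" using xc_sum[of y] y by simp
  finally show ?thesis using pbasisD(2)[OF x_pbasis, of "\<lambda>i. xc y i - a i" i] i by simp
qed

text \<open>The power \<open>^ q\<close> turns the coordinate, which is kept as a root, into the
  element of L^q itself, so \<tau> is an L^q-linear map from L to L^q.\<close>

definition \<tau> :: "'b \<Rightarrow> 'b" where "\<tau> y = xc y (q - 1) ^ q"

lemma \<tau>_eq: "y = (\<Sum>i<q. a i ^ q * x ^ i) \<Longrightarrow> \<tau> y = a (q - 1) ^ q"
  unfolding \<tau>_def using xc_unique[of "q - 1" y a] q_gt_1 by simp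

lemma \<tau>_add: "\<tau> (y + y') = \<tau> y + \<tau> y'"
proof -
  have "y + y' = (\<Sum>i<q. (xc y i + xc y' i) ^ q * x ^ i)"
    by (simp only: frobenius_add distrib_right sum.distrib xc_sum[symmetric])
  from \<tau>_eq[OF this] show ?thesis by (simp add: frobenius_add \<tau>_def)
qed

lemma \<tau>_scale: "\<tau> (a ^ q * y) = a ^ q * \<tau> y"
proof -
  have "a ^ q * (\<Sum>i<q. xc y i ^ q * x ^ i) = (\<Sum>i<q. (a * xc y i) ^ q * x ^ i)"
    by (simp only: sum_distrib_left power_mult_distrib mult.assoc)
  then have "a ^ q * y = (\<Sum>i<q. (a * xc y i) ^ q * x ^ i)" by (simp only: xc_sum[symmetric])
  from \<tau>_eq[OF this] show ?thesis by (simp add: power_mult_distrib \<tau>_def)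
qed

lemma \<tau>_0: "\<tau> 0 = 0" using \<tau>_scale[of 0 0] by (simp only: zero_power_q mult_zero_left)

lemma \<tau>_sum: "\<tau> (\<Sum>i\<in>J. h i) = (\<Sum>i\<in>J. \<tau> (h i))"
  by (induction J rule: infinite_finite_induct) (auto simp: \<tau>_0 \<tau>_add)

lemma \<tau>_\<kappa>: "\<tau> (\<kappa> c * y) = \<kappa> c * \<tau> y"
proof -
  obtain c' where "\<kappa> c = \<kappa> c' ^ q" using \<kappa>_root by blast
  then show ?thesis using \<tau>_scale by simp
qed

text \<open>The range stops at \<open>2 * q - 2\<close>, the largest sum of two basis exponents.
  From \<open>q\<close> on, \<open>x ^ q\<close> is a scalar, and the remaining exponent is below
  \<open>q - 1\<close>.\<close>

lemma \<tau>_x_power: assumes "k < 2 * q - 1" shows "\<tau> (x ^ k) = (if k = q - 1 then 1 else 0)"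
proof -
  have small: "\<tau> (x ^ k) = (if k = q - 1 then 1 else 0)" if k: "k < q" for k
  proof -
    have "x ^ k = (\<Sum>i<q. if i = k then x ^ i else 0)" using k by simp
    also have "\<dots> = (\<Sum>i<q. (if i = k then 1 else 0) ^ q * x ^ i)"
      by (intro sum.cong refl) (auto simp: zero_power_q)
    finally have "\<tau> (x ^ k) = (if q - 1 = k then 1 else 0) ^ q" by (rule \<tau>_eq)
    then show ?thesis by (auto simp: zero_power_q)
  qed
  show ?thesis
  proof (cases "k < q")
    case False
    then have "x ^ k = x ^ q * x ^ (k - q)" by (simp flip: power_add)
    then have "\<tau> (x ^ k) = x ^ q * \<tau> (x ^ (k - q))" by (simp add: \<tau>_scale)
    also have "\<tau> (x ^ (k - q)) = 0" using small[of "k - q"] assms False by simp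
    finally show ?thesis using False q_gt_1 by auto
  qed (rule small)
qed

text \<open>The basis of powers of \<open>x\<close> is its own dual basis for \<tau> in reverse
  order, because \<open>i + j = q - 1\<close> is the only way for \<tau> to be nonzero on
  \<open>x ^ (i + j)\<close>.\<close>

lemma dual_x: "y = (\<Sum>i<q. x ^ (q - Suc i) * \<tau> (x ^ i * y))"
proof -
  have "\<tau> (x ^ i * y) = xc y (q - Suc i) ^ q" if i: "i < q" for i
  proof -
    have "x ^ i * (\<Sum>j<q. xc y j ^ q * x ^ j) = (\<Sum>j<q. xc y j ^ q * x ^ (i + j))"
      unfolding sum_distrib_left by (intro sum.cong refl) (simp add: power_add mult_ac)
    then have "\<tau> (x ^ i * y) = \<tau> (\<Sum>j<q. xc y j ^ q * x ^ (i + j))" by (simp only: xc_sum[symmetric])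
    also have "\<dots> = (\<Sum>j<q. xc y j ^ q * \<tau> (x ^ (i + j)))" by (simp only: \<tau>_sum \<tau>_scale)
    also have "\<dots> = (\<Sum>j<q. if j = q - Suc i then xc y j ^ q else 0)"
      using i by (intro sum.cong refl) (auto simp: \<tau>_x_power)
    also have "\<dots> = xc y (q - Suc i) ^ q" using i by simp
    finally show ?thesis .
  qed
  then have "(\<Sum>i<q. x ^ (q - Suc i) * \<tau> (x ^ i * y)) = (\<Sum>i<q. x ^ (q - Suc i) * xc y (q - Suc i) ^ q)"
    by (intro sum.cong refl) simp
  also have "\<dots> = (\<Sum>i<q. x ^ i * xc y i ^ q)" by (rule sum.nat_diff_reindex)
  also have "\<dots> = y" using xc_sum[of y] by (simp add: mult.commute)
  finally show ?thesis by simp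
qed

text \<open>The map id \<otimes> \<tau> on the tensor square of L over L^q, precomposed with
  multiplication by 1 \<otimes> \<open>y\<close>. Elements of the tensor square are given by
  polynomials over L whose variable stands for 1 \<otimes> \<open>z\<close>.\<close>

definition lam :: "'b \<Rightarrow> 'b poly \<Rightarrow> 'b" where
  "lam y P = (\<Sum>i\<le>Polynomial.degree P. Polynomial.coeff P i * \<tau> (z ^ i * y))"

lemma lam_eq: "Polynomial.degree P \<le> n \<Longrightarrow> lam y P = (\<Sum>i\<le>n. Polynomial.coeff P i * \<tau> (z ^ i * y))"
  unfolding lam_def by (intro sum.mono_neutral_left) (auto simp: coeff_eq_0)

lemma lam_add: "lam y (P + P') = lam y P + lam y P'"
proof -
  define n where "n = max (Polynomial.degree P) (Polynomial.degree P')"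
  have "Polynomial.degree (P + P') \<le> n" unfolding n_def by (rule degree_add_le_max)
  then show ?thesis using lam_eq[of P n y] lam_eq[of P' n y] lam_eq[of "P + P'" n y]
    by (simp add: n_def distrib_right sum.distrib)
qed

lemma lam_smult: "lam y (Polynomial.smult c P) = c * lam y P"
  using lam_eq[of "Polynomial.smult c P" "Polynomial.degree P" y] degree_smult_le[of c P]
  by (simp add: lam_def sum_distrib_left mult.assoc)

lemma lam_0: "lam y 0 = 0" by (simp add: lam_def)

lemma lam_sum: "lam y (\<Sum>i\<in>J. h i) = (\<Sum>i\<in>J. lam y (h i))"
  by (induction J rule: infinite_finite_induct) (auto simp: lam_0 lam_add)

lemma lam_monom: "lam y (Polynomial.monom c i) = c * \<tau> (z ^ i * y)"
proof -
  have "lam y (Polynomial.monom c i) = (\<Sum>j\<le>i. Polynomial.coeff (Polynomial.monom c i) j * \<tau> (z ^ j * y))"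
    by (rule lam_eq) (rule degree_monom_le)
  also have "\<dots> = (\<Sum>j\<le>i. if j = i then c * \<tau> (z ^ j * y) else 0)" by (intro sum.cong refl) auto
  also have "\<dots> = c * \<tau> (z ^ i * y)" by simp
  finally show ?thesis .
qed

text \<open>Coefficients in L^q may cross the tensor sign, so such a polynomial represents 1
  \<otimes> \<open>poly P z\<close>.\<close>

lemma lam_frobenius:
  assumes "\<And>i. \<exists>a. Polynomial.coeff P i = a ^ q"
  shows "lam y P = \<tau> (poly P z * y)"
proof -
  define a where "a i = (SOME a. Polynomial.coeff P i = a ^ q)" for i
  have a: "Polynomial.coeff P i = a i ^ q" for i unfolding a_def using someI_ex[OF assms] .
  have "poly P z * y = (\<Sum>i\<le>Polynomial.degree P. a i ^ q * (z ^ i * y))"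
    by (simp add: poly_altdef a sum_distrib_right mult.assoc)
  then show ?thesis unfolding lam_def by (simp only: a \<tau>_sum \<tau>_scale)
qed

lemma poly_CHAR: "CHAR('b poly) = p" using CHAR by simp

lemma poly_frobenius: "(P - P') ^ q = P ^ q - (P' :: 'b poly) ^ q"
proof -
  have "(P - P') ^ q + P' ^ q = (P - P' + P') ^ q"
    using freshmans_dream'[where ?'a = "'b poly"] p_prime poly_CHAR by metis
  then show ?thesis by (simp add: eq_diff_eq)
qed

text \<open>In characteristic \<open>p\<close> the difference of q-th powers is the q-th power of
  the difference; one factor is cancelled against the geometric sum.\<close>

lemma power_diff_geometric:
  assumes "P \<noteq> (P' :: 'b poly)" shows "(P - P') ^ (q - 1) = (\<Sum>i<q. P' ^ (q - Suc i) * P ^ i)"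
proof -
  have "(P - P') ^ (q - 1) * (P - P') = (P - P') ^ q" by (rule power_minus_mult) simp
  then have "(P - P') * (P - P') ^ (q - 1) = (P - P') ^ q" by (simp only: mult.commute)
  also have "\<dots> = P ^ q - P' ^ q" by (rule poly_frobenius)
  also have "\<dots> = (P - P') * (\<Sum>i<q. P' ^ (q - Suc i) * P ^ i)" by (rule power_diff_sumr2)
  finally show ?thesis using assms by simp
qed

text \<open>The q-th power of X - z is X^q - z^q, and this vanishes in the tensor square because
  \<open>z ^ q\<close> lies in L^q.\<close>

lemma lam_multiple: "lam y ([:- z, 1:] ^ q * Q) = 0"
proof -
  have e: "[:- z, 1:] = Polynomial.monom 1 1 - [:z:]" by (simp add: monom_altdef)
  have "[:- z, 1:] ^ q * Q = Polynomial.monom 1 q * Q - Polynomial.smult (z ^ q) Q"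
    unfolding e poly_frobenius by (simp add: monom_power left_diff_distrib poly_const_pow)
  moreover have "lam y (Polynomial.monom 1 q * Q) = z ^ q * lam y Q"
  proof -
    have "Polynomial.monom 1 q * Q = (\<Sum>i\<le>Polynomial.degree Q. Polynomial.monom (Polynomial.coeff Q i) (i + q))"
      by (subst (1) poly_as_sum_of_monoms[of Q, symmetric]) (simp add: sum_distrib_left mult_monom add.commute)
    then have "lam y (Polynomial.monom 1 q * Q) = (\<Sum>i\<le>Polynomial.degree Q. Polynomial.coeff Q i * \<tau> (z ^ (i + q) * y))"
      by (simp only: lam_sum lam_monom)
    also have "\<dots> = (\<Sum>i\<le>Polynomial.degree Q. z ^ q * (Polynomial.coeff Q i * \<tau> (z ^ i * y)))"
    proof (intro sum.cong refl)
      fix i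
      have "z ^ (i + q) * y = z ^ q * (z ^ i * y)" by (simp add: power_add mult_ac)
      then have "\<tau> (z ^ (i + q) * y) = z ^ q * \<tau> (z ^ i * y)" by (simp only: \<tau>_scale)
      then show "Polynomial.coeff Q i * \<tau> (z ^ (i + q) * y) = z ^ q * (Polynomial.coeff Q i * \<tau> (z ^ i * y))"
        by (simp only: mult.left_commute)
    qed
    finally show ?thesis by (simp add: lam_def sum_distrib_left)
  qed
  moreover have "lam y (P - P') = lam y P - lam y P'" for P P'
    using lam_add[of y "P - P'" P'] by simp
  ultimately show ?thesis by (simp add: lam_smult)
qed

text \<open>Both \<open>x\<close> and \<open>z\<close> generate \<open>L\<close> over \<open>L ^ q\<close>, and \<open>(x \<otimes> 1 - 1 \<otimes> x) ^ (q - 1) = u ^ (q - 1) (z \<otimes> 1 - 1 \<otimes> z) ^ (q - 1)\<close>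
  in the tensor square of \<open>L\<close> over \<open>L ^ q\<close>, with \<open>u = dx/dz\<close>; applying \<open>id \<otimes> \<tau>\<close> turns this into the following identity.\<close>

lemma dual_z: "y = u ^ (q - 1) * (\<Sum>i<q. z ^ (q - Suc i) * \<tau> (z ^ i * y))"
proof -
  obtain c where c: "x = (\<Sum>i<q. c i ^ q * z ^ i)" using pbasisD(1)[OF z_pbasis] by blast
  \<comment> \<open>With coefficients in L^q and \<open>poly P z = x\<close>, this polynomial
    represents 1 \<otimes> \<open>x\<close>.\<close>
  define P where "P = (\<Sum>i<q. Polynomial.monom (c i ^ q) i)"
  have Pz: "poly P z = x" unfolding P_def c by (simp add: poly_sum poly_monom)
  have Pd: "poly (pderiv P) z = u"
  proof -
    have ps: "pderiv (\<Sum>i\<in>J. h i) = (\<Sum>i\<in>J. pderiv (h i))" for h :: "nat \<Rightarrow> 'b poly" and J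
      by (induction J rule: infinite_finite_induct) (auto simp: pderiv_add)
    have "poly (pderiv P) z = (\<Sum>i<q. c i ^ q * (of_nat i * z ^ (i - 1)))"
      unfolding P_def by (simp add: ps pderiv_monom poly_sum poly_monom mult_ac)
    also have "\<dots> = (\<Sum>i<q. der (c i ^ q * z ^ i))"
    proof (intro sum.cong refl)
      fix i
      show "c i ^ q * (of_nat i * z ^ (i - 1)) = der (c i ^ q * z ^ i)" by (simp add: der_q_mult der_power der_z)
    qed
    also have "\<dots> = u" unfolding c by (simp add: der_sum)
    finally show ?thesis .
  qed
  have Pq: "\<exists>a. Polynomial.coeff (P ^ n) i = a ^ q" for n i
  proof (induction n arbitrary: i)
    case 0
    show ?case using zero_power_q by (intro exI[of _ "if i = 0 then 1 else 0"]) (cases i; simp)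
  next
    case (Suc n)
    define a where "a i = (SOME a. Polynomial.coeff (P ^ n) i = a ^ q)" for i
    have a: "Polynomial.coeff (P ^ n) i = a i ^ q" for i unfolding a_def using someI_ex[OF Suc] .
    have Pc: "Polynomial.coeff P i = (if i < q then c i else 0) ^ q" for i
      unfolding P_def using zero_power_q by (simp add: coeff_sum sum.delta')
    have "Polynomial.coeff (P ^ Suc n) i = (\<Sum>k\<le>i. (if k < q then c k else 0) ^ q * a (i - k) ^ q)"
      by (simp only: power_Suc coeff_mult a Pc)
    also have "\<dots> = (\<Sum>k\<le>i. (if k < q then c k else 0) * a (i - k)) ^ q" by (simp only: frobenius_sum power_mult_distrib)
    finally show ?case by blast
  qed
  define t where "t = [:- z, 1:]"
  have "poly (P - [:x:]) z = 0" using Pz by simp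
  \<comment> \<open>The cofactor \<open>Q1\<close> has value \<open>poly (pderiv P) z = u\<close> at
    \<open>z\<close>: this is where dx/dz enters.\<close>
  then obtain Q1 where Q1: "P - [:x:] = t * Q1" unfolding poly_eq_0_iff_dvd t_def by (elim dvdE)
  have "pderiv P = pderiv (t * Q1)" unfolding Q1[symmetric] by (simp add: pderiv_diff pderiv_pCons)
  moreover have "poly t z = 0" "poly (pderiv t) z = 1" by (simp_all add: t_def pderiv_pCons)
  ultimately have "poly (pderiv P) z = poly Q1 z" by (simp only: pderiv_mult poly_add poly_mult) simp
  then have "poly (Q1 ^ (q - 1) - [:u ^ (q - 1):]) z = 0" using Pd by (simp add: poly_power)
  \<comment> \<open>Thus \<open>Q1 ^ (q - 1)\<close> is congruent to the constant
    \<open>u ^ (q - 1)\<close> modulo \<open>t\<close>, and after multiplication by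
    \<open>t ^ (q - 1)\<close> the error is a multiple of \<open>t ^ q\<close>, which
    \<open>lam\<close> ignores.\<close>
  then obtain Q2 where Q2: "Q1 ^ (q - 1) - [:u ^ (q - 1):] = t * Q2" unfolding poly_eq_0_iff_dvd t_def by (elim dvdE)
  have ne: "P \<noteq> [:x:]" using Pd u_nz by (auto simp: pderiv_pCons)
  have tq: "t ^ (q - 1) * t = t ^ q" by (rule power_minus_mult) simp
  have "(P - [:x:]) ^ (q - 1) = t ^ (q - 1) * (t * Q2 + [:u ^ (q - 1):])"
    unfolding Q1 power_mult_distrib Q2[symmetric] by simp
  also have "\<dots> = Polynomial.smult (u ^ (q - 1)) (t ^ (q - 1)) + t ^ q * Q2"
    by (simp add: distrib_left tq[symmetric] mult.assoc add.commute)
  finally have main: "(\<Sum>i<q. [:x:] ^ (q - Suc i) * P ^ i) = Polynomial.smult (u ^ (q - 1)) (t ^ (q - 1)) + t ^ q * Q2"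
    by (simp only: power_diff_geometric[OF ne])
  have "lam y (\<Sum>i<q. [:x:] ^ (q - Suc i) * P ^ i) = (\<Sum>i<q. x ^ (q - Suc i) * \<tau> (x ^ i * y))"
    by (simp add: lam_sum poly_const_pow lam_smult lam_frobenius[OF Pq] poly_power Pz)
  also have "\<dots> = y" using dual_x by simp
  finally have 1: "lam y (\<Sum>i<q. [:x:] ^ (q - Suc i) * P ^ i) = y" .
  have t2: "t = Polynomial.monom 1 1 - [:z:]" unfolding t_def by (simp add: monom_altdef)
  have ne2: "Polynomial.monom 1 1 \<noteq> [:z:]" using t2 t_def by auto
  have "t ^ (q - 1) = (\<Sum>i<q. Polynomial.smult (z ^ (q - Suc i)) (Polynomial.monom 1 i))"
    unfolding t2 power_diff_geometric[OF ne2] by (simp add: poly_const_pow monom_power)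
  then have "lam y (t ^ (q - 1)) = (\<Sum>i<q. z ^ (q - Suc i) * \<tau> (z ^ i * y))"
    by (simp add: lam_sum lam_smult lam_monom)
  then show ?thesis using 1 unfolding main lam_add lam_smult using lam_multiple[of y Q2] by (simp add: t_def)
qed

text \<open>In \<open>y = u ^ (q - 1) * s\<close> from \<open>dual_z\<close>, the coefficients of
  \<open>s\<close> in the powers of \<open>z\<close> are the values
  \<open>\<tau> (z ^ i * y)\<close>. They are integral exactly when \<open>s\<close> is, and they
  determine \<tau> on \<open>y * R\<close> because \<open>R\<close> has integral coordinates in the
  powers of \<open>z\<close>.\<close>

lemma dual_R: "(\<forall>r\<in>R. \<tau> (y * r) \<in> R) \<longleftrightarrow> y = 0 \<or> int (q - 1) * nu u \<le> nu y"
proof (cases "y = 0")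
  case False
  define s where "s = (\<Sum>i<q. z ^ (q - Suc i) * \<tau> (z ^ i * y))"
  have ys: "y = u ^ (q - 1) * s" unfolding s_def by (rule dual_z)
  have snz: "s \<noteq> 0" using ys False by auto
  have nuy: "nu y = int (q - 1) * nu u + nu s" using ys nu_mult[of "u ^ (q - 1)" s] nu_power[OF u_nz, of "q - 1"] u_nz snz by simp
  show ?thesis
  proof
    assume "\<forall>r\<in>R. \<tau> (y * r) \<in> R"
    then have "\<tau> (y * z ^ i) \<in> R" for i using R_power[OF z_R, of i] by blast
    then have "\<tau> (z ^ i * y) \<in> R" for i by (simp only: mult.commute)
    then have "s \<in> R" unfolding s_def by (intro R_sum R_mult R_power z_R)
    then show "y = 0 \<or> int (q - 1) * nu u \<le> nu y" using nuy snz by (simp add: R_nu)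
  next
    assume "y = 0 \<or> int (q - 1) * nu u \<le> nu y"
    then have s0: "0 \<le> nu s" using nuy False by simp
    \<comment> \<open>The q-th roots of the values of \<tau>, in the form in which
      \<open>z_power_sum\<close> expects coefficients.\<close>
    define t where "t i = xc (z ^ (q - Suc i) * y) (q - 1)" for i
    have "s = (\<Sum>i<q. z ^ i * \<tau> (z ^ (q - Suc i) * y))"
      unfolding s_def by (subst sum.nat_diff_reindex[symmetric]) (auto intro!: sum.cong)
    then have st: "s = (\<Sum>i<q. t i ^ q * z ^ i)" by (simp add: \<tau>_def t_def mult.commute)
    have tR: "t i \<in> R" if "i < q" for i
      using z_power_sum[where a = t and N = N and m = 0 and i = i] st s0 that by (auto simp: R_nu)
    have zR: "\<tau> (z ^ i * y) \<in> R" if "i < q" for i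
    proof -
      have "\<tau> (z ^ i * y) = t (q - Suc i) ^ q" using that by (simp add: t_def \<tau>_def)
      then show ?thesis using R_power[OF tR, of "q - Suc i"] q_gt_1 by simp
    qed
    show "\<forall>r\<in>R. \<tau> (y * r) \<in> R"
    proof
      fix r assume r: "r \<in> R"
      obtain a where a: "r = (\<Sum>i<q. a i ^ q * z ^ i)" using pbasisD(1)[OF z_pbasis] by blast
      have aR: "a i \<in> R" if "i < q" for i
        using z_power_sum[where a = a and N = N and m = 0 and i = i] a r that by (auto simp: R_nu)
      have "y * r = (\<Sum>i<q. a i ^ q * (z ^ i * y))" unfolding a by (simp add: sum_distrib_left mult_ac)
      then have "\<tau> (y * r) = (\<Sum>i<q. a i ^ q * \<tau> (z ^ i * y))" by (simp only: \<tau>_sum \<tau>_scale)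
      also have "\<dots> \<in> R" by (intro R_sum R_mult R_power aR zR) auto
      finally show "\<tau> (y * r) \<in> R" .
    qed
  qed
qed (simp add: \<tau>_0 R_0)

text \<open>In the expansion of \<open>a ^ q\<close> the q-th powers of the coordinates of
  \<open>a\<close> are scalars from \<open>F\<close>, and the coordinate at 1 of a constant is a
  constant, which has a q-th root.\<close>

lemma \<Phi>_1_power: "\<exists>a'. \<Phi> 1 (a ^ q) = a' ^ q"
proof -
  let ?J = "{b. b \<in> I \<and> \<Phi> b a \<noteq> 0}"
  have "a ^ q = (\<Sum>b\<in>?J. \<Phi> b a ^ q * \<kappa> (b ^ q))"
    by (subst \<Phi>_sum[of a]) (simp add: frobenius_sum power_mult_distrib \<kappa>_power mult.commute)
  then have e: "\<Phi> 1 (a ^ q) = (\<Sum>b\<in>?J. \<Phi> 1 (\<Phi> b a ^ q * \<kappa> (b ^ q)))" by (simp only: \<Phi>_sum'[OF one_I])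
  have "\<exists>a'. \<Phi> 1 (\<Phi> b a ^ q * \<kappa> (b ^ q)) = a' ^ q" if "b \<in> I" for b
  proof -
    have "\<Phi> 1 (\<Phi> b a ^ q * \<kappa> (b ^ q)) = \<Phi> b a ^ q * \<Phi> 1 (\<kappa> (b ^ q))"
      using \<Phi>_scale[OF one_I F_power[OF \<Phi>_F[OF that]]] .
    moreover obtain c where "\<Phi> 1 (\<kappa> (b ^ q)) = \<kappa> c" using \<Phi>_\<kappa>[OF one_I, of "b ^ q"] by auto
    moreover obtain c' where "\<kappa> c = \<kappa> c' ^ q" using \<kappa>_root by blast
    ultimately have "\<Phi> 1 (\<Phi> b a ^ q * \<kappa> (b ^ q)) = (\<Phi> b a * \<kappa> c') ^ q" by (simp add: power_mult_distrib)
    then show ?thesis by blast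
  qed
  then have "\<forall>b\<in>?J. \<exists>a'. \<Phi> 1 (\<Phi> b a ^ q * \<kappa> (b ^ q)) = a' ^ q" by blast
  from bchoice[OF this] obtain f where "\<forall>b\<in>?J. \<Phi> 1 (\<Phi> b a ^ q * \<kappa> (b ^ q)) = f b ^ q" ..
  then have "\<Phi> 1 (a ^ q) = (\<Sum>b\<in>?J. f b ^ q)" unfolding e by (intro sum.cong refl) simp
  then show ?thesis by (simp only: frobenius_sum[symmetric]) blast
qed

text \<open>The coordinate at 1 is an \<open>F\<close>-linear retraction onto \<open>F\<close> that
  preserves L^q. As the powers of \<open>x\<close> lie in \<open>F\<close>, applying it to the
  expansion of \<open>y\<close> gives an expansion of \<open>y\<close> with coefficients in
  \<open>F\<close>, and expansions are unique. This is why \<open>x\<close> had to be chosen in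
  \<open>D\<close>.\<close>

lemma \<tau>_F: "y \<in> F \<Longrightarrow> \<tau> y \<in> F"
proof -
  assume y: "y \<in> F"
  define a where "a i = (SOME a'. \<Phi> 1 (xc y i ^ q) = a' ^ q)" for i
  have a: "\<Phi> 1 (xc y i ^ q) = a i ^ q" for i unfolding a_def using someI_ex[OF \<Phi>_1_power] .
  have "y = \<Phi> 1 (\<Sum>i<q. x ^ i * xc y i ^ q)"
    using \<Phi>_1_F[OF y] xc_sum[of y] by (simp add: mult.commute)
  also have "\<dots> = (\<Sum>i<q. a i ^ q * x ^ i)"
    unfolding \<Phi>_sum'[OF one_I] by (intro sum.cong refl) (simp add: \<Phi>_scale[OF one_I F_power[OF DF'[OF x_D]]] a mult.commute)
  finally have "\<tau> y = a (q - 1) ^ q" by (rule \<tau>_eq)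
  then show ?thesis using \<Phi>_F[OF one_I] a by metis
qed

text \<open>The duals of \<open>A\<close> and \<open>D\<close> with respect to \<tau>. Values are
  required only in \<open>R\<close>; by \<open>\<tau>_R_A\<close> they then lie in \<open>A\<close>,
  so this agrees with the dual of \<open>A\<close> as a module over itself.\<close>

definition "Astar = {y. \<forall>a\<in>A. \<tau> (y * a) \<in> R}"
definition "Dstar = {f \<in> F. \<forall>d\<in>D. \<tau> (f * d) \<in> R}"

lemma \<tau>_R_A: "\<tau> y \<in> R \<Longrightarrow> \<tau> y \<in> A"
proof -
  assume "\<tau> y \<in> R"
  then have r: "xc y (q - 1) ^ q \<in> R" by (simp only: \<tau>_def)
  have "xc y (q - 1) \<in> R"
  proof (cases "xc y (q - 1) = 0")
    case False
    then have "0 \<le> int q * nu (xc y (q - 1))" using r nu_power[OF False, of q] by (simp add: R_nu)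
    moreover have "0 < int q" by (simp only: of_nat_0_less_iff) simp
    ultimately have "0 \<le> nu (xc y (q - 1))" by (meson mult_pos_neg not_le)
    then show ?thesis by (simp add: R_nu)
  qed (simp add: R_0)
  then show ?thesis unfolding \<tau>_def by (rule R_power_A)
qed

text \<open>The dual of \<open>A\<close> arises from the dual of \<open>D\<close> by extending the
  constants, since \<tau> is linear over constants and preserves \<open>F\<close>.\<close>

lemma Astar_iff: "y \<in> Astar \<longleftrightarrow> (\<forall>b\<in>I. \<Phi> b y \<in> Dstar)"
proof
  assume y: "y \<in> Astar"
  show "\<forall>b\<in>I. \<Phi> b y \<in> Dstar"
  proof
    fix b assume b: "b \<in> I"
    have "\<tau> (\<Phi> b y * d) \<in> R" if d: "d \<in> D" for d
    proof (cases "\<Phi> b y = 0")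
      case False
      let ?J = "{b. b \<in> I \<and> \<Phi> b y \<noteq> 0}"
      have fJ: "finite ?J" using \<Phi>_finite[of y] by simp
      have "y * d = (\<Sum>b\<in>?J. \<kappa> b * (\<Phi> b y * d))"
        by (subst \<Phi>_sum[of y]) (simp add: sum_distrib_right mult.assoc)
      then have t: "\<tau> (y * d) = (\<Sum>b\<in>?J. \<kappa> b * \<tau> (\<Phi> b y * d))" by (simp only: \<tau>_sum \<tau>_\<kappa>)
      have tF: "\<tau> (\<Phi> b' y * d) \<in> F" if "b' \<in> I" for b' by (intro \<tau>_F F_mult \<Phi>_F that DF' d)
      \<comment> \<open>Applied to the coordinate expansion, \<tau> acts on each coordinate
        separately, so it commutes with \<open>\<Phi> b\<close>.\<close>
      have "\<Phi> b (\<tau> (y * d)) = (\<Sum>b'\<in>?J. \<Phi> b (\<tau> (\<Phi> b' y * d) * \<kappa> b'))"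
        unfolding t \<Phi>_sum'[OF b] by (simp add: mult.commute)
      also have "\<dots> = (\<Sum>b'\<in>?J. if b' = b then \<tau> (\<Phi> b' y * d) else 0)"
        by (intro sum.cong refl) (auto simp: \<Phi>_scale[OF b tF] \<Phi>_basis[OF b])
      also have "\<dots> = \<tau> (\<Phi> b y * d)" using fJ b False by simp
      finally have e: "\<Phi> b (\<tau> (y * d)) = \<tau> (\<Phi> b y * d)" .
      have "\<tau> (y * d) \<in> R" using y DA[OF d] by (simp add: Astar_def)
      then have "\<Phi> b (\<tau> (y * d)) \<in> D" using \<tau>_R_A b unfolding A_iff by blast
      then show ?thesis unfolding e by (rule R_D)
    qed (simp add: \<tau>_0 R_0)
    then show "\<Phi> b y \<in> Dstar" using \<Phi>_F[OF b] by (simp add: Dstar_def)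
  qed
next
  assume y: "\<forall>b\<in>I. \<Phi> b y \<in> Dstar"
  show "y \<in> Astar" unfolding Astar_def
  proof (intro CollectI ballI)
    fix a assume a: "a \<in> A"
    let ?J = "{b. b \<in> I \<and> \<Phi> b y \<noteq> 0}" and ?J' = "{b. b \<in> I \<and> \<Phi> b a \<noteq> 0}"
    have "y * a = (\<Sum>b\<in>?J. \<Sum>b'\<in>?J'. \<kappa> (b * b') * (\<Phi> b y * \<Phi> b' a))"
    proof -
      have "y * a = (\<Sum>b\<in>?J. \<kappa> b * \<Phi> b y) * (\<Sum>b\<in>?J'. \<kappa> b * \<Phi> b a)"
        by (rule arg_cong2[of _ _ _ _ "(*)", OF \<Phi>_sum \<Phi>_sum])
      then show ?thesis unfolding sum_product \<kappa>_mult by (simp only: mult_ac)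
    qed
    then have "\<tau> (y * a) = (\<Sum>b\<in>?J. \<Sum>b'\<in>?J'. \<kappa> (b * b') * \<tau> (\<Phi> b y * \<Phi> b' a))" by (simp only: \<tau>_sum \<tau>_\<kappa>)
    also have "\<dots> \<in> R"
    proof (intro R_sum R_mult R_\<kappa>)
      fix b b' assume "b \<in> ?J" "b' \<in> ?J'"
      then have "\<Phi> b y \<in> Dstar" "\<Phi> b' a \<in> D" using y a by (auto simp: A_iff)
      then show "\<tau> (\<Phi> b y * \<Phi> b' a) \<in> R" by (simp add: Dstar_def)
    qed
    finally show "\<tau> (y * a) \<in> R" .
  qed
qed

lemma Dstar_Astar: "f \<in> Dstar \<Longrightarrow> f \<in> Astar"
proof -
  assume f: "f \<in> Dstar"
  have "\<Phi> b f \<in> Dstar" if b: "b \<in> I" for b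
  proof -
    have "\<Phi> b f = f * (if b = 1 then 1 else 0)"
      using \<Phi>_scale[OF b, of f 1] \<Phi>_basis[OF b one_I] f by (simp add: Dstar_def)
    then show ?thesis using f F0 \<tau>_0 R_0 by (auto simp: Dstar_def)
  qed
  then show ?thesis unfolding Astar_iff by blast
qed

text \<open>\<open>Dstar\<close> is a nonzero fractional ideal of a discrete valuation ring. Its
  values are bounded below because \<open>A\<close> contains \<open>\<omega> ^ e * R\<close>, whose
  dual is known from \<open>dual_R\<close>; an element of least value generates.\<close>

lemma Dstar_generator: "\<exists>g\<in>F. g \<noteq> 0 \<and> (\<forall>f\<in>F. f \<in> Dstar \<longleftrightarrow> f / g \<in> D)"
proof -
  obtain e where e: "\<And>y. y \<in> R \<Longrightarrow> \<omega> ^ e * y \<in> A" using conductor_exists by blast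
  have bound: "int (q - 1) * nu u - nu (\<omega> ^ e) \<le> nu f" if f: "f \<in> Dstar" "f \<noteq> 0" for f
  proof -
    have "\<tau> (f * \<omega> ^ e * r) \<in> R" if "r \<in> R" for r
      using Dstar_Astar[OF f(1)] e[OF that] unfolding Astar_def by (simp add: mult.assoc)
    then have "int (q - 1) * nu u \<le> nu (f * \<omega> ^ e)" using dual_R[of "f * \<omega> ^ e"] f \<omega>_nz by auto
    then show ?thesis using nu_mult[of f "\<omega> ^ e"] f \<omega>_nz by simp
  qed
  define P where "P n \<longleftrightarrow> (\<exists>f. f \<in> Dstar \<and> f \<noteq> 0 \<and> nat (nu f - (int (q - 1) * nu u - nu (\<omega> ^ e))) = n)" for n
  have "\<exists>n. P n"
  proof -
    \<comment> \<open>As \<open>nu \<omega>\<close> is at least 1, this power of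
      \<open>\<omega>\<close> lies in the dual of \<open>R\<close>, hence in \<open>Dstar\<close>,
      which is therefore nonzero.\<close>
    define k where "k = nat (int (q - 1) * nu u)"
    have "int (q - 1) * nu u \<le> int k * nu \<omega>"
    proof -
      have "int (q - 1) * nu u \<le> int k * 1" unfolding k_def by linarith
      also have "\<dots> \<le> int k * nu \<omega>" using nu_\<omega> by (intro mult_left_mono) auto
      finally show ?thesis .
    qed
    then have "\<forall>r\<in>R. \<tau> (\<omega> ^ k * r) \<in> R" unfolding dual_R using nu_power[OF \<omega>_nz, of k] by simp
    then have "\<omega> ^ k \<in> Dstar" unfolding Dstar_def using DF'[OF \<omega>_power_D] R_D by blast
    then have "P (nat (nu (\<omega> ^ k) - (int (q - 1) * nu u - nu (\<omega> ^ e))))"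
      unfolding P_def using \<omega>_nz by (intro exI[of _ "\<omega> ^ k"]) simp
    then show ?thesis ..
  qed
  then have "P (LEAST n. P n)" by (rule LeastI_ex)
  then obtain g where g: "g \<in> Dstar" "g \<noteq> 0" "nat (nu g - (int (q - 1) * nu u - nu (\<omega> ^ e))) = (LEAST n. P n)" unfolding P_def by blast
  have min: "nu g \<le> nu f" if f: "f \<in> Dstar" "f \<noteq> 0" for f
  proof -
    have "(LEAST n. P n) \<le> nat (nu f - (int (q - 1) * nu u - nu (\<omega> ^ e)))"
      by (rule Least_le) (use f in \<open>auto simp: P_def\<close>)
    then show ?thesis using g(3) bound[OF f] bound[OF g(1,2)] by linarith
  qed
  have gF: "g \<in> F" using g by (simp add: Dstar_def)
  have "f \<in> Dstar \<longleftrightarrow> f / g \<in> D" if f: "f \<in> F" for f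
  proof
    assume fD: "f \<in> Dstar"
    show "f / g \<in> D"
    proof (cases "f = 0")
      case False
      have "0 \<le> nu (f / g)" using nu_divide[of f g] min[OF fD False] g(2) False by simp
      moreover have "nu (f / g) = vF (f / g) * nu \<omega>" using nu_F[of "f / g"] F_divide[OF f gF] False g(2) by simp
      ultimately have "0 \<le> vF (f / g)" using nu_\<omega> by (simp add: zero_le_mult_iff)
      then show ?thesis using vF_D[OF F_divide[OF f gF]] False g(2) by simp
    qed (simp add: D0)
  next
    assume d: "f / g \<in> D"
    have "\<tau> (f * d') \<in> R" if "d' \<in> D" for d'
    proof -
      have "\<tau> (g * (f / g * d')) \<in> R" using g(1) D_mult[OF d that] unfolding Dstar_def by blast
      moreover have "g * (f / g * d') = f * d'" using g(2) by simp
      ultimately show ?thesis by (simp only:)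
    qed
    then show "f \<in> Dstar" using f by (simp add: Dstar_def)
  qed
  then show ?thesis using gF g(2) by blast
qed

text \<open>Since the dual of \<open>A\<close> is \<open>g * A\<close>, an inclusion of
  \<open>y * R\<close> in \<open>A\<close> means that \<open>y * g * R\<close> lies in the dual of
  \<open>A\<close>. As \<open>R\<close> absorbs multiplication by \<open>A\<close>, this says that
  \<open>y * g\<close> lies in the dual of \<open>R\<close>.\<close>

theorem conductor_formula:
  "\<exists>g\<in>F. g \<noteq> 0 \<and> (\<forall>y. (\<forall>r\<in>R. y * r \<in> A) \<longleftrightarrow> y = 0 \<or> int (q - 1) * nu u - nu g \<le> nu y)"
proof -
  obtain g where g: "g \<in> F" "g \<noteq> 0" "\<And>f. f \<in> F \<Longrightarrow> f \<in> Dstar \<longleftrightarrow> f / g \<in> D" using Dstar_generator by blast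
  have A: "y \<in> A \<longleftrightarrow> (\<forall>a\<in>A. \<tau> (y * g * a) \<in> R)" for y
  proof -
    have "\<Phi> b (g * y) \<in> Dstar \<longleftrightarrow> \<Phi> b y \<in> D" if b: "b \<in> I" for b
      using g(3)[OF F_mult[OF g(1) \<Phi>_F[OF b]]] \<Phi>_scale[OF b g(1)] g(2) by simp
    then have "g * y \<in> Astar \<longleftrightarrow> y \<in> A" unfolding Astar_iff A_iff by blast
    then show ?thesis unfolding Astar_def by (simp add: mult.commute)
  qed
  have "(\<forall>r\<in>R. y * r \<in> A) \<longleftrightarrow> y = 0 \<or> int (q - 1) * nu u - nu g \<le> nu y" for y
  proof -
    have "(\<forall>r\<in>R. y * r \<in> A) \<longleftrightarrow> (\<forall>r\<in>R. \<tau> (y * g * r) \<in> R)"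
    proof
      assume l: "\<forall>r\<in>R. y * r \<in> A"
      show "\<forall>r\<in>R. \<tau> (y * g * r) \<in> R"
      proof
        fix r assume "r \<in> R"
        then have "\<tau> (y * r * g * 1) \<in> R" using l A[of "y * r"] A_1 by blast
        then show "\<tau> (y * g * r) \<in> R" by (simp add: mult_ac)
      qed
    next
      assume l: "\<forall>r\<in>R. \<tau> (y * g * r) \<in> R"
      show "\<forall>r\<in>R. y * r \<in> A"
      proof
        fix r assume r: "r \<in> R"
        have "\<tau> (y * r * g * a) \<in> R" if "a \<in> A" for a
        proof -
          have "\<tau> (y * g * (r * a)) \<in> R" using l R_mult[OF r AR[OF that]] by blast
          then show ?thesis by (simp only: mult_ac)
        qed
        then show "y * r \<in> A" using A[of "y * r"] by blast
      qed
    qed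
    also have "\<dots> \<longleftrightarrow> y * g = 0 \<or> int (q - 1) * nu u \<le> nu (y * g)" by (rule dual_R)
    also have "\<dots> \<longleftrightarrow> y = 0 \<or> int (q - 1) * nu u - nu g \<le> nu y"
      using nu_mult[of y g] g(2) by (cases "y = 0") auto
    finally show ?thesis .
  qed
  then show ?thesis using g by blast
qed

end

section \<open>The semigroup conductor, the residue degree and the divisibility\<close>

context geom_point_val begin

lemma conductor_divisibility:
  assumes x: "extremal x"
  shows "\<exists>c::nat. (\<forall>y. (\<forall>r\<in>R. y * r \<in> A) \<longleftrightarrow> y = 0 \<or> int c \<le> nu y) \<and> nu \<omega> dvd int c + nu (der x)"
proof -
  obtain N1 where N1: "z ^ (p ^ N1) \<in> D" using z_R unfolding R_def by blast
  obtain N2 where N2: "der x ^ (p ^ N2) \<in> F" using power_F by blast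
  \<comment> \<open>Large enough for both membership conditions; \<open>Suc\<close> provides
    positivity.\<close>
  define N where "N = Suc (max N1 N2)"
  interpret dual: geom_point_dual \<kappa> F D I \<Phi> \<omega> G p z nu x N
    by unfold_locales (use x D_power_mono[OF N1, of N] F_power_mono[OF N2, of N] in \<open>auto simp: N_def\<close>)
  obtain g where g: "g \<in> F" "g \<noteq> 0"
    "\<And>y. (\<forall>r\<in>R. y * r \<in> A) \<longleftrightarrow> y = 0 \<or> int (p ^ N - 1) * nu (der x) - nu g \<le> nu y"
    using dual.conductor_formula by blast
  define c where "c = int (p ^ N - 1) * nu (der x) - nu g"
  \<comment> \<open>A negative bound would put \<open>inverse z\<close> into the conductor, hence
    into \<open>A\<close> and into \<open>R\<close>.\<close>
  have c0: "0 \<le> c"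
  proof (rule ccontr)
    assume "\<not> 0 \<le> c"
    then have "c \<le> nu (inverse z)" using nu_inverse[OF z_nz] nu_z by simp
    then have "inverse z * 1 \<in> A" using g(3)[of "inverse z"] R_1 unfolding c_def by blast
    then have "inverse z \<in> R" using AR by simp
    then show False using nu_inverse[OF z_nz] nu_z z_nz by (simp add: R_nu)
  qed
  have "c + nu (der x) = nu (der x ^ (p ^ N)) - nu g"
  proof -
    have "int (p ^ N - 1) + 1 = int (p ^ N)" using dual.q_gt_1 by linarith
    then have "int (p ^ N) * nu (der x) = int (p ^ N - 1) * nu (der x) + nu (der x)" by (metis distrib_right mult_1)
    then show ?thesis using nu_power[OF dual.u_nz, of "p ^ N"] by (simp add: c_def)
  qed
  then have "nu \<omega> dvd c + nu (der x)" using nu_F_dvd[OF g(1)] nu_F_dvd[OF dual.der_x_F] by (simp add: dvd_diff)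
  moreover have "c = int (nat c)" using c0 by simp
  ultimately show ?thesis using g(3) unfolding c_def[symmetric] by (intro exI[of _ "nat c"]) simp
qed

text \<open>Everything of value at least \<open>c\<close> lies in \<open>A\<close>, so only
  \<open>c - 1\<close> needs an argument: it must be a gap, for otherwise the largest ideal of
  \<open>R\<close> inside \<open>A\<close> would grow.\<close>

lemma semigroup_conductor_eq:
  assumes c: "\<And>y. (\<forall>r\<in>R. y * r \<in> A) \<longleftrightarrow> y = 0 \<or> int c \<le> nu y"
  shows "semigroup_conductor {n. \<exists>y\<in>A. y \<noteq> 0 \<and> nu y = int n} = c" (is "semigroup_conductor ?\<Gamma> = c")
proof -
  have cA: "y \<in> A" if "y = 0 \<or> int c \<le> nu y" for y
  proof -
    have "y * 1 \<in> A" using c[of y] that R_1 by blast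
    then show ?thesis by simp
  qed
  have above: "n \<in> ?\<Gamma>" if "c \<le> n" for n
    using cA[of "z ^ n"] that nu_z_power z_nz by (intro CollectI bexI[of _ "z ^ n"]) auto
  have gap: "c - 1 \<notin> ?\<Gamma>" if c0: "c > 0"
  proof
    assume "c - 1 \<in> ?\<Gamma>"
    then obtain a where a: "a \<in> A" "a \<noteq> 0" "nu a = int (c - 1)" by blast
    \<comment> \<open>Modulo a constant multiple of \<open>a\<close>, which lies in
      \<open>A\<close>, the product \<open>a * r\<close> is a multiple of \<open>a * z\<close>,
      which has value at least \<open>c\<close>.\<close>
    have "a * r \<in> A" if r: "r \<in> R" for r
    proof -
      obtain k r' where k: "r' \<in> R" "r = \<kappa> k + z * r'" using R_expand1[OF r] by blast
      have "a * (z * r') \<in> A"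
      proof (rule cA)
        show "a * (z * r') = 0 \<or> int c \<le> nu (a * (z * r'))"
        proof (cases "r' = 0")
          case False
          then have "nu (a * (z * r')) = int (c - 1) + 1 + nu r'"
            using nu_mult[of a "z * r'"] nu_mult[of z r'] a z_nz nu_z by simp
          then show ?thesis using k(1) False c0 by (auto simp: R_nu)
        qed simp
      qed
      moreover have "a * r = \<kappa> k * a + a * (z * r')" unfolding k(2) by (simp add: algebra_simps)
      ultimately show ?thesis using A_add[OF A_\<kappa>[OF a(1)]] by simp
    qed
    then have "int c \<le> nu a" using c[of a] a(2) by blast
    then show False using a(3) c0 by simp
  qed
  show ?thesis
  proof (cases "?\<Gamma> = UNIV")
    case True
    then have "c = 0" using gap by (cases "c = 0") auto
    then show ?thesis using True unfolding semigroup_conductor_def by simp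
  next
    case False
    then have "c > 0" using above by (metis (no_types, lifting) UNIV_eq_I gr_zeroI le0)
    have "(GREATEST n. 0 < n \<and> n \<in> ?\<Gamma> \<and> n - 1 \<notin> ?\<Gamma>) = c"
    proof (rule Greatest_equality)
      show "0 < c \<and> c \<in> ?\<Gamma> \<and> c - 1 \<notin> ?\<Gamma>" using above[of c] gap \<open>c > 0\<close> by blast
      fix n assume n: "0 < n \<and> n \<in> ?\<Gamma> \<and> n - 1 \<notin> ?\<Gamma>"
      then have "\<not> c \<le> n - 1" using above[of "n - 1"] by blast
      then show "n \<le> c" using n by linarith
    qed
    then show ?thesis unfolding semigroup_conductor_def if_not_P[OF False] .
  qed
qed

lemma R_subspace: "lin.subspace ((\<lambda>r. y * r) ` R)"
  unfolding lin.subspace_def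
proof (intro conjI ballI allI)
  show "0 \<in> (\<lambda>r. y * r) ` R" using R_0 by (intro image_eqI[of _ _ 0]) auto
  fix u assume "u \<in> (\<lambda>r. y * r) ` R"
  then obtain r where r: "r \<in> R" "u = y * r" by blast
  show "\<kappa> c * u \<in> (\<lambda>r. y * r) ` R" for c
    using R_mult[OF R_\<kappa> r(1)] r(2) by (intro image_eqI[of _ _ "\<kappa> c * r"]) (auto simp: mult_ac)
  fix v assume "v \<in> (\<lambda>r. y * r) ` R"
  then obtain r' where r': "r' \<in> R" "v = y * r'" by blast
  show "u + v \<in> (\<lambda>r. y * r) ` R"
    using R_add[OF r(1) r'(1)] r(2) r'(2) by (intro image_eqI[of _ _ "r + r'"]) (auto simp: distrib_left)
qed

lemma z_powers_inj: "inj_on (\<lambda>i. z ^ i) J"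
  by (rule inj_onI) (metis nu_z_power of_nat_eq_iff)

lemma z_powers_basis: "lin.basis_mod R ((\<lambda>r. z ^ n * r) ` R) ((\<lambda>i. z ^ i) ` {..<n})"
  unfolding lin.basis_mod_def
proof (intro conjI ballI)
  show "(\<lambda>i. z ^ i) ` {..<n} \<subseteq> R" using R_power[OF z_R] by auto
  have sum: "(\<Sum>b\<in>(\<lambda>i. z ^ i) ` {..<n}. \<kappa> (c b) * b) = (\<Sum>i<n. \<kappa> (c (z ^ i)) * z ^ i)" for c
    by (simp add: sum.reindex[OF z_powers_inj])
  show "lin.indep_mod ((\<lambda>r. z ^ n * r) ` R) ((\<lambda>i. z ^ i) ` {..<n})"
    unfolding lin.indep_mod_def sum
  proof (intro conjI allI impI)
    show "finite ((\<lambda>i. z ^ i) ` {..<n})" by simp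
    fix c assume "(\<Sum>i<n. \<kappa> (c (z ^ i)) * z ^ i) \<in> (\<lambda>r. z ^ n * r) ` R"
    then have "\<exists>r\<in>R. (\<Sum>i<n. \<kappa> (c (z ^ i)) * z ^ i) = z ^ n * r" by blast
    then have s: "(\<Sum>i<n. \<kappa> (c (z ^ i)) * z ^ i) = 0 \<or> int n \<le> nu (\<Sum>i<n. \<kappa> (c (z ^ i)) * z ^ i)"
      unfolding z_power_R .
    define J where "J = {i. i < n \<and> c (z ^ i) \<noteq> 0}"
    have eq: "(\<Sum>i<n. \<kappa> (c (z ^ i)) * z ^ i) = (\<Sum>i\<in>J. \<kappa> (c (z ^ i)) * z ^ i)"
      unfolding J_def by (intro sum.mono_neutral_right) auto
    have nn: "nu (\<kappa> (c (z ^ i)) * z ^ i) = int i" if "i \<in> J" for i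
      using nu_mult[of "\<kappa> (c (z ^ i))" "z ^ i"] that \<kappa>_eq_0 z_nz nu_\<kappa> nu_z_power by (auto simp: J_def)
    have inj: "inj_on (\<lambda>i. nu (\<kappa> (c (z ^ i)) * z ^ i)) J" by (rule inj_onI) (use nn in simp)
    have "c (z ^ i) = 0" if i: "i < n" for i
    proof (rule ccontr)
      assume ci: "c (z ^ i) \<noteq> 0"
      have "int n \<le> nu (\<kappa> (c (z ^ i)) * z ^ i)"
        by (rule nu_sum_distinct[where J = J and h = "\<lambda>i. \<kappa> (c (z ^ i)) * z ^ i", OF _ _ inj s[unfolded eq]])
          (use i ci \<kappa>_eq_0 z_nz in \<open>auto simp: J_def\<close>)
      then show False using nn[of i] i ci by (simp add: J_def)
    qed
    then show "\<forall>b\<in>(\<lambda>i. z ^ i) ` {..<n}. c b = 0" by auto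
  qed
  fix y assume "y \<in> R"
  then obtain c r where c: "r \<in> R" "y = (\<Sum>i<n. \<kappa> (c i) * z ^ i) + z ^ n * r" using R_expand by blast
  define c' where "c' b = c (nat (nu b))" for b
  have "(\<Sum>b\<in>(\<lambda>i. z ^ i) ` {..<n}. \<kappa> (c' b) * b) = (\<Sum>i<n. \<kappa> (c i) * z ^ i)"
    unfolding sum c'_def by (simp add: nu_z_power)
  then have "y - (\<Sum>b\<in>(\<lambda>i. z ^ i) ` {..<n}. \<kappa> (c' b) * b) = z ^ n * r" using c(2) by simp
  then show "\<exists>c. y - (\<Sum>b\<in>(\<lambda>i. z ^ i) ` {..<n}. \<kappa> (c b) * b) \<in> (\<lambda>r. z ^ n * r) ` R"
    using c(1) by (intro exI[of _ c']) (simp only: imageI)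
qed

text \<open>The dimension of R / \<omega>A is computed through A and through \<omega>R.
  Multiplication by \<open>\<omega>\<close> identifies R / A with \<omega>R / \<omega>A, and the
  common finite dimension cancels.\<close>

lemma basis_card_eq_nu:
  assumes B: "lin.basis_mod A ((\<lambda>a. \<omega> * a) ` A) B"
  shows "int (card B) = nu \<omega>"
proof -
  define \<omega>A \<omega>R where "\<omega>A = (\<lambda>a. \<omega> * a) ` A" and "\<omega>R = (\<lambda>a. \<omega> * a) ` R"
  have sub: "lin.subspace \<omega>A" "lin.subspace \<omega>R" "lin.subspace A" "lin.subspace R"
    using A_subspace[of \<omega>] R_subspace[of \<omega>] A_subspace[of 1] R_subspace[of 1] by (simp_all add: \<omega>A_def \<omega>R_def)
  define n where "n = nat (nu \<omega>)"
  have n: "nu \<omega> = int n" using nu_\<omega> by (simp add: n_def)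
  have \<omega>R: "\<omega>R = (\<lambda>r. z ^ n * r) ` R"
  proof -
    have "y \<in> \<omega>R \<longleftrightarrow> y = 0 \<or> int n \<le> nu y" for y
    proof
      assume "y \<in> \<omega>R"
      then obtain r where "r \<in> R" "y = \<omega> * r" by (auto simp: \<omega>R_def)
      then show "y = 0 \<or> int n \<le> nu y" using nu_mult[of \<omega> r] \<omega>_nz n by (cases "r = 0") (auto simp: R_nu)
    next
      assume y: "y = 0 \<or> int n \<le> nu y"
      have "y / \<omega> \<in> R" using y nu_divide[of y \<omega>] \<omega>_nz n by (cases "y = 0") (auto simp: R_nu)
      then show "y \<in> \<omega>R" unfolding \<omega>R_def using \<omega>_nz by (intro image_eqI[of _ _ "y / \<omega>"]) auto
    qed
    moreover have "y \<in> (\<lambda>r. z ^ n * r) ` R \<longleftrightarrow> y = 0 \<or> int n \<le> nu y" for y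
      unfolding z_power_R[symmetric] by blast
    ultimately show ?thesis by blast
  qed
  obtain e where e: "\<And>y. y \<in> R \<Longrightarrow> \<omega> ^ e * y \<in> A" using conductor_exists by blast
  \<comment> \<open>\<open>z ^ k\<close> and \<open>\<omega> ^ e\<close> have the same value, so
    \<open>z ^ k * R\<close> lies in \<open>A\<close> and R / A has dimension at most
    \<open>k\<close>.\<close>
  define k where "k = nat (nu (\<omega> ^ e))"
  have "0 \<le> nu (\<omega> ^ e)" using nu_power[OF \<omega>_nz, of e] nu_\<omega> by simp
  have zA: "(\<lambda>r. z ^ k * r) ` R \<subseteq> A"
  proof clarify
    fix r assume r: "r \<in> R"
    have "z ^ k / \<omega> ^ e \<in> R" using nu_divide[of "z ^ k" "\<omega> ^ e"] nu_z_power z_nz \<omega>_nz \<open>0 \<le> nu (\<omega> ^ e)\<close> by (simp add: R_nu k_def)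
    from e[OF R_mult[OF this r]] show "z ^ k * r \<in> A" using \<omega>_nz by simp
  qed
  have "\<exists>B1. lin.basis_mod R A B1"
  proof (rule lin.basis_mod_exists[OF sub(3), where N = "card ((\<lambda>i. z ^ i) ` {..<k})"])
    fix B1 assume B1: "B1 \<subseteq> R" "lin.indep_mod A B1"
    show "card B1 \<le> card ((\<lambda>i. z ^ i) ` {..<k})"
      using B1 lin.basis_mod_spanD[OF z_powers_basis[of k]]
      by (intro lin.indep_mod_card_le[OF R_subspace[of "z ^ k"] lin.indep_mod_mono[OF B1(2) zA]]) auto
  qed
  then obtain B1 where B1: "lin.basis_mod R A B1" ..
  have fin: "finite B" "finite B1" using B B1 by (auto simp: lin.basis_mod_def lin.indep_mod_def)
  have AsR: "A \<subseteq> R" using AR by blast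
  have \<omega>A: "\<omega>A \<subseteq> A" unfolding \<omega>A_def using A_D_mult[OF \<omega>_D] by auto
  have \<omega>RR: "\<omega>R \<subseteq> R" unfolding \<omega>R_def using R_mult[OF R_D[OF \<omega>_D]] by auto
  have \<omega>AR: "\<omega>A \<subseteq> \<omega>R" unfolding \<omega>A_def \<omega>R_def using AsR by auto
  have 1: "B \<inter> B1 = {} \<and> lin.basis_mod R \<omega>A (B \<union> B1)"
    by (rule lin.basis_mod_trans[OF sub(1) sub(3) \<omega>A AsR B[folded \<omega>A_def] B1])
  have inj: "inj_on (\<lambda>b. \<omega> * b) B1" using \<omega>_nz by (auto simp: inj_on_def)
  have \<omega>B1: "lin.basis_mod \<omega>R \<omega>A ((\<lambda>b. \<omega> * b) ` B1)"
    unfolding lin.basis_mod_def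
  proof (intro conjI ballI)
    have sum: "(\<Sum>b\<in>(\<lambda>b. \<omega> * b) ` B1. \<kappa> (c b) * b) = \<omega> * (\<Sum>b\<in>B1. \<kappa> (c (\<omega> * b)) * b)" for c
      by (simp only: sum.reindex[OF inj] o_def sum_distrib_left mult.left_commute)
    have mem: "\<omega> * y \<in> \<omega>A \<longleftrightarrow> y \<in> A" for y unfolding \<omega>A_def using \<omega>_nz by auto
    show "(\<lambda>b. \<omega> * b) ` B1 \<subseteq> \<omega>R" unfolding \<omega>R_def using B1 by (auto simp: lin.basis_mod_def)
    show "lin.indep_mod \<omega>A ((\<lambda>b. \<omega> * b) ` B1)" unfolding lin.indep_mod_def sum mem
    proof (intro conjI allI impI)
      show "finite ((\<lambda>b. \<omega> * b) ` B1)" using fin by simp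
      fix c assume "(\<Sum>b\<in>B1. \<kappa> (c (\<omega> * b)) * b) \<in> A"
      then have "\<forall>b\<in>B1. c (\<omega> * b) = 0" using lin.indep_modD[OF lin.basis_mod_indep[OF B1], of "\<lambda>b. c (\<omega> * b)"] by blast
      then show "\<forall>b\<in>(\<lambda>b. \<omega> * b) ` B1. c b = 0" by blast
    qed
    fix v assume "v \<in> \<omega>R"
    then obtain r where r: "r \<in> R" "v = \<omega> * r" by (auto simp: \<omega>R_def)
    then obtain c where c: "r - (\<Sum>b\<in>B1. \<kappa> (c b) * b) \<in> A" using B1 by (auto simp: lin.basis_mod_def)
    define c' where "c' b = c (b / \<omega>)" for b
    have "v - (\<Sum>b\<in>(\<lambda>b. \<omega> * b) ` B1. \<kappa> (c' b) * b) = \<omega> * (r - (\<Sum>b\<in>B1. \<kappa> (c b) * b))"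
      unfolding sum r(2) c'_def using \<omega>_nz by (simp add: right_diff_distrib)
    then have "v - (\<Sum>b\<in>(\<lambda>b. \<omega> * b) ` B1. \<kappa> (c' b) * b) \<in> \<omega>A" using c mem by simp
    then show "\<exists>c. v - (\<Sum>b\<in>(\<lambda>b. \<omega> * b) ` B1. \<kappa> (c b) * b) \<in> \<omega>A" by (rule exI[of _ c'])
  qed
  have B3: "lin.basis_mod R \<omega>R ((\<lambda>i. z ^ i) ` {..<n})" unfolding \<omega>R by (rule z_powers_basis)
  have 2: "(\<lambda>b. \<omega> * b) ` B1 \<inter> (\<lambda>i. z ^ i) ` {..<n} = {} \<and> lin.basis_mod R \<omega>A ((\<lambda>b. \<omega> * b) ` B1 \<union> (\<lambda>i. z ^ i) ` {..<n})"
    by (rule lin.basis_mod_trans[OF sub(1) sub(2) \<omega>AR \<omega>RR \<omega>B1 B3])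
  have "card (B \<union> B1) = card ((\<lambda>b. \<omega> * b) ` B1 \<union> (\<lambda>i. z ^ i) ` {..<n})"
    using lin.basis_mod_card_unique[OF sub(1)] 1 2 by blast
  moreover have "card (B \<union> B1) = card B + card B1" using 1 fin by (simp add: card_Un_disjoint)
  moreover have "card ((\<lambda>b. \<omega> * b) ` B1 \<union> (\<lambda>i. z ^ i) ` {..<n}) = card B1 + n"
    using 2 fin by (simp add: card_Un_disjoint card_image[OF inj] card_image[OF z_powers_inj])
  ultimately show ?thesis using n by simp
qed

lemma normalized: "normalized_discrete_valuation R nu"
  unfolding normalized_discrete_valuation_def
proof (intro conjI allI impI)
  show "nu 0 = 0" by (rule nu_0)
  show "nu ` (- {0}) = UNIV"
  proof -
    have "n \<in> nu ` (- {0})" for n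
    proof (cases "0 \<le> n")
      case True
      then show ?thesis using nu_z_power[of "nat n"] z_nz by (intro image_eqI[of _ _ "z ^ nat n"]) auto
    next
      case False
      then show ?thesis using nu_z_power[of "nat (- n)"] nu_inverse[of "z ^ nat (- n)"] z_nz
        by (intro image_eqI[of _ _ "inverse (z ^ nat (- n))"]) auto
    qed
    then show ?thesis by auto
  qed
  show "nu (x * y) = nu x + nu y" if "x \<noteq> 0 \<and> y \<noteq> 0" for x y using nu_mult that by blast
  show "min (nu x) (nu y) \<le> nu (x + y)" if "x \<noteq> 0 \<and> y \<noteq> 0 \<and> x + y \<noteq> 0" for x y using nu_add that by blast
  show "R = {x. x = 0 \<or> 0 \<le> nu x}" using R_nu by auto
qed

text \<open>A normalized valuation with ring \<open>R\<close> vanishes on the units of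
  \<open>R\<close>, hence is a multiple of \<open>nu\<close>; surjectivity and nonnegativity at
  \<open>z\<close> force the factor 1. The convention at 0 makes the two functions equal
  everywhere.\<close>

lemma valuation_of_R: "valuation_of R = nu"
  unfolding valuation_of_def
proof (rule the_equality)
  show "normalized_discrete_valuation R nu" by (rule normalized)
  fix nu' assume n: "normalized_discrete_valuation R nu'"
  have n0: "nu' 0 = 0" and ns: "nu' ` (- {0}) = UNIV"
    and nm: "\<And>x y. x \<noteq> 0 \<Longrightarrow> y \<noteq> 0 \<Longrightarrow> nu' (x * y) = nu' x + nu' y"
    and nR: "\<And>x. x \<in> R \<longleftrightarrow> x = 0 \<or> 0 \<le> nu' x"
    using n unfolding normalized_discrete_valuation_def by auto
  have n1: "nu' 1 = 0" using nm[of 1 1] by simp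
  have npow: "nu' (z ^ k) = int k * nu' z" for k
    by (induction k) (auto simp: n1 nm z_nz algebra_simps)
  have unit0: "nu' y = 0" if y: "y \<noteq> 0" "nu y = 0" for y
  proof -
    have "y \<in> R" "inverse y \<in> R" using y nu_inverse[OF y(1)] by (simp_all add: R_nu)
    then have "0 \<le> nu' y" "0 \<le> nu' (inverse y)" using nR y by auto
    moreover have "nu' y + nu' (inverse y) = 0" using nm[of y "inverse y"] y n1 by simp
    ultimately show ?thesis by linarith
  qed
  have gen: "nu' y = nu y * nu' z" if y: "y \<noteq> 0" for y
  proof (cases "0 \<le> nu y")
    case True
    define k where "k = nat (nu y)"
    have "nu' (y / z ^ k) = 0" using nu_divide[of y "z ^ k"] nu_z_power y z_nz True by (intro unit0) (auto simp: k_def)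
    moreover have "nu' y = nu' (z ^ k) + nu' (y / z ^ k)" using nm[of "z ^ k" "y / z ^ k"] y z_nz by simp
    ultimately show ?thesis using npow True by (simp add: k_def)
  next
    case False
    define k where "k = nat (- nu y)"
    have "nu' (y * z ^ k) = 0" using nu_mult[of y "z ^ k"] nu_z_power y z_nz False by (intro unit0) (auto simp: k_def)
    then have "nu' y + int k * nu' z = 0" using nm[of y "z ^ k"] npow y z_nz by simp
    moreover have "int k = - nu y" using False by (simp add: k_def)
    ultimately show ?thesis by simp
  qed
  have "1 \<in> nu' ` (- {0})" using ns by simp
  then obtain y where "1 = nu' y" "y \<in> - {0}" by (rule imageE)
  then have y: "y \<noteq> 0" "nu' y = 1" by simp_all
  then have "nu y * nu' z = 1" using gen by metis
  moreover have "0 \<le> nu' z" using nR[of z] z_R z_nz by simp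
  ultimately have "nu' z = 1" by (metis dvd_triv_right int_one_le_iff_zero_less order.antisym zdvd1_eq abs_of_nonneg)
  then show "nu' = nu" using gen n0 nu_0 by (intro ext) (metis mult_1_right)
qed

end

context geom_point begin

text \<open>An element of \<open>R\<close> is a root of X to the power \<open>p ^ N\<close> minus a
  member of \<open>D\<close>. Conversely, if \<open>y\<close> is not in \<open>R\<close>, its
  inverse has positive value, and a monic equation divided by the top power of \<open>y\<close>
  would put 1 into \<open>M\<close>.\<close>

lemma integral_closure_A: "integral_closure A = R"
proof
  show "R \<subseteq> integral_closure A"
  proof
    fix y assume "y \<in> R"
    then obtain N where N: "y ^ (p ^ N) \<in> D" by (auto simp: R_def)
    define P where "P = Polynomial.monom 1 (p ^ N) - [:y ^ (p ^ N):]"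
    have q: "p ^ N > 0" using p_gt_1 by simp
    have c: "Polynomial.coeff P i = (if i = p ^ N then 1 else 0) - (if i = 0 then y ^ (p ^ N) else 0)" for i
      unfolding P_def by (cases i) (auto simp: coeff_pCons)
    have "Polynomial.degree P = p ^ N"
    proof (rule antisym)
      show "Polynomial.degree P \<le> p ^ N" by (rule degree_le) (use q in \<open>auto simp: c\<close>)
      show "p ^ N \<le> Polynomial.degree P" by (rule le_degree) (use q in \<open>auto simp: c\<close>)
    qed
    then have "Polynomial.lead_coeff P = 1" using q by (simp add: c)
    moreover have "\<forall>i. Polynomial.coeff P i \<in> A"
      using A_diff A_1 A_0 DA[OF N] unfolding c by auto
    moreover have "poly P y = 0" unfolding P_def by (simp add: poly_monom)
    ultimately show "y \<in> integral_closure A" unfolding integral_closure_def by blast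
  qed
  show "integral_closure A \<subseteq> R"
  proof
    fix y assume "y \<in> integral_closure A"
    then obtain P where P: "Polynomial.lead_coeff P = 1" "\<And>i. Polynomial.coeff P i \<in> A" "poly P y = 0"
      unfolding integral_closure_def by blast
    show "y \<in> R"
    proof (rule ccontr)
      assume yR: "y \<notin> R"
      then have y: "y \<noteq> 0" "v0 y < 0" by (auto simp: R_iff)
      define n where "n = Polynomial.degree P"
      have "n > 0"
      proof (rule ccontr)
        assume "\<not> n > 0"
        then obtain c where "P = [:c:]" by (auto simp: n_def elim: degree_eq_zeroE)
        then show False using P by simp
      qed
      define w where "w = inverse y"
      have w: "w \<in> M" "w \<noteq> 0"
      proof -
        have "v0 w + v0 y = 0" using v0_mult[of w y] y v0_power[of 1 0] by (simp add: w_def)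
        then show "w \<in> M" using y by (simp add: M_def)
        show "w \<noteq> 0" using y by (simp add: w_def)
      qed
      have "0 = w ^ n * poly P y" using P by simp
      also have "\<dots> = (\<Sum>i\<le>n. Polynomial.coeff P i * w ^ (n - i))"
        unfolding poly_altdef n_def[symmetric] sum_distrib_left
      proof (intro sum.cong refl)
        fix i assume "i \<in> {..n}"
        then have "w ^ n = w ^ (n - i) * w ^ i" by (simp flip: power_add)
        moreover have "w ^ i * y ^ i = 1" using y by (simp add: w_def flip: power_mult_distrib)
        moreover have "w ^ (n - i) * w ^ i * (Polynomial.coeff P i * y ^ i) = Polynomial.coeff P i * w ^ (n - i) * (w ^ i * y ^ i)"
          by (simp only: mult_ac)
        ultimately show "w ^ n * (Polynomial.coeff P i * y ^ i) = Polynomial.coeff P i * w ^ (n - i)"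
          by (simp only: mult_1_right)
      qed
      also have "\<dots> = (\<Sum>i<n. Polynomial.coeff P i * w ^ (n - i)) + Polynomial.coeff P n"
        by (simp add: lessThan_Suc_atMost[symmetric])
      also have "Polynomial.coeff P n = 1" using P(1) by (simp only: n_def)
      also have "(\<Sum>i<n. Polynomial.coeff P i * w ^ (n - i)) = (\<Sum>i<n. w ^ (n - i) * Polynomial.coeff P i)"
        by (simp only: mult.commute)
      finally have "- 1 = (\<Sum>i<n. w ^ (n - i) * Polynomial.coeff P i)"
        by (metis eq_neg_iff_add_eq_0)
      also have "\<dots> \<in> M"
      proof -
        have t: "w ^ (n - i) * Polynomial.coeff P i \<in> M" if "i < n" for i
          using M_mult[OF _ AR[OF P(2)]] M_power[of "n - i" w] w(1) that by simp
        have "(\<Sum>i\<in>J. w ^ (n - i) * Polynomial.coeff P i) \<in> M" if "J \<subseteq> {..<n}" for J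
          using finite_subset[OF that finite_lessThan] that
        proof (induction J)
          case empty
          then show ?case by (simp add: M_def)
        next
          case (insert j J)
          then show ?case using M_add t by simp
        qed
        then show ?thesis by blast
      qed
      finally have "- 1 \<in> M" .
      then have "1 \<in> M" using M_uminus by fastforce
      then show False using v0_power[of 1 0] by (simp add: M_def)
    qed
  qed
qed

theorem basis_card_dvd:
  assumes B: "lin.basis_mod A ((\<lambda>a. \<omega> * a) ` A) B"
  shows "card B dvd semigroup_conductor {n. \<exists>y\<in>A. y \<noteq> 0 \<and> valuation_of (integral_closure A) y = int n}
    + differential_cokernel_dim \<kappa> A (integral_closure A)"
proof -
  obtain z where z: "z \<noteq> 0" "0 < v0 z" "\<forall>y. y \<noteq> 0 \<longrightarrow> (\<exists>n::int. v0 y = n * v0 z)" using discrete by blast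
  \<comment> \<open>The quotient is an integer by the choice of \<open>z\<close>; rounding down only
    changes its type.\<close>
  define nu where "nu y = (if y = 0 then 0 else \<lfloor>v0 y / v0 z\<rfloor>)" for y
  have nu: "v0 y = nu y * v0 z" if y: "y \<noteq> 0" for y
  proof -
    obtain n :: int where "v0 y = n * v0 z" using z(3) y by blast
    then show ?thesis using y z(2) by (simp add: nu_def)
  qed
  interpret val: geom_point_val \<kappa> F D I \<Phi> \<omega> G p z nu
  proof unfold_locales
    show "z \<noteq> 0" "0 < v0 z" by fact+
    show "nu 0 = 0" by (simp add: nu_def)
    show "v0 y = nu y * v0 z" if "y \<noteq> 0" for y using that by (rule nu)
  qed
  obtain x where x: "val.extremal x" using val.extremal_exists by blast
  obtain c where c: "\<And>y. (\<forall>r\<in>R. y * r \<in> A) \<longleftrightarrow> y = 0 \<or> int c \<le> nu y" "nu \<omega> dvd int c + nu (val.der x)"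
    using val.conductor_divisibility[OF x] by blast
  have m: "nu (val.der x) = int (nat (nu (val.der x)))"
    using val.der_R[OF R_D] x by (auto simp: val.extremal_def val.R_nu)
  have "int (card B) dvd int (c + nat (nu (val.der x)))"
    using c(2) m val.basis_card_eq_nu[OF B] by simp
  then have "card B dvd c + nat (nu (val.der x))" by (simp only: int_dvd_int_iff)
  then show ?thesis
    unfolding integral_closure_A val.valuation_of_R val.differential_cokernel_dim_eq[OF x]
      val.semigroup_conductor_eq[OF c(1)] .
qed

end

section \<open>Zariski's lemma\<close>

context field begin

text \<open>Adjoining a transcendental element gives a polynomial ring, whose units are the nonzero
  constants.\<close>

lemma mult_in_simple_extension_Units:
  assumes K: "subfield K R" and a: "a \<in> carrier R" and tr: "(transcendental over K) a"
    and c: "c \<in> simple_extension K a" and h: "h \<in> simple_extension K a" and ch: "c \<otimes> h = \<one>"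
  shows "c \<in> K"
proof -
  have Kr: "subring K R" and Kc: "K \<subseteq> carrier R" using K subfieldE(1,3) by auto
  interpret UP: domain "K[X]" using univ_poly_is_domain[OF Kr] .
  obtain C H where C: "C \<in> carrier (K[X])" "c = eval C a" and H: "H \<in> carrier (K[X])" "h = eval H a"
    using c h simple_extension_as_eval_img[OF Kc a] by auto
  have hom: "ring_hom_cring (K[X]) R (\<lambda>p. eval p a)" using eval_cring_hom[OF Kr a] .
  have "eval (C \<otimes>\<^bsub>K[X]\<^esub> H) a = eval (\<one>\<^bsub>K[X]\<^esub>) a"
    using C H ch ring_hom_mult[OF ring_hom_cring.homh[OF hom] C(1) H(1)] ring_hom_one[OF ring_hom_cring.homh[OF hom]] by simp
  moreover have "inj_on (\<lambda>p. eval p a) (carrier (K[X]))" using tr unfolding transcendental_def over_def .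
  ultimately have "C \<otimes>\<^bsub>K[X]\<^esub> H = \<one>\<^bsub>K[X]\<^esub>"
    using C(1) H(1) UP.m_closed UP.one_closed by (meson inj_onD)
  then have "C \<in> Units (K[X])"
    using C(1) H(1) UP.m_comm[OF C(1) H(1)] unfolding Units_def by auto
  then obtain k where k: "k \<in> K" "C = [k]" using univ_poly_units[OF K] by auto
  then show ?thesis using C(2) Kc by auto
qed

lemma fraction_subfield:
  assumes D: "subring D R"
  shows "subfield {x \<in> carrier R. \<exists>b \<in> D - {\<zero>}. b \<otimes> x \<in> D} R" (is "subfield ?K R")
proof -
  note D' = subringE[OF D]
  have Dc: "x \<in> carrier R" if "x \<in> D" for x using that D'(1) by auto
  show ?thesis
  proof (rule subfieldI'[OF subringI])
    show "?K \<subseteq> carrier R" by auto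
    show "\<one> \<in> ?K" using D'(3) by (auto intro!: bexI[of _ "\<one>"])
    show "\<ominus> h \<in> ?K" if "h \<in> ?K" for h
    proof -
      from that obtain b where b: "b \<in> D - {\<zero>}" "b \<otimes> h \<in> D" and h: "h \<in> carrier R" by auto
      have "b \<otimes> \<ominus> h = \<ominus> (b \<otimes> h)" using b h Dc by (simp add: r_minus)
      then show ?thesis using b h D'(5) by (auto intro!: bexI[of _ b])
    qed
    show "h1 \<otimes> h2 \<in> ?K" if "h1 \<in> ?K" "h2 \<in> ?K" for h1 h2
    proof -
      from that obtain b1 b2 where b: "b1 \<in> D - {\<zero>}" "b1 \<otimes> h1 \<in> D" "b2 \<in> D - {\<zero>}" "b2 \<otimes> h2 \<in> D"
        and h: "h1 \<in> carrier R" "h2 \<in> carrier R" by auto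
      have "(b1 \<otimes> b2) \<otimes> (h1 \<otimes> h2) = (b1 \<otimes> h1) \<otimes> (b2 \<otimes> h2)" using b h Dc by (simp add: m_ac)
      then have "(b1 \<otimes> b2) \<otimes> (h1 \<otimes> h2) \<in> D" using b D'(6) by simp
      moreover have "b1 \<otimes> b2 \<in> D - {\<zero>}" using b Dc D'(6) by (auto simp: integral_iff)
      ultimately show ?thesis using h by auto
    qed
    show "h1 \<oplus> h2 \<in> ?K" if "h1 \<in> ?K" "h2 \<in> ?K" for h1 h2
    proof -
      from that obtain b1 b2 where b: "b1 \<in> D - {\<zero>}" "b1 \<otimes> h1 \<in> D" "b2 \<in> D - {\<zero>}" "b2 \<otimes> h2 \<in> D"
        and h: "h1 \<in> carrier R" "h2 \<in> carrier R" by auto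
      have "(b1 \<otimes> b2) \<otimes> (h1 \<oplus> h2) = b2 \<otimes> (b1 \<otimes> h1) \<oplus> b1 \<otimes> (b2 \<otimes> h2)" using b h Dc by (simp add: m_ac r_distr)
      then have "(b1 \<otimes> b2) \<otimes> (h1 \<oplus> h2) \<in> D" using b D'(6,7) by simp
      moreover have "b1 \<otimes> b2 \<in> D - {\<zero>}" using b Dc D'(6) by (auto simp: integral_iff)
      ultimately show ?thesis using h by auto
    qed
    show "inv k \<in> ?K" if "k \<in> ?K - {\<zero>}" for k
    proof -
      from that obtain b where b: "b \<in> D - {\<zero>}" "b \<otimes> k \<in> D" and k: "k \<in> carrier R" "k \<noteq> \<zero>" by auto
      have bc: "b \<in> carrier R" using b Dc by auto
      have u: "k \<in> Units R" using k field_Units by auto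
      have "(b \<otimes> k) \<otimes> inv k = b" using u bc k by (simp add: m_assoc)
      moreover have "b \<otimes> k \<noteq> \<zero>" using b k bc by (auto simp: integral_iff)
      ultimately show ?thesis using b u by (auto intro!: bexI[of _ "b \<otimes> k"])
    qed
  qed
qed

lemma common_denominator:
  assumes D: "subring D R"
    and ks: "set Ks \<subseteq> {x \<in> carrier R. \<exists>b \<in> D - {\<zero>}. b \<otimes> x \<in> D}"
  shows "\<exists>b \<in> D - {\<zero>}. \<forall>k \<in> set Ks. b \<otimes> k \<in> D"
  using ks
proof (induction Ks)
  case Nil
  then show ?case using subringE(3)[OF D] by (auto intro!: bexI[of _ "\<one>"])
next
  case (Cons k Ks)
  note D' = subringE[OF D]
  from Cons obtain b where b: "b \<in> D - {\<zero>}" "\<forall>k \<in> set Ks. b \<otimes> k \<in> D" by auto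
  from Cons obtain b' where b': "b' \<in> D - {\<zero>}" "b' \<otimes> k \<in> D" and k: "k \<in> carrier R" by auto
  have c: "b \<in> carrier R" "b' \<in> carrier R" "\<And>x. x \<in> set Ks \<Longrightarrow> x \<in> carrier R"
    using b b' D'(1) Cons by auto
  have "b \<otimes> b' \<in> D - {\<zero>}" using b b' c D'(6) by (auto simp: integral_iff)
  moreover have "(b \<otimes> b') \<otimes> k \<in> D" using b b' c k D'(6) by (simp add: m_assoc)
  moreover have "(b \<otimes> b') \<otimes> x \<in> D" if "x \<in> set Ks" for x
  proof -
    have "(b \<otimes> b') \<otimes> x = b' \<otimes> (b \<otimes> x)" using c that by (simp add: m_ac)
    then show ?thesis using b b' that D'(6) by auto
  qed
  ultimately show ?case by auto
qed

text \<open>If the first generator \<open>a\<close> is transcendental, write everything in a basis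
  containing \<open>1\<close> over the fraction field of \<open>D = K[a]\<close>: the structure constants have a common
  denominator \<open>b\<close>, so every \<open>s\<close> has some \<open>b ^ N * s\<close> in the \<open>D\<close>-span. For \<open>s\<close> the inverse of
  \<open>1 + a * b\<close> this makes \<open>1 + a * b\<close> a unit of \<open>K[a]\<close>, hence a constant, which is absurd.\<close>

lemma generated_field_finite_dimension:
  assumes "subfield K R" "set xs \<subseteq> carrier R" "finite_extension K xs = carrier R"
  shows "finite_dimension K (carrier R)"
  using assms
proof (induction xs arbitrary: K)
  case Nil
  then have "K = carrier R" by simp
  then show ?case using Nil dimension_one finite_dimensionI by metis
next
  case (Cons a xs)
  have K: "subfield K R" and a: "a \<in> carrier R" and xs: "set xs \<subseteq> carrier R" using Cons by auto
  have Kr: "subring K R" and Kc: "K \<subseteq> carrier R" using K subfieldE(1,3) by auto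
  have gen: "finite_extension K' xs = carrier R" if K': "subring K' R" "K \<subseteq> K'" "a \<in> K'" for K'
  proof
    show "finite_extension K' xs \<subseteq> carrier R"
      using finite_extension_in_carrier subringE(1)[OF K'(1)] xs by blast
    have "finite_extension K (a # xs) \<subseteq> finite_extension K' xs"
    proof (rule finite_extension_subring_incl)
      show "subring (finite_extension K' xs) R" using finite_extension_is_subring[OF K'(1) xs] .
      have i: "K' \<subseteq> finite_extension K' xs" using finite_extension_incl[OF subringE(1)[OF K'(1)] xs] .
      show "K \<subseteq> finite_extension K' xs" using i K'(2) by blast
      show "set (a # xs) \<subseteq> finite_extension K' xs" using i K'(3) finite_extension_mem[OF K'(1) xs] by auto
    qed
    then show "carrier R \<subseteq> finite_extension K' xs" using Cons.prems(3) by simp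
  qed
  define D where "D = simple_extension K a"
  have D: "subring D R" unfolding D_def using simple_extension_is_subring[OF Kr a] .
  note D' = subringE[OF D]
  have KD: "K \<subseteq> D" and aD: "a \<in> D" unfolding D_def
    using simple_extension_incl[OF Kc a] simple_extension_mem[OF Kr a] by auto
  show ?case
  proof (cases "(algebraic over K) a")
    case True
    have sf: "subfield D R" unfolding D_def using simple_extension_is_subfield[OF K a] True by simp
    have "finite_dimension K D" unfolding D_def using finite_dimension_simple_extension[OF K a] True by simp
    moreover have "finite_dimension D (carrier R)"
      using Cons.IH[OF sf xs gen[OF D KD aD]] .
    ultimately show ?thesis using telescopic_base_dim(1)[OF K sf] by blast
  next
    case False
    then have tr: "(transcendental over K) a" unfolding over_def by simp
    define F where "F = {x \<in> carrier R. \<exists>b \<in> D - {\<zero>}. b \<otimes> x \<in> D}"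
    have F: "subfield F R" unfolding F_def using fraction_subfield[OF D] .
    have Fr: "subring F R" using F subfieldE(1) by auto
    have DF: "D \<subseteq> F" unfolding F_def using D' by (auto intro!: bexI[of _ "\<one>"])
    have "finite_dimension F (carrier R)"
      using Cons.IH[OF F xs gen[OF Fr]] KD DF aD by auto
    then obtain n where n: "dimension n F (carrier R)" unfolding finite_dimension_def by auto
    \<comment> \<open>With 1 in the basis, an element of \<open>F\<close> has a single coordinate,
      namely itself; this yields \<open>TF\<close> below.\<close>
    have "independent F [\<one>]" by (rule li_Cons) auto
    from complete_base[OF F n this] obtain Vs where
      Vs: "independent F (Vs @ [\<one>])" "Span F (Vs @ [\<one>]) = carrier R" by auto
    define Us where "Us = Vs @ [\<one>]"
    have Us: "independent F Us" "Span F Us = carrier R" "\<one> \<in> set Us" using Vs Us_def by auto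
    have Uc: "set Us \<subseteq> carrier R" using independent_in_carrier[OF Us(1)] .
    define T where "T = {combine Ks Us | Ks. length Ks = length Us \<and> set Ks \<subseteq> D}"
    have Dc: "D \<subseteq> carrier R" using D' by auto
    have Tc: "T \<subseteq> carrier R" unfolding T_def using Uc Dc by auto
    have Tadd: "x \<oplus> y \<in> T" if "x \<in> T" "y \<in> T" for x y
    proof -
      from that obtain Ks Ks' where k: "length Ks = length Us" "set Ks \<subseteq> D" "x = combine Ks Us"
        "length Ks' = length Us" "set Ks' \<subseteq> D" "y = combine Ks' Us" unfolding T_def by auto
      have "x \<oplus> y = combine (map2 (\<oplus>) Ks Ks') Us"
        using combine_add[of Ks Us Ks'] k Uc Dc by auto
      moreover have "set (map2 (\<oplus>) Ks Ks') \<subseteq> D" using k D'(7) by (auto intro!: D'(7) dest: set_zip_leftD set_zip_rightD)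
      ultimately show ?thesis unfolding T_def using k by force
    qed
    have Tmult: "d \<otimes> x \<in> T" if "d \<in> D" "x \<in> T" for d x
    proof -
      from that obtain Ks where k: "length Ks = length Us" "set Ks \<subseteq> D" "x = combine Ks Us" unfolding T_def by auto
      have "d \<otimes> x = combine (map ((\<otimes>) d) Ks) Us" using combine_r_distr[of Ks Us d] k Uc Dc that by auto
      moreover have "set (map ((\<otimes>) d) Ks) \<subseteq> D" using k D'(6) that by auto
      ultimately show ?thesis unfolding T_def using k by force
    qed
    have zT: "\<zero> \<in> T"
    proof -
      have "\<zero> = combine (replicate (length Us) \<zero>) Us" using combine_replicate[OF Uc] by simp
      then show ?thesis unfolding T_def using D'(2) by (auto intro!: exI[of _ "replicate (length Us) \<zero>"])
    qed
    have denT: "\<exists>b \<in> D - {\<zero>}. b \<otimes> y \<in> T" if "y \<in> carrier R" for y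
    proof -
      from that Us(2) have "y \<in> Span F Us" by simp
      then obtain Ks where k: "set Ks \<subseteq> F" "length Ks = length Us" "y = combine Ks Us"
        using Span_mem_iff_length_version[OF F Uc] by auto
      from common_denominator[OF D k(1)[unfolded F_def]] obtain b where
        b: "b \<in> D - {\<zero>}" "\<forall>k\<in>set Ks. b \<otimes> k \<in> D" by auto
      have "b \<otimes> y = combine (map ((\<otimes>) b) Ks) Us"
        using combine_r_distr[of Ks Us b] k Uc Dc b subfieldE(3)[OF F] by auto
      moreover have "set (map ((\<otimes>) b) Ks) \<subseteq> D" using b by auto
      ultimately have "b \<otimes> y \<in> T" unfolding T_def using k by force
      then show ?thesis using b by auto
    qed
    have denT': "\<exists>b \<in> D - {\<zero>}. \<forall>y \<in> set ys. b \<otimes> y \<in> T" if "set ys \<subseteq> carrier R" for ys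
      using that
    proof (induction ys)
      case Nil
      then show ?case using D'(3) by (auto intro!: bexI[of _ "\<one>"])
    next
      case (Cons y ys)
      then obtain b where b: "b \<in> D - {\<zero>}" "\<forall>y \<in> set ys. b \<otimes> y \<in> T" by auto
      from Cons.prems denT[of y] obtain b' where b': "b' \<in> D - {\<zero>}" "b' \<otimes> y \<in> T" by auto
      have c: "b \<in> carrier R" "b' \<in> carrier R" using b b' Dc by auto
      have "b \<otimes> b' \<in> D - {\<zero>}" using b b' c D'(6) by (auto simp: integral_iff)
      moreover have "(b \<otimes> b') \<otimes> y \<in> T" using b b' c Tmult Cons by (simp add: m_assoc)
      moreover have "(b \<otimes> b') \<otimes> x \<in> T" if "x \<in> set ys" for x
      proof -
        have "(b \<otimes> b') \<otimes> x = b' \<otimes> (b \<otimes> x)" using c that Cons.prems by (auto simp: m_ac)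
        then show ?thesis using b b' that Tmult by auto
      qed
      ultimately show ?case by auto
    qed
    define T' where "T' = {s \<in> carrier R. \<forall>t \<in> T. s \<otimes> t \<in> T}"
    have T'I: "s \<in> T'" if s: "s \<in> carrier R" and u: "\<And>u. u \<in> set Us \<Longrightarrow> s \<otimes> u \<in> T" for s
    proof -
      have "s \<otimes> combine Ks Us' \<in> T" if "set Us' \<subseteq> set Us" "set Ks \<subseteq> D" for Ks Us'
        using that
      proof (induction Ks Us' rule: combine.induct)
        case (1 k Ks w Us')
        have c: "k \<in> carrier R" "w \<in> carrier R" "set Ks \<subseteq> carrier R" "set Us' \<subseteq> carrier R" using 1 Dc Uc by auto
        have "s \<otimes> combine (k # Ks) (w # Us') = k \<otimes> (s \<otimes> w) \<oplus> s \<otimes> combine Ks Us'"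
          using c s combine_in_carrier[OF c(3,4)] by (simp add: r_distr m_lcomm)
        moreover have "k \<otimes> (s \<otimes> w) \<in> T" using Tmult u 1 by auto
        ultimately show ?case using 1 Tadd by auto
      qed (use zT s in auto)
      then show ?thesis unfolding T'_def T_def using s by (auto simp: T_def)
    qed
    have T'r: "subring T' R"
    proof (rule subringI)
      show "T' \<subseteq> carrier R" "\<one> \<in> T'" using Tc by (auto simp: T'_def)
      fix h1 assume h1: "h1 \<in> T'"
      have m: "\<ominus> \<one> \<in> D" using D' by auto
      show "\<ominus> h1 \<in> T'"
      proof -
        have "\<ominus> h1 \<otimes> t = \<ominus> \<one> \<otimes> (h1 \<otimes> t)" if "t \<in> T" for t using h1 that Tc by (auto simp: T'_def l_minus)
        then show ?thesis using h1 Tmult[OF m] by (auto simp: T'_def)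
      qed
      fix h2 assume h2: "h2 \<in> T'"
      show "h1 \<otimes> h2 \<in> T'" using h1 h2 Tc by (auto simp: T'_def m_assoc subset_eq)
      show "h1 \<oplus> h2 \<in> T'" using h1 h2 Tc Tadd by (auto simp: T'_def l_distr subset_eq)
    qed
    have DT': "D \<subseteq> T'" using Dc Tmult by (auto simp: T'_def)
    \<comment> \<open>One denominator for all products of a generator with a basis vector, so that
      \<open>b\<close> times each generator carries \<open>T\<close> into itself.\<close>
    obtain b where b: "b \<in> D - {\<zero>}" "\<And>g u. g \<in> set xs \<Longrightarrow> u \<in> set Us \<Longrightarrow> b \<otimes> (g \<otimes> u) \<in> T"
      "\<And>u. u \<in> set Us \<Longrightarrow> b \<otimes> u \<in> T"
    proof -
      have "set (map (\<lambda>(g,u). g \<otimes> u) (List.product xs Us) @ Us) \<subseteq> carrier R" using xs Uc by auto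
      from denT'[OF this] obtain b where "b \<in> D - {\<zero>}"
        "\<forall>y\<in>set (map (\<lambda>(g,u). g \<otimes> u) (List.product xs Us) @ Us). b \<otimes> y \<in> T" by blast
      then show ?thesis using that[of b] by (auto simp: ball_Un)
    qed
    have bc: "b \<in> carrier R" using b Dc by auto
    \<comment> \<open>The elements that some power of \<open>b\<close> carries into the multiplier
      ring of \<open>T\<close>. They form a ring containing all generators, hence the whole field,
      inverses of elements of \<open>D\<close> included.\<close>
    define Z where "Z = {s \<in> carrier R. \<exists>N::nat. b [^] N \<otimes> s \<in> T'}"
    have bT': "b [^] (N::nat) \<in> T'" for N
      by (induction N) (use b DT' subringE(3,6)[OF T'r] in auto)
    have up: "b [^] (N + M) \<otimes> s \<in> T'" if "b [^] (N::nat) \<otimes> s \<in> T'" "s \<in> carrier R" for N M s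
    proof -
      have "b [^] (N + M) \<otimes> s = b [^] M \<otimes> (b [^] N \<otimes> s)"
        using bc that by (simp add: nat_pow_mult[symmetric] m_ac)
      then show ?thesis using that bT' subringE(6)[OF T'r] by auto
    qed
    have Zr: "subring Z R"
    proof (rule subringI)
      show "Z \<subseteq> carrier R" by (auto simp: Z_def)
      show "\<one> \<in> Z" using bT' bc by (auto simp: Z_def)
      fix h1 assume "h1 \<in> Z"
      then obtain N :: nat where h1: "h1 \<in> carrier R" "b [^] N \<otimes> h1 \<in> T'" by (auto simp: Z_def)
      have "b [^] N \<otimes> \<ominus> h1 = \<ominus> (b [^] N \<otimes> h1)" using h1 bc by (simp add: r_minus)
      then show "\<ominus> h1 \<in> Z" using h1 subringE(5)[OF T'r] by (auto simp: Z_def intro!: exI[of _ N])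
      fix h2 assume "h2 \<in> Z"
      then obtain M :: nat where h2: "h2 \<in> carrier R" "b [^] M \<otimes> h2 \<in> T'" by (auto simp: Z_def)
      have "b [^] (N + M) \<otimes> (h1 \<otimes> h2) = (b [^] N \<otimes> h1) \<otimes> (b [^] M \<otimes> h2)"
        using h1 h2 bc by (simp add: nat_pow_mult[symmetric] m_ac)
      then have "b [^] (N + M) \<otimes> (h1 \<otimes> h2) \<in> T'" using h1 h2 subringE(6)[OF T'r] by auto
      then show "h1 \<otimes> h2 \<in> Z" using h1 h2 by (auto simp: Z_def)
      have "b [^] (N + M) \<otimes> (h1 \<oplus> h2) = b [^] (N + M) \<otimes> h1 \<oplus> b [^] (M + N) \<otimes> h2"
        using h1 h2 bc by (simp add: r_distr add.commute)
      then have "b [^] (N + M) \<otimes> (h1 \<oplus> h2) \<in> T'" using up h1 h2 subringE(7)[OF T'r] by auto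
      then show "h1 \<oplus> h2 \<in> Z" using h1 h2 by (auto simp: Z_def)
    qed
    have "carrier R \<subseteq> Z"
    proof -
      have "finite_extension K (a # xs) \<subseteq> Z"
      proof (rule finite_extension_subring_incl[OF Zr])
        have "D \<subseteq> Z"
          using DT' Dc by (auto simp: Z_def subset_eq intro!: exI[of _ "0::nat"])
        moreover have "g \<in> Z" if "g \<in> set xs" for g
        proof -
          have gc: "g \<in> carrier R" using xs that by auto
          have "(b \<otimes> g) \<otimes> u \<in> T" if "u \<in> set Us" for u
            using b(2)[OF \<open>g \<in> set xs\<close> that] gc bc Uc that by (simp add: m_assoc subset_eq)
          then have "b \<otimes> g \<in> T'" using T'I[of "b \<otimes> g"] gc bc by auto
          then show ?thesis using gc bc by (auto simp: Z_def intro!: exI[of _ "1::nat"])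
        qed
        ultimately show "K \<subseteq> Z" "set (a # xs) \<subseteq> Z" using KD aD by auto
      qed
      then show ?thesis using Cons.prems(3) by simp
    qed
    have oneT: "\<one> \<in> T"
    proof -
      have "\<one> = combine (replicate (length Vs) \<zero> @ [\<one>]) (Vs @ [\<one>])"
      proof -
        have "combine (replicate (length Vs) \<zero> @ [k]) (Vs @ [\<one>]) = k" if "k \<in> carrier R" "set Vs \<subseteq> carrier R" for k Vs
          using that by (induction Vs) auto
        then show ?thesis using Uc by (auto simp: Us_def)
      qed
      then show ?thesis unfolding T_def Us_def using D'(2,3)
        by (auto intro!: exI[of _ "replicate (length Vs) \<zero> @ [\<one>]"])
    qed
    \<comment> \<open>A fraction in the \<open>D\<close>-span of the basis has its coordinates in
      \<open>D\<close>; by uniqueness it is its own coordinate at 1.\<close>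
    have TF: "x \<in> D" if x: "x \<in> T" "x \<in> F" for x
    proof -
      from x obtain Ks where k: "length Ks = length Us" "set Ks \<subseteq> D" "x = combine Ks Us" unfolding T_def by auto
      have xc: "x \<in> carrier R" using x Tc by auto
      have "combine (replicate (length Vs) \<zero> @ [k]) (Vs @ [\<one>]) = k" if "k \<in> carrier R" "set Vs \<subseteq> carrier R" for k Vs
        using that by (induction Vs) auto
      then have x2: "x = combine (replicate (length Vs) \<zero> @ [x]) Us" using Uc xc by (auto simp: Us_def)
      have "x \<in> Span F Us" using Us xc by simp
      from unique_decomposition[OF F Us(1) this] obtain Ks0 where
        u: "\<And>Ks. set Ks \<subseteq> F \<Longrightarrow> length Ks = length Us \<Longrightarrow> x = combine Ks Us \<Longrightarrow> Ks = Ks0" by auto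
      have "Ks = Ks0" using u[of Ks] k DF by auto
      moreover have "replicate (length Vs) \<zero> @ [x] = Ks0"
        using u[of "replicate (length Vs) \<zero> @ [x]"] x2 x(2) subringE(2)[OF Fr] by (auto simp: Us_def set_replicate_conv_if)
      ultimately have "Ks = replicate (length Vs) \<zero> @ [x]" by simp
      then show ?thesis using k(2) by auto
    qed
    \<comment> \<open>If nonzero, \<open>c = \<one> \<oplus> a \<otimes> b'\<close> divides a power
      of \<open>b'\<close> by assumption and is prime to \<open>b'\<close> by its shape. It is
      therefore a unit of \<open>D\<close>, and units of \<open>D\<close> lie in
      \<open>K\<close>.\<close>
    have key: "\<one> \<oplus> a \<otimes> b' \<in> K" if b': "b' \<in> D" "\<And>m. m \<in> D - {\<zero>} \<Longrightarrow> \<exists>(N::nat) h. h \<in> D \<and> b' [^] N = m \<otimes> h" for b'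
    proof -
      have b'c: "b' \<in> carrier R" using b' Dc by auto
      define c where "c = \<one> \<oplus> a \<otimes> b'"
      have cD: "c \<in> D" unfolding c_def using D' aD b' by auto
      show ?thesis
      proof (cases "c = \<zero>")
        case True
        then show ?thesis using c_def subringE(2)[OF Kr] by simp
      next
        case False
        then obtain N h where h: "h \<in> D" "b' [^] (N::nat) = c \<otimes> h" using b'(2)[of c] cD by auto
        have cc: "c \<in> carrier R" "h \<in> carrier R" using cD h Dc by auto
        define e where "e = \<ominus> (a \<otimes> b')"
        have eD: "e \<in> D" "e \<in> carrier R" unfolding e_def using D' aD b' Dc a b'c by auto
        have ce: "c = \<one> \<ominus> e" unfolding c_def e_def using a b'c by (simp add: minus_eq)
        \<comment> \<open>A geometric sum: with \<open>c = \<one> \<ominus> e\<close>, every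
          \<open>\<one> \<ominus> e [^] k\<close> is a multiple of \<open>c\<close>. As
          \<open>e [^] N\<close> is one too, so is 1.\<close>
        have geo: "\<exists>w \<in> D. \<one> \<ominus> e [^] (k::nat) = c \<otimes> w" for k
        proof (induction k)
          case 0
          then show ?case using D'(2) cc by (auto intro!: bexI[of _ "\<zero>"] simp: minus_eq r_neg)
        next
          case (Suc k)
          then obtain w where w: "w \<in> D" "\<one> \<ominus> e [^] k = c \<otimes> w" by auto
          have wc: "w \<in> carrier R" using w Dc by auto
          have ek: "e [^] k \<in> carrier R" using eD by simp
          have "(\<one> \<ominus> e) \<oplus> e \<otimes> (\<one> \<ominus> e [^] k) = \<one> \<oplus> (\<ominus> e \<oplus> e) \<oplus> \<ominus> (e \<otimes> e [^] k)"
            using eD ek by (simp only: minus_eq r_distr r_minus r_one a_assoc a_closed a_inv_closed m_closed one_closed)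
          also have "\<dots> = \<one> \<ominus> e [^] Suc k" using eD ek by (simp add: l_neg minus_eq m_comm)
          finally have "\<one> \<ominus> e [^] Suc k = (\<one> \<ominus> e) \<oplus> e \<otimes> (\<one> \<ominus> e [^] k)" by simp
          also have "\<dots> = c \<oplus> e \<otimes> (c \<otimes> w)" using w ce by simp
          also have "\<dots> = c \<otimes> (\<one> \<oplus> e \<otimes> w)" using cc eD wc by (simp add: r_distr m_ac)
          finally show ?case using w eD D' by (auto intro!: bexI[of _ "\<one> \<oplus> e \<otimes> w"])
        qed
        obtain w where w: "w \<in> D" "\<one> \<ominus> e [^] N = c \<otimes> w" using geo by blast
        define s where "s = (\<ominus> a) [^] N"
        have sD: "s \<in> D" unfolding s_def by (induction N) (use D' aD in auto)
        have wc: "w \<in> carrier R" "s \<in> carrier R" using w sD Dc by auto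
        have "e [^] N = s \<otimes> b' [^] N"
          unfolding e_def s_def using a b'c by (simp add: nat_pow_distrib[symmetric] l_minus)
        then have e2: "e [^] N = c \<otimes> (s \<otimes> h)" using h cc wc by (simp add: m_ac)
        have "\<one> = (\<one> \<ominus> e [^] N) \<oplus> e [^] N" using eD by (simp add: minus_eq a_assoc l_neg)
        also have "\<dots> = c \<otimes> (w \<oplus> s \<otimes> h)" using w(2) e2 cc wc by (simp add: r_distr)
        finally have "c \<otimes> (w \<oplus> s \<otimes> h) = \<one>" by simp
        moreover have "w \<oplus> s \<otimes> h \<in> D" using w sD h D' by auto
        ultimately show ?thesis
          using mult_in_simple_extension_Units[OF K a tr] cD unfolding D_def c_def by blast
      qed
    qed
    have divpow: "\<exists>(N::nat) h. h \<in> D \<and> b [^] N = m \<otimes> h" if m: "m \<in> D - {\<zero>}" for m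
    proof -
      have mc: "m \<in> carrier R" and u: "m \<in> Units R" using m Dc field_Units by auto
      have "inv m \<in> Z" using \<open>carrier R \<subseteq> Z\<close> u by auto
      then obtain N :: nat where N: "b [^] N \<otimes> inv m \<in> T'" by (auto simp: Z_def)
      define h where "h = b [^] N \<otimes> inv m"
      have hc: "h \<in> carrier R" unfolding h_def using u bc by auto
      have "h \<otimes> \<one> \<in> T" using N oneT unfolding T'_def h_def by blast
      then have hT: "h \<in> T" using hc by simp
      have bND: "b [^] N \<in> D" by (induction N) (use b D' in auto)
      have "m \<otimes> h = b [^] N" unfolding h_def using u mc bc by (simp add: m_lcomm[of m])
      moreover from this have "h \<in> F" unfolding F_def using m hc bND by (auto intro!: bexI[of _ m])
      ultimately show ?thesis using TF[OF hT] by metis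
    qed
    have c1: "\<one> \<oplus> a \<otimes> b \<in> K" using key[of b] b divpow by auto
    \<comment> \<open>The second application, to \<open>a \<otimes> b\<close>, gives two elements of
      \<open>K\<close> with quotient \<open>a\<close>, contradicting transcendence.\<close>
    have c2: "\<one> \<oplus> a \<otimes> (a \<otimes> b) \<in> K"
    proof (rule key)
      show "a \<otimes> b \<in> D" using aD b D' by auto
      fix m assume "m \<in> D - {\<zero>}"
      with divpow obtain N h where h: "h \<in> D" "b [^] (N::nat) = m \<otimes> h" by blast
      have aN: "a [^] N \<in> D" by (induction N) (use D' aD in auto)
      have "(a \<otimes> b) [^] N = m \<otimes> (a [^] N \<otimes> h)"
        using h a bc aN Dc \<open>m \<in> D - {\<zero>}\<close> by (simp add: nat_pow_distrib m_ac subset_eq)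
      then show "\<exists>(N::nat) h. h \<in> D \<and> (a \<otimes> b) [^] N = m \<otimes> h" using aN h D' by metis
    qed
    have K': "x \<ominus> \<one> \<in> K" if "x \<in> K" for x
      using that subringE[OF Kr] by (auto simp: minus_eq)
    have cancel: "\<one> \<oplus> y \<ominus> \<one> = y" if "y \<in> carrier R" for y
      using that a_comm[of "\<one>" y] by (simp add: minus_eq a_assoc r_neg)
    have k1: "a \<otimes> b \<in> K" using K'[OF c1] cancel[of "a \<otimes> b"] a bc by simp
    have k2: "a \<otimes> (a \<otimes> b) \<in> K" using K'[OF c2] cancel[of "a \<otimes> (a \<otimes> b)"] a bc by simp
    have "a \<notin> K" using tr algebraic_self[OF Kr] by (auto simp: over_def)
    moreover have "a \<noteq> \<zero>" using calculation subringE(2)[OF Kr] by auto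
    then have nz: "a \<otimes> b \<noteq> \<zero>" using a b bc by (auto simp: integral_iff)
    then have iK: "inv (a \<otimes> b) \<in> K" using subfield_m_inv(1)[OF K] k1 by auto
    have "(a \<otimes> b) \<in> Units R" using nz a bc field_Units by auto
    then have "(a \<otimes> (a \<otimes> b)) \<otimes> inv (a \<otimes> b) = a" using a bc by (metis Units_r_inv Units_inv_closed m_assoc m_closed r_one)
    then have "a \<in> K" using k2 iK subringE(6)[OF Kr] by metis
    ultimately show ?thesis by simp
  qed
qed

end

section \<open>Integral schemes\<close>

lemma ring_of_type_algebra_simps [simp]:
  "carrier ring_of_type_algebra = (UNIV :: 'f::field set)" "\<one>\<^bsub>ring_of_type_algebra\<^esub> = (1::'f)"
  "\<zero>\<^bsub>ring_of_type_algebra\<^esub> = (0::'f)" "x \<otimes>\<^bsub>ring_of_type_algebra\<^esub> y = x * (y::'f)" "x \<oplus>\<^bsub>ring_of_type_algebra\<^esub> y = x + (y::'f)"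
  by (simp_all add: ring_of_type_algebra_def)

lemma field_ring_of_type_algebra: "Ring.field (ring_of_type_algebra :: 'f::field ring)"
  by (rule field_from_type_algebra)

lemma a_inv_ring_of_type_algebra [simp]: "\<ominus>\<^bsub>ring_of_type_algebra\<^esub> (x::'f::field) = - x"
proof -
  interpret Ring.field "ring_of_type_algebra :: 'f ring" by (rule field_ring_of_type_algebra)
  show ?thesis using add.inv_equality[of "- x" x] by simp
qed

lemma as_ring_simps [simp]:
  "carrier (as_ring A) = A" "\<one>\<^bsub>as_ring A\<^esub> = 1" "\<zero>\<^bsub>as_ring A\<^esub> = 0"
  "x \<otimes>\<^bsub>as_ring A\<^esub> y = x * y" "x \<oplus>\<^bsub>as_ring A\<^esub> y = x + y"
  by (simp_all add: as_ring_def ring_of_type_algebra_def)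

lemma subring_of_fieldD:
  assumes "subring_of_field A"
  shows "0 \<in> A" "1 \<in> A" "\<And>x. x \<in> A \<Longrightarrow> - x \<in> A" "\<And>x y. x \<in> A \<Longrightarrow> y \<in> A \<Longrightarrow> x + y \<in> A"
    "\<And>x y. x \<in> A \<Longrightarrow> y \<in> A \<Longrightarrow> x - y \<in> A" "\<And>x y. x \<in> A \<Longrightarrow> y \<in> A \<Longrightarrow> x * y \<in> A"
proof -
  interpret Ring.field "ring_of_type_algebra :: 'a ring" by (rule field_ring_of_type_algebra)
  note E = subringE[OF assms]
  show "0 \<in> A" "1 \<in> A" using E(2,3) by simp_all
  show m: "\<And>x. x \<in> A \<Longrightarrow> - x \<in> A" using E(5) by simp
  show a: "\<And>x y. x \<in> A \<Longrightarrow> y \<in> A \<Longrightarrow> x + y \<in> A" using E(7) by simp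
  show "\<And>x y. x \<in> A \<Longrightarrow> y \<in> A \<Longrightarrow> x * y \<in> A" using E(6) by simp
  show "x - y \<in> A" if "x \<in> A" "y \<in> A" for x y using a[OF that(1) m[OF that(2)]] by simp
qed

lemma subring_of_field_power: "subring_of_field A \<Longrightarrow> x \<in> A \<Longrightarrow> x ^ n \<in> A"
  by (induction n) (auto simp: subring_of_fieldD)

lemma subring_of_field_sum: "subring_of_field A \<Longrightarrow> (\<And>i. i \<in> J \<Longrightarrow> h i \<in> A) \<Longrightarrow> (\<Sum>i\<in>J. h i) \<in> A"
  by (induction J rule: infinite_finite_induct) (auto simp: subring_of_fieldD)

lemma cring_as_ring: "subring_of_field A \<Longrightarrow> cring (as_ring A)"
proof -
  assume A: "subring_of_field A"
  interpret Ring.field "ring_of_type_algebra :: 'a ring" by (rule field_ring_of_type_algebra)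
  have "subcring A ring_of_type_algebra" using A by (intro subcringI') auto
  then show ?thesis unfolding as_ring_def by (rule subcring_iff[THEN iffD1, rotated]) auto
qed

lemma Units_as_ring: "subring_of_field A \<Longrightarrow> x \<in> Units (as_ring A) \<longleftrightarrow> x \<in> A \<and> x \<noteq> 0 \<and> inverse x \<in> A"
proof
  assume A: "subring_of_field A" and "x \<in> Units (as_ring A)"
  then obtain y where y: "x \<in> A" "y \<in> A" "y * x = 1" by (auto simp: Units_def)
  then have "x \<noteq> 0" by auto
  moreover from y this have "inverse x = y" by (simp add: field_simps)
  ultimately show "x \<in> A \<and> x \<noteq> 0 \<and> inverse x \<in> A" using y by simp
next
  assume "x \<in> A \<and> x \<noteq> 0 \<and> inverse x \<in> A"
  then show "x \<in> Units (as_ring A)" unfolding Units_def by (auto intro!: bexI[of _ "inverse x"])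
qed

lemma nonunits_iff: "subring_of_field A \<Longrightarrow> x \<in> nonunits A \<longleftrightarrow> x \<in> A \<and> (x = 0 \<or> inverse x \<notin> A)"
  using Units_as_ring[of A x] by (auto simp: nonunits_def)

lemma ideal_as_ring_iff:
  assumes A: "subring_of_field A"
  shows "ideal J (as_ring A) \<longleftrightarrow> J \<subseteq> A \<and> 0 \<in> J \<and> (\<forall>x\<in>J. \<forall>y\<in>J. x + y \<in> J) \<and> (\<forall>a\<in>A. \<forall>x\<in>J. a * x \<in> J)" (is "?l \<longleftrightarrow> ?r")
proof
  interpret cring "as_ring A" by (rule cring_as_ring[OF A])
  { assume ?l
    then interpret ideal J "as_ring A" .
    show ?r using a_subset additive_subgroup.zero_closed[OF additive_subgroup_axioms] a_closed I_l_closed by auto }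
  { assume r: ?r
    show ?l
    proof (rule idealI)
      show "ring (as_ring A)" by (rule ring_axioms)
      show "subgroup J (add_monoid (as_ring A))"
      proof (rule add.subgroupI)
        show "J \<subseteq> carrier (as_ring A)" "J \<noteq> {}" using r by auto
        fix a assume a: "a \<in> J"
        then have aA: "a \<in> A" using r by auto
        have m: "- a \<in> A" using subring_of_fieldD(3)[OF A aA] .
        have "\<ominus>\<^bsub>as_ring A\<^esub> a = - a" using add.inv_equality[of "- a" a] aA m by simp
        moreover have "- 1 * a \<in> J" using r a subring_of_fieldD(2,3)[OF A] by blast
        ultimately show "\<ominus>\<^bsub>as_ring A\<^esub> a \<in> J" by simp
        fix b assume "b \<in> J"
        then show "a \<oplus>\<^bsub>as_ring A\<^esub> b \<in> J" using r a by simp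
      qed
    next
      fix a x assume ax: "a \<in> J" "x \<in> carrier (as_ring A)"
      then have "x * a \<in> J" using r by simp
      then show "x \<otimes>\<^bsub>as_ring A\<^esub> a \<in> J" "a \<otimes>\<^bsub>as_ring A\<^esub> x \<in> J" by (simp_all add: mult.commute)
    qed }
qed

lemma primeideal_as_ring_iff:
  assumes A: "subring_of_field A"
  shows "primeideal J (as_ring A) \<longleftrightarrow> J \<subseteq> A \<and> 0 \<in> J \<and> (\<forall>x\<in>J. \<forall>y\<in>J. x + y \<in> J) \<and> (\<forall>a\<in>A. \<forall>x\<in>J. a * x \<in> J) \<and>
    1 \<notin> J \<and> (\<forall>a\<in>A. \<forall>b\<in>A. a * b \<in> J \<longrightarrow> a \<in> J \<or> b \<in> J)" (is "?l \<longleftrightarrow> ?r")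
proof
  interpret cring "as_ring A" by (rule cring_as_ring[OF A])
  { assume p: ?l
    then interpret primeideal J "as_ring A" .
    have "1 \<notin> J" using one_imp_carrier I_notcarr by auto
    moreover have "\<forall>a\<in>A. \<forall>b\<in>A. a * b \<in> J \<longrightarrow> a \<in> J \<or> b \<in> J" using I_prime by auto
    ultimately show ?r using ideal_as_ring_iff[OF A, of J] ideal_axioms by blast }
  { assume r: ?r
    show ?l
    proof (rule primeidealI)
      show "ideal J (as_ring A)" using r ideal_as_ring_iff[OF A] by blast
      show "cring (as_ring A)" by (rule cring_axioms)
      show "carrier (as_ring A) \<noteq> J" using r subring_of_fieldD(2)[OF A] by auto
      show "\<And>a b. a \<in> carrier (as_ring A) \<Longrightarrow> b \<in> carrier (as_ring A) \<Longrightarrow> a \<otimes>\<^bsub>as_ring A\<^esub> b \<in> J \<Longrightarrow> a \<in> J \<or> b \<in> J" using r by auto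
    qed }
qed

lemma ideal_add_multiples:
  assumes A: "subring_of_field A" and M: "ideal M (as_ring A)" and a: "a \<in> A"
  shows "ideal {m + s * a | m s. m \<in> M \<and> s \<in> A} (as_ring A)" (is "ideal ?K _")
    and "M \<subseteq> {m + s * a | m s. m \<in> M \<and> s \<in> A}" and "a \<in> {m + s * a | m s. m \<in> M \<and> s \<in> A}"
proof -
  note AD = subring_of_fieldD[OF A]
  have MD: "M \<subseteq> A" "0 \<in> M" "\<And>x y. x \<in> M \<Longrightarrow> y \<in> M \<Longrightarrow> x + y \<in> M" "\<And>a x. a \<in> A \<Longrightarrow> x \<in> M \<Longrightarrow> a * x \<in> M"
    using M unfolding ideal_as_ring_iff[OF A] by auto
  show MK: "M \<subseteq> ?K"
  proof
    fix m assume "m \<in> M"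
    then show "m \<in> ?K" using AD(1) by (intro CollectI exI[of _ m] exI[of _ 0]) simp
  qed
  show "a \<in> ?K" using MD(2) AD(2) by (intro CollectI exI[of _ 0] exI[of _ 1]) simp
  show "ideal ?K (as_ring A)" unfolding ideal_as_ring_iff[OF A]
  proof (intro conjI ballI)
    show "?K \<subseteq> A" using MD(1) AD(4,6) a by auto
    show "0 \<in> ?K" using MK MD(2) by blast
    fix x assume "x \<in> ?K"
    then obtain m s where x: "m \<in> M" "s \<in> A" "x = m + s * a" by auto
    show "x + y \<in> ?K" if "y \<in> ?K" for y
    proof -
      from that obtain m' s' where y: "m' \<in> M" "s' \<in> A" "y = m' + s' * a" by auto
      have "x + y = (m + m') + (s + s') * a" using x y by (simp add: algebra_simps)
      then show ?thesis using MD(3)[OF x(1) y(1)] AD(4)[OF x(2) y(2)] by blast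
    qed
    show "b * x \<in> ?K" if "b \<in> A" for b
    proof -
      have "b * x = b * m + (b * s) * a" using x by (simp add: algebra_simps)
      then show ?thesis using MD(4)[OF that x(1)] AD(6)[OF that x(2)] by blast
    qed
  qed
qed

text \<open>An ideal maximal among the proper ones above \<open>J\<close> exists by Zorn's lemma. It
  is prime: if it contained neither \<open>a\<close> nor \<open>b\<close>, then multiplying two
  expressions of 1 would show that \<open>a * b\<close> is not in it.\<close>

lemma prime_ideal_containing:
  assumes A: "subring_of_field A" and J: "ideal J (as_ring A)" "1 \<notin> J"
  shows "\<exists>\<pp>. primeideal \<pp> (as_ring A) \<and> J \<subseteq> \<pp>"
proof -
  define \<A> where "\<A> = {K. ideal K (as_ring A) \<and> J \<subseteq> K \<and> 1 \<notin> K}"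
  note ii = ideal_as_ring_iff[OF A]
  have "\<exists>M\<in>\<A>. \<forall>X'\<in>\<A>. M \<subseteq> X' \<longrightarrow> X' = M"
  proof (rule subset_Zorn_nonempty)
    show "\<A> \<noteq> {}" using J by (auto simp: \<A>_def)
    fix \<C> assume c: "\<C> \<noteq> {}" "subset.chain \<A> \<C>"
    then have sub: "\<And>K. K \<in> \<C> \<Longrightarrow> ideal K (as_ring A) \<and> J \<subseteq> K \<and> 1 \<notin> K" by (auto simp: subset.chain_def \<A>_def)
    have lin: "K \<subseteq> K' \<or> K' \<subseteq> K" if "K \<in> \<C>" "K' \<in> \<C>" for K K' using c(2) that by (auto simp: subset.chain_def)
    have "ideal (\<Union>\<C>) (as_ring A)" unfolding ii
    proof (intro conjI ballI)
      show "\<Union>\<C> \<subseteq> A" "0 \<in> \<Union>\<C>" using sub c(1) unfolding ii by blast+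
      show "a * x \<in> \<Union>\<C>" if "a \<in> A" "x \<in> \<Union>\<C>" for a x using that sub unfolding ii by blast
      fix x y assume "x \<in> \<Union>\<C>" "y \<in> \<Union>\<C>"
      then obtain K K' where k: "K \<in> \<C>" "K' \<in> \<C>" "x \<in> K" "y \<in> K'" by blast
      then obtain K'' where "K'' \<in> \<C>" "x \<in> K''" "y \<in> K''" using lin by blast
      then show "x + y \<in> \<Union>\<C>" using sub unfolding ii by blast
    qed
    then show "\<Union>\<C> \<in> \<A>" using sub c(1) unfolding \<A>_def by blast
  qed
  then obtain M where M: "ideal M (as_ring A)" "J \<subseteq> M" "1 \<notin> M"
    and max: "\<And>K. ideal K (as_ring A) \<Longrightarrow> J \<subseteq> K \<Longrightarrow> 1 \<notin> K \<Longrightarrow> M \<subseteq> K \<Longrightarrow> K = M" by (auto simp: \<A>_def)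
  have MD: "M \<subseteq> A" "0 \<in> M" "\<And>x y. x \<in> M \<Longrightarrow> y \<in> M \<Longrightarrow> x + y \<in> M" "\<And>a x. a \<in> A \<Longrightarrow> x \<in> M \<Longrightarrow> a * x \<in> M"
    using M(1) unfolding ii by auto
  note AD = subring_of_fieldD[OF A]
  have ext: "\<exists>m\<in>M. \<exists>s\<in>A. 1 = m + s * a" if a: "a \<in> A" "a \<notin> M" for a
  proof (rule ccontr)
    assume n: "\<not> ?thesis"
    define K where "K = {m + s * a | m s. m \<in> M \<and> s \<in> A}"
    note K = ideal_add_multiples[OF A M(1) a(1), folded K_def]
    have MK: "M \<subseteq> K" and aK: "a \<in> K" and "ideal K (as_ring A)" using K by auto
    have "1 \<notin> K" using n by (auto simp: K_def)
    with \<open>ideal K (as_ring A)\<close> have "K = M" using max M(2) MK by blast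
    then show False using aK a(2) by simp
  qed
  have "a \<in> M \<or> b \<in> M" if ab: "a \<in> A" "b \<in> A" "a * b \<in> M" for a b
  proof (rule ccontr)
    assume "\<not> ?thesis"
    then obtain m s m' s' where e: "m \<in> M" "s \<in> A" "1 = m + s * a" "m' \<in> M" "s' \<in> A" "1 = m' + s' * b" using ext ab by meson
    have "1 = (m + s * a) * (m' + s' * b)" by (simp flip: e(3,6))
    also have "\<dots> = m' * m + (s' * b) * m + (s * a) * m' + (s * s') * (a * b)" by (simp add: algebra_simps)
    also have "\<dots> \<in> M"
    proof (intro MD(3))
      have m: "m \<in> A" "m' \<in> A" using e MD(1) by blast+
      show "m' * m \<in> M" by (rule MD(4)[OF m(2) e(1)])
      show "s' * b * m \<in> M" by (rule MD(4)[OF AD(6)[OF e(5) ab(2)] e(1)])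
      show "s * a * m' \<in> M" by (rule MD(4)[OF AD(6)[OF e(2) ab(1)] e(4)])
      show "s * s' * (a * b) \<in> M" by (rule MD(4)[OF AD(6)[OF e(2) e(5)] ab(3)])
    qed
    finally show False using M(3) by simp
  qed
  then have "primeideal M (as_ring A)" unfolding primeideal_as_ring_iff[OF A] using MD M(3) by blast
  then show ?thesis using M(2) by blast
qed

lemma field_homD:
  assumes "field_hom h"
  shows "h 0 = 0" "h 1 = 1" "h (x + y) = h x + h y" "h (x * y) = h x * h y"
    "h (- x) = - h x" "h (x - y) = h x - h y" "h (x ^ n) = h x ^ n" "h (inverse x) = inverse (h x)"
    "h x = 0 \<longleftrightarrow> x = 0" "h x = h y \<longleftrightarrow> x = y" "h (x / y) = h x / h y"
proof -
  have hom: "h \<in> ring_hom ring_of_type_algebra ring_of_type_algebra" using assms by (simp add: field_hom_def)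
  show one: "h 1 = 1" using ring_hom_one[OF hom] by simp
  show add: "h (x + y) = h x + h y" for x y using ring_hom_add[OF hom, of x y] by simp
  show mult: "h (x * y) = h x * h y" for x y using ring_hom_mult[OF hom, of x y] by simp
  show zero: "h 0 = 0" using add[of 0 0] by (metis add.right_neutral add_left_cancel)
  show minus: "h (- x) = - h x" for x using add[of x "-x"] zero by (simp add: eq_neg_iff_add_eq_0 add.commute)
  show diff: "h (x - y) = h x - h y" for x y using add[of x "-y"] minus[of y] by simp
  show "h (x ^ n) = h x ^ n" by (induction n) (auto simp: one mult)
  show z: "h x = 0 \<longleftrightarrow> x = 0" for x
  proof
    assume "h x = 0"
    show "x = 0"
    proof (rule ccontr)
      assume "x \<noteq> 0"
      then have "h x * h (inverse x) = 1" using one by (simp flip: mult)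
      then show False using \<open>h x = 0\<close> by simp
    qed
  qed (simp add: zero)
  show "h x = h y \<longleftrightarrow> x = y" using z[of "x - y"] diff[of x y] by simp
  show inv: "h (inverse x) = inverse (h x)" for x
  proof (cases "x = 0")
    case False
    then have "h x * h (inverse x) = 1" using one by (simp flip: mult)
    then show ?thesis by (metis inverse_unique)
  qed (simp add: zero)
  show "h (x / y) = h x / h y" by (simp add: divide_inverse mult inv)
qed

text \<open>The topology is generated by the sets D(f) as a subbasis; they are closed under
  intersection, because D(f) and D(g) meet in D(fg), so they form a basis.\<close>

lemma Spec_basis:
  assumes A: "subring_of_field A" and V: "openin (Spec A) V" "\<pp> \<in> V"
  shows "\<exists>f\<in>A. f \<notin> \<pp> \<and> {\<qq>. primeideal \<qq> (as_ring A) \<and> f \<notin> \<qq>} \<subseteq> V \<and> primeideal \<pp> (as_ring A)"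
proof -
  define D where "D f = {\<qq>. primeideal \<qq> (as_ring A) \<and> f \<notin> \<qq>}" for f
  have DA: "D f \<inter> D g = D (f * g)" if fg: "f \<in> A" "g \<in> A" for f g
  proof (intro equalityI subsetI)
    fix \<qq> assume q: "\<qq> \<in> D f \<inter> D g"
    then have "primeideal \<qq> (as_ring A)" "f \<notin> \<qq>" "g \<notin> \<qq>" by (auto simp: D_def)
    then have "f * g \<notin> \<qq>" using fg unfolding primeideal_as_ring_iff[OF A] by blast
    then show "\<qq> \<in> D (f * g)" using q by (simp add: D_def)
  next
    fix \<qq> assume q: "\<qq> \<in> D (f * g)"
    then have mu: "\<And>a x. a \<in> A \<Longrightarrow> x \<in> \<qq> \<Longrightarrow> a * x \<in> \<qq>" unfolding D_def primeideal_as_ring_iff[OF A] by blast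
    have "f \<notin> \<qq>" "g \<notin> \<qq>" using mu[OF fg(2), of f] mu[OF fg(1), of g] q by (auto simp: D_def mult.commute)
    then show "\<qq> \<in> D f \<inter> D g" using q by (simp add: D_def)
  qed
  have "generate_topology_on {D f | f. f \<in> A} V"
    using V(1) unfolding Spec_def openin_topology_generated_by_iff D_def .
  then have "\<forall>\<qq>\<in>V. \<exists>f\<in>A. \<qq> \<in> D f \<and> D f \<subseteq> V"
  proof (induction rule: generate_topology_on.induct)
    case (Int a b)
    show ?case
    proof
      fix \<qq> assume "\<qq> \<in> a \<inter> b"
      then have qa: "\<qq> \<in> a" and qb: "\<qq> \<in> b" by auto
      obtain f where f: "f \<in> A" "\<qq> \<in> D f" "D f \<subseteq> a" using bspec[OF Int.IH(1) qa] by blast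
      obtain g where g: "g \<in> A" "\<qq> \<in> D g" "D g \<subseteq> b" using bspec[OF Int.IH(2) qb] by blast
      have "\<qq> \<in> D (f * g)" "D (f * g) \<subseteq> a \<inter> b" using f g DA[OF f(1) g(1)] by auto
      then show "\<exists>f\<in>A. \<qq> \<in> D f \<and> D f \<subseteq> a \<inter> b" using subring_of_fieldD(6)[OF A f(1) g(1)] by blast
    qed
  next
    case (UN K)
    show ?case
    proof
      fix \<qq> assume "\<qq> \<in> \<Union>K"
      then obtain k where k: "k \<in> K" "\<qq> \<in> k" by blast
      from bspec[OF UN.IH[OF k(1)] k(2)] show "\<exists>f\<in>A. \<qq> \<in> D f \<and> D f \<subseteq> \<Union>K" using k(1) by blast
    qed
  next
    case (Basis s)
    then show ?case by blast
  qed simp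
  from bspec[OF this V(2)] show ?thesis by (auto simp: D_def)
qed

lemma topspace_Spec: "subring_of_field A \<Longrightarrow> topspace (Spec A) = {\<pp>. primeideal \<pp> (as_ring A)}"
proof -
  assume A: "subring_of_field A"
  have "1 \<notin> \<pp>" if "primeideal \<pp> (as_ring A)" for \<pp> using that unfolding primeideal_as_ring_iff[OF A] by blast
  then show ?thesis unfolding Spec_def topology_generated_by_topspace using subring_of_fieldD(2)[OF A] by auto
qed

lemma openin_Spec_basic: "f \<in> A \<Longrightarrow> openin (Spec A) {\<pp>. primeideal \<pp> (as_ring A) \<and> f \<notin> \<pp>}"
  unfolding Spec_def by (rule topology_generated_by_Basis) blast

section \<open>Points, primes and stalks of an integral scheme\<close>

locale int_scheme =
  fixes \<X> :: "('p, 'f::field) ringed_space"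
  assumes scheme: "integral_scheme \<X>"
begin

lemmas schemeD = scheme[unfolded integral_scheme_def, THEN conjunct2, THEN conjunct1, rule_format]
  scheme[unfolded integral_scheme_def, THEN conjunct2, THEN conjunct2, THEN conjunct1, rule_format]
  scheme[unfolded integral_scheme_def, THEN conjunct2, THEN conjunct2, THEN conjunct2, THEN conjunct1, rule_format]
  scheme[unfolded integral_scheme_def, THEN conjunct2, THEN conjunct2, THEN conjunct2, THEN conjunct2, THEN conjunct1]
  scheme[unfolded integral_scheme_def, THEN conjunct2, THEN conjunct2, THEN conjunct2, THEN conjunct2, THEN conjunct2, rule_format]

lemma sections_subring: "openin (space \<X>) U \<Longrightarrow> U \<noteq> {} \<Longrightarrow> subring_of_field (sections \<X> U)"
  by (rule schemeD(2)) (rule conjI)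

lemma open_Int_nonempty: "openin (space \<X>) U \<Longrightarrow> U \<noteq> {} \<Longrightarrow> openin (space \<X>) V \<Longrightarrow> V \<noteq> {} \<Longrightarrow> U \<inter> V \<noteq> {}"
  by (rule schemeD(1)) (intro conjI)

text \<open>Restriction along \<open>V \<subseteq> U\<close> is not an axiom of the presentation; it
  is the sheaf axiom for the cover of \<open>U\<close> by \<open>U\<close> and
  \<open>V\<close>.\<close>

lemma sections_mono:
  assumes "openin (space \<X>) U" "openin (space \<X>) V" "V \<noteq> {}" "V \<subseteq> U"
  shows "sections \<X> U \<subseteq> sections \<X> V"
proof -
  have "sections \<X> (\<Union>{U, V}) = (\<Inter>U\<in>{U, V}. sections \<X> U)" by (rule schemeD(3)) (use assms in auto)
  then have "sections \<X> (U \<union> V) = sections \<X> U \<inter> sections \<X> V" by simp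
  moreover have "U \<union> V = U" using assms(4) by blast
  ultimately show ?thesis by auto
qed

lemma sections_stalk: "openin (space \<X>) U \<Longrightarrow> P \<in> U \<Longrightarrow> sections \<X> U \<subseteq> stalk \<X> P"
  unfolding stalk_def by blast

lemma stalk_subring: assumes P: "P \<in> topspace (space \<X>)" shows "subring_of_field (stalk \<X> P)"
proof -
  interpret Ring.field "ring_of_type_algebra :: 'f ring" by (rule field_ring_of_type_algebra)
  have dir: "\<exists>W. openin (space \<X>) W \<and> P \<in> W \<and> x \<in> sections \<X> W \<and> y \<in> sections \<X> W" if xy: "x \<in> stalk \<X> P" "y \<in> stalk \<X> P" for x y
  proof -
    from xy obtain U V where UV: "openin (space \<X>) U" "P \<in> U" "x \<in> sections \<X> U" "openin (space \<X>) V" "P \<in> V" "y \<in> sections \<X> V"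
      unfolding stalk_def by blast
    have W: "openin (space \<X>) (U \<inter> V)" "U \<inter> V \<noteq> {}" using UV by auto
    have "x \<in> sections \<X> (U \<inter> V)" "y \<in> sections \<X> (U \<inter> V)"
      using sections_mono[OF UV(1) W] sections_mono[OF UV(4) W] UV by blast+
    then show ?thesis using W UV by blast
  qed
  have sub: "subring_of_field (sections \<X> W)" if "openin (space \<X>) W" "P \<in> W" for W using sections_subring that by blast
  show ?thesis
  proof (rule subringI)
    show "stalk \<X> P \<subseteq> carrier ring_of_type_algebra" by simp
    have "1 \<in> sections \<X> (topspace (space \<X>))" using subring_of_fieldD(2)[OF sub] P by simp
    then have "1 \<in> stalk \<X> P" using sections_stalk[OF openin_topspace P] by blast
    then show "\<one>\<^bsub>ring_of_type_algebra\<^esub> \<in> stalk \<X> P" by simp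
    fix x assume x: "x \<in> stalk \<X> P"
    from dir[OF x x] obtain W where W: "openin (space \<X>) W" "P \<in> W" "x \<in> sections \<X> W" by blast
    then show "\<ominus>\<^bsub>ring_of_type_algebra\<^esub> x \<in> stalk \<X> P"
      using subring_of_fieldD(3)[OF sub[OF W(1,2)] W(3)] sections_stalk[OF W(1,2)] by auto
    fix y assume y: "y \<in> stalk \<X> P"
    from dir[OF x y] obtain W where W: "openin (space \<X>) W" "P \<in> W" "x \<in> sections \<X> W" "y \<in> sections \<X> W" by blast
    show "x \<otimes>\<^bsub>ring_of_type_algebra\<^esub> y \<in> stalk \<X> P" "x \<oplus>\<^bsub>ring_of_type_algebra\<^esub> y \<in> stalk \<X> P"
      using subring_of_fieldD(4,6)[OF sub[OF W(1,2)] W(3,4)] sections_stalk[OF W(1,2)] by auto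
  qed
qed

lemma affine_openD:
  assumes "affine_open \<X> U"
  shows "openin (space \<X>) U" "U \<noteq> {}" "subring_of_field (sections \<X> U)"
    "homeomorphic_map (subtopology (space \<X>) U) (Spec (sections \<X> U)) (\<lambda>P. sections \<X> U \<inter> nonunits (stalk \<X> P))"
    "f \<in> sections \<X> U \<Longrightarrow> f \<noteq> 0 \<Longrightarrow> sections \<X> {P \<in> U. f \<notin> nonunits (stalk \<X> P)} = {a / f ^ n | a n. a \<in> sections \<X> U}"
proof -
  note U = assms[unfolded affine_open_def]
  show o: "openin (space \<X>) U" "U \<noteq> {}"
    by (rule U[THEN conjunct1], rule U[THEN conjunct2, THEN conjunct1])
  show "subring_of_field (sections \<X> U)" by (rule sections_subring[OF o])
  show "homeomorphic_map (subtopology (space \<X>) U) (Spec (sections \<X> U)) (\<lambda>P. sections \<X> U \<inter> nonunits (stalk \<X> P))"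
    by (rule U[THEN conjunct2, THEN conjunct2, THEN conjunct1])
  show "sections \<X> {P \<in> U. f \<notin> nonunits (stalk \<X> P)} = {a / f ^ n | a n. a \<in> sections \<X> U}" if "f \<in> sections \<X> U" "f \<noteq> 0"
    by (rule U[THEN conjunct2, THEN conjunct2, THEN conjunct2, THEN bspec]) (use that in simp)
qed

abbreviation "pt U P \<equiv> sections \<X> U \<inter> nonunits (stalk \<X> P)"

lemma affine_topspace: "affine_open \<X> U \<Longrightarrow> topspace (subtopology (space \<X>) U) = U"
  using affine_openD(1) by (simp add: openin_subset inf.absorb2)

lemma pt_image: "affine_open \<X> U \<Longrightarrow> (\<lambda>P. pt U P) ` U = {\<pp>. primeideal \<pp> (as_ring (sections \<X> U))}"
  using homeomorphic_imp_surjective_map[OF affine_openD(4)[of U]] affine_topspace[of U] topspace_Spec[OF affine_openD(3)[of U]]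
  by simp

lemma pt_prime: assumes "affine_open \<X> U" "P \<in> U" shows "primeideal (pt U P) (as_ring (sections \<X> U))"
  using imageI[OF assms(2), of "\<lambda>P. pt U P"] unfolding pt_image[OF assms(1)] by simp

lemma pt_surj:
  assumes "affine_open \<X> U" "primeideal \<pp> (as_ring (sections \<X> U))"
  obtains P where "P \<in> U" "pt U P = \<pp>"
proof -
  have "\<pp> \<in> (\<lambda>P. pt U P) ` U" unfolding pt_image[OF assms(1)] using assms(2) by simp
  then show ?thesis by (auto intro: that)
qed

lemma pt_inj:
  assumes "affine_open \<X> U" "P \<in> U" "P' \<in> U" "pt U P = pt U P'"
  shows "P = P'"
  using inj_onD[OF homeomorphic_imp_injective_map[OF affine_openD(4)[OF assms(1)]] assms(4)] assms(2,3)
    affine_topspace[OF assms(1)] by metis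

lemma basic_open:
  assumes U: "affine_open \<X> U" and f: "f \<in> sections \<X> U"
  shows "openin (space \<X>) {P \<in> U. f \<notin> nonunits (stalk \<X> P)}"
proof -
  have "openin (subtopology (space \<X>) U) {P \<in> topspace (subtopology (space \<X>) U).
      pt U P \<in> {\<pp>. primeideal \<pp> (as_ring (sections \<X> U)) \<and> f \<notin> \<pp>}}"
    using homeomorphic_imp_continuous_map[OF affine_openD(4)[OF U]] openin_Spec_basic[OF f] by (rule openin_continuous_map_preimage)
  moreover have "{P \<in> topspace (subtopology (space \<X>) U). pt U P \<in> {\<pp>. primeideal \<pp> (as_ring (sections \<X> U)) \<and> f \<notin> \<pp>}}
      = {P \<in> U. f \<notin> nonunits (stalk \<X> P)}"
    unfolding affine_topspace[OF U] using pt_prime[OF U] f by blast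
  ultimately show ?thesis using openin_trans_full[OF _ affine_openD(1)[OF U]] by simp
qed

lemma basic_open_refine:
  assumes U: "affine_open \<X> U" and P: "P \<in> U" and W: "openin (space \<X>) W" "P \<in> W"
  shows "\<exists>f\<in>sections \<X> U. f \<notin> nonunits (stalk \<X> P) \<and> {P \<in> U. f \<notin> nonunits (stalk \<X> P)} \<subseteq> W"
proof -
  have "openin (subtopology (space \<X>) U) (U \<inter> W)" using W(1) by (simp add: openin_subtopology_Int2)
  then have "openin (Spec (sections \<X> U)) ((\<lambda>P. pt U P) ` (U \<inter> W))"
    using homeomorphic_imp_open_map[OF affine_openD(4)[OF U]] unfolding open_map_def by blast
  from Spec_basis[OF affine_openD(3)[OF U] this, of "pt U P"] obtain f where
    f: "f \<in> sections \<X> U" "f \<notin> pt U P" "{\<qq>. primeideal \<qq> (as_ring (sections \<X> U)) \<and> f \<notin> \<qq>} \<subseteq> (\<lambda>P. pt U P) ` (U \<inter> W)"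
    using P W(2) by blast
  have "P' \<in> W" if "P' \<in> U" "f \<notin> nonunits (stalk \<X> P')" for P'
  proof -
    have "pt U P' \<in> (\<lambda>P. pt U P) ` (U \<inter> W)" using f(3) pt_prime[OF U that(1)] that(2) by blast
    then obtain P'' where "P'' \<in> U \<inter> W" "pt U P' = pt U P''" by blast
    then show ?thesis using pt_inj[OF U that(1)] by blast
  qed
  then show ?thesis using f by blast
qed

text \<open>Basic open sets are cofinal among the neighbourhoods of \<open>P\<close>, and their
  sections are localizations at one element, so the union is the localization at the prime of
  \<open>P\<close>.\<close>

lemma stalk_eq:
  assumes U: "affine_open \<X> U" and P: "P \<in> U"
  shows "stalk \<X> P = {a / s | a s. a \<in> sections \<X> U \<and> s \<in> sections \<X> U \<and> s \<notin> pt U P}"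
proof -
  have Pt: "P \<in> topspace (space \<X>)" using P affine_openD(1)[OF U] openin_subset by blast
  note st = stalk_subring[OF Pt]
  have nz: "f \<noteq> 0" if "f \<notin> nonunits (stalk \<X> P)" for f
    using that nonunits_iff[OF st, of 0] subring_of_fieldD(1)[OF st] by auto
  show ?thesis
  proof (intro equalityI subsetI)
    fix x assume "x \<in> stalk \<X> P"
    then obtain W where W: "openin (space \<X>) W" "P \<in> W" "x \<in> sections \<X> W" unfolding stalk_def by blast
    obtain f where f: "f \<in> sections \<X> U" "f \<notin> nonunits (stalk \<X> P)" "{P \<in> U. f \<notin> nonunits (stalk \<X> P)} \<subseteq> W"
      using basic_open_refine[OF U P W(1,2)] by blast
    have "x \<in> sections \<X> {P \<in> U. f \<notin> nonunits (stalk \<X> P)}"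
      using sections_mono[OF W(1) basic_open[OF U f(1)] _ f(3)] W(3) P f(2) by blast
    then obtain a n where a: "a \<in> sections \<X> U" "x = a / f ^ n" unfolding affine_openD(5)[OF U f(1) nz[OF f(2)]] by blast
    have fst: "f \<in> stalk \<X> P" using f(1) sections_stalk[OF affine_openD(1)[OF U] P] by blast
    have "inverse f \<in> stalk \<X> P" using f(2) fst nonunits_iff[OF st] by blast
    then have "inverse (f ^ n) \<in> stalk \<X> P" using subring_of_field_power[OF st] by (simp add: power_inverse[symmetric])
    then have "f ^ n \<notin> nonunits (stalk \<X> P)" using nonunits_iff[OF st] nz[OF f(2)] by auto
    moreover have "f ^ n \<in> sections \<X> U" using subring_of_field_power[OF affine_openD(3)[OF U] f(1)] .
    ultimately show "x \<in> {a / s | a s. a \<in> sections \<X> U \<and> s \<in> sections \<X> U \<and> s \<notin> pt U P}" using a by blast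
  next
    fix x assume "x \<in> {a / s | a s. a \<in> sections \<X> U \<and> s \<in> sections \<X> U \<and> s \<notin> pt U P}"
    then obtain a s where a: "a \<in> sections \<X> U" "s \<in> sections \<X> U" "s \<notin> nonunits (stalk \<X> P)" "x = a / s" by blast
    have "a / s ^ 1 \<in> sections \<X> {P \<in> U. s \<notin> nonunits (stalk \<X> P)}"
      unfolding affine_openD(5)[OF U a(2) nz[OF a(3)]] using a(1) by blast
    then show "x \<in> stalk \<X> P" using sections_stalk[OF basic_open[OF U a(2)], of P] P a by auto
  qed
qed

lemma stalkE:
  assumes U: "affine_open \<X> U" and P: "P \<in> U" and x: "x \<in> stalk \<X> P"
  obtains a s where "a \<in> sections \<X> U" "s \<in> sections \<X> U" "s \<notin> pt U P" "x = a / s"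
proof -
  have "\<exists>a s. x = a / s \<and> a \<in> sections \<X> U \<and> s \<in> sections \<X> U \<and> s \<notin> pt U P"
    by (rule CollectD[OF subsetD[OF equalityD1[OF stalk_eq[OF U P]] x]])
  then show ?thesis by (elim exE conjE) (rule that)
qed

lemma stalk_unit_iff:
  assumes U: "affine_open \<X> U" and P: "P \<in> U" and s: "s \<in> sections \<X> U"
  shows "s \<notin> pt U P \<longleftrightarrow> s \<noteq> 0 \<and> inverse s \<in> stalk \<X> P"
proof -
  have Pt: "P \<in> topspace (space \<X>)" using P affine_openD(1)[OF U] openin_subset by blast
  have "s \<in> stalk \<X> P" using s sections_stalk[OF affine_openD(1)[OF U] P] by blast
  then show ?thesis using nonunits_iff[OF stalk_subring[OF Pt], of s] s by blast
qed

text \<open>Any rational function is a section over some nonempty open set, which meets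
  \<open>U\<close> by irreducibility; the stalk at a common point consists of fractions.\<close>

lemma fraction: "affine_open \<X> U \<Longrightarrow> \<exists>a s. a \<in> sections \<X> U \<and> s \<in> sections \<X> U \<and> s \<noteq> 0 \<and> x = a / s"
proof -
  assume U: "affine_open \<X> U"
  have "x \<in> (\<Union>U \<in> {U. openin (space \<X>) U \<and> U \<noteq> {}}. sections \<X> U)" unfolding schemeD(4) by simp
  then obtain V where V: "openin (space \<X>) V" "V \<noteq> {}" "x \<in> sections \<X> V" by blast
  obtain P where P: "P \<in> U" "P \<in> V" using open_Int_nonempty[OF affine_openD(1,2)[OF U] V(1,2)] by blast
  have "x \<in> stalk \<X> P" using sections_stalk[OF V(1) P(2)] V(3) by blast
  from stalkE[OF U P(1) this] obtain a s where as: "a \<in> sections \<X> U" "s \<in> sections \<X> U" "s \<notin> pt U P" "x = a / s" by this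
  moreover have "s \<noteq> 0" using stalk_unit_iff[OF U P(1) as(2)] as(3) by simp
  ultimately show ?thesis by (intro exI[of _ a] exI[of _ s] conjI)
qed

end

section \<open>Closed points and regular curves\<close>

context int_scheme
begin

lemma point_in_topspace: "affine_open \<X> U \<Longrightarrow> P \<in> U \<Longrightarrow> P \<in> topspace (space \<X>)"
  using affine_openD(1) openin_subset by blast

text \<open>If 1 were not of this form, a prime containing the prime of \<open>P\<close> and
  \<open>s\<close> would belong to another point \<open>Q\<close>. Since \<open>P\<close> is closed,
  some section vanishes at \<open>P\<close> and not at \<open>Q\<close>, contradicting the inclusion
  of primes.\<close>

lemma closed_point_maximal:
  assumes U: "affine_open \<X> U" and P: "P \<in> U" "closedin (space \<X>) {P}"
    and s: "s \<in> sections \<X> U" "s \<notin> pt U P"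
  shows "\<exists>t\<in>sections \<X> U. \<exists>m\<in>pt U P. 1 = m + t * s"
proof (rule ccontr)
  assume n: "\<not> ?thesis"
  note A = affine_openD(3)[OF U]
  define J where "J = {m + t * s | m t. m \<in> pt U P \<and> t \<in> sections \<X> U}"
  have "ideal (pt U P) (as_ring (sections \<X> U))" using pt_prime[OF U P(1)] primeideal.axioms(1) by blast
  note J = ideal_add_multiples[OF A this s(1), folded J_def]
  have "1 \<notin> J" using n unfolding J_def by blast
  then obtain \<qq> where q: "primeideal \<qq> (as_ring (sections \<X> U))" "J \<subseteq> \<qq>" using prime_ideal_containing[OF A J(1)] by blast
  obtain Q where Q: "Q \<in> U" "pt U Q = \<qq>" by (rule pt_surj[OF U q(1)])
  have "Q \<noteq> P" using Q(2) q(2) J(3) s(2) by blast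
  then have "Q \<in> topspace (space \<X>) - {P}" using point_in_topspace[OF U Q(1)] by blast
  then obtain f where f: "f \<in> sections \<X> U" "f \<notin> nonunits (stalk \<X> Q)"
    "{P \<in> U. f \<notin> nonunits (stalk \<X> P)} \<subseteq> topspace (space \<X>) - {P}"
    using basic_open_refine[OF U Q(1), of "topspace (space \<X>) - {P}"] P(2) by blast
  have "f \<in> nonunits (stalk \<X> P)" using f(3) P(1) by blast
  then have "f \<in> pt U Q" using f(1) J(2) q(2) Q(2) by blast
  then show False using f(2) by blast
qed

lemma specialization_iff:
  assumes U: "affine_open \<X> U" and Q: "Q \<in> U" "Q' \<in> U"
  shows "Q' \<in> space \<X> closure_of {Q} \<longleftrightarrow> pt U Q \<subseteq> pt U Q'"
proof
  assume cl: "Q' \<in> space \<X> closure_of {Q}"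
  show "pt U Q \<subseteq> pt U Q'"
  proof
    fix f assume f: "f \<in> pt U Q"
    show "f \<in> pt U Q'"
    proof (rule ccontr)
      assume "f \<notin> pt U Q'"
      then have fU: "f \<in> sections \<X> U" and "f \<notin> nonunits (stalk \<X> Q')" using f by auto
      then have Q': "Q' \<in> {P \<in> U. f \<notin> nonunits (stalk \<X> P)}" using Q(2) by simp
      have "\<forall>T. Q' \<in> T \<and> openin (space \<X>) T \<longrightarrow> (\<exists>y. y \<in> {Q} \<and> y \<in> T)" using cl unfolding in_closure_of by (rule conjunct2)
      from this[rule_format, OF conjI[OF Q' basic_open[OF U fU]]] have "f \<notin> nonunits (stalk \<X> Q)" by simp
      then show False using f by simp
    qed
  qed
next
  assume sub: "pt U Q \<subseteq> pt U Q'"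
  have "Q \<in> W" if W: "Q' \<in> W" "openin (space \<X>) W" for W
  proof -
    obtain f where f: "f \<in> sections \<X> U" "f \<notin> nonunits (stalk \<X> Q')" "{P \<in> U. f \<notin> nonunits (stalk \<X> P)} \<subseteq> W"
      using basic_open_refine[OF U Q(2) W(2,1)] by blast
    have "f \<notin> nonunits (stalk \<X> Q)" using f sub by blast
    then show ?thesis using f(3) Q(1) by blast
  qed
  then show "Q' \<in> space \<X> closure_of {Q}" unfolding in_closure_of using point_in_topspace[OF U Q(2)] by blast
qed

lemma irreducible_closed_closure:
  assumes "Q \<in> topspace (space \<X>)"
  shows "irreducible_closed (space \<X>) (space \<X> closure_of {Q})"
  unfolding irreducible_closed_def
proof (intro conjI allI impI)
  have Q: "Q \<in> space \<X> closure_of {Q}" using assms unfolding in_closure_of by blast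
  then show "space \<X> closure_of {Q} \<noteq> {}" by blast
  fix A B assume ab: "closedin (space \<X>) A \<and> closedin (space \<X>) B \<and> space \<X> closure_of {Q} \<subseteq> A \<union> B"
  then have "Q \<in> A \<or> Q \<in> B" using Q by blast
  then show "space \<X> closure_of {Q} \<subseteq> A \<or> space \<X> closure_of {Q} \<subseteq> B"
    using ab closure_of_minimal[of "{Q}" A "space \<X>"] closure_of_minimal[of "{Q}" B "space \<X>"] by blast
qed (rule closedin_closure_of)

lemma prime_contract:
  assumes U: "affine_open \<X> U" and P: "P \<in> U" and pp: "primeideal \<pp> (as_ring (stalk \<X> P))"
  obtains Q where "Q \<in> U" "pt U Q = \<pp> \<inter> sections \<X> U"
proof (rule pt_surj[OF U])
  note st = stalk_subring[OF point_in_topspace[OF U P]]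
  note A = affine_openD(3)[OF U]
  have sub: "\<And>s. s \<in> sections \<X> U \<Longrightarrow> s \<in> stalk \<X> P" using sections_stalk[OF affine_openD(1)[OF U] P] by blast
  note pD = pp[unfolded primeideal_as_ring_iff[OF st]]
  show "primeideal (\<pp> \<inter> sections \<X> U) (as_ring (sections \<X> U))"
    unfolding primeideal_as_ring_iff[OF A]
  proof (intro conjI ballI impI)
    show "0 \<in> \<pp> \<inter> sections \<X> U" using pD subring_of_fieldD(1)[OF A] by blast
    show "1 \<notin> \<pp> \<inter> sections \<X> U" using pD by blast
    show "x + y \<in> \<pp> \<inter> sections \<X> U" if "x \<in> \<pp> \<inter> sections \<X> U" "y \<in> \<pp> \<inter> sections \<X> U" for x y
      using pD that subring_of_fieldD(4)[OF A] by blast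
    show "a * x \<in> \<pp> \<inter> sections \<X> U" if "a \<in> sections \<X> U" "x \<in> \<pp> \<inter> sections \<X> U" for a x
      using pD that sub[OF that(1)] subring_of_fieldD(6)[OF A] by blast
    show "a \<in> \<pp> \<inter> sections \<X> U \<or> b \<in> \<pp> \<inter> sections \<X> U"
      if "a \<in> sections \<X> U" "b \<in> sections \<X> U" "a * b \<in> \<pp> \<inter> sections \<X> U" for a b
      using pD that sub[OF that(1)] sub[OF that(2)] by blast
  qed blast
qed

text \<open>Multiplying a fraction by its denominator, a unit of the stalk, gives a section in the
  same primes; so primes of the stalk are determined by their sections.\<close>

lemma prime_contract_strict:
  assumes U: "affine_open \<X> U" and P: "P \<in> U"
    and pp: "primeideal \<pp> (as_ring (stalk \<X> P))" "primeideal \<qq> (as_ring (stalk \<X> P))" "\<pp> \<subset> \<qq>"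
  shows "\<not> \<qq> \<inter> sections \<X> U \<subseteq> \<pp> \<inter> sections \<X> U"
proof
  assume le: "\<qq> \<inter> sections \<X> U \<subseteq> \<pp> \<inter> sections \<X> U"
  note st = stalk_subring[OF point_in_topspace[OF U P]]
  obtain x where x: "x \<in> \<qq>" "x \<notin> \<pp>" using pp(3) by blast
  note pD = pp(1)[unfolded primeideal_as_ring_iff[OF st]] and qD = pp(2)[unfolded primeideal_as_ring_iff[OF st]]
  have "x \<in> stalk \<X> P" using x(1) qD by blast
  from stalkE[OF U P this] obtain a s where a: "a \<in> sections \<X> U" "s \<in> sections \<X> U" "s \<notin> pt U P" "x = a / s" by this
  have s: "s \<noteq> 0" "inverse s \<in> stalk \<X> P" "s \<in> stalk \<X> P"
    using stalk_unit_iff[OF U P a(2)] a sections_stalk[OF affine_openD(1)[OF U] P] by blast+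
  have "s * x \<in> \<qq>" using qD x(1) s(3) by blast
  then have "a \<in> \<pp>" using a s(1) le by auto
  then have "inverse s * a \<in> \<pp>" using pD s(2) by blast
  then show False using x(2) a(4) by (simp add: divide_inverse mult.commute)
qed

text \<open>The dimension of the local ring is 1: a chain of three primes would give three nested
  closures of points, and dimension 0 would make the scheme a single point. Regularity then makes
  the maximal ideal principal, and the noetherian property makes every nonzero element a power of
  its generator times a unit.\<close>

lemma regular_closed_point_dvr:
  assumes dim: "chain_dimension {Z. irreducible_closed (space \<X>) Z} 1"
    and reg: "regular_local_ring (stalk \<X> P)" and P: "closedin (space \<X>) {P}"
  shows "\<exists>w\<in>stalk \<X> P. w \<noteq> 0 \<and> inverse w \<notin> stalk \<X> P \<and> nonunits (stalk \<X> P) = (\<lambda>a. w * a) ` stalk \<X> P \<and>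
    (\<forall>x. x \<noteq> 0 \<longrightarrow> (\<exists>u n. u \<in> stalk \<X> P \<and> u \<noteq> 0 \<and> inverse u \<in> stalk \<X> P \<and> (x = w ^ n * u \<or> x * w ^ n = u)))"
proof -
  define R where "R = stalk \<X> P"
  have PX: "P \<in> topspace (space \<X>)" using closedin_subset[OF P] by blast
  then obtain U where U: "affine_open \<X> U" and PU: "P \<in> U" using schemeD(5) by blast
  note st = stalk_subring[OF PX, folded R_def]
  note RD = subring_of_fieldD[OF st]
  interpret ring_R: cring "as_ring R" by (rule cring_as_ring[OF st])
  have noeth: "noetherian_ring (as_ring R)" using reg unfolding regular_local_ring_def R_def by blast
  obtain n H where n: "krull_dimension R n" "H \<subseteq> R" "finite H" "card H = n" "nonunits R = genideal (as_ring R) H"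
    using reg unfolding regular_local_ring_def R_def by blast
  note SR = sections_stalk[OF affine_openD(1)[OF U] PU, folded R_def]
  \<comment> \<open>If the maximal ideal were zero, \<open>P\<close> would be the only point of
    \<open>U\<close> and, by irreducibility, of the whole space, leaving no chain of two irreducible
    closed sets.\<close>
  have nz: "nonunits R \<noteq> {0}"
  proof
    assume z: "nonunits R = {0}"
    have z0: "pt U P = {0}" using z subring_of_fieldD(1)[OF affine_openD(3)[OF U]] unfolding R_def by blast
    have "Q = P" if Q: "Q \<in> U" for Q
    proof (rule pt_inj[OF U Q PU])
      note qD = pt_prime[OF U Q, unfolded primeideal_as_ring_iff[OF affine_openD(3)[OF U]]]
      have "s \<in> {0}" if s: "s \<in> pt U Q" for s
      proof (rule ccontr)
        assume "s \<notin> {0}"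
        then have "s \<notin> pt U P" unfolding z0 .
        then obtain t m where t: "t \<in> sections \<X> U" "m \<in> pt U P" "1 = m + t * s"
          using closed_point_maximal[OF U PU P] s by blast
        then have "t * s = 1" using z0 by simp
        moreover have "t * s \<in> pt U Q" using qD t(1) s by blast
        ultimately show False using qD by simp
      qed
      moreover have "0 \<in> pt U Q" using qD by blast
      ultimately show "pt U Q = pt U P" unfolding z0 by (intro equalityI subsetI) auto
    qed
    then have UP: "U = {P}" using PU by blast
    have top: "topspace (space \<X>) = {P}"
    proof (rule ccontr)
      assume "topspace (space \<X>) \<noteq> {P}"
      then have "topspace (space \<X>) - {P} \<noteq> {}" using PX by blast
      moreover have "openin (space \<X>) (topspace (space \<X>) - {P})" using P by blast
      ultimately have "U \<inter> (topspace (space \<X>) - {P}) \<noteq> {}" by (intro open_Int_nonempty affine_openD(1,2)[OF U])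
      then show False using UP by blast
    qed
    obtain Z where Z: "\<forall>i\<le>1. Z i \<in> {Z. irreducible_closed (space \<X>) Z}" "\<forall>i<1. Z i \<subset> Z (Suc i)"
      using dim unfolding chain_dimension_def has_chain_def by blast
    have "irreducible_closed (space \<X>) (Z 0)" "irreducible_closed (space \<X>) (Z (Suc 0))" "Z 0 \<subset> Z (Suc 0)"
      using Z by auto
    then have "Z 0 \<noteq> {}" "closedin (space \<X>) (Z (Suc 0))" "Z 0 \<subset> Z (Suc 0)"
      unfolding irreducible_closed_def by simp_all
    moreover from this(2) have "Z (Suc 0) \<subseteq> {P}" using closedin_subset[of "space \<X>" "Z (Suc 0)"] unfolding top by simp
    ultimately show False by blast
  qed
  have "n \<noteq> 0"
  proof
    assume "n = 0"
    then have H: "H = {}" using n(3,4) by simp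
    have "ideal {0} (as_ring R)" using ring_R.zeroideal by simp
    then have "genideal (as_ring R) {} \<subseteq> {0}" by (intro ring_R.genideal_minimal) auto
    moreover have "0 \<in> nonunits R" using nonunits_iff[OF st] RD(1) by blast
    ultimately show False using nz n(5) H by blast
  qed
  moreover have "\<not> 2 \<le> n"
  proof
    assume n2: "2 \<le> n"
    obtain Z where Z: "\<forall>i\<le>n. Z i \<in> {\<pp>. primeideal \<pp> (as_ring R)}" "\<forall>i<n. Z i \<subset> Z (Suc i)"
      using n(1) unfolding krull_dimension_def chain_dimension_def has_chain_def by blast
    have pr: "primeideal (Z i) (as_ring (stalk \<X> P))" if "i \<le> 2" for i using Z(1) that n2 unfolding R_def by force
    have lt: "Z 0 \<subset> Z 1" "Z 1 \<subset> Z 2" using Z(2)[rule_format, of 0] Z(2)[rule_format, of 1] n2 by (auto simp: numeral_2_eq_2)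
    obtain Q0 where Q0: "Q0 \<in> U" "pt U Q0 = Z 0 \<inter> sections \<X> U" by (rule prime_contract[OF U PU pr[of 0]]) auto
    obtain Q1 where Q1: "Q1 \<in> U" "pt U Q1 = Z 1 \<inter> sections \<X> U" by (rule prime_contract[OF U PU pr[of 1]]) auto
    obtain Q2 where Q2: "Q2 \<in> U" "pt U Q2 = Z 2 \<inter> sections \<X> U" by (rule prime_contract[OF U PU pr[of 2]]) auto
    have cl: "space \<X> closure_of {Q'} \<subset> space \<X> closure_of {Q}"
      if "Q \<in> U" "Q' \<in> U" "pt U Q \<subseteq> pt U Q'" "\<not> pt U Q' \<subseteq> pt U Q" for Q Q'
    proof -
      have "Q' \<in> space \<X> closure_of {Q}" using specialization_iff[OF U that(1,2)] that(3) by blast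
      then have "space \<X> closure_of {Q'} \<subseteq> space \<X> closure_of {Q}" by (intro closure_of_minimal closedin_closure_of) auto
      moreover have "Q \<in> space \<X> closure_of {Q}" using specialization_iff[OF U that(1,1)] by blast
      moreover have "Q \<notin> space \<X> closure_of {Q'}" using specialization_iff[OF U that(2,1)] that(4) by blast
      ultimately show ?thesis by blast
    qed
    have c1: "space \<X> closure_of {Q1} \<subset> space \<X> closure_of {Q0}"
      using prime_contract_strict[OF U PU pr[of 0] pr[of 1] lt(1)] lt(1) Q0(2) Q1(2) by (intro cl[OF Q0(1) Q1(1)]) auto
    have c2: "space \<X> closure_of {Q2} \<subset> space \<X> closure_of {Q1}"
      using prime_contract_strict[OF U PU pr[of 1] pr[of 2] lt(2)] lt(2) Q1(2) Q2(2) by (intro cl[OF Q1(1) Q2(1)]) auto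
    \<comment> \<open>Closures reverse the inclusion of primes, so the chain starts with the point
      of the largest prime.\<close>
    define Y where "Y i = space \<X> closure_of {if i = (0::nat) then Q2 else if i = 1 then Q1 else Q0}" for i
    have "has_chain {Z. irreducible_closed (space \<X>) Z} 2" unfolding has_chain_def
    proof (intro exI[of _ Y] conjI allI impI)
      show "Y i \<in> {Z. irreducible_closed (space \<X>) Z}" for i
        unfolding Y_def using irreducible_closed_closure point_in_topspace[OF U] Q0(1) Q1(1) Q2(1) by auto
      fix i :: nat assume "i < 2"
      then consider "i = 0" | "i = 1" by linarith
      then show "Y i \<subset> Y (Suc i)" using c1 c2 by cases (auto simp: Y_def)
    qed
    then show False using dim unfolding chain_dimension_def by (simp add: numeral_2_eq_2)
  qed
  ultimately have "n = 1" by linarith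
  then obtain w where H: "H = {w}" using n(4) by (auto simp: card_1_singleton_iff)
  have wR: "w \<in> R" using n(2) H by blast
  have "nonunits R = cgenideal (as_ring R) w" using n(5) ring_R.cgenideal_eq_genideal[of w] wR H by simp
  then have nu: "nonunits R = (\<lambda>a. w * a) ` R" unfolding cgenideal_def by (auto simp: mult.commute)
  have w0: "w \<noteq> 0" using nz nu RD(1) by auto
  have "w * 1 \<in> nonunits R" unfolding nu using RD(2) by blast
  then have wi: "inverse w \<notin> R" using nonunits_iff[OF st, of w] w0 by simp
  have dv: "\<exists>u n. u \<in> R \<and> u \<noteq> 0 \<and> inverse u \<in> R \<and> x = w ^ n * u" if x: "x \<in> R" "x \<noteq> 0" for x
  proof (rule ccontr)
    assume no: "\<not> ?thesis"
    have xn: "x / w ^ k \<in> R" for k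
    proof (induction k)
      case (Suc k)
      have ne: "x / w ^ k \<noteq> 0" using x w0 by simp
      have "x = w ^ k * (x / w ^ k)" using w0 by simp
      then have "inverse (x / w ^ k) \<notin> R" using no Suc ne by blast
      then have "x / w ^ k \<in> nonunits R" using nonunits_iff[OF st] Suc by blast
      then obtain a where a: "a \<in> R" "x / w ^ k = w * a" unfolding nu by blast
      then have "x / w ^ Suc k = a" using w0 by (simp add: field_simps)
      then show ?case using a by simp
    qed (use x in simp)
    \<comment> \<open>If division by \<open>w\<close> never ended in a unit, the ideals generated by
      \<open>x / w ^ k\<close> would form an ascending chain; where it becomes stationary,
      \<open>inverse w\<close> lies in \<open>R\<close>.\<close>
    define J where "J k = (\<lambda>a. a * (x / w ^ k)) ` R" for k
    have Ji: "ideal (J k) (as_ring R)" for k unfolding ideal_as_ring_iff[OF st]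
    proof (intro conjI ballI)
      show "J k \<subseteq> R" unfolding J_def using RD(6)[OF _ xn[of k]] by blast
      show "0 \<in> J k" unfolding J_def using RD(1) by (intro image_eqI[of _ _ 0]) auto
      fix u assume "u \<in> J k"
      then obtain a where a: "a \<in> R" "u = a * (x / w ^ k)" unfolding J_def by blast
      show "b * u \<in> J k" if "b \<in> R" for b
        unfolding J_def using a RD(6)[OF that a(1)] by (intro image_eqI[of _ _ "b * a"]) (auto simp: mult_ac)
      fix v assume "v \<in> J k"
      then obtain b where b: "b \<in> R" "v = b * (x / w ^ k)" unfolding J_def by blast
      show "u + v \<in> J k"
        unfolding J_def using a b RD(4)[OF a(1) b(1)] by (intro image_eqI[of _ _ "a + b"]) (simp_all only: distrib_right)
    qed
    have Jm: "J k \<subseteq> J (k + l)" for k l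
    proof
      fix u assume "u \<in> J k"
      then obtain a where a: "a \<in> R" "u = a * (x / w ^ k)" unfolding J_def by blast
      have "u = (a * w ^ l) * (x / w ^ (k + l))" using a w0 by (simp add: power_add field_simps)
      moreover have "a * w ^ l \<in> R" using RD(6)[OF a(1) subring_of_field_power[OF st wR]] .
      ultimately show "u \<in> J (k + l)" unfolding J_def by blast
    qed
    have "J k \<subseteq> J l \<or> J l \<subseteq> J k" for k l
      using Jm[of k "l - k"] Jm[of l "k - l"] by (cases "k \<le> l") auto
    then have "subset.chain {I. ideal I (as_ring R)} (range J)" using Ji unfolding subset.chain_def by auto
    then have "\<Union>(range J) \<in> range J" by (intro noetherian_ring.ideal_chain_is_trivial[OF noeth]) auto
    then obtain k where k: "\<Union>(range J) = J k" by blast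
    have "x / w ^ Suc k \<in> J (Suc k)" unfolding J_def using RD(2) by (intro image_eqI[of _ _ 1]) auto
    then have "x / w ^ Suc k \<in> J k" using k by blast
    then obtain a where a: "a \<in> R" "x / w ^ Suc k = a * (x / w ^ k)" unfolding J_def by blast
    have "inverse w = a" using a(2) w0 x(2) by (simp add: field_simps)
    then show False using wi a(1) by simp
  qed
  have "\<exists>u n. u \<in> R \<and> u \<noteq> 0 \<and> inverse u \<in> R \<and> (x = w ^ n * u \<or> x * w ^ n = u)" if x0: "x \<noteq> 0" for x
  proof -
    obtain a s where as: "a \<in> sections \<X> U" "s \<in> sections \<X> U" "s \<noteq> 0" "x = a / s" using fraction[OF U, of x] by blast
    have "a \<in> R" "a \<noteq> 0" "s \<in> R" using as x0 SR by auto
    then obtain u k v l where u: "u \<in> R" "u \<noteq> 0" "inverse u \<in> R" "a = w ^ k * u"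
      and v: "v \<in> R" "v \<noteq> 0" "inverse v \<in> R" "s = w ^ l * v" using dv[of a] dv[of s] as(3) by blast
    have uv: "u * inverse v \<in> R" "u * inverse v \<noteq> 0" "inverse (u * inverse v) \<in> R"
      using RD(6)[OF u(1) v(3)] RD(6)[OF u(3) v(1)] u v by auto
    have "x = w ^ (k - l) * (u * inverse v) \<or> x * w ^ (l - k) = u * inverse v"
    proof (cases "l \<le> k")
      case True
      then have "w ^ k = w ^ l * w ^ (k - l)" by (simp flip: power_add)
      then have "x = w ^ (k - l) * (u * inverse v)" using as(4) u(4) v(2,4) w0 by (simp add: field_simps)
      then show ?thesis ..
    next
      case False
      then have "w ^ l = w ^ k * w ^ (l - k)" by (simp flip: power_add)
      then have "x * w ^ (l - k) = u * inverse v" using as(4) u(4) v(2,4) w0 by (simp add: field_simps)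
      then show ?thesis ..
    qed
    then show ?thesis
    proof
      assume "x = w ^ (k - l) * (u * inverse v)"
      then show ?thesis by (intro exI[of _ "u * inverse v"] exI[of _ "k - l"]) (use uv in simp)
    next
      assume "x * w ^ (l - k) = u * inverse v"
      then show ?thesis by (intro exI[of _ "u * inverse v"] exI[of _ "l - k"]) (use uv in simp)
    qed
  qed
  then show ?thesis using wR w0 wi nu unfolding R_def by blast
qed

end

section \<open>Base change to the algebraic closure\<close>

text \<open>Take a polynomial of least degree that vanishes at some \<open>c ^ (p ^ N)\<close>. It
  is irreducible, and its derivative is nonzero, for otherwise it would be a polynomial in the p-th
  power of the variable and a smaller one would vanish at the next p-power. So it is separable,
  hence linear.\<close>

lemma separably_closed_power_in_base:
  fixes c :: "'k::field alg_closure"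
  assumes sep: "separably_closed TYPE('k)" and p: "CHAR('k) = p" "p > 0"
  shows "\<exists>N. c ^ (p ^ N) \<in> range to_ac"
proof -
  \<comment> \<open>The degree is minimized over all \<open>N\<close> at once, so that passing to a
    further p-th power cannot lower it.\<close>
  define D where "D n \<longleftrightarrow> (\<exists>N (q::'k poly). q \<noteq> 0 \<and> Polynomial.degree q = n \<and> poly (map_poly to_ac q) (c ^ (p ^ N)) = 0)" for n
  obtain q0 :: "'k poly" where q0: "q0 \<noteq> 0" "poly (map_poly to_ac q0) c = 0" by (rule alg_closure_algebraic)
  have "D (Polynomial.degree q0)" unfolding D_def using q0 by (intro exI[of _ 0] exI[of _ q0]) simp
  then have "D (LEAST n. D n)" by (rule LeastI)
  then obtain N and q :: "'k poly" where q: "q \<noteq> 0" "Polynomial.degree q = (LEAST n. D n)" "poly (map_poly to_ac q) (c ^ (p ^ N)) = 0"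
    unfolding D_def by blast
  have min: "Polynomial.degree q \<le> Polynomial.degree r" if "r \<noteq> 0" "poly (map_poly to_ac r) (c ^ (p ^ M)) = 0" for r :: "'k poly" and M
  proof -
    have "D (Polynomial.degree r)" unfolding D_def using that by blast
    then show ?thesis unfolding q(2) by (rule Least_le)
  qed
  define y where "y = c ^ (p ^ N)"
  have eval: "poly (map_poly to_ac r) x = (\<Sum>i\<le>Polynomial.degree r. to_ac (Polynomial.coeff r i) * x ^ i)" for r :: "'k poly" and x
    by (simp add: poly_altdef degree_map_poly coeff_map_poly)
  have hom: "poly (map_poly to_ac (a * b)) x = poly (map_poly to_ac a) x * poly (map_poly to_ac b) x" for a b :: "'k poly" and x
  proof -
    have "map_poly to_ac (a * b) = map_poly to_ac a * map_poly to_ac b"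
      by (rule poly_eqI) (simp add: coeff_map_poly coeff_mult to_ac_sum)
    then show ?thesis by simp
  qed
  have irr: "Factorial_Ring.irreducible q"
  proof (rule irreducibleI)
    show "\<not> q dvd 1"
    proof
      assume "q dvd 1"
      then have "Polynomial.degree q = 0" using q(1) by (simp add: is_unit_iff_degree)
      then obtain a where a: "q = [:a:]" by (rule degree_eq_zeroE)
      then show False using q by (simp add: map_poly_pCons)
    qed
    fix a b assume ab: "q = a * b"
    have nz: "a \<noteq> 0" "b \<noteq> 0" using ab q(1) by auto
    have dg: "Polynomial.degree q = Polynomial.degree a + Polynomial.degree b" using ab nz by (simp add: degree_mult_eq)
    have "poly (map_poly to_ac a) y = 0 \<or> poly (map_poly to_ac b) y = 0" using q(3) hom[of a b] ab unfolding y_def by simp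
    then show "a dvd 1 \<or> b dvd 1"
    proof
      assume "poly (map_poly to_ac a) y = 0"
      then have "Polynomial.degree q \<le> Polynomial.degree a" unfolding y_def by (rule min[OF nz(1)])
      then show ?thesis using dg nz by (simp add: is_unit_iff_degree)
    next
      assume "poly (map_poly to_ac b) y = 0"
      then have "Polynomial.degree q \<le> Polynomial.degree b" unfolding y_def by (rule min[OF nz(2)])
      then show ?thesis using dg nz by (simp add: is_unit_iff_degree)
    qed
  qed (rule q(1))
  have dpos: "Polynomial.degree q > 0"
  proof (rule ccontr)
    assume "\<not> ?thesis"
    then have "q dvd 1" using q(1) by (simp add: is_unit_iff_degree)
    then show False using irr by (simp add: Factorial_Ring.irreducible_def)
  qed
  have pd: "pderiv q \<noteq> 0"
  proof
    assume z: "pderiv q = 0"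
    have co: "p dvd i" if "Polynomial.coeff q i \<noteq> 0" for i
    proof (cases i)
      case (Suc m)
      have "of_nat (Suc m) * Polynomial.coeff q (Suc m) = Polynomial.coeff (pderiv q) m" by (simp only: coeff_pderiv)
      then have "of_nat i = (0 :: 'k)" using z that Suc by simp
      then show ?thesis using p(1) of_nat_eq_0_iff_char_dvd by blast
    qed simp
    define m where "m = Polynomial.degree q div p"
    have lc: "Polynomial.coeff q (Polynomial.degree q) \<noteq> 0" using q(1) by simp
    then have dm: "Polynomial.degree q = p * m" unfolding m_def using co by simp
    \<comment> \<open>This is the polynomial with \<open>q(X) = r(X^p)\<close>; its degree is that
      of \<open>q\<close> divided by \<open>p\<close>.\<close>
    define r where "r = (\<Sum>k\<le>m. Polynomial.monom (Polynomial.coeff q (p * k)) k)"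
    have cr: "Polynomial.coeff r k = (if k \<le> m then Polynomial.coeff q (p * k) else 0)" for k
      unfolding r_def coeff_sum by (simp add: coeff_monom)
    have "Polynomial.coeff r m \<noteq> 0" using cr lc dm by simp
    then have rnz: "r \<noteq> 0" by auto
    have dr: "Polynomial.degree r \<le> m" by (rule degree_le) (simp add: cr)
    have "poly (map_poly to_ac r) (y ^ p) = (\<Sum>k\<le>m. to_ac (Polynomial.coeff r k) * (y ^ p) ^ k)"
      unfolding eval using dr by (intro sum.mono_neutral_left) (auto simp: coeff_eq_0)
    also have "\<dots> = (\<Sum>k\<le>m. to_ac (Polynomial.coeff q (p * k)) * y ^ (p * k))"
      by (intro sum.cong) (simp_all add: cr power_mult)
    also have "\<dots> = (\<Sum>i\<in>(\<lambda>k. p * k) ` {..m}. to_ac (Polynomial.coeff q i) * y ^ i)"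
      using p(2) by (subst sum.reindex) (auto simp: inj_on_def)
    also have "\<dots> = (\<Sum>i\<le>Polynomial.degree q. to_ac (Polynomial.coeff q i) * y ^ i)"
    proof (rule sum.mono_neutral_left)
      show "(\<lambda>k. p * k) ` {..m} \<subseteq> {..Polynomial.degree q}" unfolding dm by auto
      show "\<forall>i\<in>{..Polynomial.degree q} - (\<lambda>k. p * k) ` {..m}. to_ac (Polynomial.coeff q i) * y ^ i = 0"
      proof
        fix i assume i: "i \<in> {..Polynomial.degree q} - (\<lambda>k. p * k) ` {..m}"
        have "Polynomial.coeff q i = 0"
        proof (rule ccontr)
          assume "Polynomial.coeff q i \<noteq> 0"
          then obtain k where "i = p * k" using co by (auto simp: dvd_def)
          then show False using i p(2) unfolding dm by auto
        qed
        then show "to_ac (Polynomial.coeff q i) * y ^ i = 0" by simp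
      qed
    qed simp
    also have "\<dots> = 0" using q(3) unfolding eval y_def .
    finally have "poly (map_poly to_ac r) (c ^ (p ^ Suc N)) = 0" unfolding y_def by (simp add: power_mult[symmetric] mult.commute)
    from min[OF rnz this] dr have "p * m \<le> m" unfolding dm by (rule le_trans)
    moreover have "p \<noteq> 1" using p(1) by auto
    ultimately show False using p(2) dpos dm by simp
  qed
  have "coprime q (pderiv q)"
  proof (rule coprimeI)
    fix d assume d: "d dvd q" "d dvd pderiv q"
    then obtain e where e: "q = d * e" by (auto simp: dvd_def)
    with irr have "d dvd 1 \<or> e dvd 1" by (rule irreducibleD)
    then show "d dvd 1"
    proof
      assume "e dvd 1"
      then have "q dvd d" using e by (metis dvd_mult_unit_iff' dvd_refl mult.commute)
      then have "q dvd pderiv q" using d(2) by (rule dvd_trans)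
      then have "Polynomial.degree q \<le> Polynomial.degree (pderiv q)" using pd by (rule dvd_imp_degree_le)
      moreover have "Polynomial.degree (pderiv q) \<le> Polynomial.degree q - 1"
        using dpos by (intro degree_le allI impI) (simp add: coeff_pderiv coeff_eq_0)
      ultimately show ?thesis using dpos by linarith
    qed
  qed
  then have "Polynomial.degree q = 1" using sep irr unfolding separably_closed_def separable_irreducible_def by blast
  then have "to_ac (Polynomial.coeff q 0) + to_ac (Polynomial.coeff q 1) * y = 0" and c1: "Polynomial.coeff q 1 \<noteq> 0"
    using q(3) q(1) leading_coeff_neq_0[of q] unfolding eval y_def by auto
  then have "y = to_ac (- Polynomial.coeff q 0 / Polynomial.coeff q 1)"
    by (simp add: field_simps eq_neg_iff_add_eq_0)
  then show ?thesis unfolding y_def by blast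
qed

lemma tensor_eval_superset:
  assumes "finite T" "Poly_Mapping.keys z \<subseteq> T"
  shows "tensor_eval f g z = (\<Sum>x\<in>T. of_int (Poly_Mapping.lookup z x) * (f (fst x) * g (snd x)))"
proof -
  have "tensor_eval f g z = (\<Sum>x\<in>Poly_Mapping.keys z. of_int (Poly_Mapping.lookup z x) * (f (fst x) * g (snd x)))"
    unfolding tensor_eval_def by (intro sum.cong) auto
  also have "\<dots> = (\<Sum>x\<in>T. of_int (Poly_Mapping.lookup z x) * (f (fst x) * g (snd x)))"
    using assms by (intro sum.mono_neutral_left) (auto simp: in_keys_iff)
  finally show ?thesis .
qed

lemma tensor_eval_add: "tensor_eval f g (z + z') = tensor_eval f g z + tensor_eval f g z'"
proof -
  define T where "T = Poly_Mapping.keys z \<union> Poly_Mapping.keys z'"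
  have T: "finite T" "Poly_Mapping.keys z \<subseteq> T" "Poly_Mapping.keys z' \<subseteq> T" "Poly_Mapping.keys (z + z') \<subseteq> T"
    unfolding T_def using Poly_Mapping.keys_add[of z z'] by auto
  show ?thesis
    unfolding tensor_eval_superset[OF T(1,2)] tensor_eval_superset[OF T(1,3)] tensor_eval_superset[OF T(1,4)]
    by (simp add: lookup_add distrib_right sum.distrib)
qed

lemma tensor_eval_0 [simp]: "tensor_eval f g 0 = 0"
  by (simp add: tensor_eval_def)

lemma tensor_eval_frag_of [simp]: "tensor_eval f g (frag_of (a, b)) = f a * g b"
  by (simp add: tensor_eval_def)

lemma tensor_eval_diff: "tensor_eval f g (z - z') = tensor_eval f g z - tensor_eval f g z'"
  using tensor_eval_add[of f g "z - z'" z'] by simp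

lemma tensor_eval_cmul: "tensor_eval f g (frag_cmul n z) = of_int n * tensor_eval f g z"
proof -
  have sub: "Poly_Mapping.keys (frag_cmul n z) \<subseteq> Poly_Mapping.keys z" by (rule keys_cmul)
  show ?thesis
    unfolding tensor_eval_superset[OF finite_keys sub, of f g] tensor_eval_superset[OF finite_keys order_refl, of f g z]
    by (simp add: sum_distrib_left mult_ac)
qed

lemma tensor_eval_lin_span:
  assumes "z \<in> lin_span frag_cmul UNIV R" "\<And>r. r \<in> R \<Longrightarrow> tensor_eval f g r = 0"
  shows "tensor_eval f g z = 0"
  using assms(1) by (induction rule: lin_span.induct) (simp_all add: tensor_eval_add tensor_eval_cmul assms(2))

lemma field_hom_of_nat: "field_hom h \<Longrightarrow> h (of_nat n) = of_nat n"
  by (induction n) (simp_all add: field_homD)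

lemma field_hom_of_int: "field_hom h \<Longrightarrow> h (of_int n) = of_int n"
  by (cases n rule: int_cases2) (simp_all add: field_homD(5) field_hom_of_nat)

lemma subring_of_field_of_int: assumes "subring_of_field A" shows "of_int n \<in> A"
proof -
  note AD = subring_of_fieldD[OF assms]
  have "of_nat m \<in> A" for m by (induction m) (use AD(1,2,4) in auto)
  then show ?thesis using AD(3) by (cases n rule: int_cases2) auto
qed

lemma field_hom_poly: "field_hom h \<Longrightarrow> h (poly q x) = poly (map_poly h q) (h x)"
  by (induction q) (simp_all add: map_poly_pCons field_homD)

lemma field_hom_CHAR:
  fixes h :: "'a::field \<Rightarrow> 'b::field"
  assumes "field_hom h"
  shows "CHAR('b) = CHAR('a)"
proof (rule CHAR_eqI)
  show "of_nat CHAR('a) = (0 :: 'b)" using field_hom_of_nat[OF assms, of "CHAR('a)"] field_homD(1)[OF assms] by simp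
  fix n assume "of_nat n = (0 :: 'b)"
  then have "h (of_nat n) = 0" by (simp add: field_hom_of_nat[OF assms])
  then show "CHAR('a) dvd n" by (simp add: field_homD(9)[OF assms] of_nat_eq_0_iff_char_dvd)
qed

interpretation to_ac: vector_space "\<lambda>(k::'k::field) c. to_ac k * c"
  by unfold_locales (simp_all add: algebra_simps)

text \<open>A basis containing 1, so that the coordinate at 1 restricts to the identity on the
  base.\<close>

definition ac_basis :: "'k::field alg_closure set" where
  "ac_basis = to_ac.extend_basis {1}"

definition ac_coord :: "'k::field alg_closure \<Rightarrow> 'k alg_closure \<Rightarrow> 'k" where
  "ac_coord b c = to_ac.representation ac_basis c b"

lemma ac_basis: "\<not> to_ac.dependent (ac_basis :: 'a::field alg_closure set)" "(c :: 'a alg_closure) \<in> to_ac.span ac_basis" "(1 :: 'a alg_closure) \<in> ac_basis"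
proof -
  have i: "\<not> to_ac.dependent {1 :: 'a alg_closure}" by (simp add: to_ac.dependent_single)
  show "\<not> to_ac.dependent (ac_basis :: 'a alg_closure set)" unfolding ac_basis_def by (rule to_ac.independent_extend_basis[OF i])
  show "c \<in> to_ac.span ac_basis" unfolding ac_basis_def to_ac.span_extend_basis[OF i] by simp
  show "1 \<in> (ac_basis :: 'a alg_closure set)" using to_ac.extend_basis_superset[OF i] unfolding ac_basis_def by simp
qed

lemma ac_coord_add: "ac_coord b (c + c') = ac_coord b c + ac_coord b c'"
  unfolding ac_coord_def by (simp add: to_ac.representation_add ac_basis)

lemma ac_coord_scale: "ac_coord b (to_ac k * c) = k * ac_coord b c"
  unfolding ac_coord_def by (simp add: to_ac.representation_scale ac_basis)

lemma ac_coord_basis: "b' \<in> ac_basis \<Longrightarrow> ac_coord b b' = (if b = b' then 1 else 0)"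
  unfolding ac_coord_def by (simp add: to_ac.representation_basis ac_basis)

lemma ac_coord_finite: "finite {b. ac_coord b c \<noteq> 0}"
  unfolding ac_coord_def by (rule to_ac.finite_representation)

lemma ac_coord_nonzero: "ac_coord b c \<noteq> 0 \<Longrightarrow> b \<in> ac_basis"
  unfolding ac_coord_def by (rule to_ac.representation_ne_zero)

lemma ac_coord_sum:
  assumes "finite T" "{b. ac_coord b c \<noteq> 0} \<subseteq> T"
  shows "c = (\<Sum>b\<in>T. to_ac (ac_coord b c) * b)"
proof -
  have "c = (\<Sum>b | ac_coord b c \<noteq> 0. to_ac (ac_coord b c) * b)"
    unfolding ac_coord_def by (rule to_ac.sum_nonzero_representation_eq[symmetric]) (rule ac_basis)+
  also have "\<dots> = (\<Sum>b\<in>T. to_ac (ac_coord b c) * b)" using assms by (intro sum.mono_neutral_left) auto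
  finally show ?thesis .
qed

locale base_change_affine =
  fixes \<iota> :: "'k::field \<Rightarrow> 'f::field"
    and C :: "('p, 'f) ringed_space"
    and \<kappa> :: "'k alg_closure \<Rightarrow> 'l::field"
    and CK :: "('q, 'l) ringed_space"
    and \<pi> :: "'q \<Rightarrow> 'p"
    and j :: "'f \<Rightarrow> 'l"
    and p :: nat
    and U :: "'p set"
  assumes CHAR_K: "CHAR('k) = p" "p > 0"
    and sep_closed: "separably_closed TYPE('k)"
    and C_scheme: "integral_scheme C" and C_over: "scheme_over \<iota> C"
    and base_change: "is_geometric_base_change \<iota> C \<kappa> CK \<pi> j"
    and CK_scheme: "integral_scheme CK"
    and U: "affine_open C U"
begin

sublocale C: int_scheme C by unfold_locales (rule C_scheme)
sublocale CK: int_scheme CK by unfold_locales (rule CK_scheme)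

abbreviation "S \<equiv> sections C U"
definition "W = {Q \<in> topspace (space CK). \<pi> Q \<in> U}"
abbreviation "T \<equiv> sections CK W"

lemma hom_\<iota>: "field_hom \<iota>" using C_over by (simp add: scheme_over_def)
lemma \<kappa>_over: "scheme_over \<kappa> CK" using base_change by (simp add: is_geometric_base_change_def)
lemma hom_\<kappa>: "field_hom \<kappa>" using \<kappa>_over by (simp add: scheme_over_def)
lemma dominant: "dominant_morphism CK C \<pi> j" using base_change by (simp add: is_geometric_base_change_def)
lemma hom_j: "field_hom j" using dominant by (simp add: dominant_morphism_def)

lemmas \<iota>D = field_homD[OF hom_\<iota>] and \<kappa>D = field_homD[OF hom_\<kappa>] and jD = field_homD[OF hom_j]

lemma base_change_U: "affine_open CK W" "is_tensor_product \<iota> to_ac j \<kappa> S UNIV T"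
  using base_change[unfolded is_geometric_base_change_def, THEN conjunct2, THEN conjunct2, rule_format, OF U]
  unfolding W_def by (rule conjunct1, rule conjunct2)

lemma j_\<iota>: "j (\<iota> c) = \<kappa> (to_ac c)"
  using base_change_U(2)[unfolded is_tensor_product_def, THEN conjunct1] by (rule spec)

lemma tensor_image: "tensor_eval j \<kappa> ` {z. Poly_Mapping.keys z \<subseteq> S \<times> UNIV} = T"
  by (rule base_change_U(2)[unfolded is_tensor_product_def, THEN conjunct2, THEN conjunct1])

lemma tensor_kernel:
  "Poly_Mapping.keys z \<subseteq> S \<times> UNIV \<Longrightarrow> tensor_eval j \<kappa> z = 0 \<Longrightarrow> z \<in> lin_span frag_cmul UNIV (tensor_relations \<iota> to_ac S UNIV)"
  by (rule base_change_U(2)[unfolded is_tensor_product_def, THEN conjunct2, THEN conjunct2, rule_format]) (rule conjI)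

lemma S_subring: "subring_of_field S" by (rule C.affine_openD(3)[OF U])
lemma T_subring: "subring_of_field T" by (rule CK.affine_openD(3)[OF base_change_U(1)])
lemmas SD = subring_of_fieldD[OF S_subring] and TD = subring_of_fieldD[OF T_subring]

lemma \<iota>_S: "\<iota> k \<in> S"
proof -
  have "range \<iota> \<subseteq> sections C (topspace (space C))" using C_over by (simp add: scheme_over_def)
  also have "\<dots> \<subseteq> S" using C.affine_openD(1,2)[OF U] by (intro C.sections_mono) (auto dest: openin_subset)
  finally show ?thesis by blast
qed

lemma CHAR_l: "CHAR('l) = p" and prime_p: "prime p"
proof -
  show "CHAR('l) = p" using field_hom_CHAR[OF hom_\<kappa>] CHAR_K(1) by simp
  show "prime p" using prime_CHAR_semidom[where ?'a = 'k] CHAR_K by simp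
qed

lemma frobenius_add: "(x + y :: 'l) ^ (p ^ n) = x ^ (p ^ n) + y ^ (p ^ n)"
  by (rule freshmans_dream') (simp_all add: CHAR_l prime_p)

text \<open>A list stands for a sum of pure tensors in the tensor product of the function field with
  the algebraic closure. \<open>ev\<close> is the multiplication map into the function field of the
  base change, and \<open>coord\<close> below is id \<otimes> \<phi>.\<close>

definition ev :: "('f \<times> 'k alg_closure) list \<Rightarrow> 'l" where
  "ev xs = (\<Sum>(a, c)\<leftarrow>xs. j a * \<kappa> c)"

definition coord :: "('k alg_closure \<Rightarrow> 'k) \<Rightarrow> ('f \<times> 'k alg_closure) list \<Rightarrow> 'f" where
  "coord \<phi> xs = (\<Sum>(a, c)\<leftarrow>xs. a * \<iota> (\<phi> c))"

lemma ev_simps [simp]: "ev [] = 0" "ev ((a, c) # xs) = j a * \<kappa> c + ev xs" "ev (xs @ ys) = ev xs + ev ys"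
  by (simp_all add: ev_def)

lemma coord_simps [simp]: "coord \<phi> [] = 0" "coord \<phi> ((a, c) # xs) = a * \<iota> (\<phi> c) + coord \<phi> xs"
  "coord \<phi> (xs @ ys) = coord \<phi> xs + coord \<phi> ys"
  by (simp_all add: coord_def)

abbreviation scale :: "'f \<Rightarrow> ('f \<times> 'k alg_closure) list \<Rightarrow> ('f \<times> 'k alg_closure) list" where
  "scale s xs \<equiv> map (\<lambda>(a, c). (s * a, c)) xs"

lemma ev_scale: "ev (scale s xs) = j s * ev xs"
  by (induction xs) (auto simp: jD algebra_simps)

lemma coord_scale: "coord \<phi> (scale s xs) = s * coord \<phi> xs"
  by (induction xs) (auto simp: algebra_simps)

lemma ev_T: "fst ` set xs \<subseteq> S \<Longrightarrow> ev xs \<in> T"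
proof (induction xs)
  case (Cons x xs)
  obtain a c where x: "x = (a, c)" by (cases x)
  have "tensor_eval j \<kappa> (frag_of (a, c)) \<in> tensor_eval j \<kappa> ` {z. Poly_Mapping.keys z \<subseteq> S \<times> UNIV}"
    using Cons.prems x by (intro imageI) simp
  then have "j a * \<kappa> c \<in> T" unfolding tensor_image by simp
  then show ?case using Cons x TD(4) by simp
qed (simp add: TD(1))

lemma T_ev: assumes "y \<in> T" obtains xs where "fst ` set xs \<subseteq> S" "y = ev xs"
proof -
  have "y \<in> tensor_eval j \<kappa> ` {z. Poly_Mapping.keys z \<subseteq> S \<times> UNIV}" unfolding tensor_image by (rule assms)
  then have "\<exists>z. Poly_Mapping.keys z \<subseteq> S \<times> UNIV \<and> y = tensor_eval j \<kappa> z"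
    by (simp only: image_iff Bex_def mem_Collect_eq)
  then obtain z where z: "Poly_Mapping.keys z \<subseteq> S \<times> UNIV" "y = tensor_eval j \<kappa> z" by (elim exE conjE)
  obtain ks where ks: "set ks = Poly_Mapping.keys z \<and> distinct ks" using finite_distinct_list[OF finite_keys[of z]] by (elim exE)
  define xs where "xs = map (\<lambda>x. (of_int (Poly_Mapping.lookup z x) * fst x, snd x)) ks"
  have "fst ` set xs \<subseteq> S"
  proof
    fix a assume "a \<in> fst ` set xs"
    then obtain x where x: "x \<in> set ks" "a = of_int (Poly_Mapping.lookup z x) * fst x" unfolding xs_def by auto
    then have "fst x \<in> S" using z(1) ks(1) by auto
    then show "a \<in> S" using x(2) SD(6)[OF subring_of_field_of_int[OF S_subring]] by simp
  qed
  moreover have "ev xs = (\<Sum>x\<leftarrow>ks. of_int (Poly_Mapping.lookup z x) * (j (fst x) * \<kappa> (snd x)))"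
    unfolding ev_def xs_def by (simp add: o_def jD(4) field_hom_of_int[OF hom_j] mult.assoc)
  then have "ev xs = y"
    unfolding z(2) tensor_eval_superset[OF finite_keys order_refl] using ks by (simp add: sum_list_distinct_conv_sum_set)
  ultimately show ?thesis using that by blast
qed

text \<open>Stated for a general multiplicative set, because it serves twice: for all nonzero
  sections, and for the sections that do not vanish at the point.\<close>

lemma common_multiplier:
  assumes M: "1 \<in> M" "M \<subseteq> S" "\<And>s t. s \<in> M \<Longrightarrow> t \<in> M \<Longrightarrow> s * t \<in> M"
    and "\<And>a. a \<in> fst ` set xs \<Longrightarrow> \<exists>s\<in>M. s * a \<in> S"
  shows "\<exists>s\<in>M. fst ` set (scale s xs) \<subseteq> S"
  using assms(4)
proof (induction xs)
  case (Cons x xs)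
  obtain a c where x: "x = (a, c)" by (cases x)
  have "\<exists>s\<in>M. fst ` set (scale s xs) \<subseteq> S" by (rule Cons.IH) (use Cons.prems in simp)
  then obtain s where s: "s \<in> M" "fst ` set (scale s xs) \<subseteq> S" by blast
  have "\<exists>t\<in>M. t * a \<in> S" by (rule Cons.prems) (simp add: x)
  then obtain t where t: "t \<in> M" "t * a \<in> S" by blast
  have sS: "s \<in> S" "t \<in> S" using s t M(2) by auto
  have "b \<in> S" if "b \<in> fst ` set (scale (t * s) (x # xs))" for b
  proof -
    from that have "b \<in> (\<lambda>v. fst (case v of (a, c) \<Rightarrow> (t * s * a, c))) ` set (x # xs)" by (simp only: set_map image_image)
    then obtain v where v: "b = fst (case v of (a, c) \<Rightarrow> (t * s * a, c))" "v \<in> set (x # xs)" by (rule imageE)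
    obtain a' c' where ac: "v = (a', c')" by (cases v)
    have b: "(a', c') \<in> set (x # xs)" "b = t * s * a'" using v by (simp_all add: ac)
    show ?thesis
    proof (cases "(a', c') = x")
      case True
      then have "b = s * (t * a)" using b(2) x by simp
      then show ?thesis using SD(6)[OF sS(1) t(2)] by simp
    next
      case False
      then have "(a', c') \<in> set xs" using b(1) by simp
      then have "s * a' \<in> fst ` set (scale s xs)" by force
      then have "t * (s * a') \<in> S" using s(2) SD(6)[OF sS(2)] by blast
      then show ?thesis using b(2) by (simp add: mult_ac)
    qed
  qed
  then show ?case using M(3)[OF t(1) s(1)] by blast
qed (use M(1) in auto)

text \<open>Linear disjointness: a \<open>K\<close>-linear functional on the algebraic closure extends to the tensor product.\<close>

lemma coord_eq_0:
  assumes \<phi>: "\<And>c c'. \<phi> (c + c') = \<phi> c + \<phi> c'" "\<And>k c. \<phi> (to_ac k * c) = k * \<phi> c"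
    and xs: "ev xs = 0"
  shows "coord \<phi> xs = 0"
proof -
  \<comment> \<open>The kernel of the evaluation is known only for tensors over sections, so
    denominators are cleared beforehand.\<close>
  have "\<exists>s\<in>S - {0}. fst ` set (scale s xs) \<subseteq> S"
  proof (rule common_multiplier)
    show "1 \<in> S - {0}" "S - {0} \<subseteq> S" using SD(2) by auto
    show "\<And>s t. s \<in> S - {0} \<Longrightarrow> t \<in> S - {0} \<Longrightarrow> s * t \<in> S - {0}" using SD(6) by simp
    fix a
    obtain b s where b: "b \<in> S" "s \<in> S" "s \<noteq> 0" "a = b / s" using C.fraction[OF U, of a] by blast
    then show "\<exists>s\<in>S - {0}. s * a \<in> S" by (intro bexI[of _ s]) auto
  qed
  then obtain s where s: "s \<noteq> 0" "fst ` set (scale s xs) \<subseteq> S" by blast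
  define ys where "ys = scale s xs"
  define z where "z = (\<Sum>x\<leftarrow>ys. frag_of x)"
  have tz: "tensor_eval j \<kappa> (\<Sum>x\<leftarrow>zs. frag_of x) = ev zs" for zs
    by (induction zs) (auto simp: tensor_eval_add)
  have tc: "tensor_eval (\<lambda>a. a) (\<lambda>c. \<iota> (\<phi> c)) (\<Sum>x\<leftarrow>zs. frag_of x) = coord \<phi> zs" for zs
    by (induction zs) (auto simp: tensor_eval_add)
  have kz: "Poly_Mapping.keys (\<Sum>x\<leftarrow>zs. frag_of x) \<subseteq> S \<times> UNIV" if "fst ` set zs \<subseteq> S" for zs :: "('f \<times> 'k alg_closure) list"
    using that
  proof (induction zs)
    case (Cons x zs)
    have "Poly_Mapping.keys (\<Sum>x\<leftarrow>x # zs. frag_of x) \<subseteq> Poly_Mapping.keys (frag_of x) \<union> Poly_Mapping.keys (\<Sum>x\<leftarrow>zs. frag_of x)"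
      using Poly_Mapping.keys_add[of "frag_of x" "\<Sum>x\<leftarrow>zs. frag_of x"] by simp
    moreover have "Poly_Mapping.keys (frag_of x) \<subseteq> S \<times> UNIV" using Cons.prems by (cases x) simp
    moreover have "Poly_Mapping.keys (\<Sum>x\<leftarrow>zs. frag_of x) \<subseteq> S \<times> UNIV" using Cons by simp
    ultimately show ?case by blast
  qed simp
  have "tensor_eval j \<kappa> z = 0" unfolding z_def tz unfolding ys_def ev_scale using xs by simp
  then have "z \<in> lin_span frag_cmul UNIV (tensor_relations \<iota> to_ac S UNIV)"
    using kz[OF s(2)] by (intro tensor_kernel) (simp_all only: z_def ys_def)
  \<comment> \<open>Another bilinear evaluation of the same formal sum: it kills the tensor
    relations because \<phi> is linear.\<close>
  then have "tensor_eval (\<lambda>a. a) (\<lambda>c. \<iota> (\<phi> c)) z = 0"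
  proof (rule tensor_eval_lin_span)
    fix r assume "r \<in> tensor_relations \<iota> to_ac S UNIV"
    then show "tensor_eval (\<lambda>a. a) (\<lambda>c. \<iota> (\<phi> c)) r = 0"
      unfolding tensor_relations_def
      by (elim UnE CollectE exE conjE; (simp only: tensor_eval_diff tensor_eval_frag_of \<phi> \<iota>D(3,4)); (simp add: algebra_simps))
  qed
  then have "s * coord \<phi> xs = 0" unfolding z_def tc unfolding ys_def coord_scale .
  then show ?thesis using s(1) by simp
qed

text \<open>The algebraic closure is purely inseparable over the separably closed field, and
  Frobenius is additive, so a sum of pure tensors has a p-power in the base.\<close>

lemma T_power: assumes "y \<in> T" shows "\<exists>N. \<exists>a\<in>S. y ^ (p ^ N) = j a"
proof -
  have up: "y ^ (p ^ (N + M)) = j (a ^ (p ^ M))" if "y ^ (p ^ N) = j a" for y N M a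
    using that by (simp add: power_add power_mult jD(7))
  obtain xs where xs: "fst ` set xs \<subseteq> S" "y = ev xs" by (rule T_ev[OF assms])
  have "\<exists>N. \<exists>a\<in>S. ev xs ^ (p ^ N) = j a" using xs(1)
  proof (induction xs)
    case Nil
    then show ?case using SD(1) jD(1) by (intro exI[of _ 0] bexI[of _ 0]) auto
  next
    case (Cons x xs)
    obtain a c where x: "x = (a, c)" by (cases x)
    obtain N b where N: "b \<in> S" "ev xs ^ (p ^ N) = j b" using Cons by auto
    obtain M where "c ^ (p ^ M) \<in> range to_ac" using separably_closed_power_in_base[OF sep_closed CHAR_K] by blast
    then obtain k where k: "c ^ (p ^ M) = to_ac k" by blast
    have aS: "a \<in> S" using Cons.prems x by simp
    have "(j a * \<kappa> c) ^ (p ^ M) = j (a ^ (p ^ M) * \<iota> k)"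
      by (simp add: power_mult_distrib jD(4,7) j_\<iota> k[symmetric] \<kappa>D(7))
    from up[OF this, of N] up[OF N(2), of M]
    have "ev (x # xs) ^ (p ^ (M + N)) = j ((a ^ (p ^ M) * \<iota> k) ^ (p ^ N) + b ^ (p ^ M))"
      unfolding x by (simp add: frobenius_add jD(3) add.commute[of N M])
    moreover have "(a ^ (p ^ M) * \<iota> k) ^ (p ^ N) + b ^ (p ^ M) \<in> S"
      by (intro SD(4) subring_of_field_power[OF S_subring] SD(6) aS N(1) \<iota>_S)
    ultimately show ?case by blast
  qed
  then show ?thesis unfolding xs(2) .
qed

lemma power_p_up: "y ^ (p ^ N) = j a \<Longrightarrow> y ^ (p ^ (N + M)) = j (a ^ (p ^ M))"
  by (simp add: power_add power_mult jD(7))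

text \<open>A denominator has a p-power in the base; multiplying by its power of exponent
  \<open>p ^ N - 1\<close> moves the denominator there. So the function field of the base change is
  the full tensor product.\<close>

lemma ex_ev: "\<exists>xs. y = ev xs"
proof -
  obtain a s where as: "a \<in> T" "s \<in> T" "s \<noteq> 0" "y = a / s" using CK.fraction[OF base_change_U(1), of y] by blast
  obtain N t where t: "t \<in> S" "s ^ (p ^ N) = j t" using T_power[OF as(2)] by blast
  have "t \<noteq> 0" using t(2) as(3) jD(1) by (metis power_not_zero)
  have "a * s ^ (p ^ N - 1) \<in> T" by (intro TD(6) as(1) subring_of_field_power[OF T_subring] as(2))
  then obtain xs where xs: "a * s ^ (p ^ N - 1) = ev xs" by (rule T_ev)
  have "s ^ (p ^ N) = s ^ (p ^ N - 1) * s" using CHAR_K(2) by (simp flip: power_Suc2)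
  then have "y = ev xs / j t" unfolding as(4) xs[symmetric] t(2)[symmetric] using as(3) by (simp add: field_simps)
  then have "y = ev (scale (inverse t) xs)" unfolding ev_scale jD(8) by (simp add: field_simps)
  then show ?thesis by blast
qed

lemma power_in_range_j: "\<exists>N. y ^ (p ^ N) \<in> range j"
proof -
  obtain a s where as: "a \<in> T" "s \<in> T" "s \<noteq> 0" "y = a / s" using CK.fraction[OF base_change_U(1), of y] by blast
  obtain N b where b: "a ^ (p ^ N) = j b" using T_power[OF as(1)] by blast
  obtain M t where t: "s ^ (p ^ M) = j t" using T_power[OF as(2)] by blast
  have "y ^ (p ^ (N + M)) = j (b ^ (p ^ M) / t ^ (p ^ N))"
    unfolding as(4) power_divide power_p_up[OF b] jD(11) using power_p_up[OF t, of N] by (simp add: add.commute)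
  then show ?thesis by blast
qed

text \<open>The representation by a list is far from unique; \<open>coord_eq_0\<close> makes the
  result independent of it.\<close>

definition \<Phi> :: "'k alg_closure \<Rightarrow> 'l \<Rightarrow> 'l" where
  "\<Phi> b y = j (coord (ac_coord b) (SOME xs. y = ev xs))"

lemma \<Phi>_ev: "\<Phi> b (ev xs) = j (coord (ac_coord b) xs)"
proof -
  define ys where "ys = (SOME ys. ev xs = ev ys)"
  have y: "ev xs = ev ys" unfolding ys_def by (rule someI[of _ xs]) simp
  have "ev (xs @ scale (-1) ys) = 0" unfolding ev_simps ev_scale using y by (simp add: jD)
  then have "coord (ac_coord b) (xs @ scale (-1) ys) = 0" by (intro coord_eq_0 ac_coord_add ac_coord_scale)
  then have "coord (ac_coord b) xs = coord (ac_coord b) ys" unfolding coord_simps coord_scale by simp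
  then show ?thesis unfolding \<Phi>_def ys_def[symmetric] by simp
qed

lemma \<Phi>_add: "\<Phi> b (y + y') = \<Phi> b y + \<Phi> b y'"
proof -
  obtain xs ys where "y = ev xs" "y' = ev ys" using ex_ev by blast
  then show ?thesis using \<Phi>_ev[of b "xs @ ys"] by (simp add: \<Phi>_ev jD)
qed

lemma \<Phi>_scale: "\<Phi> b (j a * y) = j a * \<Phi> b y"
proof -
  obtain xs where "y = ev xs" using ex_ev by blast
  then show ?thesis using \<Phi>_ev[of b "scale a xs"] by (simp add: \<Phi>_ev jD ev_scale coord_scale)
qed

lemma \<Phi>_j: "\<Phi> b (j a) = j (a * \<iota> (ac_coord b 1))"
  using \<Phi>_ev[of b "[(a, 1)]"] by (simp add: \<kappa>D)

lemma \<Phi>_\<kappa>: "\<Phi> b (\<kappa> c) = j (\<iota> (ac_coord b c))"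
  using \<Phi>_ev[of b "[(1, c)]"] by (simp add: jD)

lemma \<Phi>_support: "finite {b. \<Phi> b y \<noteq> 0}"
proof -
  obtain xs where y: "y = ev xs" using ex_ev by blast
  have "finite {b. coord (ac_coord b) xs \<noteq> 0}"
  proof (induction xs)
    case (Cons x xs)
    obtain a c where x: "x = (a, c)" by (cases x)
    have "{b. coord (ac_coord b) (x # xs) \<noteq> 0} \<subseteq> {b. ac_coord b c \<noteq> 0} \<union> {b. coord (ac_coord b) xs \<noteq> 0}"
      unfolding x by (auto simp: \<iota>D)
    then show ?case using Cons ac_coord_finite[of c] by (metis finite_UnI finite_subset)
  qed simp
  then show ?thesis unfolding y \<Phi>_ev jD(9) .
qed

lemma \<Phi>_nonzero_basis: "\<Phi> b y \<noteq> 0 \<Longrightarrow> b \<in> ac_basis"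
proof -
  assume nz: "\<Phi> b y \<noteq> 0"
  obtain xs where y: "y = ev xs" using ex_ev by blast
  have "coord (ac_coord b) xs = 0" if "b \<notin> ac_basis"
  proof -
    have z: "ac_coord b c = 0" for c using ac_coord_nonzero that by blast
    show ?thesis by (induction xs) (auto simp: z \<iota>D)
  qed
  then show ?thesis using nz unfolding y \<Phi>_ev jD(9) by blast
qed

lemma \<Phi>_sum: "y = (\<Sum>b | \<Phi> b y \<noteq> 0. \<kappa> b * \<Phi> b y)"
proof -
  obtain xs where y: "y = ev xs" using ex_ev by blast
  have fin: "finite (\<Union>x\<in>set xs. {b. ac_coord b (snd x) \<noteq> 0})" using ac_coord_finite by blast
  define B where "B = (\<Union>x\<in>set xs. {b. ac_coord b (snd x) \<noteq> 0}) \<union> {b. \<Phi> b y \<noteq> 0}"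
  have B: "finite B" unfolding B_def using fin \<Phi>_support by blast
  have "ev zs = (\<Sum>b\<in>B. \<kappa> b * j (coord (ac_coord b) zs))" if "\<And>x. x \<in> set zs \<Longrightarrow> {b. ac_coord b (snd x) \<noteq> 0} \<subseteq> B" for zs
    using that
  proof (induction zs)
    case (Cons x zs)
    obtain a c where x: "x = (a, c)" by (cases x)
    have "c = (\<Sum>b\<in>B. to_ac (ac_coord b c) * b)" by (rule ac_coord_sum[OF B]) (use Cons.prems[of x] x in simp)
    then have "\<kappa> c = \<kappa> (\<Sum>b\<in>B. to_ac (ac_coord b c) * b)" by simp
    also have "\<dots> = (\<Sum>b\<in>B. \<kappa> b * j (\<iota> (ac_coord b c)))"
      by (induction B rule: infinite_finite_induct) (simp_all add: \<kappa>D j_\<iota> mult.commute)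
    finally have "j a * \<kappa> c = (\<Sum>b\<in>B. \<kappa> b * j (a * \<iota> (ac_coord b c)))"
      by (simp add: sum_distrib_left jD mult_ac)
    moreover have "ev zs = (\<Sum>b\<in>B. \<kappa> b * j (coord (ac_coord b) zs))" by (rule Cons.IH) (use Cons.prems in simp)
    ultimately show ?case unfolding x by (simp add: jD(3) distrib_left sum.distrib)
  qed (simp add: jD)
  from this[of xs] have "y = (\<Sum>b\<in>B. \<kappa> b * \<Phi> b y)" unfolding y \<Phi>_ev unfolding B_def by blast
  also have "\<dots> = (\<Sum>b | \<Phi> b y \<noteq> 0. \<kappa> b * \<Phi> b y)" using B unfolding B_def by (intro sum.mono_neutral_right) auto
  finally show ?thesis .
qed

end

lemma prime_ideal_power:
  assumes A: "subring_of_field A" and pp: "primeideal \<pp> (as_ring A)" and x: "x \<in> A" "x ^ n \<in> \<pp>"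
  shows "x \<in> \<pp>"
  using x(2)
proof (induction n)
  case 0
  then show ?case using pp[unfolded primeideal_as_ring_iff[OF A]] by simp
next
  case (Suc n)
  have "x \<in> \<pp> \<or> x ^ n \<in> \<pp>"
    using Suc.prems pp[unfolded primeideal_as_ring_iff[OF A]] x(1) subring_of_field_power[OF A x(1), of n] by simp
  then show ?case using Suc.IH by blast
qed

lemma maximal_ideal_as_ring:
  assumes A: "subring_of_field A" and M: "ideal M (as_ring A)" "1 \<notin> M"
    and max: "\<And>s. s \<in> A \<Longrightarrow> s \<notin> M \<Longrightarrow> \<exists>t\<in>A. \<exists>m\<in>M. 1 = m + t * s"
  shows "maximalideal M (as_ring A)"
proof (rule maximalidealI[OF M(1)])
  show "carrier (as_ring A) \<noteq> M" using M(2) subring_of_fieldD(2)[OF A] by auto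
  fix J assume J: "ideal J (as_ring A)" "M \<subseteq> J" "J \<subseteq> carrier (as_ring A)"
  note JD = J(1)[unfolded ideal_as_ring_iff[OF A]]
  show "J = M \<or> J = carrier (as_ring A)"
  proof (cases "J \<subseteq> M")
    case False
    then obtain s where s: "s \<in> J" "s \<notin> M" by blast
    then have "s \<in> A" using JD by blast
    then obtain t m where t: "t \<in> A" "m \<in> M" "1 = m + t * s" using max s(2) by blast
    have "t * s \<in> J" "m \<in> J" using JD t s J(2) by auto
    then have "m + t * s \<in> J" using JD by blast
    then have "1 \<in> J" using t(3) by simp
    then have "a * 1 \<in> J" if "a \<in> A" for a using JD that by blast
    then show ?thesis using J(3) by auto
  qed (use J(2) in blast)
qed

text \<open>The residue field is generated as a ring over the image of the base field by finitely
  many elements, so it is of finite dimension by \<open>generated_field_finite_dimension\<close>,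
  hence algebraic.\<close>

lemma residue_field_algebraic:
  fixes \<iota> :: "'k::field \<Rightarrow> 'f::field"
  assumes hom: "field_hom \<iota>" and A: "subring_of_field A" and G: "finite G"
    and gen: "A = generate_ring ring_of_type_algebra (range \<iota> \<union> G)"
    and M: "maximalideal M (as_ring A)" and g: "g \<in> A"
  shows "\<exists>q::'k poly. q \<noteq> 0 \<and> poly (map_poly \<iota> q) g \<in> M"
proof -
  define E where "E = as_ring A Quot M"
  define h where "h = (\<lambda>a. M +>\<^bsub>as_ring A\<^esub> a)"
  interpret A: cring "as_ring A" by (rule cring_as_ring[OF A])
  interpret M: maximalideal M "as_ring A" by (rule M)
  interpret E: Ring.field E unfolding E_def by (rule M.quotient_is_field[OF A.cring_axioms])
  have hh: "h \<in> ring_hom (as_ring A) E" unfolding h_def E_def by (rule M.rcos_ring_hom)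
  note AD = subring_of_fieldD[OF A] and iD = field_homD[OF hom]
  have hc: "h a \<in> carrier E" if "a \<in> A" for a using ring_hom_closed[OF hh] that by simp
  have hadd: "h (a + b) = h a \<oplus>\<^bsub>E\<^esub> h b" if "a \<in> A" "b \<in> A" for a b using ring_hom_add[OF hh, of a b] that by simp
  have hmult: "h (a * b) = h a \<otimes>\<^bsub>E\<^esub> h b" if "a \<in> A" "b \<in> A" for a b using ring_hom_mult[OF hh, of a b] that by simp
  have hone: "h 1 = \<one>\<^bsub>E\<^esub>" using ring_hom_one[OF hh] by simp
  have hzero: "h 0 = \<zero>\<^bsub>E\<^esub>" using ring_hom_zero[OF hh A.ring_axioms E.ring_axioms] by simp
  have hminus: "h (- a) = \<ominus>\<^bsub>E\<^esub> h a" if "a \<in> A" for a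
  proof -
    have "h (- a) \<oplus>\<^bsub>E\<^esub> h a = \<zero>\<^bsub>E\<^esub>" using hadd[OF AD(3)[OF that] that] hzero by simp
    then show ?thesis using E.minus_equality[OF _ hc[OF that] hc[OF AD(3)[OF that]]] by simp
  qed
  have hker: "a \<in> M" if "a \<in> A" "h a = \<zero>\<^bsub>E\<^esub>" for a
  proof -
    have "\<zero>\<^bsub>E\<^esub> = M" unfolding E_def FactRing_def by simp
    then show ?thesis using M.rcos_const_imp_mem that unfolding h_def by simp
  qed
  have hsurj: "carrier E = h ` A" unfolding E_def h_def FactRing_def A_RCOSETS_def' by auto
  have iA: "\<iota> k \<in> A" for k unfolding gen by (rule generate_ring.incl) blast
  define K where "K = h ` range \<iota>"
  have sub: "subring K E"
  proof (rule E.subringI)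
    show "K \<subseteq> carrier E" unfolding K_def using hc iA by blast
    show "\<one>\<^bsub>E\<^esub> \<in> K" unfolding K_def using hone iD(2) by (metis rangeI image_eqI)
    fix x assume "x \<in> K"
    then obtain k where k: "x = h (\<iota> k)" unfolding K_def by blast
    have "\<ominus>\<^bsub>E\<^esub> x = h (\<iota> (- k))" unfolding k iD(5) by (rule hminus[OF iA, symmetric])
    then show "\<ominus>\<^bsub>E\<^esub> x \<in> K" unfolding K_def by blast
    fix y assume "y \<in> K"
    then obtain l where l: "y = h (\<iota> l)" unfolding K_def by blast
    have "x \<otimes>\<^bsub>E\<^esub> y = h (\<iota> (k * l))" unfolding k l iD(4) by (rule hmult[OF iA iA, symmetric])
    then show "x \<otimes>\<^bsub>E\<^esub> y \<in> K" unfolding K_def by blast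
    have "x \<oplus>\<^bsub>E\<^esub> y = h (\<iota> (k + l))" unfolding k l iD(3) by (rule hadd[OF iA iA, symmetric])
    then show "x \<oplus>\<^bsub>E\<^esub> y \<in> K" unfolding K_def by blast
  qed
  have subf: "subfield K E"
  proof (rule E.subfieldI'[OF sub])
    fix x assume "x \<in> K - {\<zero>\<^bsub>E\<^esub>}"
    then have "x \<in> K" and x: "x \<noteq> \<zero>\<^bsub>E\<^esub>" by simp_all
    then obtain k where k: "x = h (\<iota> k)" unfolding K_def by blast
    have "k \<noteq> 0"
    proof
      assume "k = 0"
      then have "x = \<zero>\<^bsub>E\<^esub>" unfolding k by (simp only: iD(1) hzero)
      then show False using x by contradiction
    qed
    then have "\<iota> k * \<iota> (inverse k) = 1" using iD(4)[of k "inverse k"] iD(2) by simp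
    then have "x \<otimes>\<^bsub>E\<^esub> h (\<iota> (inverse k)) = \<one>\<^bsub>E\<^esub>" unfolding k hmult[OF iA iA, symmetric] using hone by simp
    then have "inv\<^bsub>E\<^esub> x = h (\<iota> (inverse k))" unfolding k by (intro E.comm_inv_char hc iA)
    then show "inv\<^bsub>E\<^esub> x \<in> K" unfolding K_def by blast
  qed
  obtain gs where gs: "set gs = G" using finite_list[OF G] by blast
  have GA: "G \<subseteq> A" unfolding gen using generate_ring.incl[of _ "range \<iota> \<union> G" ring_of_type_algebra] by blast
  have xs: "set (map h gs) \<subseteq> carrier E" using gs GA hc by auto
  define H where "H = E.finite_extension K (map h gs)"
  have Hs: "subring H E" unfolding H_def by (rule E.finite_extension_is_subring[OF sub xs])
  note HE = subringE[OF Hs]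
  have KH: "K \<subseteq> H" unfolding H_def by (rule E.finite_extension_incl[OF subringE(1)[OF sub] xs])
  have gH: "h a \<in> H" if "a \<in> G" for a using E.finite_extension_mem[OF sub xs] that gs unfolding H_def by auto
  have "a \<in> A \<and> h a \<in> H" if "a \<in> generate_ring ring_of_type_algebra (range \<iota> \<union> G)" for a
    using that
  proof (induction rule: generate_ring.induct)
    case one
    then show ?case using AD(2) hone HE(3) by simp
  next
    case (incl a)
    then show ?case using gH GA KH iA unfolding K_def by blast
  next
    case (a_inv a)
    then show ?case using AD(3) hminus HE(5) by simp
  next
    case (eng_add a b)
    then show ?case using AD(4) hadd HE(7) by simp
  next
    case (eng_mult a b)
    then show ?case using AD(6) hmult HE(6) by simp
  qed
  then have "carrier E \<subseteq> H" unfolding hsurj using gen by blast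
  then have "E.finite_extension K (map h gs) = carrier E" using HE(1) unfolding H_def by blast
  then have "E.finite_dimension K (carrier E)" by (rule E.generated_field_finite_dimension[OF subf xs])
  then have alg: "(E.algebraic over K) (h g)"
    by (rule E.finite_dimension_imp_algebraic[OF subf E.carrier_is_subring]) (rule hc[OF g])
  obtain ps where ps: "ps \<in> carrier (K[X]\<^bsub>E\<^esub>)" "ps \<noteq> []" "E.eval ps (h g) = \<zero>\<^bsub>E\<^esub>"
    by (rule E.algebraicE[OF sub hc[OF g] alg])
  have pol: "set ps \<subseteq> K" "hd ps \<noteq> \<zero>\<^bsub>E\<^esub>" using ps(1,2) unfolding univ_poly_carrier[symmetric] polynomial_def by auto
  have "\<exists>ks. ps = map (\<lambda>k. h (\<iota> k)) ks" using pol(1)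
  proof (induction ps)
    case (Cons a ps)
    then obtain k ks where "a = h (\<iota> k)" "ps = map (\<lambda>k. h (\<iota> k)) ks" unfolding K_def by auto
    then show ?case by (intro exI[of _ "k # ks"]) simp
  qed simp
  then obtain ks where ks: "ps = map (\<lambda>k. h (\<iota> k)) ks" by blast
  have gn: "g ^ n \<in> A" for n by (rule subring_of_field_power[OF A g])
  have pow: "h g [^]\<^bsub>E\<^esub> n = h (g ^ n)" for n :: nat
    by (induction n) (simp_all add: hone hmult[OF gn g, symmetric] mult.commute)
  \<comment> \<open>Translation from coefficient lists, leading coefficient first, to polynomials;
    the clause on \<open>hd ks\<close> is kept to conclude that the polynomial is nonzero.\<close>
  have "\<exists>q::'k poly. poly (map_poly \<iota> q) g \<in> A \<and> E.eval (map (\<lambda>k. h (\<iota> k)) ks) (h g) = h (poly (map_poly \<iota> q) g) \<and>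
    (\<forall>i\<ge>length ks. Polynomial.coeff q i = 0) \<and> (ks \<noteq> [] \<longrightarrow> Polynomial.coeff q (length ks - 1) = hd ks)" for ks
  proof (induction ks)
    case Nil
    then show ?case using AD(1) hzero by (intro exI[of _ 0]) simp
  next
    case (Cons k ks)
    then obtain q where q: "poly (map_poly \<iota> q) g \<in> A" "E.eval (map (\<lambda>k. h (\<iota> k)) ks) (h g) = h (poly (map_poly \<iota> q) g)"
      "\<forall>i\<ge>length ks. Polynomial.coeff q i = 0" by blast
    define r where "r = Polynomial.monom k (length ks) + q"
    have "map_poly \<iota> r = Polynomial.monom (\<iota> k) (length ks) + map_poly \<iota> q"
      unfolding r_def by (rule poly_eqI) (simp add: coeff_map_poly iD)
    then have ev: "poly (map_poly \<iota> r) g = \<iota> k * g ^ length ks + poly (map_poly \<iota> q) g" by (simp add: poly_monom)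
    have m: "\<iota> k * g ^ length ks \<in> A" by (rule AD(6)[OF iA gn])
    have "E.eval (map (\<lambda>k. h (\<iota> k)) (k # ks)) (h g) = h (poly (map_poly \<iota> r) g)"
      unfolding ev hadd[OF m q(1)] hmult[OF iA gn] by (simp add: q(2) pow)
    moreover have "poly (map_poly \<iota> r) g \<in> A" unfolding ev by (rule AD(4)[OF m q(1)])
    ultimately show ?case using q(3) by (intro exI[of _ r]) (simp add: r_def coeff_monom)
  qed
  from this[of ks, folded ks] obtain q :: "'k poly" where q: "poly (map_poly \<iota> q) g \<in> A" "E.eval ps (h g) = h (poly (map_poly \<iota> q) g)"
    "ks \<noteq> [] \<longrightarrow> Polynomial.coeff q (length ks - 1) = hd ks" by (elim exE conjE)
  have kn: "ks \<noteq> []" using ps(2) unfolding ks by simp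
  have "hd ks \<noteq> 0"
  proof
    assume "hd ks = 0"
    then have "hd ps = \<zero>\<^bsub>E\<^esub>" by (simp add: ks list.map_sel(1)[OF kn] iD(1) hzero)
    then show False using pol(2) by contradiction
  qed
  then have "q \<noteq> 0" using q(3) kn by auto
  moreover have "poly (map_poly \<iota> q) g \<in> M" using hker[OF q(1)] q(2) ps(3) by simp
  ultimately show ?thesis by blast
qed

section \<open>The unique point of the base change over a given point\<close>

context base_change_affine
begin

lemma j_stalk:
  assumes Q: "Q \<in> topspace (space CK)" and x: "x \<in> stalk C (\<pi> Q)"
  shows "j x \<in> stalk CK Q"
proof -
  obtain V where V: "openin (space C) V" "\<pi> Q \<in> V" "x \<in> sections C V" using x unfolding stalk_def by blast
  have "continuous_map (space CK) (space C) \<pi>" using dominant by (simp add: dominant_morphism_def)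
  then have o: "openin (space CK) {Q \<in> topspace (space CK). \<pi> Q \<in> V}" using V(1) by (rule openin_continuous_map_preimage)
  have "j ` sections C V \<subseteq> sections CK {Q \<in> topspace (space CK). \<pi> Q \<in> V}"
    using dominant[unfolded dominant_morphism_def, THEN conjunct2, THEN conjunct2, THEN conjunct1, rule_format, of V] V(1,2) by auto
  then have "j x \<in> sections CK {Q \<in> topspace (space CK). \<pi> Q \<in> V}" using V(3) by (rule subsetD[OF _ imageI])
  then show ?thesis using CK.sections_stalk[OF o, of Q] V(2) Q by auto
qed

lemma j_nonunits: "Q \<in> topspace (space CK) \<Longrightarrow> x \<in> nonunits (stalk C (\<pi> Q)) \<Longrightarrow> j x \<in> nonunits (stalk CK Q)"
  using dominant[unfolded dominant_morphism_def, THEN conjunct2, THEN conjunct2, THEN conjunct2] by blast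

lemma j_T: assumes "a \<in> S" shows "j a \<in> T"
  using ev_T[of "[(a, 1)]"] assms by (simp add: \<kappa>D)

text \<open>A p-power of \<open>s\<close> comes from the base, and embedding a section does not
  change whether it vanishes: units of the stalk go to units and nonunits to nonunits.\<close>

lemma nonunit_iff_power:
  assumes Q: "Q \<in> W" and s: "s \<in> T"
  shows "s \<in> nonunits (stalk CK Q) \<longleftrightarrow> (\<exists>N. s ^ (p ^ N) \<in> j ` C.pt U (\<pi> Q))"
proof
  have Q': "Q \<in> topspace (space CK)" "\<pi> Q \<in> U" using Q unfolding W_def by auto
  note pr = CK.pt_prime[OF base_change_U(1) Q]
  { assume n: "s \<in> nonunits (stalk CK Q)"
    obtain N a where a: "a \<in> S" "s ^ (p ^ N) = j a" using T_power[OF s] by blast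
    have "s ^ (p ^ N - 1) * s \<in> CK.pt W Q"
      using pr[unfolded primeideal_as_ring_iff[OF T_subring]] n s subring_of_field_power[OF T_subring s] by blast
    moreover have "s ^ (p ^ N - 1) * s = s ^ (p ^ N)" using CHAR_K(2) by (simp flip: power_Suc2)
    ultimately have ja: "j a \<in> nonunits (stalk CK Q)" using a(2) by simp
    have "a \<in> C.pt U (\<pi> Q)"
    proof (rule ccontr)
      assume "a \<notin> C.pt U (\<pi> Q)"
      then have "a \<noteq> 0" "inverse a \<in> stalk C (\<pi> Q)" using C.stalk_unit_iff[OF U Q'(2) a(1)] by blast+
      then have "j a \<noteq> 0" "inverse (j a) \<in> stalk CK Q" using j_stalk[OF Q'(1)] jD(8,9) by metis+
      then show False using ja nonunits_iff[OF CK.stalk_subring[OF Q'(1)]] by blast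
    qed
    then show "\<exists>N. s ^ (p ^ N) \<in> j ` C.pt U (\<pi> Q)" using a(2) by blast }
  { assume "\<exists>N. s ^ (p ^ N) \<in> j ` C.pt U (\<pi> Q)"
    then obtain N a where a: "a \<in> C.pt U (\<pi> Q)" "s ^ (p ^ N) = j a" by blast
    have "s ^ (p ^ N) \<in> CK.pt W Q" unfolding a(2) using j_T j_nonunits[OF Q'(1)] a(1) by blast
    then have "s \<in> CK.pt W Q" by (rule prime_ideal_power[OF T_subring pr s])
    then show "s \<in> nonunits (stalk CK Q)" by blast }
qed

text \<open>The prime over that of \<open>P\<close> must consist of the elements with a p-power in
  it, by \<open>nonunit_iff_power\<close>. This set is indeed prime, since Frobenius is additive and
  multiplicative, which gives both existence and uniqueness.\<close>

lemma point_over_exists: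
  assumes P: "P \<in> U"
  shows "\<exists>!Q. Q \<in> topspace (space CK) \<and> \<pi> Q = P"
proof -
  note pr = C.pt_prime[OF U P, unfolded primeideal_as_ring_iff[OF S_subring]]
  define I where "I P = {s \<in> T. \<exists>N. s ^ (p ^ N) \<in> j ` C.pt U P}" for P
  have pt: "CK.pt W Q = I (\<pi> Q)" if "Q \<in> W" for Q unfolding I_def using nonunit_iff_power[OF that] by blast
  have jI: "j a \<in> I P' \<longleftrightarrow> a \<in> C.pt U P'" if a: "a \<in> S" and P': "P' \<in> U" for a P'
  proof
    assume "j a \<in> I P'"
    then obtain N b where b: "b \<in> C.pt U P'" "j a ^ (p ^ N) = j b" unfolding I_def by blast
    have "a ^ (p ^ N) = b" using b(2) unfolding jD(7)[symmetric] jD(10) .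
    then show "a \<in> C.pt U P'" using prime_ideal_power[OF S_subring C.pt_prime[OF U P'] a] b(1) by blast
  next
    assume "a \<in> C.pt U P'"
    then show "j a \<in> I P'" unfolding I_def using j_T[OF a] by (auto intro!: exI[of _ 0])
  qed
  have up: "s ^ (p ^ (N + M)) \<in> j ` C.pt U P" if "s ^ (p ^ N) \<in> j ` C.pt U P" for s N M
  proof -
    from that obtain a where a: "a \<in> C.pt U P" "s ^ (p ^ N) = j a" by blast
    have "a ^ (p ^ M - 1) * a \<in> C.pt U P" using pr a(1) subring_of_field_power[OF S_subring, of a] by blast
    moreover have "a ^ (p ^ M - 1) * a = a ^ (p ^ M)" using CHAR_K(2) by (simp flip: power_Suc2)
    ultimately show ?thesis using power_p_up[OF a(2), of M] by auto
  qed
  have "primeideal (I P) (as_ring T)" unfolding primeideal_as_ring_iff[OF T_subring]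
  proof (intro conjI ballI impI)
    show "I P \<subseteq> T" unfolding I_def by blast
    have "0 \<in> C.pt U P" using pr by blast
    then show "0 \<in> I P" using jI[OF SD(1) P] jD(1) by simp
    have "1 \<notin> C.pt U P" using pr by blast
    then show "1 \<notin> I P" using jI[OF SD(2) P] jD(2) by simp
    fix x assume "x \<in> I P"
    then obtain N where x: "x \<in> T" "x ^ (p ^ N) \<in> j ` C.pt U P" unfolding I_def by blast
    show "x + y \<in> I P" if "y \<in> I P" for y
    proof -
      from that obtain M where y: "y \<in> T" "y ^ (p ^ M) \<in> j ` C.pt U P" unfolding I_def by blast
      obtain a where a: "a \<in> C.pt U P" "x ^ (p ^ (N + M)) = j a" using up[OF x(2), of M] by blast
      obtain b where b: "b \<in> C.pt U P" "y ^ (p ^ (N + M)) = j b" using up[OF y(2), of N] by (auto simp: add.commute)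
      have "(x + y) ^ (p ^ (N + M)) = j (a + b)" by (simp add: frobenius_add a b jD(3))
      moreover have "a + b \<in> C.pt U P" using pr a(1) b(1) by blast
      ultimately show ?thesis unfolding I_def using TD(4)[OF x(1) y(1)] by blast
    qed
    show "y * x \<in> I P" if y: "y \<in> T" for y
    proof -
      obtain M c where c: "c \<in> S" "y ^ (p ^ M) = j c" using T_power[OF y] by blast
      obtain a where a: "a \<in> C.pt U P" "x ^ (p ^ (N + M)) = j a" using up[OF x(2), of M] by blast
      have "(y * x) ^ (p ^ (N + M)) = j (c ^ (p ^ N) * a)"
        using power_p_up[OF c(2), of N] a(2) by (simp only: power_mult_distrib jD(4) add.commute[of M N])
      moreover have "c ^ (p ^ N) * a \<in> C.pt U P" using pr a(1) subring_of_field_power[OF S_subring c(1)] by blast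
      ultimately show ?thesis unfolding I_def using TD(6)[OF y x(1)] by blast
    qed
  next
    fix x y assume xy: "x \<in> T" "y \<in> T" "x * y \<in> I P"
    obtain N a where a: "a \<in> S" "x ^ (p ^ N) = j a" using T_power[OF xy(1)] by blast
    obtain M b where b: "b \<in> S" "y ^ (p ^ M) = j b" using T_power[OF xy(2)] by blast
    obtain L where L: "(x * y) ^ (p ^ L) \<in> j ` C.pt U P" using xy(3) unfolding I_def by blast
    obtain c where c: "c \<in> C.pt U P" "(x * y) ^ (p ^ (L + (N + M))) = j c" using up[OF L, of "N + M"] by blast
    have e: "x ^ (p ^ (L + (N + M))) = j (a ^ (p ^ (L + M)))" "y ^ (p ^ (L + (N + M))) = j (b ^ (p ^ (L + N)))"
      using power_p_up[OF a(2), of "L + M"] power_p_up[OF b(2), of "L + N"] by (simp_all add: ac_simps)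
    have "j (a ^ (p ^ (L + M)) * b ^ (p ^ (L + N))) = j c" using c(2) unfolding power_mult_distrib e jD(4) .
    then have "a ^ (p ^ (L + M)) * b ^ (p ^ (L + N)) = c" unfolding jD(10) .
    moreover have "a ^ (p ^ (L + M)) \<in> S" "b ^ (p ^ (L + N)) \<in> S" by (rule subring_of_field_power[OF S_subring], fact)+
    ultimately have "a ^ (p ^ (L + M)) \<in> C.pt U P \<or> b ^ (p ^ (L + N)) \<in> C.pt U P" using pr c(1) by blast
    then show "x \<in> I P \<or> y \<in> I P" unfolding I_def using e xy(1,2) by blast
  qed
  then obtain Q where Q: "Q \<in> W" "CK.pt W Q = I P" by (rule CK.pt_surj[OF base_change_U(1)])
  have QU: "Q \<in> topspace (space CK)" "\<pi> Q \<in> U" using Q(1) unfolding W_def by auto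
  have "I (\<pi> Q) = I P" using pt[OF Q(1)] Q(2) by simp
  then have "a \<in> C.pt U (\<pi> Q) \<longleftrightarrow> a \<in> C.pt U P" if "a \<in> S" for a using jI[OF that QU(2)] jI[OF that P] by simp
  then have "C.pt U (\<pi> Q) = C.pt U P" by blast
  then have "\<pi> Q = P" by (rule C.pt_inj[OF U QU(2) P])
  moreover have "Q' = Q" if Q': "Q' \<in> topspace (space CK)" "\<pi> Q' = P" for Q'
  proof (rule CK.pt_inj[OF base_change_U(1) _ Q(1)])
    show W': "Q' \<in> W" unfolding W_def using Q' P by simp
    show "CK.pt W Q' = CK.pt W Q" unfolding pt[OF W'] pt[OF Q(1)] Q'(2) \<open>\<pi> Q = P\<close> ..
  qed
  ultimately show ?thesis using QU(1) by blast
qed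

end

lemma field_hom_sum: "field_hom h \<Longrightarrow> h (\<Sum>i\<in>J. f i) = (\<Sum>i\<in>J. h (f i))"
  by (induction J rule: infinite_finite_induct) (simp_all add: field_homD)

lemma field_hom_map_poly_mult: "field_hom h \<Longrightarrow> map_poly h (a * b) = map_poly h a * map_poly h b"
  by (rule poly_eqI) (simp add: coeff_map_poly coeff_mult field_homD field_hom_sum)

lemma prime_ideal_prod_mset:
  assumes A: "subring_of_field A" and pp: "primeideal \<pp> (as_ring A)"
    and "\<And>x. x \<in># M \<Longrightarrow> f x \<in> A" and "(\<Prod>x\<in>#M. f x) \<in> \<pp>"
  shows "\<exists>x\<in>#M. f x \<in> \<pp>"
  using assms(3,4)
proof (induction M)
  case empty
  then show ?case using pp[unfolded primeideal_as_ring_iff[OF A]] by simp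
next
  case (add x M)
  have "(\<Prod>x\<in>#N. f x) \<in> A" if "\<And>x. x \<in># N \<Longrightarrow> f x \<in> A" for N
    using that by (induction N) (simp_all add: subring_of_fieldD(2,6)[OF A])
  then have "(\<Prod>x\<in>#M. f x) \<in> A" using add.prems(1) by simp
  moreover have "f x \<in> A" using add.prems(1) by simp
  moreover have "f x * (\<Prod>x\<in>#M. f x) \<in> \<pp>" using add.prems(2) by simp
  ultimately have "f x \<in> \<pp> \<or> (\<Prod>x\<in>#M. f x) \<in> \<pp>" using pp[unfolded primeideal_as_ring_iff[OF A]] by blast
  then show ?case
  proof
    assume "(\<Prod>x\<in>#M. f x) \<in> \<pp>"
    then have "\<exists>x\<in>#M. f x \<in> \<pp>" by (intro add.IH) (use add.prems(1) in simp_all)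
    then show ?thesis by auto
  qed auto
qed

locale base_change_point = base_change_affine \<iota> C \<kappa> CK \<pi> j p U
  for \<iota> :: "'k::field \<Rightarrow> 'f::field" and C :: "('p, 'f) ringed_space" and \<kappa> :: "'k alg_closure \<Rightarrow> 'l::field"
    and CK :: "('q, 'l) ringed_space" and \<pi> :: "'q \<Rightarrow> 'p" and j :: "'f \<Rightarrow> 'l" and p :: nat and U :: "'p set" +
  fixes P :: 'p and w :: 'f and G :: "'f set"
  assumes P: "P \<in> U" and closed: "closedin (space C) {P}"
    and G: "finite G" "S = generate_ring ring_of_type_algebra (range \<iota> \<union> G)"
    and w: "w \<in> stalk C P" "w \<noteq> 0" "inverse w \<notin> stalk C P" "nonunits (stalk C P) = (\<lambda>a. w * a) ` stalk C P"
    and dvr: "x \<noteq> 0 \<Longrightarrow> \<exists>u n. u \<in> stalk C P \<and> u \<noteq> 0 \<and> inverse u \<in> stalk C P \<and> (x = w ^ n * u \<or> x * w ^ n = u)"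
begin

abbreviation "B \<equiv> stalk C P"
definition "Q = point_over CK \<pi> P"

lemma B_subring: "subring_of_field B" by (rule C.stalk_subring[OF C.point_in_topspace[OF U P]])
lemmas BD = subring_of_fieldD[OF B_subring]

lemma S_B: "S \<subseteq> B" by (rule C.sections_stalk[OF C.affine_openD(1)[OF U] P])

lemma \<iota>_B: "\<iota> k \<in> B" using \<iota>_S S_B by blast

lemma Q: "Q \<in> topspace (space CK)" "\<pi> Q = P" "Q \<in> W"
proof -
  have "Q \<in> topspace (space CK) \<and> \<pi> Q = P" unfolding Q_def point_over_def by (rule theI'[OF point_over_exists[OF P]])
  then show "Q \<in> topspace (space CK)" "\<pi> Q = P" "Q \<in> W" using P by (auto simp: W_def)
qed

lemma stalk_Q_subring: "subring_of_field (stalk CK Q)" by (rule CK.stalk_subring[OF Q(1)])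

lemma j_stalk_Q: "a \<in> B \<Longrightarrow> j a \<in> stalk CK Q" using j_stalk[OF Q(1)] Q(2) by simp

lemma \<kappa>_stalk_Q: "\<kappa> c \<in> stalk CK Q"
proof -
  have "range \<kappa> \<subseteq> sections CK (topspace (space CK))" using \<kappa>_over by (simp add: scheme_over_def)
  also have "\<dots> \<subseteq> stalk CK Q" by (rule CK.sections_stalk[OF openin_topspace Q(1)])
  finally show ?thesis by blast
qed

lemma coord_B: "fst ` set xs \<subseteq> B \<Longrightarrow> coord \<phi> xs \<in> B"
proof (induction xs)
  case (Cons x xs)
  then show ?case by (cases x) (simp add: BD(4) BD(6) \<iota>_B)
qed (simp add: BD(1))

text \<open>A denominator that does not vanish at \<open>Q\<close> has a p-power from the base that
  does not vanish at \<open>P\<close>; so the stalk is the tensor product of the stalk at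
  \<open>P\<close> with the algebraic closure.\<close>

lemma stalk_Q_ev:
  assumes y: "y \<in> stalk CK Q"
  obtains xs where "fst ` set xs \<subseteq> B" "y = ev xs"
proof -
  from CK.stalkE[OF base_change_U(1) Q(3) y]
  obtain a s where as: "a \<in> T" "s \<in> T" "s \<notin> CK.pt W Q" "y = a / s" by this
  have s0: "s \<noteq> 0" using CK.stalk_unit_iff[OF base_change_U(1) Q(3) as(2)] as(3) by simp
  obtain N t where t: "t \<in> S" "s ^ (p ^ N) = j t" using T_power[OF as(2)] by blast
  have "t \<notin> C.pt U P"
  proof
    assume "t \<in> C.pt U P"
    then have "s \<in> nonunits (stalk CK Q)" unfolding nonunit_iff_power[OF Q(3) as(2)] Q(2) using t(2) by blast
    then show False using as(2,3) by blast
  qed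
  then have ti: "t \<noteq> 0" "inverse t \<in> B" using C.stalk_unit_iff[OF U P t(1)] by simp_all
  have "a * s ^ (p ^ N - 1) \<in> T" by (intro TD(6) as(1) subring_of_field_power[OF T_subring] as(2))
  then obtain xs where xs: "fst ` set xs \<subseteq> S" "a * s ^ (p ^ N - 1) = ev xs" by (rule T_ev)
  have "s ^ (p ^ N) = s ^ (p ^ N - 1) * s" using CHAR_K(2) by (simp flip: power_Suc2)
  then have "y = ev xs / j t" unfolding as(4) xs(2)[symmetric] t(2)[symmetric] using s0 by (simp add: field_simps)
  then have "y = ev (scale (inverse t) xs)" unfolding ev_scale jD(8) by (simp add: field_simps)
  moreover have "fst ` set (scale (inverse t) xs) \<subseteq> B"
  proof
    fix b assume "b \<in> fst ` set (scale (inverse t) xs)"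
    then obtain a c where b: "(a, c) \<in> set xs" "b = inverse t * a" by auto
    then have "a \<in> fst ` set xs" by force
    then have "a \<in> B" using xs(1) S_B by blast
    then show "b \<in> B" unfolding b(2) by (rule BD(6)[OF ti(2)])
  qed
  ultimately show ?thesis using that by blast
qed

lemma stalk_Q_iff: "y \<in> stalk CK Q \<longleftrightarrow> (\<forall>b\<in>ac_basis. \<Phi> b y \<in> j ` B)"
proof
  assume "y \<in> stalk CK Q"
  then obtain xs where xs: "fst ` set xs \<subseteq> B" "y = ev xs" by (rule stalk_Q_ev)
  show "\<forall>b\<in>ac_basis. \<Phi> b y \<in> j ` B" unfolding xs(2) \<Phi>_ev using coord_B[OF xs(1)] by blast
next
  assume *: "\<forall>b\<in>ac_basis. \<Phi> b y \<in> j ` B"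
  have "(\<Sum>b | \<Phi> b y \<noteq> 0. \<kappa> b * \<Phi> b y) \<in> stalk CK Q"
  proof (rule subring_of_field_sum[OF stalk_Q_subring])
    fix b assume "b \<in> {b. \<Phi> b y \<noteq> 0}"
    then have "b \<in> ac_basis" by (intro \<Phi>_nonzero_basis) simp
    with * have "\<Phi> b y \<in> j ` B" by (rule bspec)
    then have "\<Phi> b y \<in> stalk CK Q" by (rule imageE) (simp add: j_stalk_Q)
    then show "\<kappa> b * \<Phi> b y \<in> stalk CK Q" by (rule subring_of_fieldD(6)[OF stalk_Q_subring \<kappa>_stalk_Q])
  qed
  then show "y \<in> stalk CK Q" using \<Phi>_sum[of y] by simp
qed

lemma T_generated: "T \<subseteq> generate_ring ring_of_type_algebra (range \<kappa> \<union> j ` G)" (is "_ \<subseteq> ?R")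
proof
  interpret Ring.field "ring_of_type_algebra :: 'l ring" by (rule field_ring_of_type_algebra)
  have R: "subring_of_field ?R" by (rule generate_ring_is_subring) simp
  note RD = subring_of_fieldD[OF R]
  have \<kappa>R: "\<kappa> c \<in> ?R" for c by (rule generate_ring.incl) blast
  have jR: "j a \<in> ?R" if "a \<in> S" for a
    using that unfolding G(2)
  proof (induction rule: generate_ring.induct)
    case (incl a)
    then show ?case
    proof
      assume "a \<in> range \<iota>"
      then show ?thesis using \<kappa>R j_\<iota> by auto
    qed (intro generate_ring.incl, blast)
  qed (simp_all add: jD RD)
  fix y assume "y \<in> T"
  then obtain xs where xs: "fst ` set xs \<subseteq> S" "y = ev xs" by (rule T_ev)
  have "ev xs \<in> ?R" using xs(1)
  proof (induction xs)
    case (Cons x xs)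
    then show ?case by (cases x) (simp add: RD(4) RD(6) jR \<kappa>R)
  qed (simp add: RD(1))
  then show "y \<in> ?R" using xs(2) by simp
qed

lemma stalk_Q_localization:
  assumes y: "y \<in> stalk CK Q"
  shows "\<exists>s\<in>T. \<exists>t\<in>T. t \<noteq> 0 \<and> inverse t \<in> stalk CK Q \<and> y * t = s"
proof -
  obtain xs where xs: "fst ` set xs \<subseteq> B" "y = ev xs" by (rule stalk_Q_ev[OF y])
  note pr = C.pt_prime[OF U P, unfolded primeideal_as_ring_iff[OF S_subring]]
  have "\<exists>s\<in>S - C.pt U P. fst ` set (scale s xs) \<subseteq> S"
  proof (rule common_multiplier)
    show "1 \<in> S - C.pt U P" using pr SD(2) by blast
    show "s * t \<in> S - C.pt U P" if "s \<in> S - C.pt U P" "t \<in> S - C.pt U P" for s t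
      using pr that SD(6)[of s t] by blast
    fix a assume "a \<in> fst ` set xs"
    then have "a \<in> B" using xs(1) by blast
    from C.stalkE[OF U P this] obtain b s where bs: "b \<in> S" "s \<in> S" "s \<notin> C.pt U P" "a = b / s" by this
    have "s \<noteq> 0" using C.stalk_unit_iff[OF U P bs(2)] bs(3) by simp
    then have "s * a \<in> S" using bs by simp
    then show "\<exists>s\<in>S - C.pt U P. s * a \<in> S" using bs(2,3) by blast
  qed blast
  then obtain s where s: "s \<in> S" "s \<notin> C.pt U P" "fst ` set (scale s xs) \<subseteq> S" by blast
  have si: "s \<noteq> 0" "inverse s \<in> B" using C.stalk_unit_iff[OF U P s(1)] s(2) by simp_all
  have "inverse (j s) \<in> stalk CK Q" using j_stalk_Q[OF si(2)] unfolding jD(8) .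
  moreover have "y * j s \<in> T" using ev_T[OF s(3)] unfolding ev_scale xs(2) by (simp only: mult.commute)
  moreover have "j s \<noteq> 0" using si(1) unfolding jD(9) .
  ultimately show ?thesis using j_T[OF s(1)] by blast
qed

text \<open>The prime of \<open>P\<close> is maximal in \<open>S\<close>, so denominators are
  invertible modulo it, and this prime lies in \<open>w\<close> times the stalk.\<close>

lemma B_approx: assumes "x \<in> B" shows "\<exists>s\<in>S. \<exists>x'\<in>B. x = s + w * x'"
proof -
  from C.stalkE[OF U P assms] obtain a s where as: "a \<in> S" "s \<in> S" "s \<notin> C.pt U P" "x = a / s" by this
  obtain t m where t: "t \<in> S" "m \<in> C.pt U P" "1 = m + t * s" using C.closed_point_maximal[OF U P closed as(2,3)] by blast
  have "m \<in> nonunits B" using t(2) by blast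
  then obtain b where b: "b \<in> B" "m = w * b" unfolding w(4) by blast
  have "s \<noteq> 0" using C.stalk_unit_iff[OF U P as(2)] as(3) by simp
  then have "x = x * (m + t * s)" using t(3) by simp
  also have "\<dots> = t * a + w * (b * x)" using as(4) b(2) \<open>s \<noteq> 0\<close> by (simp add: field_simps)
  finally show ?thesis using SD(6)[OF t(1) as(1)] BD(6)[OF b(1) assms] by blast
qed

lemma stalk_Q_approx:
  assumes y: "y \<in> stalk CK Q"
  shows "\<exists>s\<in>T. \<exists>y'\<in>stalk CK Q. y = s + j w * y'"
proof -
  obtain xs where xs: "fst ` set xs \<subseteq> B" "y = ev xs" by (rule stalk_Q_ev[OF y])
  note QD = subring_of_fieldD[OF stalk_Q_subring]
  have "\<exists>s\<in>T. \<exists>y'\<in>stalk CK Q. ev xs = s + j w * y'" using xs(1)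
  proof (induction xs)
    case Nil
    show ?case using TD(1) QD(1) by (intro bexI[of _ 0]) auto
  next
    case (Cons x xs)
    obtain a c where x: "x = (a, c)" by (cases x)
    obtain s y' where s: "s \<in> T" "y' \<in> stalk CK Q" "ev xs = s + j w * y'" using Cons by auto
    have "a \<in> B" using Cons.prems x by simp
    then obtain t a' where t: "t \<in> S" "a' \<in> B" "a = t + w * a'" using B_approx by blast
    have "ev (x # xs) = (j t * \<kappa> c + s) + j w * (j a' * \<kappa> c + y')"
      unfolding x by (simp add: s(3) t(3) jD(3,4) algebra_simps)
    moreover have "j t * \<kappa> c \<in> T" using ev_T[of "[(t, c)]"] t(1) by simp
    ultimately show ?case using TD(4)[OF _ s(1)] QD(4)[OF QD(6)[OF j_stalk_Q[OF t(2)] \<kappa>_stalk_Q[of c]] s(2)] by blast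
  qed
  then show ?thesis using xs(2) by simp
qed

text \<open>\<open>g\<close> satisfies a polynomial equation over the base field modulo the maximal
  ideal. Over the algebraic closure the polynomial splits into linear factors, and the prime at
  \<open>Q\<close> contains one of them, \<open>j g - \<kappa> c\<close>.\<close>

lemma generator_residue:
  assumes g: "g \<in> S"
  shows "\<exists>c N. \<exists>d\<in>B. (j g - \<kappa> c) ^ (p ^ N) = j w * j d"
proof -
  have pp: "primeideal (C.pt U P) (as_ring S)" by (rule C.pt_prime[OF U P])
  note pr = pp[unfolded primeideal_as_ring_iff[OF S_subring]]
  have "maximalideal (C.pt U P) (as_ring S)"
  proof (rule maximal_ideal_as_ring[OF S_subring])
    show "ideal (C.pt U P) (as_ring S)" using pp by (rule primeideal.axioms(1))
    show "1 \<notin> C.pt U P" using pr by blast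
    show "\<exists>t\<in>S. \<exists>m\<in>C.pt U P. 1 = m + t * s" if "s \<in> S" "s \<notin> C.pt U P" for s
      by (rule C.closed_point_maximal[OF U P closed that])
  qed
  then obtain q :: "'k poly" where q: "q \<noteq> 0" "poly (map_poly \<iota> q) g \<in> C.pt U P"
    using residue_field_algebraic[OF hom_\<iota> S_subring G _ g] by blast
  define r where "r = map_poly to_ac q"
  have "r \<noteq> 0" unfolding r_def using q(1) by (simp add: map_poly_eq_0_iff)
  then obtain M where M: "r = smult (Polynomial.lead_coeff r) (\<Prod>x\<in>#M. [:- x, 1:])" using alg_closed_imp_factorization by blast
  define l where "l = Polynomial.lead_coeff r"
  have l: "l \<noteq> 0" unfolding l_def using \<open>r \<noteq> 0\<close> by simp
  have "map_poly j (map_poly \<iota> q) = map_poly \<kappa> r"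
    unfolding r_def by (rule poly_eqI) (simp add: coeff_map_poly jD \<kappa>D \<iota>D j_\<iota>)
  then have "j (poly (map_poly \<iota> q) g) = poly (map_poly \<kappa> r) (j g)" unfolding field_hom_poly[OF hom_j] by simp
  also have "\<dots> = \<kappa> l * poly (map_poly \<kappa> (\<Prod>x\<in>#M. [:- x, 1:])) (j g)"
  proof -
    have "r = [:l:] * (\<Prod>x\<in>#M. [:- x, 1:])" using M unfolding l_def by simp
    then have "map_poly \<kappa> r = map_poly \<kappa> [:l:] * map_poly \<kappa> (\<Prod>x\<in>#M. [:- x, 1:])"
      by (simp only: field_hom_map_poly_mult[OF hom_\<kappa>])
    then show ?thesis by (simp add: map_poly_pCons \<kappa>D)
  qed
  also have "poly (map_poly \<kappa> (\<Prod>x\<in>#M. [:- x, 1:])) (j g) = (\<Prod>x\<in>#M. j g - \<kappa> x)"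
  proof (induction M)
    case (add x M)
    have "map_poly \<kappa> (\<Prod>x\<in>#add_mset x M. [:- x, 1:]) = map_poly \<kappa> [:- x, 1:] * map_poly \<kappa> (\<Prod>x\<in>#M. [:- x, 1:])"
      by (simp only: image_mset_add_mset prod_mset.add_mset field_hom_map_poly_mult[OF hom_\<kappa>])
    moreover have "poly (map_poly \<kappa> [:- x, 1:]) (j g) = j g - \<kappa> x" by (simp add: map_poly_pCons \<kappa>D)
    ultimately show ?case using add by simp
  qed (simp add: \<kappa>D)
  finally have e: "j (poly (map_poly \<iota> q) g) = \<kappa> l * (\<Prod>x\<in>#M. j g - \<kappa> x)" .
  note pW = CK.pt_prime[OF base_change_U(1) Q(3)]
  note pWD = pW[unfolded primeideal_as_ring_iff[OF T_subring]]
  have \<kappa>T: "\<kappa> c \<in> T" for c using ev_T[of "[(1, c)]"] SD(2) by (simp add: jD)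
  have fT: "j g - \<kappa> x \<in> T" for x by (rule TD(5)[OF j_T[OF g] \<kappa>T])
  have jq: "j (poly (map_poly \<iota> q) g) \<in> CK.pt W Q"
  proof
    show "j (poly (map_poly \<iota> q) g) \<in> T" using q(2) j_T by blast
    show "j (poly (map_poly \<iota> q) g) \<in> nonunits (stalk CK Q)" using j_nonunits[OF Q(1)] q(2) Q(2) by simp
  qed
  have "\<kappa> (inverse l) * (\<kappa> l * (\<Prod>x\<in>#M. j g - \<kappa> x)) \<in> CK.pt W Q" using pWD jq \<kappa>T unfolding e by blast
  moreover have "\<kappa> (inverse l) * \<kappa> l = 1" using l by (simp flip: \<kappa>D(4)) (simp add: \<kappa>D)
  ultimately have "(\<Prod>x\<in>#M. j g - \<kappa> x) \<in> CK.pt W Q" by (simp only: mult.assoc[symmetric] mult_1_left)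
  from prime_ideal_prod_mset[OF T_subring pW fT this] obtain c where "j g - \<kappa> c \<in> CK.pt W Q" by blast
  then have "j g - \<kappa> c \<in> nonunits (stalk CK Q)" by blast
  \<comment> \<open>Vanishing at \<open>Q\<close> is turned back into a statement at
    \<open>P\<close>, where the nonunits are the multiples of \<open>w\<close>.\<close>
  then obtain N a where a: "a \<in> C.pt U P" "(j g - \<kappa> c) ^ (p ^ N) = j a"
    unfolding nonunit_iff_power[OF Q(3) fT] Q(2) by blast
  have "a \<in> nonunits B" using a(1) by blast
  then obtain d where "d \<in> B" "a = w * d" unfolding w(4) by blast
  then show ?thesis using a(2) unfolding jD(4)[symmetric] by blast
qed

lemma geom_point: "geom_point \<kappa> (range j) (j ` B) ac_basis \<Phi> (j w) (j ` G) p"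
proof (rule geom_point.intro)
  fix c c' :: "'k alg_closure" and x y y' a g :: 'l and f
  show "\<kappa> 1 = 1" "\<kappa> (c + c') = \<kappa> c + \<kappa> c'" "\<kappa> (c * c') = \<kappa> c * \<kappa> c'" by (simp_all add: \<kappa>D)
  show "prime p" "CHAR('l) = p" by (rule prime_p, rule CHAR_l)
  show "1 \<in> range j" using jD(2) by (metis rangeI)
  show "x - y \<in> range j" "x * y \<in> range j" if "x \<in> range j" "y \<in> range j"
    using that by (auto simp flip: jD(4,6))
  show "inverse x \<in> range j" if "x \<in> range j" using that by (auto simp flip: jD(8))
  show "j ` B \<subseteq> range j" by blast
  show "1 \<in> j ` B" using imageI[OF BD(2), of j] jD(2) by simp
  show "x - y \<in> j ` B" "x * y \<in> j ` B" if "x \<in> j ` B" "y \<in> j ` B"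
    using that BD(5,6) by (auto simp flip: jD(4,6))
  show "j w \<in> j ` B" "j w \<noteq> 0" using w(1,2) by (simp_all add: jD(9))
  show "inverse (j w) \<notin> j ` B" using w(3) by (auto simp flip: jD(8) simp: jD(10))
  show "\<exists>u n. u \<in> j ` B \<and> u \<noteq> 0 \<and> inverse u \<in> j ` B \<and> (x = j w ^ n * u \<or> x * j w ^ n = u)" if x: "x \<in> range j" "x \<noteq> 0"
  proof -
    obtain z where z: "x = j z" using x(1) by blast
    have "z \<noteq> 0" using x(2) unfolding z jD(9) .
    from dvr[OF this] obtain u n where u: "u \<in> B" "u \<noteq> 0" "inverse u \<in> B" "z = w ^ n * u \<or> z * w ^ n = u" by blast
    show ?thesis
    proof (intro exI[of _ "j u"] exI[of _ n] conjI)
      show "j u \<in> j ` B" using u(1) by blast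
      show "j u \<noteq> 0" using u(2) unfolding jD(9) .
      show "inverse (j u) \<in> j ` B" unfolding jD(8)[symmetric] using u(3) by blast
      show "x = j w ^ n * j u \<or> x * j w ^ n = j u" unfolding z jD(7)[symmetric] jD(4)[symmetric] jD(10) by (rule u(4))
    qed
  qed
  show "\<exists>N. y ^ (p ^ N) \<in> range j" by (rule power_in_range_j)
  show "\<exists>N. \<kappa> c ^ (p ^ N) \<in> j ` B"
  proof -
    obtain N k where "c ^ (p ^ N) = to_ac k" using separably_closed_power_in_base[OF sep_closed CHAR_K, of c] by blast
    then have "\<kappa> c ^ (p ^ N) = j (\<iota> k)" unfolding \<kappa>D(7)[symmetric] j_\<iota> by simp
    then show ?thesis using \<iota>_B by blast
  qed
  show "\<Phi> b y \<in> range j" for b unfolding \<Phi>_def by blast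
  show "\<Phi> b (y + y') = \<Phi> b y + \<Phi> b y'" for b by (rule \<Phi>_add)
  show "\<Phi> b (f * y) = f * \<Phi> b y" if "f \<in> range j" for b using that \<Phi>_scale by blast
  show "\<Phi> b (\<kappa> c) \<in> j ` B \<inter> range \<kappa>" for b unfolding \<Phi>_\<kappa> using \<iota>_B j_\<iota> by blast
  have supp: "{b \<in> ac_basis. \<Phi> b y \<noteq> 0} = {b. \<Phi> b y \<noteq> 0}" using \<Phi>_nonzero_basis by blast
  show "finite {b \<in> ac_basis. \<Phi> b y \<noteq> 0}" unfolding supp by (rule \<Phi>_support)
  show "y = (\<Sum>b | b \<in> ac_basis \<and> \<Phi> b y \<noteq> 0. \<kappa> b * \<Phi> b y)" unfolding supp by (rule \<Phi>_sum)
  show "1 \<in> (ac_basis :: 'k alg_closure set)" by (rule ac_basis(3))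
  show "\<Phi> b (\<kappa> b') = (if b = b' then 1 else 0)" if "b' \<in> ac_basis" for b b'
    unfolding \<Phi>_\<kappa> by (simp add: ac_coord_basis[OF that] \<iota>D jD)
  show "finite (j ` G)" using G(1) by simp
  have GS: "G \<subseteq> S" unfolding G(2) using generate_ring.incl[of _ "range \<iota> \<union> G" ring_of_type_algebra] by blast
  show "\<Phi> b g \<in> j ` B" if gG: "g \<in> j ` G" for b
  proof -
    obtain h where h: "h \<in> G" "g = j h" using gG by blast
    have "h * \<iota> (ac_coord b 1) \<in> B" using h(1) GS S_B by (intro BD(6) \<iota>_B) blast
    then show ?thesis unfolding h(2) \<Phi>_j by blast
  qed
  let ?R = "generate_ring ring_of_type_algebra (range \<kappa> \<union> j ` G)"
  show "\<exists>s t. s \<in> ?R \<and> t \<in> ?R \<and> t \<noteq> 0 \<and> (\<forall>b\<in>ac_basis. \<Phi> b (inverse t) \<in> j ` B) \<and> a * t = s"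
    if aB: "\<And>b. b \<in> ac_basis \<Longrightarrow> \<Phi> b a \<in> j ` B"
  proof -
    have "a \<in> stalk CK Q" unfolding stalk_Q_iff by (intro ballI aB)
    from stalk_Q_localization[OF this] obtain s t where st: "s \<in> T" "t \<in> T" "t \<noteq> 0" "inverse t \<in> stalk CK Q" "a * t = s"
      by (elim bexE conjE)
    show ?thesis
      by (intro exI[of _ s] exI[of _ t] conjI st(3,5) subsetD[OF T_generated st(1)] subsetD[OF T_generated st(2)]
          st(4)[unfolded stalk_Q_iff])
  qed
  show "\<exists>s a'. s \<in> ?R \<and> (\<forall>b\<in>ac_basis. \<Phi> b a' \<in> j ` B) \<and> a = s + j w * a'"
    if aB: "\<And>b. b \<in> ac_basis \<Longrightarrow> \<Phi> b a \<in> j ` B"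
  proof -
    have "a \<in> stalk CK Q" unfolding stalk_Q_iff by (intro ballI aB)
    from stalk_Q_approx[OF this] obtain s a' where sa: "s \<in> T" "a' \<in> stalk CK Q" "a = s + j w * a'" by (elim bexE)
    show ?thesis
      by (intro exI[of _ s] exI[of _ a'] conjI sa(3) subsetD[OF T_generated sa(1)] sa(2)[unfolded stalk_Q_iff])
  qed
  show "\<exists>c N d. d \<in> j ` B \<and> (g - \<kappa> c) ^ (p ^ N) = j w * d" if gG: "g \<in> j ` G"
  proof -
    obtain h where h: "h \<in> S" "g = j h" using gG GS by blast
    obtain c N d where "d \<in> B" "(j h - \<kappa> c) ^ (p ^ N) = j w * j d" using generator_residue[OF h(1)] by (elim exE bexE)
    then show ?thesis unfolding h(2) by (intro exI[of _ c] exI[of _ N] exI[of _ "j d"] conjI imageI)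
  qed
qed

sublocale gp: geom_point \<kappa> "range j" "j ` B" ac_basis \<Phi> "j w" "j ` G" p
  by (rule geom_point)

lemma gp_A: "gp.A = stalk CK Q"
  unfolding gp.A_def using stalk_Q_iff by blast

sublocale K: linear_quotient "\<lambda>c x. \<iota> c * x"
  by unfold_locales (simp_all add: \<iota>D algebra_simps)

lemma nonunits_subspace: "K.subspace (nonunits B)"
  unfolding K.subspace_def w(4)
proof (intro conjI ballI allI)
  show "0 \<in> (\<lambda>a. w * a) ` B" using BD(1) by (intro image_eqI[of _ _ 0]) auto
  fix x assume "x \<in> (\<lambda>a. w * a) ` B"
  then obtain a where a: "a \<in> B" "x = w * a" by blast
  show "\<iota> c * x \<in> (\<lambda>a. w * a) ` B" for c
    using BD(6)[OF \<iota>_B a(1), of c] a(2) by (intro image_eqI[of _ _ "\<iota> c * a"]) (simp_all add: mult_ac)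
  fix y assume "y \<in> (\<lambda>a. w * a) ` B"
  then obtain b where b: "b \<in> B" "y = w * b" by blast
  show "x + y \<in> (\<lambda>a. w * a) ` B"
    using BD(4)[OF a(1) b(1)] a(2) b(2) by (intro image_eqI[of _ _ "a + b"]) (simp_all add: distrib_left)
qed

text \<open>Taking the coordinate at a basis element of the algebraic closure turns a relation
  upstairs into a relation over the base field.\<close>

lemma indep_mod_base_change:
  assumes Y: "K.indep_mod (nonunits B) Y"
  shows "gp.lin.indep_mod ((\<lambda>a. j w * a) ` gp.A) (j ` Y)"
  unfolding gp.lin.indep_mod_def
proof (intro conjI allI impI ballI)
  have fin: "finite Y" using Y by (simp add: K.indep_mod_def)
  then show "finite (j ` Y)" by simp
  fix c y' assume "(\<Sum>b\<in>j ` Y. \<kappa> (c b) * b) \<in> (\<lambda>a. j w * a) ` gp.A" and "y' \<in> j ` Y"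
  then obtain a y where a: "a \<in> gp.A" "(\<Sum>b\<in>j ` Y. \<kappa> (c b) * b) = j w * a" and y: "y \<in> Y" "y' = j y" by blast
  have inj: "inj_on j Y" by (rule inj_onI) (simp add: jD(10))
  have "ac_coord b (c (j y)) = 0" for b
  proof (cases "b \<in> ac_basis")
    case True
    have \<Phi>sum: "\<Phi> b (\<Sum>y\<in>Z. \<kappa> (c (j y)) * j y) = (\<Sum>y\<in>Z. j (\<iota> (ac_coord b (c (j y))) * y))" if "finite Z" for Z
      using that
    proof induction
      case empty
      have "\<Phi> b 0 = 0" using \<Phi>_ev[of b "[]"] by (simp add: jD)
      then show ?case by simp
    next
      case (insert y Z)
      have "\<Phi> b (\<kappa> (c (j y)) * j y) = j (\<iota> (ac_coord b (c (j y))) * y)"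
        using \<Phi>_scale[of b y "\<kappa> (c (j y))"] by (simp add: \<Phi>_\<kappa> jD(4) mult.commute)
      then show ?case using insert by (simp add: \<Phi>_add)
    qed
    obtain d where d: "d \<in> B" "\<Phi> b a = j d" using a(1) True by (auto simp: gp.A_iff)
    have "j (\<Sum>y\<in>Y. \<iota> (ac_coord b (c (j y))) * y) = \<Phi> b (\<Sum>y\<in>Y. \<kappa> (c (j y)) * j y)"
      unfolding \<Phi>sum[OF fin] by (rule field_hom_sum[OF hom_j])
    also have "\<dots> = \<Phi> b (j w * a)" unfolding a(2)[symmetric] using inj by (simp add: sum.reindex)
    also have "\<dots> = j (w * d)" unfolding \<Phi>_scale d(2) jD(4) ..
    finally have "(\<Sum>y\<in>Y. \<iota> (ac_coord b (c (j y))) * y) = w * d" unfolding jD(10) .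
    then have "(\<Sum>y\<in>Y. \<iota> (ac_coord b (c (j y))) * y) \<in> nonunits B" unfolding w(4) using d(1) by blast
    then show ?thesis using K.indep_modD[OF Y, of "\<lambda>y. ac_coord b (c (j y))"] y(1) by blast
  qed (use ac_coord_nonzero in blast)
  then show "c y' = 0" using ac_coord_sum[of "{}" "c (j y)"] y(2) by simp
qed

text \<open>Spanning passes to the tensor product one pure tensor at a time, so the residue degree
  becomes the dimension of the upstairs ring modulo \<open>j w\<close>.\<close>

lemma basis_mod_base_change:
  assumes Y: "K.basis_mod B (nonunits B) Y"
  shows "gp.lin.basis_mod gp.A ((\<lambda>a. j w * a) ` gp.A) (j ` Y)"
  unfolding gp.lin.basis_mod_def
proof (intro conjI ballI)
  have YB: "Y \<subseteq> B" and ind: "K.indep_mod (nonunits B) Y" using Y by (auto simp: K.basis_mod_def)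
  show "j ` Y \<subseteq> gp.A" unfolding gp_A using YB j_stalk_Q by blast
  show "gp.lin.indep_mod ((\<lambda>a. j w * a) ` gp.A) (j ` Y)" by (rule indep_mod_base_change[OF ind])
  have inj: "inj_on j Y" by (rule inj_onI) (simp add: jD(10))
  note QD = subring_of_fieldD[OF stalk_Q_subring]
  fix v assume "v \<in> gp.A"
  then obtain xs where xs: "fst ` set xs \<subseteq> B" "v = ev xs" unfolding gp_A by (rule stalk_Q_ev)
  have "\<exists>c. \<exists>a\<in>stalk CK Q. ev xs = (\<Sum>y\<in>Y. \<kappa> (c y) * j y) + j w * a" using xs(1)
  proof (induction xs)
    case Nil
    show ?case using QD(1) by (intro exI[of _ "\<lambda>_. 0"] bexI[of _ 0]) (simp_all add: \<kappa>D)
  next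
    case (Cons x xs)
    obtain b e where x: "x = (b, e)" by (cases x)
    obtain c a where c: "a \<in> stalk CK Q" "ev xs = (\<Sum>y\<in>Y. \<kappa> (c y) * j y) + j w * a" using Cons by auto
    have bB: "b \<in> B" using Cons.prems x by simp
    obtain k where "b - (\<Sum>y\<in>Y. \<iota> (k y) * y) \<in> nonunits B" using Y bB unfolding K.basis_mod_def by blast
    then obtain d where d: "d \<in> B" "b - (\<Sum>y\<in>Y. \<iota> (k y) * y) = w * d" unfolding w(4) by blast
    have "b = (\<Sum>y\<in>Y. \<iota> (k y) * y) + w * d" using d(2) by (simp add: algebra_simps)
    then have "j b = (\<Sum>y\<in>Y. \<kappa> (to_ac (k y)) * j y) + j w * j d"
      by (simp add: jD(3,4) field_hom_sum[OF hom_j] j_\<iota>)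
    then have "ev (x # xs) = (\<Sum>y\<in>Y. \<kappa> (to_ac (k y) * e + c y) * j y) + j w * (j d * \<kappa> e + a)"
      unfolding x by (simp add: c(2) \<kappa>D(3,4) distrib_right distrib_left sum.distrib sum_distrib_left sum_distrib_right mult_ac)
    moreover have "j d * \<kappa> e + a \<in> stalk CK Q" by (intro QD(4) QD(6) j_stalk_Q[OF d(1)] \<kappa>_stalk_Q c(1))
    ultimately show ?case by (intro exI[of _ "\<lambda>y. to_ac (k y) * e + c y"] bexI)
  qed
  then obtain c a where c: "a \<in> stalk CK Q" "v = (\<Sum>y\<in>Y. \<kappa> (c y) * j y) + j w * a" unfolding xs(2) by blast
  have "(\<Sum>b\<in>j ` Y. \<kappa> (c (inv_into Y j b)) * b) = (\<Sum>y\<in>Y. \<kappa> (c y) * j y)"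
    using inj by (simp add: sum.reindex)
  then have "v - (\<Sum>b\<in>j ` Y. \<kappa> (c (inv_into Y j b)) * b) = j w * a" using c(2) by simp
  then have "v - (\<Sum>b\<in>j ` Y. \<kappa> (c (inv_into Y j b)) * b) \<in> (\<lambda>a. j w * a) ` gp.A" unfolding gp_A using c(1) by blast
  then show "\<exists>c. v - (\<Sum>b\<in>j ` Y. \<kappa> (c b) * b) \<in> (\<lambda>a. j w * a) ` gp.A" by (intro exI[of _ "\<lambda>b. c (inv_into Y j b)"])
qed

text \<open>Finiteness of the residue degree, without which \<open>quotient_dim\<close> would not be
  meaningful, is deduced from the base change: independent sets stay independent there, and the
  quotient modulo \<open>j w\<close> is finite-dimensional by \<open>A_finite_mod\<close>.\<close>

theorem residue_degree_dvd:
  "residue_degree \<iota> C P dvd conductor_at CK \<pi> P + differential_degree_at \<kappa> CK \<pi> P - 1"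
proof -
  obtain E where E: "finite E" "\<forall>a\<in>gp.A. \<exists>x\<in>gp.lin.span E. \<exists>a'\<in>gp.A. a = x + j w ^ 1 * a'"
    using gp.A_finite_mod[of 1] by blast
  have "\<exists>Y. K.basis_mod B (nonunits B) Y"
  proof (rule K.basis_mod_exists[OF nonunits_subspace])
    fix Y assume Y: "Y \<subseteq> B" "K.indep_mod (nonunits B) Y"
    have "card (j ` Y) \<le> card E"
    proof (rule gp.lin.indep_mod_card_le[OF gp.A_subspace indep_mod_base_change[OF Y(2)] E(1)])
      fix y assume "y \<in> j ` Y"
      then have "y \<in> gp.A" unfolding gp_A using Y(1) j_stalk_Q by blast
      then obtain x a' where x: "x \<in> gp.lin.span E" "a' \<in> gp.A" "y = x + j w ^ 1 * a'" using E(2) by blast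
      have "y - x = j w * a'" using x(3) by simp
      then show "\<exists>x\<in>gp.lin.span E. y - x \<in> (\<lambda>a. j w * a) ` gp.A" using x(1,2) by blast
    qed
    moreover have "card (j ` Y) = card Y" by (rule card_image) (simp add: inj_on_def jD(10))
    ultimately show "card Y \<le> card E" by simp
  qed
  then obtain Y where Y: "K.basis_mod B (nonunits B) Y" by blast
  have "residue_degree \<iota> C P = card Y"
    unfolding residue_degree_def by (rule K.quotient_dim_eq_card[OF nonunits_subspace Y])
  also have "\<dots> = card (j ` Y)" by (rule card_image[symmetric]) (simp add: inj_on_def jD(10))
  finally have deg: "residue_degree \<iota> C P = card (j ` Y)" .
  have cond: "conductor_at CK \<pi> P =
      semigroup_conductor {n. \<exists>y\<in>gp.A. y \<noteq> 0 \<and> valuation_of (integral_closure gp.A) y = int n}"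
    unfolding gp_A by (simp only: conductor_at_def value_semigroup_def normalization_stalk_def Q_def)
  have diff: "differential_degree_at \<kappa> CK \<pi> P = 1 + differential_cokernel_dim \<kappa> gp.A (integral_closure gp.A)"
    unfolding gp_A by (simp only: differential_degree_at_def normalization_stalk_def Q_def)
  have eq: "c + (1 + d) - 1 = c + d" for c d :: nat by simp
  show ?thesis unfolding deg cond diff eq by (rule gp.basis_card_dvd[OF basis_mod_base_change[OF Y]])
qed

end

theorem theorem3p22:
  fixes \<iota> :: "'k::field \<Rightarrow> 'f::field"
    and C :: "('p, 'f) ringed_space"
    and \<kappa> :: "'k alg_closure \<Rightarrow> 'l::field"
    and CK :: "('q, 'l) ringed_space"
    and \<pi> :: "'q \<Rightarrow> 'p"
    and j :: "'f \<Rightarrow> 'l"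
    and P :: 'p
    and p :: nat
  assumes "CHAR('k) = p" and "p > 0"
    and "\<not> perfect_field TYPE('k)"
    and "separably_closed TYPE('k)"
    and "integral_curve_over \<iota> C"
    and "regular_scheme C"
    and "is_geometric_base_change \<iota> C \<kappa> CK \<pi> j"
    and "integral_scheme CK"
    and "closedin (space C) {P}"
  shows "residue_degree \<iota> C P dvd conductor_at CK \<pi> P + differential_degree_at \<kappa> CK \<pi> P - 1"
proof -
  note curve = assms(5)[unfolded integral_curve_over_def]
  interpret int_scheme C by unfold_locales (rule conjunct1[OF curve])
  have PC: "P \<in> topspace (space C)" using closedin_subset[OF assms(9)] by blast
  have "finite_type_over \<iota> C" using curve by blast
  then obtain \<U> where "\<Union>\<U> = topspace (space C)" "\<forall>U\<in>\<U>. affine_open C U \<and> finitely_generated_algebra \<iota> (sections C U)"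
    unfolding finite_type_over_def by blast
  then obtain U where U: "affine_open C U" "P \<in> U" "finitely_generated_algebra \<iota> (sections C U)" using PC by blast
  obtain G where G: "finite G" "sections C U = generate_ring ring_of_type_algebra (range \<iota> \<union> G)"
    using U(3) unfolding finitely_generated_algebra_def by blast
  have "regular_local_ring (stalk C P)" using assms(6) PC unfolding regular_scheme_def by blast
  moreover have "chain_dimension {Z. irreducible_closed (space C) Z} 1" using curve by blast
  ultimately obtain w where w: "w \<in> stalk C P" "w \<noteq> 0" "inverse w \<notin> stalk C P" "nonunits (stalk C P) = (\<lambda>a. w * a) ` stalk C P"
    "\<forall>x. x \<noteq> 0 \<longrightarrow> (\<exists>u n. u \<in> stalk C P \<and> u \<noteq> 0 \<and> inverse u \<in> stalk C P \<and> (x = w ^ n * u \<or> x * w ^ n = u))"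
    using regular_closed_point_dvr assms(9) by blast
  interpret base_change_point \<iota> C \<kappa> CK \<pi> j p U P w G
  proof unfold_locales
    show "scheme_over \<iota> C" using curve by blast
    show "\<exists>u n. u \<in> stalk C P \<and> u \<noteq> 0 \<and> inverse u \<in> stalk C P \<and> (x = w ^ n * u \<or> x * w ^ n = u)" if "x \<noteq> 0" for x
      by (rule w(5)[rule_format, OF that])
  qed (fact assms U G w scheme)+
  show ?thesis by (rule residue_degree_dvd)
qed

end
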